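(* Let $P_{2k}$ be a real-valued polynomial in $z_1,\bar z_1$ such that (i) there is an integer $k>1$ with $P_{2k}(rz)=r^{2k}P_{2k}(z)$ for all $r\in\mathbb R$, $z\in\mathbb C$, and (ii) $\frac{\partial^2 P_{2k}}{\partial z_1\partial\bar z_1}(z_1)>0$ for every $z_1\neq 0$. Let $\Omega=\{(z_1,z_2)\in\mathbb C^2 : \mathrm{Re}\, z_2+P_{2k}(z_1)<0\}$ (a Kohn-Nirenberg domain). Then the Bergman metric and the Carath\'eodory metric of $\Omega$ are both positive and complete.
   Context: For a domain $W\subset\mathbb C^n$, let $A^2(W)$ be the Hilbert space of square-integrable holomorphic functions on $W$ with complete orthonormal system $\{\varphi_j\}$, and $K_W(z,w)=\sum_j\varphi_j(z)\overline{\varphi_j(w)}$ its Bergman kernel. When $K_W(z,z)>0$, the Bergman metric is $\beta^W_z=\sum_{j,k}\frac{\partial^2\log K_W(z,z)}{\partial z_j\partial\bar z_k}dz_j\otimes d\bar z_k$. The Carath\'eodory pseudo-metric is $F^C_W(p,v)=\sup\{|df_p(v)| : f:W\to\Delta \text{ holomorphic}, f(p)=0\}$, $\Delta$ the unit disc, and the (integrated) Carath\'eodory distance $\rho^C_W(p,q)$ is the infimum of $\int_0^1F^C_W(\gamma(t),\gamma'(t))dt$ over piecewise $C^1$ curves $\gamma$ from $p$ to $q$ in $W$. A metric is positive if every nonzero tangent vector has positive length; it is complete if $W$ with the induced integrated distance (for the Bergman metric, the Riemannian distance of its real part) is Cauchy-complete. *)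

theory Defs
  imports "HOL-Analysis.Analysis"
begin

type_synonym c2 = "complex \<times> complex"

definition cscale :: "complex \<Rightarrow> c2 \<Rightarrow> c2" where
  "cscale c v = (c * fst v, c * snd v)"

definition holo_on :: "c2 set \<Rightarrow> (c2 \<Rightarrow> complex) \<Rightarrow> bool" where
  "holo_on W f \<longleftrightarrow> (\<forall>z\<in>W. \<exists>L. (f has_derivative L) (at z) \<and>
       (\<forall>c v. L (cscale c v) = c * L v))"

text \<open>Bergman space A^2(W); elements are normalised to vanish outside W,
  so that distinct elements are distinct L^2 classes.\<close>
definition A2 :: "c2 set \<Rightarrow> (c2 \<Rightarrow> complex) set" where
  "A2 W = {f. holo_on W f \<and> (\<forall>z. z \<notin> W \<longrightarrow> f z = 0) \<and>
              f \<in> borel_measurable lborel \<and>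
              set_integrable lborel W (\<lambda>z. (cmod (f z))\<^sup>2)}"

definition L2inner :: "c2 set \<Rightarrow> (c2 \<Rightarrow> complex) \<Rightarrow> (c2 \<Rightarrow> complex) \<Rightarrow> complex" where
  "L2inner W f g = (LINT z:W|lborel. f z * cnj (g z))"

definition complete_ONS :: "c2 set \<Rightarrow> (c2 \<Rightarrow> complex) set \<Rightarrow> bool" where
  "complete_ONS W B \<longleftrightarrow> B \<subseteq> A2 W \<and>
     (\<forall>f\<in>B. L2inner W f f = 1) \<and>
     (\<forall>f\<in>B. \<forall>g\<in>B. f \<noteq> g \<longrightarrow> L2inner W f g = 0) \<and>
     (\<forall>f\<in>A2 W. (\<forall>\<phi>\<in>B. L2inner W f \<phi> = 0) \<longrightarrow> f = (\<lambda>_. 0))"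

text \<open>Bergman kernel K_W(z,w) = sum_j phi_j(z) conj(phi_j(w)) for a complete
  orthonormal system (independent of the choice).\<close>
definition bergman_kernel :: "c2 set \<Rightarrow> c2 \<Rightarrow> c2 \<Rightarrow> complex" where
  "bergman_kernel W z w =
     infsum (\<lambda>\<phi>. \<phi> z * cnj (\<phi> w)) (SOME B. complete_ONS W B)"

definition pd :: "('a::real_normed_vector \<Rightarrow> complex) \<Rightarrow> 'a \<Rightarrow> 'a \<Rightarrow> complex" where
  "pd f z e = vector_derivative (\<lambda>t::real. f (z + t *\<^sub>R e)) (at 0)"

definition cunit :: "nat \<Rightarrow> c2" where
  "cunit j = (if j = 1 then (1, 0) else (0, 1))"

definition ccomp :: "nat \<Rightarrow> c2 \<Rightarrow> complex" where
  "ccomp j v = (if j = 1 then fst v else snd v)"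

definition Dz :: "nat \<Rightarrow> (c2 \<Rightarrow> complex) \<Rightarrow> c2 \<Rightarrow> complex" where
  "Dz j f z = (pd f z (cunit j) - \<i> * pd f z (cscale \<i> (cunit j))) / 2"

definition Dzb :: "nat \<Rightarrow> (c2 \<Rightarrow> complex) \<Rightarrow> c2 \<Rightarrow> complex" where
  "Dzb j f z = (pd f z (cunit j) + \<i> * pd f z (cscale \<i> (cunit j))) / 2"

definition Dz1 :: "(complex \<Rightarrow> complex) \<Rightarrow> complex \<Rightarrow> complex" where
  "Dz1 f z = (pd f z 1 - \<i> * pd f z \<i>) / 2"

definition Dzb1 :: "(complex \<Rightarrow> complex) \<Rightarrow> complex \<Rightarrow> complex" where
  "Dzb1 f z = (pd f z 1 + \<i> * pd f z \<i>) / 2"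

definition bergman_coeff :: "c2 set \<Rightarrow> nat \<Rightarrow> nat \<Rightarrow> c2 \<Rightarrow> complex" where
  "bergman_coeff W j k z =
     Dz j (Dzb k (\<lambda>w. complex_of_real (ln (Re (bergman_kernel W w w))))) z"

definition bergman_form :: "c2 set \<Rightarrow> c2 \<Rightarrow> c2 \<Rightarrow> complex" where
  "bergman_form W z v =
     (\<Sum>j\<in>{1,2}. \<Sum>k\<in>{1,2}. bergman_coeff W j k z * ccomp j v * cnj (ccomp k v))"

definition bergman_length :: "c2 set \<Rightarrow> c2 \<Rightarrow> c2 \<Rightarrow> ennreal" where
  "bergman_length W z v = ennreal (sqrt (Re (bergman_form W z v)))"

definition bergman_positive :: "c2 set \<Rightarrow> bool" where
  "bergman_positive W \<longleftrightarrow>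
     (\<forall>z\<in>W. Re (bergman_kernel W z z) > 0 \<and> Im (bergman_kernel W z z) = 0 \<and>
        (\<forall>v. v \<noteq> 0 \<longrightarrow> Re (bergman_form W z v) > 0))"

definition carath :: "c2 set \<Rightarrow> c2 \<Rightarrow> c2 \<Rightarrow> ennreal" where
  "carath W p v = (SUP f\<in>{f. holo_on W f \<and> f ` W \<subseteq> ball 0 1 \<and> f p = 0}.
       ennreal (cmod (frechet_derivative f (at p) v)))"

definition carath_positive :: "c2 set \<Rightarrow> bool" where
  "carath_positive W \<longleftrightarrow> (\<forall>p\<in>W. \<forall>v. v \<noteq> 0 \<longrightarrow> carath W p v > 0)"

definition curves :: "c2 set \<Rightarrow> c2 \<Rightarrow> c2 \<Rightarrow> (real \<Rightarrow> c2) set" where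
  "curves W p q = {\<gamma>. \<gamma> piecewise_C1_differentiable_on {0..1} \<and>
       \<gamma> ` {0..1} \<subseteq> W \<and> \<gamma> 0 = p \<and> \<gamma> 1 = q}"

definition int_dist :: "c2 set \<Rightarrow> (c2 \<Rightarrow> c2 \<Rightarrow> ennreal) \<Rightarrow> c2 \<Rightarrow> c2 \<Rightarrow> ennreal" where
  "int_dist W F p q = (INF \<gamma>\<in>curves W p q.
       \<integral>\<^sup>+ t. indicator {0..1} t * F (\<gamma> t) (vector_derivative \<gamma> (at t)) \<partial>lborel)"

definition metric_complete :: "c2 set \<Rightarrow> (c2 \<Rightarrow> c2 \<Rightarrow> ennreal) \<Rightarrow> bool" where
  "metric_complete W F \<longleftrightarrow>
     (\<forall>x::nat \<Rightarrow> c2. (\<forall>n. x n \<in> W) \<and>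
        (\<forall>e>0. \<exists>N. \<forall>m\<ge>N. \<forall>n\<ge>N. int_dist W F (x m) (x n) < ennreal e) \<longrightarrow>
        (\<exists>p\<in>W. ((\<lambda>n. int_dist W F (x n) p) \<longlongrightarrow> 0) sequentially))"

end

theory Submission
  imports Defs "HOL-Complex_Analysis.Complex_Analysis" "HOL-Real_Asymp.Real_Asymp" "HOL-Computational_Algebra.Fundamental_Theorem_Algebra"
begin

text \<open>Write \<open>n = 2k\<close>. Everything rests on entire functions \<open>h\<close> with \<open>h a = 1\<close> and
  \<open>\<bar>h w\<bar> \<le> C exp (t (P w - P a) - t \<epsilon> \<bar>w\<^sup>k - a\<^sup>k\<bar>\<^sup>2)\<close>, where \<open>C\<close> and \<open>\<epsilon>\<close> depend neither on \<open>t > 0\<close> nor on \<open>a\<close>.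
  They come from a function \<open>r\<^sup>n g(\<theta>)\<close> below \<open>P\<close>, touching \<open>P\<close> along the ray through \<open>a\<close>, with \<open>g\<close> piecewise
  \<open>n\<close>-sinusoidal and with convex kinks. Up to a bounded error it is \<open>log \<bar>F\<bar>\<close> for an entire \<open>F\<close>: each kink is
  produced by a canonical product with its zeros on one ray, and dilations take care of \<open>t\<close>.

  Functions \<open>h(z\<^sub>1) e(z\<^sub>2)\<close> with \<open>e\<close> built from exponentials then peak at boundary points, or decay at infinity, so a
  Cauchy sequence for the Caratheodory metric converges inside \<open>\<Omega>\<close>. The Bergman metric dominates the Caratheodory metric:
  for \<open>f\<close> into the disc with \<open>f p = 0\<close>, the function \<open>f K(\<cdot>, p)\<close> competes in the extremal problem which
  characterises the Bergman length. So both metrics are positive and complete.\<close>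

section \<open>A canonical product with zeros along a ray\<close>

text \<open>So \<open>h\<close> must have zeros. Zeros only lower \<open>log |h|\<close>, which
  suits the asymmetry of the task: the upper bound is needed everywhere, the lower one only along
  the ray of \<open>a\<close>. Hence errors are controlled on both sides off the zero rays, but only
  from above near them. Entire functions of integer order \<open>n\<close> with zeros on rays grow
  like \<open>r^n log r\<close> unless the zero densities balance. Here they balance automatically,
  because a piecewise sinusoid closes up after a full turn. The constants must be uniform in
  \<open>a\<close> and \<open>t\<close>, since along a Cauchy sequence the test function is chosen
  after the index that controls its oscillation and depends on the term at that index. The
  \<epsilon>-term is paid for with half of the strict subharmonicity; it controls \<open>z_1\<close>
  along Cauchy sequences and leaves room for the decay that square integrability requires.\<close>

lemma midpoint_rule_error:
  fixes F f f1 f2 :: "real \<Rightarrow> real"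
  assumes "\<And>t. t \<in> {c - 1/2..c + 1/2} \<Longrightarrow> (F has_real_derivative f t) (at t)"
    and "\<And>t. t \<in> {c - 1/2..c + 1/2} \<Longrightarrow> (f has_real_derivative f1 t) (at t)"
    and "\<And>t. t \<in> {c - 1/2..c + 1/2} \<Longrightarrow> (f1 has_real_derivative f2 t) (at t)"
    and B: "\<And>t. t \<in> {c - 1/2..c + 1/2} \<Longrightarrow> \<bar>f2 t\<bar> \<le> B"
  shows "\<bar>f c - (F (c + 1/2) - F (c - 1/2))\<bar> \<le> B"
proof -
  define D where "D m = (if m = 0 then F else if m = 1 then f else if m = 2 then f1 else f2)" for m :: nat
  have D: "\<forall>m t. m < 3 \<and> c - 1/2 \<le> t \<and> t \<le> c + 1/2 \<longrightarrow> (D m has_real_derivative D (Suc m) t) (at t)"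
    using assms(1-3) by (auto simp: D_def less_Suc_eq numeral_3_eq_3 numeral_2_eq_2)
  have D0: "D 0 = F" by (simp add: D_def)
  have "\<exists>t1. c < t1 \<and> t1 < c + 1/2 \<and>
      F (c + 1/2) = (\<Sum>m<3. (D m c / fact m) * (c + 1/2 - c)^m) + (D 3 t1 / fact 3) * (c + 1/2 - c)^3"
    using Taylor[of 3 D F "c - 1/2" "c + 1/2" c "c + 1/2", OF _ D0 D] by simp
  then obtain t1 where t1: "c < t1" "t1 < c + 1/2"
      "F (c + 1/2) = (\<Sum>m<3. (D m c / fact m) * (c + 1/2 - c)^m) + (D 3 t1 / fact 3) * (c + 1/2 - c)^3"
    by blast
  have "\<exists>t1. c - 1/2 < t1 \<and> t1 < c \<and>
      F (c - 1/2) = (\<Sum>m<3. (D m c / fact m) * (c - 1/2 - c)^m) + (D 3 t1 / fact 3) * (c - 1/2 - c)^3"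
    using Taylor[of 3 D F "c - 1/2" "c + 1/2" c "c - 1/2", OF _ D0 D] by simp
  then obtain t2 where t2: "c - 1/2 < t2" "t2 < c"
      "F (c - 1/2) = (\<Sum>m<3. (D m c / fact m) * (c - 1/2 - c)^m) + (D 3 t2 / fact 3) * (c - 1/2 - c)^3"
    by blast
  \<comment> \<open>In the difference the terms of even order cancel; each cubic remainder carries
    the factor \<open>(1/2)^3 / 3! = 1/48\<close>, so the bound \<open>B\<close> is
    generous.\<close>
  have "F (c + 1/2) - F (c - 1/2) = f c + f2 t1 / 48 + f2 t2 / 48"
    unfolding t1(3) t2(3) by (simp add: D_def numeral_3_eq_3 fact_numeral field_simps)
  moreover have "\<bar>f2 t1\<bar> \<le> B" "\<bar>f2 t2\<bar> \<le> B" using B t1 t2 by auto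
  ultimately show ?thesis by linarith
qed

text \<open>The errors on \<open>[m, m + 1]\<close> are of order \<open>1 / m^2\<close>, hence
  summable. The interval \<open>[0, 1]\<close>, where derivatives may blow up at 0, only shifts the
  limit. The limits obtained in this way become the coefficients that normalise the canonical
  product.\<close>

lemma sum_midpoint_convergent:
  fixes F f f1 f2 :: "real \<Rightarrow> real"
  assumes D: "\<And>t. t > 0 \<Longrightarrow> (F has_real_derivative f t) (at t)"
    "\<And>t. t > 0 \<Longrightarrow> (f has_real_derivative f1 t) (at t)"
    "\<And>t. t > 0 \<Longrightarrow> (f1 has_real_derivative f2 t) (at t)"
    and B: "\<And>t. t \<ge> 1 \<Longrightarrow> \<bar>f2 t\<bar> \<le> K / t\<^sup>2"
  shows "convergent (\<lambda>M. (\<Sum>m<M. f (real m + 1/2)) - F (real M))"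
proof -
  define a where "a m = f (real m + 1/2) - (F (real (Suc m)) - F (real m))" for m
  have K: "K \<ge> 0" using B[of 1] by force
  have bd: "\<bar>a m\<bar> \<le> K / (real m)\<^sup>2" if "m \<ge> 1" for m
  proof -
    have "\<bar>f (real m + 1/2) - (F (real m + 1/2 + 1/2) - F (real m + 1/2 - 1/2))\<bar> \<le> K / (real m)\<^sup>2"
    proof (rule midpoint_rule_error[of _ F f f1 f2])
      fix t assume t: "t \<in> {real m + 1/2 - 1/2..real m + 1/2 + 1/2}"
      then have "t \<ge> 1" "t > 0" "real m \<le> t" "real m > 0" using that by auto
      then show "(F has_real_derivative f t) (at t)" "(f has_real_derivative f1 t) (at t)"
        "(f1 has_real_derivative f2 t) (at t)" using D by auto
      have "\<bar>f2 t\<bar> \<le> K / t\<^sup>2" using B \<open>t \<ge> 1\<close> by auto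
      also have "\<dots> \<le> K / (real m)\<^sup>2"
        using \<open>real m \<le> t\<close> \<open>real m > 0\<close> K by (intro divide_left_mono power_mono) (auto simp: zero_less_mult_iff)
      finally show "\<bar>f2 t\<bar> \<le> K / (real m)\<^sup>2" .
    qed
    then show ?thesis by (simp add: a_def add.commute)
  qed
  have "summable (\<lambda>m. K * (1 / (real m)\<^sup>2))"
    using inverse_power_summable[of 2, where 'a=real] by (intro summable_mult) (simp add: divide_simps)
  then have "summable a"
    by (rule summable_comparison_test'[where N=1]) (use bd in auto)
  then have "convergent (\<lambda>M. \<Sum>m<M. a m)" by (simp add: summable_iff_convergent)
  moreover have "(\<Sum>m<M. a m) - F 0 = (\<Sum>m<M. f (real m + 1/2)) - F (real M)" for M
    unfolding a_def sum_subtractf using sum_lessThan_telescope[of "\<lambda>m. F (real m)" M] by (simp add: sum_subtractf)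
  ultimately have "convergent (\<lambda>M. (\<Sum>m<M. a m) - F 0)"
    by (intro convergent_diff convergent_const)
  then show ?thesis using \<open>\<And>M. (\<Sum>m<M. a m) - F 0 = _ M\<close> by simp
qed

lemma sum_ln_convergent:
  "convergent (\<lambda>M. (\<Sum>m<M. ln (real m + 1/2)) - (real M * ln (real M) - real M))"
proof (rule sum_midpoint_convergent[where ?f1.0 = "\<lambda>t. 1 / t" and ?f2.0 = "\<lambda>t. - 1 / t\<^sup>2" and K = 1])
  show "((\<lambda>t. t * ln t - t) has_real_derivative ln t) (at t)" if "t > 0" for t :: real
    using that by (auto intro!: derivative_eq_intros)
  show "((\<lambda>t. 1 / t) has_real_derivative - 1 / t\<^sup>2) (at t)" if "t > 0" for t :: real
    using that by (auto intro!: derivative_eq_intros simp: power2_eq_square divide_simps)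
qed (auto intro!: derivative_eq_intros)

lemma sum_inverse_convergent:
  "convergent (\<lambda>M. (\<Sum>m<M. 1 / (real m + 1/2)) - ln (real M))"
proof (rule sum_midpoint_convergent[where ?f1.0 = "\<lambda>t. - 1 / t\<^sup>2" and ?f2.0 = "\<lambda>t. 2 / t^3" and K = 2])
  show "((\<lambda>t. 1 / t) has_real_derivative - 1 / t\<^sup>2) (at t)" if "t > 0" for t :: real
    using that by (auto intro!: derivative_eq_intros simp: power2_eq_square divide_simps)
  show "((\<lambda>t. - 1 / t\<^sup>2) has_real_derivative 2 / t^3) (at t)" if "t > 0" for t :: real
    using that by (auto intro!: derivative_eq_intros simp: power2_eq_square power3_eq_cube divide_simps)
  show "\<bar>2 / t ^ 3\<bar> \<le> 2 / t\<^sup>2" if "1 \<le> t" for t :: real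
    using that by (auto simp: power2_eq_square power3_eq_cube divide_simps mult_le_cancel_left1)
qed (auto intro!: derivative_eq_intros)

lemma sum_powr_convergent:
  assumes "0 < b" "b < 1"
  shows "convergent (\<lambda>M. (\<Sum>m<M. (real m + 1/2) powr (-b)) - real M powr (1 - b) / (1 - b))"
proof (rule sum_midpoint_convergent[where ?f1.0 = "\<lambda>t. - b * t powr (-b - 1)"
      and ?f2.0 = "\<lambda>t. b * (b + 1) * t powr (-b - 2)" and K = 2])
  show "((\<lambda>t. t powr (1 - b) / (1 - b)) has_real_derivative t powr (- b)) (at t)" if "t > 0" for t
    using that assms by (auto intro!: derivative_eq_intros)
  show "((\<lambda>t. t powr - b) has_real_derivative - b * t powr (- b - 1)) (at t)" if "t > 0" for t
    using that assms by (auto intro!: derivative_eq_intros)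
  show "((\<lambda>t. - b * t powr (- b - 1)) has_real_derivative b * (b + 1) * t powr (- b - 2)) (at t)" if "t > 0" for t
    using that assms by (auto intro!: derivative_eq_intros simp: algebra_simps)
  show "\<bar>b * (b + 1) * t powr (- b - 2)\<bar> \<le> 2 / t\<^sup>2" if "1 \<le> t" for t
  proof -
    have "t powr (-b - 2) \<le> t powr (-2)" using that assms by (intro powr_mono) auto
    also have "\<dots> = 1 / t\<^sup>2" using that by (simp add: powr_minus divide_simps flip: powr_numeral)
    finally have 1: "t powr (-b - 2) \<le> 1 / t\<^sup>2" .
    have "b * (b + 1) \<le> 1 * 2" using assms by (intro mult_mono) auto
    then have "b * (b + 1) * t powr (- b - 2) \<le> 2 * (1 / t\<^sup>2)" using 1 assms by (intro mult_mono) auto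
    then show ?thesis using assms by (simp add: abs_mult)
  qed
qed

section \<open>Logarithms along the zero ray and their primitive\<close>

text \<open>A scale-invariant distance from the positive axis: it holds with one fixed
  \<open>s > 0\<close> on every closed sector that meets the axis only at 0.\<close>

definition off_ray :: "real \<Rightarrow> complex \<Rightarrow> bool" where
  "off_ray s y \<longleftrightarrow> (\<forall>t>0. s * t \<le> cmod (of_real t - y) \<and> s * cmod y \<le> cmod (of_real t - y))"

text \<open>An antiderivative of \<open>\<lambda>t. Ln (t powr (1/n) - y)\<close>, continuous up to \<open>t = 0\<close>.\<close>
definition ray_prim :: "nat \<Rightarrow> complex \<Rightarrow> real \<Rightarrow> complex" where
  "ray_prim n y t = (of_real t - y ^ n) * Ln (of_real (t powr (1 / n)) - y)
     - (\<Sum>i<n. y ^ i * of_real (t powr (1 - i / n)) / of_nat (n - i))"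

lemma ray_diff_nonpos:
  assumes "y \<notin> \<real>\<^sub>\<ge>\<^sub>0" "t \<ge> (0::real)"
  shows "complex_of_real t - y \<notin> \<real>\<^sub>\<le>\<^sub>0"
proof
  assume "complex_of_real t - y \<in> \<real>\<^sub>\<le>\<^sub>0"
  then obtain r where "r \<le> 0" "complex_of_real t - y = complex_of_real r" by (auto elim!: nonpos_Reals_cases)
  then have "y = of_real (t - r)" by (simp add: algebra_simps)
  then show False using assms \<open>r \<le> 0\<close> by (simp flip: of_real_diff add: nonneg_Reals_of_real_iff)
qed

lemma DERIV_Re_of_real:
  assumes "(F has_field_derivative D) (at (complex_of_real t))" "t > 0"
    and "\<And>x::real. x > 0 \<Longrightarrow> Re (F (of_real x)) = g x"
  shows "(g has_real_derivative Re D) (at t)"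
proof -
  have "((\<lambda>t. F (of_real t)) has_vector_derivative D) (at t)"
    using assms(1) by (rule has_vector_derivative_real_field)
  then have "((\<lambda>t. Re (F (of_real t))) has_real_derivative Re D) (at t)"
    by (rule has_field_derivative_Re)
  moreover have "\<forall>\<^sub>F x in nhds t. Re (F (of_real x)) = g x"
  proof (rule eventually_mono)
    show "\<forall>\<^sub>F x in nhds t. x \<in> {0<..}" using assms by (intro eventually_nhds_in_open) auto
  qed (use assms in auto)
  ultimately show ?thesis by (subst (asm) DERIV_cong_ev) auto
qed

text \<open>Put \<open>w = t^(1/n)\<close>. As \<open>t = w^n\<close>, differentiating
  \<open>Ln (w - y)\<close> produces the quotient \<open>(w^n - y^n) / (w - y)\<close>, a geometric
  sum in \<open>y\<close> and \<open>w\<close>. The derivative of the sum subtracted in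
  \<open>ray_prim\<close> is the same geometric sum, so only the logarithm is left.\<close>

lemma ray_prim_deriv:
  assumes n: "n > 0" and y: "y \<notin> \<real>\<^sub>\<ge>\<^sub>0" and t: "t > 0"
  shows "((\<lambda>t. Re (ray_prim n y t)) has_real_derivative ln (cmod (of_real (t powr (1/n)) - y))) (at t)"
proof -
  define \<beta> :: complex where "\<beta> = of_real (1 / n)"
  define F where "F z = (z - y ^ n) * Ln (z powr \<beta> - y)
     - (\<Sum>i<n. y ^ i * z powr (1 - of_nat i * \<beta>) / of_nat (n - i))" for z
  define w :: complex where "w = of_real (t powr (1/n))"
  have w: "of_real t powr \<beta> = w" using t by (simp add: \<beta>_def w_def flip: powr_of_real)
  have wn: "w ^ n = of_real t" unfolding w_def
    using n t by (simp flip: of_real_power add: powr_power)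
  have w0: "w \<noteq> 0" and t0: "of_real t \<noteq> (0::complex)" using t by (auto simp: w_def)
  have tn: "of_real t \<notin> (\<real>\<^sub>\<le>\<^sub>0 :: complex set)" using t by (simp add: nonpos_Reals_of_real_iff)
  have wy: "w - y \<notin> \<real>\<^sub>\<le>\<^sub>0" unfolding w_def using y by (rule ray_diff_nonpos) auto
  then have wy0: "w - y \<noteq> 0" by auto
  have pw: "of_real t powr (- (of_nat i * \<beta>)) = w ^ (n - i) / of_real t" if "i < n" for i
  proof -
    have "of_real t powr (- (of_nat i * \<beta>)) = 1 / (of_real t powr \<beta>) ^ i"
      using t0 by (simp add: powr_def divide_inverse mult.assoc flip: exp_of_nat_mult exp_minus)
    also have "\<dots> = w ^ (n - i) / of_real t"
      using that w0 unfolding w by (simp add: divide_simps flip: power_add wn)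
    finally show ?thesis .
  qed
  have "(F has_field_derivative
      (Ln (w - y) + (of_real t - y ^ n) * (\<beta> * of_real t powr (\<beta> - 1) / (w - y))
       - (\<Sum>i<n. y ^ i * ((1 - of_nat i * \<beta>) * of_real t powr (- (of_nat i * \<beta>))) / of_nat (n - i))))
      (at (of_real t))"
    unfolding F_def using tn wy t0
    by (auto intro!: derivative_eq_intros sum.cong simp: w divide_inverse mult_ac)
  also have "(of_real t - y ^ n) * (\<beta> * of_real t powr (\<beta> - 1) / (w - y)) =
      \<beta> * w / of_real t * ((w ^ n - y ^ n) / (w - y))"
    using t0 by (simp add: powr_diff w wn)
  also have "(w ^ n - y ^ n) / (w - y) = (\<Sum>i<n. y ^ i * w ^ (n - Suc i))"
    using wy0 power_diff_sumr2[of y n w] by (simp add: divide_simps) (simp add: algebra_simps)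
  also have "(\<Sum>i<n. y ^ i * ((1 - of_nat i * \<beta>) * of_real t powr (- (of_nat i * \<beta>))) / of_nat (n - i))
      = \<beta> * w / of_real t * (\<Sum>i<n. y ^ i * w ^ (n - Suc i))"
    unfolding sum_distrib_left
  proof (rule sum.cong[OF refl])
    fix i assume i: "i \<in> {..<n}"
    then have q: "1 - of_nat i * \<beta> = \<beta> * of_nat (n - i)" "of_nat (n - i) \<noteq> (0 :: complex)"
      using n by (auto simp: \<beta>_def of_nat_diff divide_simps)
    have "w ^ (n - i) = w * w ^ (n - Suc i)" using i by (simp add: Suc_diff_Suc flip: power_Suc)
    then have "of_real t powr - (of_nat i * \<beta>) = w * w ^ (n - Suc i) / of_real t" using pw[of i] i by simp
    then show "y ^ i * ((1 - of_nat i * \<beta>) * of_real t powr - (of_nat i * \<beta>)) / of_nat (n - i) =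
         \<beta> * w / of_real t * (y ^ i * w ^ (n - Suc i))"
      unfolding q(1) using q(2) by (simp add: field_simps del: of_nat_diff)
  qed
  finally have "(F has_field_derivative Ln (w - y)) (at (of_real t))" by simp
  then have "((\<lambda>t. Re (ray_prim n y t)) has_real_derivative Re (Ln (w - y))) (at t)"
  proof (rule DERIV_Re_of_real[OF _ t])
    fix x :: real assume x: "x > 0"
    have "of_real x powr (1 - of_nat i * \<beta>) = complex_of_real (x powr (1 - i / n))" for i
    proof -
      have "(1 - of_nat i * \<beta>) = of_real (1 - i / n)" by (simp add: \<beta>_def)
      then show ?thesis using x by (metis less_imp_le powr_of_real)
    qed
    moreover have "of_real x powr \<beta> = complex_of_real (x powr (1/n))"
      unfolding \<beta>_def using x by (intro powr_of_real) auto
    ultimately show "Re (F (of_real x)) = Re (ray_prim n y x)" by (simp add: F_def ray_prim_def)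
  qed
  then show ?thesis using wy0 by (simp add: w_def)
qed

text \<open>For \<open>w = t^b\<close> this is \<open>w / (w - y)\<close>. Up to powers of
  \<open>t\<close>, both derivatives of \<open>ln |w - y|\<close> are polynomials in this ratio, and
  off the ray the ratio is at most \<open>1 / s\<close>; this makes the midpoint errors uniform in
  \<open>y\<close>.\<close>

definition ray_ratio :: "complex \<Rightarrow> real \<Rightarrow> real \<Rightarrow> complex" where
  "ray_ratio y b t = complex_of_real (t powr b) / (complex_of_real (t powr b) - y)"

lemma ray_ln_deriv:
  fixes y :: complex
  assumes n: "n > 0" and y: "y \<notin> \<real>\<^sub>\<ge>\<^sub>0" and t: "t > 0"
  defines "\<beta> \<equiv> 1 / real n"
  shows "((\<lambda>t. ln (cmod (of_real (t powr \<beta>) - y))) has_real_derivative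
      Re (of_real \<beta> * ray_ratio y \<beta> t / of_real t)) (at t)"
    and "((\<lambda>t. Re (of_real \<beta> * ray_ratio y \<beta> t / of_real t)) has_real_derivative
      Re (of_real (\<beta> * (\<beta> - 1)) * ray_ratio y \<beta> t / of_real (t\<^sup>2) - of_real (\<beta>\<^sup>2) * (ray_ratio y \<beta> t)\<^sup>2 / of_real (t\<^sup>2))) (at t)"
proof -
  define w :: complex where "w = of_real (t powr \<beta>)"
  have w: "of_real t powr complex_of_real \<beta> = w" using t by (simp add: w_def flip: powr_of_real)
  have t0: "of_real t \<noteq> (0::complex)" using t by (auto simp: w_def)
  have tn: "of_real t \<notin> (\<real>\<^sub>\<le>\<^sub>0 :: complex set)" using t by (simp add: nonpos_Reals_of_real_iff)
  have wy: "complex_of_real (x powr \<beta>) - y \<notin> \<real>\<^sub>\<le>\<^sub>0" for x using y by (rule ray_diff_nonpos) auto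
  then have wy0: "complex_of_real (x powr \<beta>) - y \<noteq> 0" for x by (metis nonpos_Reals_zero_I)
  have wy': "w - y \<notin> \<real>\<^sub>\<le>\<^sub>0" "w - y \<noteq> 0" unfolding w_def using wy wy0 by auto
  have xb: "of_real x powr complex_of_real \<beta> = complex_of_real (x powr \<beta>)" if "x > 0" for x
    using that by (simp flip: powr_of_real)
  have "((\<lambda>z. Ln (z powr \<beta> - y)) has_field_derivative (\<beta> * (w / (w - y)) / t)) (at (of_real t))"
    using tn wy' t0 by (auto intro!: derivative_eq_intros simp: w powr_diff divide_inverse mult_ac)
  then show "((\<lambda>t. ln (cmod (of_real (t powr \<beta>) - y))) has_real_derivative
      Re (of_real \<beta> * ray_ratio y \<beta> t / of_real t)) (at t)"
    unfolding w_def ray_ratio_def by (rule DERIV_Re_of_real[OF _ t]) (use wy0 in \<open>auto simp: xb\<close>)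
  have "((\<lambda>z. \<beta> * (z powr \<beta> / (z powr \<beta> - y)) / z) has_field_derivative
      (\<beta> * (\<beta> - 1) * (w / (w - y)) / t\<^sup>2 - \<beta>\<^sup>2 * (w / (w - y))\<^sup>2 / t\<^sup>2)) (at (of_real t))"
    using tn wy' t0 by (auto intro!: derivative_eq_intros simp: w powr_diff)
      (simp add: divide_simps power2_eq_square, simp add: algebra_simps)
  then show "((\<lambda>t. Re (of_real \<beta> * ray_ratio y \<beta> t / of_real t)) has_real_derivative
      Re (of_real (\<beta> * (\<beta> - 1)) * ray_ratio y \<beta> t / of_real (t\<^sup>2) - of_real (\<beta>\<^sup>2) * (ray_ratio y \<beta> t)\<^sup>2 / of_real (t\<^sup>2))) (at t)"
    unfolding w_def ray_ratio_def by (rule DERIV_Re_of_real[OF _ t]) (auto simp: xb)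
qed

lemma off_ray_bounds:
  fixes y :: complex
  assumes off: "off_ray s y" and s: "0 < s" and t: "t > 0" and n: "n > 0"
  defines "\<beta> \<equiv> 1 / real n"
  shows "\<bar>Re (of_real \<beta> * ray_ratio y \<beta> t / of_real t)\<bar> \<le> 1 / (s * t)"
    and "\<bar>Re (of_real (\<beta> * (\<beta> - 1)) * ray_ratio y \<beta> t / of_real (t\<^sup>2) - of_real (\<beta>\<^sup>2) * (ray_ratio y \<beta> t)\<^sup>2 / of_real (t\<^sup>2))\<bar>
      \<le> (1 / s + 1 / s\<^sup>2) / t\<^sup>2"
proof -
  define v where "v = ray_ratio y \<beta> t"
  have b: "0 \<le> \<beta>" "\<beta> \<le> 1" using n by (auto simp: \<beta>_def)
  have pos: "t powr \<beta> > 0" using t by simp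
  then have "s * (t powr \<beta>) \<le> cmod (of_real (t powr \<beta>) - y)" using off unfolding off_ray_def by blast
  moreover have "0 < s * (t powr \<beta>)" using pos s by simp
  ultimately have v: "cmod v \<le> 1 / s"
    using s by (simp add: v_def ray_ratio_def norm_divide divide_simps mult.commute)
  have "\<bar>Re (\<beta> * v / t)\<bar> \<le> cmod (\<beta> * v / t)" by (rule abs_Re_le_cmod)
  also have "\<dots> \<le> 1 * (1 / s) / t"
    unfolding norm_divide norm_mult using b v t by (intro divide_mono mult_mono) auto
  finally show "\<bar>Re (of_real \<beta> * ray_ratio y \<beta> t / of_real t)\<bar> \<le> 1 / (s * t)"
    by (simp add: v_def)
  have "\<bar>Re (of_real (\<beta> * (\<beta> - 1)) * v / of_real (t\<^sup>2) - of_real (\<beta>\<^sup>2) * v\<^sup>2 / of_real (t\<^sup>2))\<bar> \<le> cmod (of_real (\<beta> * (\<beta> - 1)) * v / of_real (t\<^sup>2) - of_real (\<beta>\<^sup>2) * v\<^sup>2 / of_real (t\<^sup>2))"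
    by (rule abs_Re_le_cmod)
  also have "\<dots> \<le> cmod (of_real (\<beta> * (\<beta> - 1)) * v / of_real (t\<^sup>2)) + cmod (of_real (\<beta>\<^sup>2) * v\<^sup>2 / of_real (t\<^sup>2))" by (rule norm_triangle_ineq4)
  also have "cmod (of_real (\<beta> * (\<beta> - 1)) * v / of_real (t\<^sup>2)) \<le> (1 * 1) * (1 / s) / t\<^sup>2"
    unfolding norm_divide norm_mult norm_of_real abs_mult using b v t
    by (intro divide_mono mult_mono mult_nonneg_nonneg) auto
  also have "cmod (of_real (\<beta>\<^sup>2) * v\<^sup>2 / of_real (t\<^sup>2)) \<le> 1 * (1 / s)\<^sup>2 / t\<^sup>2"
    unfolding norm_divide norm_mult norm_power norm_of_real using b v t
    by (intro divide_mono mult_mono power_mono) (auto simp: abs_square_le_1)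
  finally show "\<bar>Re (of_real (\<beta> * (\<beta> - 1)) * ray_ratio y \<beta> t / of_real (t\<^sup>2) - of_real (\<beta>\<^sup>2) * (ray_ratio y \<beta> t)\<^sup>2 / of_real (t\<^sup>2))\<bar>
      \<le> (1 / s + 1 / s\<^sup>2) / t\<^sup>2"
    unfolding v_def by (simp add: power_one_over add_divide_distrib)
qed

lemma continuous_on_ray_prim:
  assumes n: "n > 0" and y: "y \<notin> \<real>\<^sub>\<ge>\<^sub>0"
  shows "continuous_on {0..} (ray_prim n y)"
  unfolding ray_prim_def
  by (intro continuous_on_powr' continuous_on_Ln continuous_intros ray_diff_nonpos[OF y])
    (use n in \<open>auto simp: divide_simps\<close>)


section \<open>Midpoint error away from the zero ray\<close>

text \<open>The increments of the primitive telescope, so this is the total error of replacing the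
  sum of \<open>ln |a_m - y|\<close> over the first \<open>M\<close> zeros by an integral over
  \<open>[0, M]\<close>. Placing the zeros at the \<open>n\<close>-th roots of the midpoints
  \<open>m + 1/2\<close> makes the quadrature second order.\<close>

definition ray_err :: "nat \<Rightarrow> complex \<Rightarrow> nat \<Rightarrow> real" where
  "ray_err n y M = (\<Sum>m<M. ln (cmod (of_real ((real m + 1/2) powr (1 / n)) - y))
     - (Re (ray_prim n y (real (Suc m))) - Re (ray_prim n y (real m))))"

lemma continuous_on_x_ln: "continuous_on {0..} (\<lambda>t. t * ln (t * 2) :: real)"
proof (clarsimp simp: continuous_on_eq_continuous_within)
  fix t :: real assume "t \<ge> 0"
  show "continuous (at t within {0..}) (\<lambda>t. t * ln (t * 2))"
  proof (cases "t = 0")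
    case True
    have *: "{0..} - {0} = {0::real<..}" by auto
    have "((\<lambda>t::real. t * ln (t * 2)) \<longlongrightarrow> 0) (at_right 0)" by real_asymp
    then have "((\<lambda>t::real. t * ln (t * 2)) \<longlongrightarrow> 0) (at 0 within {0..})"
      by (simp add: at_within_def *)
    then show ?thesis using True by (simp add: continuous_within)
  next
    case False
    then have "isCont (\<lambda>t. t * ln (t * 2)) t" using \<open>t \<ge> 0\<close> by (intro continuous_intros) auto
    then show ?thesis using continuous_at_imp_continuous_at_within by blast
  qed
qed

text \<open>On \<open>[0, 1]\<close> the second derivative may grow like \<open>1 / t^2\<close>, too
  fast for the midpoint estimate. The first derivative is at most \<open>K / t\<close>, so the
  integrand differs from its midpoint value by at most \<open>K |ln (2 t)|\<close>, and this is
  integrable down to 0.\<close>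

lemma ray_err_first:
  assumes n: "n > 0" and s: "0 < s" and y: "y \<notin> \<real>\<^sub>\<ge>\<^sub>0" and off: "off_ray s y"
  shows "\<bar>ln (cmod (of_real ((1/2) powr (1 / n)) - y)) - (Re (ray_prim n y 1) - Re (ray_prim n y 0))\<bar> \<le> 2 / s"
proof -
  define f where "f t = ln (cmod (of_real (t powr (1 / n)) - y))" for t :: real
  define f1 where "f1 t = Re (of_real (1 / n) * ray_ratio y (1 / n) t / of_real t)" for t
  define K where "K = 1 / s"
  have K: "K > 0" using s by (simp add: K_def)
  have fd: "(f has_real_derivative f1 t) (at t)" if "t > 0" for t
    unfolding f_def f1_def using ray_ln_deriv(1)[OF n y that] by simp
  have f1: "\<bar>f1 t\<bar> \<le> K / t" if "t > 0" for t
    unfolding f1_def K_def using off_ray_bounds(1)[OF off s that n] by (simp add: mult.commute)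
  have mono: "f b - f a \<le> K * (ln b - ln a) \<and> f a - f b \<le> K * (ln b - ln a)"
    if "0 < a" "a \<le> b" for a b
  proof -
    have "f b - K * ln b \<le> f a - K * ln a"
    proof (rule DERIV_nonpos_imp_nonincreasing[OF that(2)])
      fix x assume "a \<le> x" "x \<le> b"
      then have x: "x > 0" using that by auto
      show "\<exists>y. ((\<lambda>a. f a - K * ln a) has_real_derivative y) (at x) \<and> y \<le> 0"
        by (intro exI[of _ "f1 x - K / x"] conjI)
          (use x f1[OF x] in \<open>auto intro!: derivative_eq_intros fd\<close>)
    qed
    moreover have "f a + K * ln a \<le> f b + K * ln b"
    proof (rule DERIV_nonneg_imp_nondecreasing[OF that(2)])
      fix x assume "a \<le> x" "x \<le> b"
      then have x: "x > 0" using that by auto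
      show "\<exists>y. ((\<lambda>a. f a + K * ln a) has_real_derivative y) (at x) \<and> y \<ge> 0"
        by (intro exI[of _ "f1 x + K / x"] conjI)
          (use x f1[OF x] in \<open>auto intro!: derivative_eq_intros fd\<close>)
    qed
    ultimately show ?thesis by (simp add: algebra_simps)
  qed
  have ln2: "ln (t * 2) = ln t - ln (1/2)" if "t > 0" for t :: real
    using that by (simp add: ln_mult ln_div)
  define R where "R t = Re (ray_prim n y t) - t * f (1/2)" for t
  \<comment> \<open>A primitive of \<open>K ln (2 t)\<close>. This majorant changes sign at the
    midpoint, so the halves are compared separately, with opposite signs of \<mu>; taking both signs
    of \<open>R\<close> gives two-sided bounds.\<close>
  define \<mu> where "\<mu> t = K * (t * ln (t * 2) - t)" for t :: real
  have Rd: "(R has_real_derivative f t - f (1/2)) (at t)" if "t > 0" for t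
    unfolding R_def by (rule derivative_eq_intros refl ray_prim_deriv[OF n y that])+ (simp add: f_def)
  have \<mu>d: "(\<mu> has_real_derivative K * ln (t * 2)) (at t)" if "t > 0" for t
    unfolding \<mu>_def using that by (auto intro!: derivative_eq_intros)
  have \<mu>c: "continuous_on {0..} \<mu>" unfolding \<mu>_def by (intro continuous_intros continuous_on_x_ln)
  have Rc: "continuous_on {0..} R"
    unfolding R_def using continuous_on_ray_prim[OF n y] by (intro continuous_intros)
  have comb: "e * \<mu> a + c * R a \<le> e * \<mu> b + c * R b"
    if "0 \<le> a" "a \<le> b" "\<And>t. a < t \<Longrightarrow> t < b \<Longrightarrow> 0 \<le> e * (K * ln (t * 2)) + c * (f t - f (1/2))" for a b c e
  proof (rule DERIV_nonneg_imp_increasing_open[OF that(2)])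
    fix x assume "a < x" "x < b"
    then show "\<exists>y. ((\<lambda>a. e * \<mu> a + c * R a) has_real_derivative y) (at x) \<and> 0 \<le> y"
      using that by (intro exI[of _ "e * (K * ln (x * 2)) + c * (f x - f (1/2))"] conjI)
        (auto intro!: derivative_eq_intros \<mu>d Rd)
  next
    show "continuous_on {a..b} (\<lambda>a. e * \<mu> a + c * R a)"
      using that(1) by (intro continuous_intros continuous_on_subset[OF \<mu>c] continuous_on_subset[OF Rc]) auto
  qed
  have "- 1 * \<mu> 0 + c * R 0 \<le> - 1 * \<mu> (1/2) + c * R (1/2)" if "\<bar>c\<bar> = 1" for c
  proof (rule comb)
    fix t :: real assume t: "0 < t" "t < 1/2"
    have "\<bar>c * (f t - f (1/2))\<bar> = \<bar>f t - f (1/2)\<bar>" using that by (simp add: abs_mult)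
    also have "\<dots> \<le> K * (ln (1/2) - ln t)" using mono[of t "1/2"] t by (simp add: abs_le_iff)
    finally have "- (c * (f t - f (1/2))) \<le> K * (ln (1/2) - ln t)" by linarith
    then show "0 \<le> - 1 * (K * ln (t * 2)) + c * (f t - f (1/2))"
      unfolding ln2[OF t(1)] by (simp add: right_diff_distrib)
  qed auto
  from this[of 1] this[of "-1"] have 1: "\<bar>R (1/2) - R 0\<bar> \<le> \<mu> 0 - \<mu> (1/2)" by (auto simp: abs_le_iff)
  have "1 * \<mu> (1/2) + c * R (1/2) \<le> 1 * \<mu> 1 + c * R 1" if "\<bar>c\<bar> = 1" for c
  proof (rule comb)
    fix t :: real assume t: "1/2 < t" "t < 1"
    have "\<bar>c * (f t - f (1/2))\<bar> = \<bar>f t - f (1/2)\<bar>" using that by (simp add: abs_mult)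
    also have "\<dots> \<le> K * (ln t - ln (1/2))" using mono[of "1/2" t] t by (simp add: abs_le_iff)
    finally have *: "- (c * (f t - f (1/2))) \<le> K * (ln t - ln (1/2))" by linarith
    have "ln (t * 2) = ln t - ln (1/2)" using ln2 t by simp
    then show "0 \<le> 1 * (K * ln (t * 2)) + c * (f t - f (1/2))"
      using * by (simp add: right_diff_distrib)
  qed auto
  from this[of 1] this[of "-1"] have 2: "\<bar>R 1 - R (1/2)\<bar> \<le> \<mu> 1 - \<mu> (1/2)" by (auto simp: abs_le_iff)
  have "ln (2::real) \<le> 1" using ln_le_minus_one[of 2] by simp
  then have "\<mu> 0 - \<mu> (1/2) + (\<mu> 1 - \<mu> (1/2)) \<le> K * 2"
    using K by (simp add: \<mu>_def algebra_simps)
  then have "\<bar>R 1 - R 0\<bar> \<le> K * 2" using 1 2 by linarith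
  then show ?thesis by (simp add: R_def f_def K_def abs_minus_commute algebra_simps)
qed

lemma ray_err_off:
  assumes n: "n > 0" and s: "0 < s"
  obtains C where "\<And>y M. y \<notin> \<real>\<^sub>\<ge>\<^sub>0 \<Longrightarrow> off_ray s y \<Longrightarrow> \<bar>ray_err n y M\<bar> \<le> C"
proof
  define K where "K = 1 / s + 1 / s\<^sup>2"
  have K: "K \<ge> 0" using s by (simp add: K_def)
  have sm: "summable (\<lambda>m. 1 / (real m)\<^sup>2)"
    using inverse_power_summable[of 2, where 'a=real] by (simp add: divide_simps)
  fix y M assume y: "y \<notin> \<real>\<^sub>\<ge>\<^sub>0" and off: "off_ray s y"
  define a where "a m = ln (cmod (of_real ((real m + 1/2) powr (1 / n)) - y))
     - (Re (ray_prim n y (real (Suc m))) - Re (ray_prim n y (real m)))" for m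
  have a: "\<bar>a m\<bar> \<le> (if m = 0 then 2 / s else 0) + K * (1 / (real m)\<^sup>2)" for m
  proof (cases "m = 0")
    case True
    then show ?thesis using ray_err_first[OF n s y off] by (simp add: a_def)
  next
    case False
    define f where "f t = ln (cmod (of_real (t powr (1 / n)) - y))" for t :: real
    have "\<bar>f (real m + 1/2) - (Re (ray_prim n y (real m + 1/2 + 1/2)) - Re (ray_prim n y (real m + 1/2 - 1/2)))\<bar> \<le> K / (real m)\<^sup>2"
    proof (rule midpoint_rule_error)
      fix t assume t: "t \<in> {real m + 1/2 - 1/2..real m + 1/2 + 1/2}"
      then have m: "t > 0" "real m \<le> t" "real m > 0" using False by auto
      show "((\<lambda>x. Re (ray_prim n y x)) has_real_derivative f t) (at t)"
        unfolding f_def by (rule ray_prim_deriv[OF n y m(1)])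
      show "(f has_real_derivative Re (of_real (1 / n) * ray_ratio y (1 / n) t / of_real t)) (at t)"
        unfolding f_def by (rule ray_ln_deriv(1)[OF n y m(1)])
      note ray_ln_deriv(2)[OF n y m(1)]
      then show "((\<lambda>t. Re (of_real (1 / n) * ray_ratio y (1 / n) t / of_real t)) has_real_derivative
        Re (of_real (1 / n * (1 / n - 1)) * ray_ratio y (1 / n) t / of_real (t\<^sup>2) - of_real ((1 / n)\<^sup>2) * (ray_ratio y (1 / n) t)\<^sup>2 / of_real (t\<^sup>2))) (at t)" .
      have "\<bar>Re (of_real (1 / n * (1 / n - 1)) * ray_ratio y (1 / n) t / of_real (t\<^sup>2) - of_real ((1 / n)\<^sup>2) * (ray_ratio y (1 / n) t)\<^sup>2 / of_real (t\<^sup>2))\<bar>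
        \<le> K / t\<^sup>2" unfolding K_def by (rule off_ray_bounds(2)[OF off s m(1) n])
      also have "\<dots> \<le> K / (real m)\<^sup>2"
        using m K by (intro divide_left_mono power_mono) (auto simp: zero_less_mult_iff)
      finally show "\<bar>Re (of_real (1 / n * (1 / n - 1)) * ray_ratio y (1 / n) t / of_real (t\<^sup>2) - of_real ((1 / n)\<^sup>2) * (ray_ratio y (1 / n) t)\<^sup>2 / of_real (t\<^sup>2))\<bar>
        \<le> K / (real m)\<^sup>2" .
    qed
    then show ?thesis using False by (simp add: a_def f_def add.commute)
  qed
  have "\<bar>ray_err n y M\<bar> \<le> (\<Sum>m<M. \<bar>a m\<bar>)" unfolding ray_err_def a_def by (rule sum_abs)
  also have "\<dots> \<le> (\<Sum>m<M. (if m = 0 then 2 / s else 0) + K * (1 / (real m)\<^sup>2))" by (rule sum_mono) (rule a)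
  also have "\<dots> = (\<Sum>m<M. (if m = 0 then 2 / s else 0)) + K * (\<Sum>m<M. 1 / (real m)\<^sup>2)"
    by (simp add: sum.distrib sum_distrib_left)
  also have "(\<Sum>m<M. (if m = 0 then 2 / s else 0)) \<le> 2 / s" using s by (simp add: sum.delta)
  also have "K * (\<Sum>m<M. 1 / (real m)\<^sup>2) \<le> K * (\<Sum>m. 1 / (real m)\<^sup>2)"
    by (intro mult_left_mono sum_le_suminf sm K) auto
  finally show "\<bar>ray_err n y M\<bar> \<le> 2 / s + K * (\<Sum>m. 1 / (real m)\<^sup>2)" by simp
qed


section \<open>Midpoint error near the zero ray\<close>

text \<open>Uniform in the shift \<open>b\<close>, because each value of \<open>|m - b|\<close> is
  taken at most twice. The shift will be the integer part of \<open>Re (y^n)\<close>, over which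
  there is no control.\<close>

lemma sum_inverse_square_shift:
  obtains S where "S \<ge> 0" "\<And>M (b::int). (\<Sum>m<M. 1 / (1 + (real_of_int (int m - b))\<^sup>2)) \<le> S"
proof
  define g where "g k = 1 / (1 + (real k)\<^sup>2)" for k
  have "summable (\<lambda>m. 1 / (real m)\<^sup>2)"
    using inverse_power_summable[of 2, where 'a=real] by (simp add: divide_simps)
  then have g: "summable g"
    by (rule summable_comparison_test'[where N=1]) (auto simp: g_def intro!: divide_left_mono mult_pos_pos add_pos_nonneg)
  show "2 * suminf g \<ge> 0" using g by (simp add: suminf_nonneg g_def)
  have fin: "sum g A \<le> suminf g" if "finite A" for A
    using that g by (intro sum_le_suminf) (auto simp: g_def)
  fix M and b :: int
  define h where "h m = nat \<bar>int m - b\<bar>" for m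
  have "(\<Sum>m<M. 1 / (1 + (real_of_int (int m - b))\<^sup>2)) = (\<Sum>m<M. g (h m))"
    by (intro sum.cong) (auto simp: g_def h_def)
  also have "\<dots> = (\<Sum>m\<in>{m\<in>{..<M}. int m \<ge> b}. g (h m)) + (\<Sum>m\<in>{m\<in>{..<M}. \<not> int m \<ge> b}. g (h m))"
    by (subst sum.union_disjoint[symmetric]) (auto intro!: sum.cong)
  also have "(\<Sum>m\<in>{m\<in>{..<M}. int m \<ge> b}. g (h m)) = sum g (h ` {m\<in>{..<M}. int m \<ge> b})"
    by (subst sum.reindex) (auto simp: inj_on_def h_def)
  also have "(\<Sum>m\<in>{m\<in>{..<M}. \<not> int m \<ge> b}. g (h m)) = sum g (h ` {m\<in>{..<M}. \<not> int m \<ge> b})"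
    by (subst sum.reindex) (auto simp: inj_on_def h_def)
  also have "sum g (h ` {m\<in>{..<M}. int m \<ge> b}) + sum g (h ` {m\<in>{..<M}. \<not> int m \<ge> b}) \<le> suminf g + suminf g"
    by (intro add_mono fin) auto
  finally show "(\<Sum>m<M. 1 / (1 + (real_of_int (int m - b))\<^sup>2)) \<le> 2 * suminf g" by simp
qed

definition ln_prim :: "complex \<Rightarrow> real \<Rightarrow> real" where
  "ln_prim x t = Re ((of_real t - x) * Ln (of_real t - x)) - t"

lemma ln_prim_deriv:
  assumes "x \<notin> \<real>\<^sub>\<ge>\<^sub>0" "t \<ge> 0"
  shows "(ln_prim x has_real_derivative ln (cmod (of_real t - x))) (at t)"
    and "((\<lambda>t. ln (cmod (of_real t - x))) has_real_derivative Re (1 / (of_real t - x))) (at t)"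
    and "((\<lambda>t. Re (1 / (of_real t - x))) has_real_derivative Re (- 1 / (of_real t - x)\<^sup>2)) (at t)"
proof -
  have tx: "complex_of_real t - x \<notin> \<real>\<^sub>\<le>\<^sub>0" using assms by (rule ray_diff_nonpos)
  then have nz: "complex_of_real t - x \<noteq> 0" by (metis nonpos_Reals_zero_I)
  have "((\<lambda>t. (complex_of_real t - x) * Ln (complex_of_real t - x)) has_vector_derivative (1 + Ln (of_real t - x))) (at t)"
    by (rule has_vector_derivative_real_field) (use tx nz in \<open>auto intro!: derivative_eq_intros\<close>)
  then have "((\<lambda>t. Re ((complex_of_real t - x) * Ln (complex_of_real t - x))) has_real_derivative Re (1 + Ln (of_real t - x))) (at t)"
    by (rule has_field_derivative_Re)
  from DERIV_diff[OF this DERIV_ident] show "(ln_prim x has_real_derivative ln (cmod (of_real t - x))) (at t)"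
    using nz by (simp add: ln_prim_def[abs_def])
  have ev: "\<forall>\<^sub>F u in nhds t. Re (Ln (of_real u - x)) = ln (cmod (of_real u - x))"
  proof (rule eventually_mono)
    have "\<forall>\<^sub>F u in nhds t. complex_of_real u - x \<in> - {0}"
      using nz by (intro eventually_compose_filterlim[OF eventually_nhds_in_open[of "- {0}" "of_real t - x"]] tendsto_intros filterlim_ident) auto
    then show "\<forall>\<^sub>F u in nhds t. complex_of_real u \<noteq> x" by eventually_elim auto
  qed auto
  have "((\<lambda>t. Ln (complex_of_real t - x)) has_vector_derivative (1 / (of_real t - x))) (at t)"
    by (rule has_vector_derivative_real_field) (use tx nz in \<open>auto intro!: derivative_eq_intros simp: divide_inverse\<close>)
  from has_field_derivative_Re[OF this]
  show "((\<lambda>t. ln (cmod (of_real t - x))) has_real_derivative Re (1 / (of_real t - x))) (at t)"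
    by (subst (asm) DERIV_cong_ev[OF refl ev refl])
  have "((\<lambda>t. 1 / (complex_of_real t - x)) has_vector_derivative (- 1 / (of_real t - x)\<^sup>2)) (at t)"
    by (rule has_vector_derivative_real_field) (use tx nz in \<open>auto intro!: derivative_eq_intros simp: divide_inverse power2_eq_square\<close>)
  from has_field_derivative_Re[OF this]
  show "((\<lambda>t. Re (1 / (of_real t - x))) has_real_derivative Re (- 1 / (of_real t - x)\<^sup>2)) (at t)" .
qed

text \<open>The modulus of the logarithm is at most \<open>|ln |w|| + pi\<close>; multiplied by
  \<open>|w|\<close>, the first part stays below 1 even near 0 and the second below 6.\<close>

lemma w_Ln_w_bound:
  assumes "cmod w \<le> 3/2"
  shows "\<bar>Re (w * Ln w)\<bar> \<le> 7"
proof (cases "w = 0")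
  case False
  have "cmod (Ln w) \<le> \<bar>Re (Ln w)\<bar> + \<bar>Im (Ln w)\<bar>" by (rule cmod_le)
  moreover have "\<bar>Im (Ln w)\<bar> \<le> pi" using mpi_less_Im_Ln[OF False] Im_Ln_le_pi[OF False] by linarith
  moreover have "Re (Ln w) = ln (cmod w)" using False by simp
  ultimately have "cmod (Ln w) \<le> \<bar>ln (cmod w)\<bar> + pi" by linarith
  then have "cmod w * cmod (Ln w) \<le> cmod w * (\<bar>ln (cmod w)\<bar> + pi)" by (intro mult_left_mono) auto
  moreover have "cmod w * \<bar>ln (cmod w)\<bar> \<le> 1"
  proof (cases "cmod w \<le> 1")
    case True
    have "ln (1 / cmod w) \<le> 1 / cmod w" using False ln_le_minus_one[of "1 / cmod w"] by simp
    then have "- ln (cmod w) \<le> 1 / cmod w" using False by (simp add: ln_div)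
    then have "cmod w * - ln (cmod w) \<le> cmod w * (1 / cmod w)" by (intro mult_left_mono) auto
    then show ?thesis using True False by simp
  next
    case c: False
    then have "ln (cmod w) \<le> 1/2" "ln (cmod w) \<ge> 0" using ln_le_minus_one[of "cmod w"] assms False by (simp_all add: field_simps)
    then have "cmod w * \<bar>ln (cmod w)\<bar> \<le> 3/2 * (1/2)" using assms by (intro mult_mono) auto
    then show ?thesis by simp
  qed
  moreover have "cmod w * pi \<le> 3/2 * 4" using assms pi_less_4 by (intro mult_mono) auto
  ultimately have "cmod (w * Ln w) \<le> 7" by (simp add: norm_mult distrib_left)
  then show ?thesis using abs_Re_le_cmod order_trans by blast
qed auto

text \<open>Only an upper bound can hold, since the midpoint value tends to minus infinity when
  \<open>x\<close> approaches the midpoint. Within distance 1 of it the logarithm is nonpositive and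
  the primitive is bounded; farther away the midpoint rule applies with a second derivative of size
  \<open>1 / distance^2\<close>.\<close>

lemma ln_prim_err:
  fixes x :: complex
  assumes x: "x \<notin> \<real>\<^sub>\<ge>\<^sub>0"
  shows "ln (cmod (of_real (real m + 1/2) - x)) - (ln_prim x (real m + 1) - ln_prim x (real m))
    \<le> 30 * (1 / (1 + (real_of_int (int m - \<lfloor>Re x\<rfloor>))\<^sup>2))"
proof -
  define c where "c = of_real (real m + 1/2) - x"
  define k where "k = \<bar>int m - \<lfloor>Re x\<rfloor>\<bar>"
  have k: "cmod c \<ge> real_of_int k - 1/2"
  proof -
    have "\<bar>Re c\<bar> \<le> cmod c" by (rule abs_Re_le_cmod)
    moreover have "\<bar>Re c\<bar> \<ge> real_of_int k - 1/2"
      unfolding c_def k_def by simp linarith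
    ultimately show ?thesis by linarith
  qed
  have k2: "(real_of_int (int m - \<lfloor>Re x\<rfloor>))\<^sup>2 = (real_of_int k)\<^sup>2" unfolding k_def by simp
  show ?thesis
  proof (cases "cmod c < 1")
    case True
    have "complex_of_real (real m + 1) - x = c + 1/2" "complex_of_real (real m) - x = c - 1/2" by (auto simp: c_def)
    moreover have "cmod (c + 1/2) \<le> 3/2" "cmod (c - 1/2) \<le> 3/2"
      using True norm_triangle_ineq[of c "1/2"] norm_triangle_ineq4[of c "1/2"] by auto
    ultimately have "\<bar>Re ((complex_of_real (real m + 1) - x) * Ln (complex_of_real (real m + 1) - x))\<bar> \<le> 7"
      "\<bar>Re ((complex_of_real (real m) - x) * Ln (complex_of_real (real m) - x))\<bar> \<le> 7"
      by (metis w_Ln_w_bound)+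
    moreover have "ln (cmod c) \<le> 0" using True by (cases "c = 0") auto
    \<comment> \<open>Each of the two values of the primitive contributes at most 7, and the linear
      term \<open>- t\<close> contributes 1. In this case \<open>k \<le> 1\<close>, so
      \<open>1 + k^2 \<le> 2\<close>, which turns 15 into the 30 of the statement.\<close>
    ultimately have 15: "ln (cmod c) - (ln_prim x (real m + 1) - ln_prim x (real m)) \<le> 15"
      unfolding ln_prim_def by linarith
    have "k \<le> 1" using k True by linarith
    then have "(real_of_int k)\<^sup>2 \<le> 1\<^sup>2" unfolding k_def by (intro power_mono) auto
    moreover have "0 < 1 + (real_of_int k)\<^sup>2" by (intro add_pos_nonneg) auto
    ultimately have "15 \<le> 30 * (1 / (1 + (real_of_int k)\<^sup>2))" by (simp add: divide_simps)
    then show ?thesis using 15 unfolding k2 c_def by linarith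
  next
    case False
    define B where "B = 1 / (cmod c - 1/2)\<^sup>2"
    define f where "f t = ln (cmod (of_real t - x))" for t :: real
    have "\<bar>f (real m + 1/2) - (ln_prim x (real m + 1/2 + 1/2) - ln_prim x (real m + 1/2 - 1/2))\<bar> \<le> B"
    proof (rule midpoint_rule_error)
      fix t assume t: "t \<in> {real m + 1/2 - 1/2..real m + 1/2 + 1/2}"
      then have t0: "t \<ge> 0" by auto
      show "(ln_prim x has_real_derivative f t) (at t)" unfolding f_def by (rule ln_prim_deriv[OF x t0])
      show "(f has_real_derivative Re (1 / (of_real t - x))) (at t)" unfolding f_def by (rule ln_prim_deriv[OF x t0])
      show "((\<lambda>t. Re (1 / (of_real t - x))) has_real_derivative Re (- 1 / (of_real t - x)\<^sup>2)) (at t)"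
        by (rule ln_prim_deriv[OF x t0])
      have "cmod c \<le> cmod (of_real t - x) + cmod (of_real (real m + 1/2) - of_real t)"
        unfolding c_def by (rule order_trans[OF _ norm_triangle_ineq]) simp
      moreover have "cmod (of_real (real m + 1/2) - of_real t) \<le> 1/2"
        unfolding of_real_diff[symmetric] norm_of_real abs_le_iff using t by auto
      ultimately have *: "cmod c - 1/2 \<le> cmod (of_real t - x)" by linarith
      have "\<bar>Re (- 1 / (of_real t - x)\<^sup>2)\<bar> \<le> cmod (- 1 / (of_real t - x)\<^sup>2)" by (rule abs_Re_le_cmod)
      also have "\<dots> = 1 / (cmod (of_real t - x))\<^sup>2" by (simp add: norm_divide norm_power)
      also have "\<dots> \<le> B" unfolding B_def
        using False * by (intro divide_left_mono power_mono zero_less_power mult_pos_pos) auto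
      finally show "\<bar>Re (- 1 / (of_real t - x)\<^sup>2)\<bar> \<le> B" .
    qed
    then have "f (real m + 1/2) - (ln_prim x (real m + 1) - ln_prim x (real m)) \<le> B" by (simp add: add.assoc)
    \<comment> \<open>For \<open>k \<le> 1\<close> use \<open>|c| - 1/2 \<ge> 1/2\<close>; for
      \<open>k \<ge> 2\<close> use \<open>|c| - 1/2 \<ge> k - 1 \<ge> k/2\<close>. The factor 8
      serves both.\<close>
    moreover have "1 + (real_of_int k)\<^sup>2 \<le> 8 * (cmod c - 1/2)\<^sup>2"
    proof (cases "k \<le> 1")
      case True
      then have "(real_of_int k)\<^sup>2 \<le> 1\<^sup>2" unfolding k_def by (intro power_mono) auto
      moreover have "(1/2)\<^sup>2 \<le> (cmod c - 1/2)\<^sup>2" using False by (intro power_mono) auto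
      ultimately show ?thesis by (simp add: power2_eq_square)
    next
      case k1: False
      have "(real_of_int k / 2)\<^sup>2 \<le> (cmod c - 1/2)\<^sup>2" using k k1 by (intro power_mono) auto
      moreover have "1\<^sup>2 \<le> (real_of_int k)\<^sup>2" using k1 by (intro power_mono) auto
      ultimately show ?thesis by (simp add: power_divide)
    qed
    then have "B \<le> 8 * (1 / (1 + (real_of_int k)\<^sup>2))"
      unfolding B_def using False by (simp add: divide_simps add_pos_nonneg zero_less_power split: if_splits)
    moreover have "8 * (1 / (1 + (real_of_int k)\<^sup>2)) \<le> 30 * (1 / (1 + (real_of_int k)\<^sup>2))"
      by (intro mult_right_mono) auto
    ultimately show ?thesis unfolding k2 f_def by linarith
  qed
qed


lemma prod_diff_roots_unity:
  fixes w y :: complex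
  assumes n: "n > 0"
  shows "w ^ n - y ^ n = (\<Prod>\<omega> | \<omega> ^ n = 1. w - \<omega> * y)"
proof (cases "y = 0")
  case True
  then show ?thesis using n by (simp add: card_roots_unity_eq power_0_left)
next
  case False
  define p :: "complex poly" where "p = monom 1 n + [:-1:]"
  have root: "poly p z = 0 \<longleftrightarrow> z ^ n = 1" for z by (simp add: p_def poly_monom)
  have "rsquarefree p"
    unfolding rsquarefree_roots using n
    by (auto simp: p_def poly_monom pderiv_add pderiv_monom pderiv_pCons power_0_left)
  then have "p = smult (lead_coeff p) (\<Prod>z|poly p z = 0. [:-z, 1:])"
    by (simp add: complex_poly_decompose_rsquarefree)
  moreover have "lead_coeff p = 1"
  proof -
    have "degree (monom 1 n + [:-1:] :: complex poly) = n"
      using n by (subst degree_add_eq_left) (auto simp: degree_monom_eq)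
    then show ?thesis using n by (simp add: p_def coeff_pCons split: nat.split)
  qed
  ultimately have "p = (\<Prod>z|z ^ n = 1. [:-z, 1:])" by (simp add: root)
  then have "poly p (w / y) = (\<Prod>z|z ^ n = 1. w / y - z)" by (simp add: poly_prod)
  then have "(w / y) ^ n - 1 = (\<Prod>z|z ^ n = 1. w / y - z)" by (simp add: p_def poly_monom)
  moreover have "(\<Prod>z|z ^ n = 1. w - z * y) = (\<Prod>z|z ^ n = 1. y * (w / y - z))"
    using False by (intro prod.cong) (auto simp: field_simps)
  moreover have "\<dots> = y ^ n * (\<Prod>z|z ^ n = 1. w / y - z)"
    using n by (simp add: prod.distrib card_roots_unity_eq)
  ultimately show ?thesis using False by (simp add: power_divide field_simps)
qed

text \<open>The product of \<open>t^(1/n) - \<omega> y\<close> over all \<open>n\<close>-th roots of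
  unity \<omega> is \<open>t - y^n\<close>. So the errors at the points \<open>\<omega> y\<close>
  add up to a midpoint error for \<open>ln |t - y^n|\<close>, which is bounded above. All summands
  except the one at \<open>y\<close> itself belong to points off the ray and are bounded below; what
  remains is an upper bound at \<open>y\<close>.\<close>

lemma ray_err_near:
  assumes n: "n > 0" and s: "0 < s"
  obtains C where "\<And>y M. y \<notin> \<real>\<^sub>\<ge>\<^sub>0 \<Longrightarrow> y ^ n \<notin> \<real>\<^sub>\<ge>\<^sub>0 \<Longrightarrow>
    (\<And>\<omega>. \<omega> ^ n = 1 \<Longrightarrow> \<omega> \<noteq> 1 \<Longrightarrow> off_ray s (\<omega> * y)) \<Longrightarrow> ray_err n y M \<le> C"
proof -
  obtain C where C: "\<And>y M. y \<notin> \<real>\<^sub>\<ge>\<^sub>0 \<Longrightarrow> off_ray s y \<Longrightarrow> \<bar>ray_err n y M\<bar> \<le> C"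
    using ray_err_off[OF n s] by blast
  obtain S where "S \<ge> 0" and S: "\<And>M (b::int). (\<Sum>m<M. 1 / (1 + (real_of_int (int m - b))\<^sup>2)) \<le> S"
    using sum_inverse_square_shift by metis
  define U where "U = {\<omega>::complex. \<omega> ^ n = 1}"
  have finU: "finite U" unfolding U_def using n by (intro finite_roots_unity) auto
  show ?thesis
  proof (rule that)
    fix y M
    assume y: "y \<notin> \<real>\<^sub>\<ge>\<^sub>0" and yn: "y ^ n \<notin> \<real>\<^sub>\<ge>\<^sub>0"
      and off: "\<And>\<omega>. \<omega> ^ n = 1 \<Longrightarrow> \<omega> \<noteq> 1 \<Longrightarrow> off_ray s (\<omega> * y)"
    have ny: "\<omega> * y \<notin> \<real>\<^sub>\<ge>\<^sub>0" if "\<omega> \<in> U" for \<omega>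
    proof
      assume "\<omega> * y \<in> \<real>\<^sub>\<ge>\<^sub>0"
      then have "(\<omega> * y) ^ n \<in> \<real>\<^sub>\<ge>\<^sub>0" by (auto elim!: nonneg_Reals_cases simp flip: of_real_power)
      then show False using yn that by (simp add: U_def power_mult_distrib)
    qed
    have lnsum: "(\<Sum>\<omega>\<in>U. ln (cmod (of_real (t powr (1 / n)) - \<omega> * y))) = ln (cmod (of_real t - y ^ n))"
      if "t > 0" for t :: real
    proof -
      have "(of_real (t powr (1 / n)) :: complex) ^ n = of_real t"
        using n that by (simp flip: of_real_power add: powr_power)
      then have "cmod (of_real t - y ^ n) = (\<Prod>\<omega>\<in>U. cmod (of_real (t powr (1 / n)) - \<omega> * y))"
        using prod_diff_roots_unity[OF n, of "of_real (t powr (1 / n))" y] by (simp add: U_def prod_norm)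
      then show ?thesis
        using ny ray_diff_nonpos[OF ny, of _ "t powr (1 / n)"]
        by (simp, subst ln_prod) (use finU in \<open>auto, force\<close>)
    qed
    \<comment> \<open>Both sides have the same derivative for \<open>t > 0\<close>; continuity at 0
      covers the interval with \<open>m = 0\<close>.\<close>
    have prim: "(\<Sum>\<omega>\<in>U. Re (ray_prim n (\<omega> * y) (real (Suc m))) - Re (ray_prim n (\<omega> * y) (real m)))
        = ln_prim (y ^ n) (real m + 1) - ln_prim (y ^ n) (real m)" for m
    proof -
      define D where "D t = (\<Sum>\<omega>\<in>U. Re (ray_prim n (\<omega> * y) t)) - ln_prim (y ^ n) t" for t
      have "D (real m + 1) = D (real m)"
      proof (rule DERIV_isconst2[of "real m" "real m + 1"])
        have "continuous_on {0..} (\<lambda>t. \<Sum>\<omega>\<in>U. Re (ray_prim n (\<omega> * y) t))"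
          using continuous_on_ray_prim[OF n ny] by (intro continuous_intros) auto
        moreover have "continuous_on {0..} (ln_prim (y ^ n))"
          by (rule continuous_at_imp_continuous_on) (auto intro: DERIV_isCont[OF ln_prim_deriv(1)[OF yn]])
        ultimately show "continuous_on {real m..real m + 1} D"
          unfolding D_def by (intro continuous_on_diff) (auto elim: continuous_on_subset)
        fix t assume t: "real m < t" "t < real m + 1"
        then have t0: "t > 0" by linarith
        have "((\<lambda>t. \<Sum>\<omega>\<in>U. Re (ray_prim n (\<omega> * y) t)) has_real_derivative
            (\<Sum>\<omega>\<in>U. ln (cmod (of_real (t powr (1 / n)) - \<omega> * y)))) (at t)"
          using ray_prim_deriv[OF n ny t0] by (intro DERIV_sum) auto
        from DERIV_diff[OF this ln_prim_deriv(1)[OF yn, of t]] lnsum[OF t0] t0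
        show "(D has_real_derivative 0) (at t)" by (simp add: D_def[abs_def])
      qed auto
      then show ?thesis by (simp add: D_def sum_subtractf add.commute algebra_simps)
    qed
    have "(\<Sum>\<omega>\<in>U. ray_err n (\<omega> * y) M) =
      (\<Sum>m<M. ln (cmod (of_real (real m + 1/2) - y ^ n)) - (ln_prim (y ^ n) (real m + 1) - ln_prim (y ^ n) (real m)))"
      unfolding ray_err_def by (subst sum.swap) (simp add: sum_subtractf lnsum prim[unfolded sum_subtractf] flip: of_nat_Suc)
    also have "\<dots> \<le> (\<Sum>m<M. 30 * (1 / (1 + (real_of_int (int m - \<lfloor>Re (y ^ n)\<rfloor>))\<^sup>2)))"
      by (intro sum_mono ln_prim_err yn)
    also have "\<dots> \<le> 30 * S" unfolding sum_distrib_left[symmetric] by (intro mult_left_mono S) auto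
    finally have 1: "(\<Sum>\<omega>\<in>U. ray_err n (\<omega> * y) M) \<le> 30 * S" .
    have "1 \<in> U" by (simp add: U_def)
    then have "(\<Sum>\<omega>\<in>U. ray_err n (\<omega> * y) M) = ray_err n y M + (\<Sum>\<omega>\<in>U - {1}. ray_err n (\<omega> * y) M)"
      using finU by (simp add: sum.remove)
    moreover have "(\<Sum>\<omega>\<in>U - {1}. - C) \<le> (\<Sum>\<omega>\<in>U - {1}. ray_err n (\<omega> * y) M)"
    proof (rule sum_mono)
      fix \<omega> assume "\<omega> \<in> U - {1}"
      then have "\<bar>ray_err n (\<omega> * y) M\<bar> \<le> C" using ny off by (intro C) (auto simp: U_def)
      then show "- C \<le> ray_err n (\<omega> * y) M" by linarith
    qed
    ultimately show "ray_err n y M \<le> 30 * S + real (card (U - {1})) * C" using 1 by simp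
  qed
qed


text \<open>Expand \<open>|t - y|^2\<close> and absorb the cross term by
  \<open>2 t |y| \<le> t^2 + |y|^2\<close>, which leaves the fraction \<open>1 - c\<close> of both
  squares.\<close>

lemma off_rayI:
  assumes c: "Re y \<le> c * cmod y" and c1: "0 \<le> c" "c \<le> 1"
  shows "off_ray (sqrt (1 - c)) y"
  unfolding off_ray_def
proof (intro allI impI)
  fix t :: real assume t: "t > 0"
  have "(cmod (of_real t - y))\<^sup>2 = t\<^sup>2 + (cmod y)\<^sup>2 - 2 * t * Re y"
    by (simp add: cmod_power2 power2_diff algebra_simps)
  moreover have "t * Re y \<le> t * (c * cmod y)" using t c by (intro mult_left_mono) auto
  moreover have "c * (2 * t * cmod y) \<le> c * (t\<^sup>2 + (cmod y)\<^sup>2)"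
    using sum_squares_bound[of t "cmod y"] c1 by (intro mult_left_mono) (auto simp: mult_ac)
  ultimately have *: "(1 - c) * (t\<^sup>2 + (cmod y)\<^sup>2) \<le> (cmod (of_real t - y))\<^sup>2"
    by (simp add: algebra_simps)
  have "(sqrt (1 - c) * t)\<^sup>2 \<le> (1 - c) * (t\<^sup>2 + (cmod y)\<^sup>2)"
    "(sqrt (1 - c) * cmod y)\<^sup>2 \<le> (1 - c) * (t\<^sup>2 + (cmod y)\<^sup>2)"
    using c1 by (auto simp: power_mult_distrib intro!: mult_left_mono)
  from this[THEN order_trans[OF _ *]]
  show "sqrt (1 - c) * t \<le> cmod (of_real t - y) \<and> sqrt (1 - c) * cmod y \<le> cmod (of_real t - y)"
    by (auto dest: power2_le_imp_le)
qed

text \<open>The dichotomy is on the argument of \<open>y\<close>. Outside the sector of half-angle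
  \<open>pi / n\<close> the point is off the ray. Inside it, each nontrivial root of unity turns
  \<open>y\<close> out of the sector, and \<open>n\<close> times the argument is nonzero and lies
  strictly between \<open>- pi\<close> and \<open>pi\<close>, so \<open>y^n\<close> avoids the
  nonnegative axis.\<close>

lemma off_ray_alternative:
  fixes y :: complex
  assumes n: "n \<ge> 2" and y: "y \<notin> \<real>\<^sub>\<ge>\<^sub>0"
  defines "s \<equiv> sqrt (1 - cos (pi / n))"
  shows "off_ray s y \<or> y ^ n \<notin> \<real>\<^sub>\<ge>\<^sub>0 \<and> (\<forall>\<omega>. \<omega> ^ n = 1 \<and> \<omega> \<noteq> 1 \<longrightarrow> off_ray s (\<omega> * y))"
proof -
  define c where "c = cos (pi / n)"
  have pn: "0 < pi / n" "pi / n \<le> pi / 2" using n by (auto simp: divide_simps)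
  have c: "0 \<le> c" "c \<le> 1" unfolding c_def using pn by (auto intro!: cos_ge_zero)
  define \<phi> where "\<phi> = Arg y"
  have y0: "y \<noteq> 0" using y by auto
  have yp: "y = of_real (cmod y) * cis \<phi>" unfolding \<phi>_def using y0 by (simp add: rcis_cmod_Arg flip: rcis_def)
  have \<phi>: "- pi < \<phi>" "\<phi> \<le> pi" using Arg_bounded[of y] by (auto simp: \<phi>_def)
  show ?thesis
  proof (cases "\<bar>\<phi>\<bar> < pi / n")
    case False
    have "cos \<phi> = cos \<bar>\<phi>\<bar>" by simp
    also have "\<dots> \<le> c" unfolding c_def using False \<phi> pn by (intro cos_monotone_0_pi_le) auto
    finally have "Re y \<le> c * cmod y" using mult_left_mono[of "cos \<phi>" c "cmod y"] by (subst yp) (simp add: mult.commute)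
    then show ?thesis using off_rayI[OF _ c] by (auto simp: s_def c_def)
  next
    case True
    have "\<phi> \<noteq> 0"
    proof
      assume "\<phi> = 0"
      then have "y = of_real (cmod y)" using yp by simp
      then show False using y by (metis nonneg_Reals_of_real_iff norm_ge_zero)
    qed
    have "y ^ n \<notin> \<real>\<^sub>\<ge>\<^sub>0"
    proof
      assume "y ^ n \<in> \<real>\<^sub>\<ge>\<^sub>0"
      then obtain r where r: "r \<ge> 0" "y ^ n = of_real r" by (auto elim: nonneg_Reals_cases)
      have yn: "y ^ n = of_real (cmod y ^ n) * cis (n * \<phi>)"
        by (subst yp) (simp add: power_mult_distrib Complex.DeMoivre)
      have "sin (n * \<phi>) = 0"
        using arg_cong[OF yn, of Im] r y0 by simp
      moreover have "\<bar>n * \<phi>\<bar> < pi" using True n by (simp add: abs_mult divide_simps mult.commute)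
      ultimately show False using \<open>\<phi> \<noteq> 0\<close> n sin_eq_0_pi[of "n * \<phi>"] by (auto simp: abs_less_iff)
    qed
    moreover have "off_ray s (\<omega> * y)" if \<omega>: "\<omega> ^ n = 1" "\<omega> \<noteq> 1" for \<omega>
    proof -
      obtain j where j: "j < n" "\<omega> = cis (2 * pi * j / n)"
        using \<omega> Complex.bij_betw_roots_unity[of n] n by (auto simp: bij_betw_def)
      have j0: "j > 0" using \<omega> j by (cases j) auto
      define \<theta> where "\<theta> = 2 * pi * j / n + \<phi>"
      have "\<omega> * y = of_real (cmod y) * cis \<theta>"
        by (subst yp) (simp add: j \<theta>_def cis_mult mult_ac add.commute)
      moreover have "pi / n \<le> \<theta>" "\<theta> \<le> 2 * pi - pi / n"
      proof -
        have "2 * pi * 1 / n \<le> 2 * pi * j / n" using j0 by (intro divide_right_mono mult_left_mono) auto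
        then show "pi / n \<le> \<theta>" using True by (simp add: \<theta>_def abs_less_iff)
        have "2 * pi * j / n \<le> 2 * pi * (real n - 1) / n" using j by (intro divide_right_mono mult_left_mono) auto
        also have "\<dots> = 2 * pi - 2 * pi / n" using n by (simp add: field_simps)
        finally show "\<theta> \<le> 2 * pi - pi / n" using True by (simp add: \<theta>_def abs_less_iff)
      qed
      then have "cos \<theta> \<le> c"
      proof (cases "\<theta> \<le> pi")
        case True
        then show ?thesis unfolding c_def using \<open>pi / n \<le> \<theta>\<close> pn by (intro cos_monotone_0_pi_le) auto
      next
        case False
        have "cos \<theta> = cos (2 * pi - \<theta>)" by simp
        also have "\<dots> \<le> c" unfolding c_def using \<open>\<theta> \<le> 2 * pi - pi / n\<close> False pn
          by (intro cos_monotone_0_pi_le) auto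
        finally show ?thesis .
      qed
      ultimately have "Re (\<omega> * y) \<le> c * cmod (\<omega> * y)"
        using mult_left_mono[of "cos \<theta>" c "cmod y"] by (simp add: norm_mult mult.commute)
      then show ?thesis using off_rayI[OF _ c] by (auto simp: s_def c_def)
    qed
    ultimately show ?thesis by blast
  qed
qed

lemma ray_err_upper:
  assumes n: "n \<ge> 2"
  obtains C where "\<And>y M. y \<notin> \<real>\<^sub>\<ge>\<^sub>0 \<Longrightarrow> ray_err n y M \<le> C"
proof -
  define s where "s = sqrt (1 - cos (pi / n))"
  have "cos (pi / n) < cos 0" using n by (intro cos_monotone_0_pi) (auto simp: divide_simps)
  then have s: "s > 0" by (simp add: s_def)
  have n0: "n > 0" using n by simp
  obtain C1 where C1: "\<And>y M. y \<notin> \<real>\<^sub>\<ge>\<^sub>0 \<Longrightarrow> off_ray s y \<Longrightarrow> \<bar>ray_err n y M\<bar> \<le> C1"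
    using ray_err_off[OF n0 s] by metis
  obtain C2 where C2: "\<And>y M. y \<notin> \<real>\<^sub>\<ge>\<^sub>0 \<Longrightarrow> y ^ n \<notin> \<real>\<^sub>\<ge>\<^sub>0 \<Longrightarrow>
    (\<And>\<omega>. \<omega> ^ n = 1 \<Longrightarrow> \<omega> \<noteq> 1 \<Longrightarrow> off_ray s (\<omega> * y)) \<Longrightarrow> ray_err n y M \<le> C2"
    using ray_err_near[OF n0 s] by metis
  show ?thesis
  proof (rule that[of "max C1 C2"])
    fix y :: complex and M assume y: "y \<notin> \<real>\<^sub>\<ge>\<^sub>0"
    show "ray_err n y M \<le> max C1 C2"
      using off_ray_alternative[OF n y, folded s_def] C1[OF y, of M] C2[OF y, of M] by force
  qed
qed


section \<open>The canonical product and its normalisation\<close>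

lemma powr_root_power:
  fixes t :: real
  assumes "n > 0" "t > 0"
  shows "(t powr (1 / real n)) ^ i = t powr (real i / real n)"
  using assms by (simp add: powr_power)

lemma abs_ln_le:
  fixes x :: real
  assumes "x \<ge> 1/2"
  shows "\<bar>ln x\<bar> \<le> 2 * \<bar>x - 1\<bar>"
proof -
  have "ln x \<le> x - 1" using assms by (intro ln_le_minus_one) auto
  moreover have "ln (1 / x) \<le> 1 / x - 1" using assms by (intro ln_le_minus_one) auto
  then have "- ln x \<le> (1 - x) / x" using assms by (simp add: ln_div diff_divide_distrib)
  moreover have "(1 - x) * (1 / x) \<le> 2 * \<bar>x - 1\<bar>"
  proof (cases "x \<le> 1")
    case True
    then have "(1 - x) * (1 / x) \<le> (1 - x) * 2" using assms by (intro mult_left_mono) (auto simp: divide_simps)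
    then show ?thesis using True by simp
  next
    case False
    then have "(1 - x) * (1 / x) \<le> 0" by (intro mult_nonpos_nonneg) auto
    also have "0 \<le> 2 * \<bar>x - 1\<bar>" by simp
    finally show ?thesis .
  qed
  moreover have "x - 1 \<le> 2 * \<bar>x - 1\<bar>" by (simp add: abs_if)
  ultimately show ?thesis by (intro abs_leI) auto
qed

text \<open>The zeros grow like \<open>m^(1/n)\<close>, so \<open>n + 1\<close> is the smallest
  integer exponent for which their reciprocal powers are summable; the genus is therefore
  \<open>n\<close>.\<close>

lemma weierstrass_ray_product:
  assumes n: "n > 0"
  shows "weierstrass_product (\<lambda>m. of_real ((real m + 1/2) powr (1 / real n))) (\<lambda>_. n)"
proof
  show "complex_of_real ((real m + 1/2) powr (1 / real n)) \<noteq> 0" for m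
    by (simp add: add_nonneg_eq_0_iff)
  have "filterlim (\<lambda>m. (real m + 1/2) powr (1 / real n)) at_top sequentially"
    using n by real_asymp
  then show "filterlim (\<lambda>m. complex_of_real ((real m + 1/2) powr (1 / real n))) at_infinity sequentially"
    by (intro filterlim_norm_at_top_imp_at_infinity) (simp add: filterlim_at_top)
  fix r :: real assume r: "r > 0"
  define q where "q = real (Suc n) / real n"
  have q: "q > 1" using n by (simp add: q_def divide_simps)
  have "summable (\<lambda>m. r ^ Suc n * real m powr (-q))"
    using q by (intro summable_mult) (simp add: summable_real_powr_iff)
  then show "summable (\<lambda>m. (r / cmod (complex_of_real ((real m + 1/2) powr (1 / real n)))) ^ Suc n)"
  proof (rule summable_comparison_test'[where N=1])
    fix m :: nat assume m: "1 \<le> m"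
    have "(r / cmod (complex_of_real ((real m + 1/2) powr (1 / real n)))) ^ Suc n
        = r ^ Suc n * (real m + 1/2) powr (- q)"
    proof -
      have "((real m + 1/2) powr (1 / real n)) ^ Suc n = (real m + 1/2) powr q"
        unfolding q_def by (rule powr_root_power[OF n]) auto
      moreover have "cmod (complex_of_real ((real m + 1/2) powr (1 / real n))) = (real m + 1/2) powr (1 / real n)"
        by (simp only: norm_of_real abs_of_nonneg powr_ge_zero)
      ultimately show ?thesis by (simp only: power_divide powr_minus_divide times_divide_eq_right mult_1_right)
    qed
    also have "\<dots> \<le> r ^ Suc n * real m powr (- q)"
      using m r q by (intro mult_left_mono powr_mono2') auto
    finally show "norm ((r / cmod (complex_of_real ((real m + 1/2) powr (1 / real n)))) ^ Suc n) \<le> r ^ Suc n * real m powr (- q)"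
      using r by simp
  qed
qed

lemma ln_weierstrass_factor:
  assumes "v \<noteq> 1"
  shows "ln (cmod (weierstrass_factor n v)) = ln (cmod (1 - v)) + (\<Sum>i=1..n. Re (v ^ i) / real i)"
proof -
  have "cmod (1 - v) > 0" using assms by simp
  then show ?thesis unfolding weierstrass_factor_def norm_mult
    by (subst ln_mult) (auto simp: Re_sum Re_divide_of_nat)
qed

text \<open>This is what the boundary term of the primitive at \<open>t = M\<close> turns into. The
  logarithm of the factor at \<open>v\<close> is \<open>O(|v|^(n+1))\<close> and here
  \<open>|v|\<close> is of order \<open>M^(-1/n)\<close>, which beats the factor
  \<open>M\<close>.\<close>

lemma weierstrass_factor_remainder:
  assumes n: "n > 0"
  shows "(\<lambda>M. real M * ln (cmod (weierstrass_factor n (y / of_real (real M powr (1 / real n)))))) \<longlonglongrightarrow> 0"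
proof (rule Lim_null_comparison)
  define v where "v M = y / of_real (real M powr (1 / real n))" for M
  have nv: "cmod (v M) = cmod y * real M powr (- 1 / real n)" for M
    by (simp add: v_def norm_divide powr_minus_divide)
  have "(\<lambda>M. cmod y * real M powr (- 1 / real n)) \<longlonglongrightarrow> 0" using n by real_asymp
  then have "(\<lambda>M. cmod (v M)) \<longlonglongrightarrow> 0" unfolding nv .
  then have "\<forall>\<^sub>F M in sequentially. cmod (v M) < 1/6" by (rule order_tendstoD) auto
  then show "\<forall>\<^sub>F M in sequentially. norm (real M * ln (cmod (weierstrass_factor n (y / of_real (real M powr (1 / real n))))))
      \<le> 6 * (cmod y) ^ Suc n * real M powr (- 1 / real n)"
    using eventually_gt_at_top[of 0]
  proof eventually_elim
    case (elim M)
    let ?E = "weierstrass_factor n (v M)"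
    have E: "cmod (?E - 1) \<le> 3 * cmod (v M) ^ Suc n" using elim by (intro weierstrass_factor_bound) auto
    also have "\<dots> \<le> 3 * cmod (v M) ^ 1" using elim by (intro mult_left_mono power_decreasing) auto
    finally have E2: "cmod (?E - 1) \<le> 1/2" using elim by simp
    have d: "\<bar>cmod ?E - 1\<bar> \<le> cmod (?E - 1)" using norm_triangle_ineq3[of ?E 1] by simp
    have "\<bar>ln (cmod ?E)\<bar> \<le> 2 * \<bar>cmod ?E - 1\<bar>" using d E2 by (intro abs_ln_le) linarith
    also have "\<dots> \<le> 2 * (3 * cmod (v M) ^ Suc n)" by (intro mult_left_mono order_trans[OF d E]) auto
    finally have "real M * \<bar>ln (cmod ?E)\<bar> \<le> real M * (2 * (3 * cmod (v M) ^ Suc n))" by (intro mult_left_mono) auto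
    also have "cmod (v M) ^ Suc n = cmod y ^ Suc n * (real M powr (- 1 / real n)) ^ Suc n"
      unfolding nv power_mult_distrib ..
    also have "(real M powr (- 1 / real n)) ^ Suc n = real M powr (- 1 / real n) / real M"
    proof -
      have "(real M powr (- 1 / real n)) ^ n = real M powr (-1)" using n elim by (simp add: powr_power)
      then show ?thesis using elim by (simp add: powr_minus_divide[of _ 1])
    qed
    finally show ?case using elim by (simp add: abs_mult v_def mult_ac)
  qed
  show "(\<lambda>M. 6 * (cmod y) ^ Suc n * real M powr (- 1 / real n)) \<longlonglongrightarrow> 0" using n by real_asymp
qed


text \<open>Up to \<open>M\<close>, the logarithm of the product is \<open>ray_err\<close>, plus
  \<open>Re (y^n Ln (- y))\<close> from the value of the primitive at 0, plus a remainder that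
  converges to the real part of a polynomial up to a constant. Dividing by the exponential of this
  polynomial leaves the wanted function. On \<open>y = r cis \<theta>\<close> with \<theta> between
  0 and \<open>2 pi\<close> it is \<open>r^n (ln r cos (n \<theta>) - (\<theta> - pi) sin (n
  \<theta>))\<close>, whose angular slope jumps up by \<open>2 pi n r^n\<close> across the positive
  axis: this is the kink.\<close>

lemma kink_function:
  assumes n: "n \<ge> 2"
  obtains G C where "G holomorphic_on UNIV" "G 0 = 1"
    "\<And>y. y \<notin> \<real>\<^sub>\<ge>\<^sub>0 \<Longrightarrow> cmod (G y) \<le> exp (Re (y ^ n * Ln (- y)) + C)"
    "\<And>s. s > 0 \<Longrightarrow> \<exists>C'. \<forall>y. y \<notin> \<real>\<^sub>\<ge>\<^sub>0 \<longrightarrow> off_ray s y \<longrightarrow> exp (Re (y ^ n * Ln (- y)) - C') \<le> cmod (G y)"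
proof -
  have n0: "n > 0" using n by simp
  define a where "a m = complex_of_real ((real m + 1/2) powr (1 / real n))" for m
  interpret W: weierstrass_product a "\<lambda>_. n"
    unfolding a_def by (rule weierstrass_ray_product[OF n0])
  obtain l where l: "(\<lambda>M. (\<Sum>m<M. ln (real m + 1/2)) - (real M * ln (real M) - real M)) \<longlonglongrightarrow> l"
    using sum_ln_convergent by (auto simp: convergent_def)
  \<comment> \<open>The power sums that the Weierstrass factors contribute, regularised by the
    primitive of \<open>t powr (- i / n)\<close> at \<open>M\<close>; in the resonant case
    \<open>i = n\<close> that primitive is a logarithm.\<close>
  define T where "T i M = (\<Sum>m<M. (real m + 1/2) powr (- (real i / real n))) -
      (if i = n then ln (real M) else real M powr (1 - real i / real n) / (1 - real i / real n))" for i M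
  define \<kappa> where "\<kappa> i = lim (T i)" for i
  have \<kappa>: "T i \<longlonglongrightarrow> \<kappa> i" if "i \<in> {1..n}" for i
  proof (cases "i = n")
    case True
    have "T n = (\<lambda>M. (\<Sum>m<M. 1 / (real m + 1/2)) - ln (real M))"
      using n by (auto simp: T_def fun_eq_iff powr_minus_divide)
    then show ?thesis using sum_inverse_convergent True by (simp add: \<kappa>_def convergent_LIMSEQ_iff)
  next
    case False
    then have "T i = (\<lambda>M. (\<Sum>m<M. (real m + 1/2) powr (- (real i / real n))) - real M powr (1 - real i / real n) / (1 - real i / real n))"
      by (auto simp: T_def fun_eq_iff)
    then show ?thesis using sum_powr_convergent[of "real i / real n"] that n False
      by (simp add: \<kappa>_def convergent_LIMSEQ_iff)
  qed
  \<comment> \<open>Read off from \<open>Z\<close>: its real part is the limit of \<open>Z\<close>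
    apart from the constant \<open>- l / n\<close>. The separate \<open>- y^n / n\<close> is the
    last term of \<open>Z\<close>.\<close>
  define q where "q y = (\<Sum>i=1..n. of_real (\<kappa> i) * y ^ i / of_nat i) - y ^ n / of_nat n" for y :: complex
  define G where "G y = W.f y * exp (- q y)" for y
  define Z where "Z y M = - (1 / n) * ((\<Sum>m<M. ln (real m + 1/2)) - (real M * ln (real M) - real M))
        + (\<Sum>i=1..n. Re (y ^ i) / real i * T i M)
        + real M * ln (cmod (weierstrass_factor n (y / of_real (real M powr (1 / real n)))))
        - Re (y ^ n * Ln (1 - y / of_real (real M powr (1 / real n)))) - Re (y ^ n) / n" for y M
  have key: "(\<lambda>M. exp (ray_err n y M + Re (y ^ n * Ln (- y)) + Z y M)) \<longlonglongrightarrow> cmod (W.f y)"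
    "Z y \<longlonglongrightarrow> Re (q y) - l / n" if y: "y \<notin> \<real>\<^sub>\<ge>\<^sub>0" for y
  proof -
    have vy: "1 - y / of_real r \<notin> \<real>\<^sub>\<le>\<^sub>0" if "r > 0" for r
    proof
      assume "1 - y / of_real r \<in> \<real>\<^sub>\<le>\<^sub>0"
      then obtain x where "x \<le> 0" "1 - y / of_real r = of_real x" by (auto elim: nonpos_Reals_cases)
      then have "y = of_real (r * (1 - x))" using that by (simp add: field_simps)
      moreover have "r * (1 - x) \<ge> 0" using that \<open>x \<le> 0\<close> by simp
      ultimately show False using y by (metis nonneg_Reals_of_real_iff)
    qed
    have v1: "y / of_real r \<noteq> 1" if "r > 0" for r using vy[OF that] by auto
    have tp: "(real m + 1/2) powr (1 / real n) > 0" for m :: nat by (simp add: add_nonneg_eq_0_iff)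
    \<comment> \<open>An exact identity for finite \<open>M\<close>. With \<open>V = M^(1/n)\<close>
      the boundary logarithm \<open>Ln (V - y)\<close> splits into \<open>ln M / n\<close> and
      \<open>Ln (1 - y / V)\<close>. The powers of \<open>M\<close> match by the partial fractions
      \<open>1 / (i (1 - i/n)) = 1/i + 1/(n - i)\<close>.\<close>
    have logs: "(\<Sum>m<M. ln (cmod (weierstrass_factor n (y / a m)))) = ray_err n y M + Re (y ^ n * Ln (- y)) + Z y M"
      if M: "M > 0" for M
    proof -
      define V where "V = real M powr (1 / real n)"
      define v where "v = y / of_real V"
      define p where "p i = real M powr (1 - real i / real n)" for i
      have V: "V > 0" using M by (simp add: V_def)
      have Vi: "V ^ i = real M powr (real i / real n)" for i
        unfolding V_def using M by (intro powr_root_power[OF n0]) auto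
      have pM: "real M / V ^ i = p i" for i unfolding p_def Vi using M by (simp add: powr_diff)
      have vi: "real M * Re (v ^ i) = Re (y ^ i) * p i" for i
        unfolding v_def power_divide by (simp add: Re_divide_of_real pM[symmetric] flip: of_real_power)
      have a: "a m ^ i = of_real ((real m + 1/2) powr (real i / real n))" for m i
        unfolding a_def of_real_power[symmetric] by (subst powr_root_power[OF n0]) auto
      have "ln (cmod (weierstrass_factor n (y / a m))) =
          ln (cmod (a m - y)) - ln (real m + 1/2) / n
          + (\<Sum>i=1..n. Re (y ^ i) / real i * (real m + 1/2) powr (- (real i / real n)))" for m
      proof -
        have a0: "a m \<noteq> 0" using tp[of m] by (simp add: a_def)
        have ya: "y / a m \<noteq> 1" unfolding a_def by (rule v1[OF tp])
        have "1 - y / a m = (a m - y) / a m" using a0 by (simp add: field_simps)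
        moreover have "cmod (a m) = (real m + 1/2) powr (1 / real n)" using tp[of m] by (simp add: a_def)
        moreover have "a m - y \<noteq> 0" using ya a0 by auto
        ultimately have "ln (cmod (1 - y / a m)) = ln (cmod (a m - y)) - ln (real m + 1/2) / n"
          using tp[of m] by (simp add: norm_divide ln_div ln_powr)
        moreover have "Re ((y / a m) ^ i) / real i = Re (y ^ i) / real i * (real m + 1/2) powr (- (real i / real n))" for i
          unfolding power_divide a by (simp add: Re_divide_of_real powr_minus_divide)
        ultimately show ?thesis unfolding ln_weierstrass_factor[OF ya] by (simp only:)
      qed
      then have "(\<Sum>m<M. ln (cmod (weierstrass_factor n (y / a m)))) =
          (\<Sum>m<M. ln (cmod (a m - y))) - (\<Sum>m<M. ln (real m + 1/2)) / n
          + (\<Sum>i=1..n. Re (y ^ i) / real i * (\<Sum>m<M. (real m + 1/2) powr (- (real i / real n))))"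
        by (simp add: sum.distrib sum_subtractf sum_divide_distrib sum_distrib_left) (rule sum.swap)
      moreover have "(\<Sum>m<M. ln (cmod (a m - y))) = ray_err n y M + Re (ray_prim n y M) - Re (ray_prim n y 0)"
        unfolding ray_err_def a_def
        using sum_lessThan_telescope[of "\<lambda>m. Re (ray_prim n y (real m))" M] by (simp add: sum_subtractf)
      moreover have "ray_prim n y 0 = - (y ^ n * Ln (- y))" by (simp add: ray_prim_def)
      moreover have "Re (ray_prim n y M) = (real M - Re (y ^ n)) * (ln M / n)
          + real M * ln (cmod (1 - v)) - Re (y ^ n * Ln (1 - v)) - (M / n + (\<Sum>i\<in>{1..<n}. Re (y ^ i) * p i / real (n - i)))"
      proof -
        have "of_real V - y = of_real V * (1 - v)" using V by (simp add: v_def field_simps)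
        then have "Ln (of_real V - y) = of_real (ln V) + Ln (1 - v)"
          using V v1[OF V] by (simp add: Ln_times_of_real Ln_of_real v_def)
        moreover have "ln V = ln M / n" using M by (simp add: V_def ln_powr)
        moreover have "Re (Ln (1 - v)) = ln (cmod (1 - v))" using v1[OF V] by (simp add: v_def)
        ultimately have "Re ((of_real M - y ^ n) * Ln (of_real V - y)) = (real M - Re (y ^ n)) * (ln M / n)
          + real M * ln (cmod (1 - v)) - Re (y ^ n * Ln (1 - v))"
          by (simp add: algebra_simps diff_divide_distrib)
        moreover have "(\<Sum>i<n. Re (y ^ i * of_real (p i) / of_nat (n - i))) = M / n + (\<Sum>i\<in>{1..<n}. Re (y ^ i) * p i / real (n - i))"
        proof -
          have "{..<n} = insert 0 {1..<n}" using n0 by auto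
          then show ?thesis using M by (simp add: p_def Re_divide_of_nat del: of_nat_diff)
        qed
        ultimately show ?thesis unfolding ray_prim_def by (simp add: p_def V_def Re_sum del: of_nat_diff)
      qed
      moreover have "real M * ln (cmod (weierstrass_factor n v)) = real M * ln (cmod (1 - v)) + (\<Sum>i=1..n. Re (y ^ i) * p i / real i)"
        using v1[OF V] vi by (simp add: ln_weierstrass_factor v_def[symmetric] distrib_left sum_distrib_left)
      moreover have "(\<Sum>i=1..n. Re (y ^ i) / real i * T i M) = (\<Sum>i=1..n. Re (y ^ i) / real i * (\<Sum>m<M. (real m + 1/2) powr (- (real i / real n))))
          - (Re (y ^ n) / n * ln M + (\<Sum>i\<in>{1..<n}. Re (y ^ i) * p i / real i + Re (y ^ i) * p i / real (n - i)))"
      proof -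
        have "(\<Sum>i=1..n. Re (y ^ i) / real i * (if i = n then ln (real M) else real M powr (1 - real i / real n) / (1 - real i / real n)))
          = Re (y ^ n) / n * ln M + (\<Sum>i\<in>{1..<n}. Re (y ^ i) / real i * (p i / (1 - real i / real n)))"
        proof -
          have "{1..n} = insert n {1..<n}" using n0 by auto
          then show ?thesis by (simp add: p_def mult_ac)
        qed
        also have "(\<Sum>i\<in>{1..<n}. Re (y ^ i) / real i * (p i / (1 - real i / real n))) = (\<Sum>i\<in>{1..<n}. Re (y ^ i) * p i / real i + Re (y ^ i) * p i / real (n - i))"
        proof (rule sum.cong[OF refl])
          fix i assume i: "i \<in> {1..<n}"
          have "1 / (real i * (1 - real i / real n)) = 1 / real i + 1 / real (n - i)"
            using i by (simp add: of_nat_diff field_simps)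
          then have "Re (y ^ i) * p i * (1 / (real i * (1 - real i / real n))) = Re (y ^ i) * p i * (1 / real i + 1 / real (n - i))" by simp
          then show "Re (y ^ i) / real i * (p i / (1 - real i / real n)) = Re (y ^ i) * p i / real i + Re (y ^ i) * p i / real (n - i)"
            by (simp add: distrib_left del: of_nat_diff)
        qed
        finally show ?thesis by (simp add: T_def right_diff_distrib sum_subtractf)
      qed
      moreover have "(\<Sum>i=1..n. Re (y ^ i) * p i / real i) = Re (y ^ n) / n + (\<Sum>i\<in>{1..<n}. Re (y ^ i) * p i / real i)"
      proof -
        have "{1..n} = insert n {1..<n}" "p n = 1" using n0 M by (auto simp: p_def)
        then show ?thesis by simp
      qed
      ultimately show ?thesis
        unfolding Z_def v_def[symmetric] V_def[symmetric] sum.distrib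
        by (simp only: minus_complex.sel uminus_complex.sel) (simp add: algebra_simps diff_divide_distrib del: of_nat_diff times_complex.sel)
    qed
    have "(\<lambda>M. \<Prod>m<M. weierstrass_factor n (y / a m)) \<longlonglongrightarrow> W.f y"
      using convergent_prod_LIMSEQ[OF W.convergent[of y]] unfolding W.f_def lessThan_Suc_atMost[symmetric]
      by (subst (asm) filterlim_sequentially_Suc)
    then have "(\<lambda>M. cmod (\<Prod>m<M. weierstrass_factor n (y / a m))) \<longlonglongrightarrow> cmod (W.f y)" by (rule tendsto_norm)
    moreover have "\<forall>\<^sub>F M in sequentially. cmod (\<Prod>m<M. weierstrass_factor n (y / a m)) =
        exp (ray_err n y M + Re (y ^ n * Ln (- y)) + Z y M)"
      using eventually_gt_at_top[of 0]
    proof eventually_elim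
      case (elim M)
      have "exp (ray_err n y M + Re (y ^ n * Ln (- y)) + Z y M) = exp (\<Sum>m<M. ln (cmod (weierstrass_factor n (y / a m))))"
        using logs[OF elim] by simp
      also have "\<dots> = (\<Prod>m<M. exp (ln (cmod (weierstrass_factor n (y / a m)))))" by (rule exp_sum) auto
      also have "\<dots> = (\<Prod>m<M. cmod (weierstrass_factor n (y / a m)))"
        using v1[OF tp] by (intro prod.cong) (auto simp: a_def)
      finally show ?case by (simp add: prod_norm)
    qed
    ultimately show "(\<lambda>M. exp (ray_err n y M + Re (y ^ n * Ln (- y)) + Z y M)) \<longlonglongrightarrow> cmod (W.f y)"
      by (rule Lim_transform_eventually)
    have "(\<lambda>M. 1 / real M powr (1 / real n)) \<longlonglongrightarrow> 0" using n by real_asymp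
    then have "(\<lambda>M. y * complex_of_real (1 / real M powr (1 / real n))) \<longlonglongrightarrow> y * of_real 0"
      by (intro tendsto_intros)
    then have "(\<lambda>M. Ln (1 - y / of_real (real M powr (1 / real n)))) \<longlonglongrightarrow> Ln (1 - 0)"
      by (intro tendsto_Ln tendsto_diff tendsto_const) (simp_all add: divide_inverse)
    then have Ln0: "(\<lambda>M. Re (y ^ n * Ln (1 - y / of_real (real M powr (1 / real n))))) \<longlonglongrightarrow> Re (y ^ n * Ln (1 - 0))"
      by (intro tendsto_Re tendsto_mult tendsto_const)
    have "Z y \<longlonglongrightarrow> - (1 / n) * l + (\<Sum>i=1..n. Re (y ^ i) / real i * \<kappa> i) + 0 - Re (y ^ n * Ln (1 - 0)) - Re (y ^ n) / n"
      unfolding Z_def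
      by (intro tendsto_diff tendsto_add tendsto_sum tendsto_mult tendsto_const l \<kappa> weierstrass_factor_remainder[OF n0] Ln0)
    also have "- (1 / n) * l + (\<Sum>i=1..n. Re (y ^ i) / real i * \<kappa> i) + 0 - Re (y ^ n * Ln (1 - 0)) - Re (y ^ n) / n = Re (q y) - l / n"
      by (simp add: q_def Re_sum Re_divide_of_nat mult_ac)
    finally show "Z y \<longlonglongrightarrow> Re (q y) - l / n" .
  qed
  have Gn: "cmod (G y) = cmod (W.f y) * exp (- Re (q y))" for y by (simp add: G_def norm_mult)
  obtain C where C: "\<And>y M. y \<notin> \<real>\<^sub>\<ge>\<^sub>0 \<Longrightarrow> ray_err n y M \<le> C" using ray_err_upper[OF n] by metis
  show ?thesis
  proof (rule that[of G "C - l / n"])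
    show "G holomorphic_on UNIV" unfolding G_def q_def using n by (intro holomorphic_intros) auto
    have "W.f 0 = 1" unfolding W.f_def by simp
    then show "G 0 = 1" using n by (simp add: G_def q_def power_0_left)
  next
    fix y :: complex assume y: "y \<notin> \<real>\<^sub>\<ge>\<^sub>0"
    note Z = key[OF y]
    have "cmod (W.f y) \<le> exp (C + Re (y ^ n * Ln (- y)) + (Re (q y) - l / n))"
    proof (rule LIMSEQ_le[OF Z(1)])
      show "(\<lambda>M. exp (C + Re (y ^ n * Ln (- y)) + Z y M)) \<longlonglongrightarrow> exp (C + Re (y ^ n * Ln (- y)) + (Re (q y) - l / n))"
        by (intro tendsto_intros Z)
    qed (use C[OF y] in auto)
    then have "cmod (G y) \<le> exp (C + Re (y ^ n * Ln (- y)) + (Re (q y) - l / n)) * exp (- Re (q y))"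
      unfolding Gn by (intro mult_right_mono) auto
    then show "cmod (G y) \<le> exp (Re (y ^ n * Ln (- y)) + (C - l / n))" by (simp add: algebra_simps flip: exp_add)
  next
    fix s :: real assume s: "s > 0"
    obtain C where C: "\<And>y M. y \<notin> \<real>\<^sub>\<ge>\<^sub>0 \<Longrightarrow> off_ray s y \<Longrightarrow> \<bar>ray_err n y M\<bar> \<le> C"
      using ray_err_off[OF n0 s] by metis
    have "exp (Re (y ^ n * Ln (- y)) - (C + l / n)) \<le> cmod (G y)" if y: "y \<notin> \<real>\<^sub>\<ge>\<^sub>0" and off: "off_ray s y" for y
    proof -
      note Z = key[OF y]
      have "exp (- C + Re (y ^ n * Ln (- y)) + (Re (q y) - l / n)) \<le> cmod (W.f y)"
      proof (rule LIMSEQ_le[OF _ Z(1)])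
        show "(\<lambda>M. exp (- C + Re (y ^ n * Ln (- y)) + Z y M)) \<longlonglongrightarrow> exp (- C + Re (y ^ n * Ln (- y)) + (Re (q y) - l / n))"
          by (intro tendsto_intros Z)
        have "- C \<le> ray_err n y M" for M using C[OF y off, of M] by linarith
        then show "\<exists>N. \<forall>M\<ge>N. exp (- C + Re (y ^ n * Ln (- y)) + Z y M) \<le> exp (ray_err n y M + Re (y ^ n * Ln (- y)) + Z y M)"
          by simp
      qed
      then have "exp (- C + Re (y ^ n * Ln (- y)) + (Re (q y) - l / n)) * exp (- Re (q y)) \<le> cmod (G y)"
        unfolding Gn by (intro mult_right_mono) auto
      then show ?thesis by (simp add: algebra_simps flip: exp_add)
    qed
    then show "\<exists>C'. \<forall>y. y \<notin> \<real>\<^sub>\<ge>\<^sub>0 \<longrightarrow> off_ray s y \<longrightarrow> exp (Re (y ^ n * Ln (- y)) - C') \<le> cmod (G y)" by blast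
  qed
qed

section \<open>Entire functions with a prescribed piecewise sinusoidal indicator\<close>

lemma Ln_of_real_cis:
  assumes "r > 0" "- pi < a" "a \<le> pi"
  shows "Ln (of_real r * cis a) = of_real (ln r) + \<i> * of_real a"
proof -
  have "of_real r * cis a = exp (of_real (ln r) + \<i> * of_real a)"
    using assms by (simp add: exp_add cis_conv_exp exp_of_real)
  then show ?thesis using assms by (simp add: Ln_exp)
qed

lemma cis_notin_nonneg:
  assumes "r > 0" "0 < a" "a < 2 * pi"
  shows "of_real r * cis a \<notin> \<real>\<^sub>\<ge>\<^sub>0"
proof
  assume "of_real r * cis a \<in> \<real>\<^sub>\<ge>\<^sub>0"
  then have *: "Re (of_real r * cis a) \<ge> 0" "Im (of_real r * cis a) = 0"
    by (auto simp: complex_nonneg_Reals_iff)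
  then have "sin a = 0" "cos a \<ge> 0" using assms by (auto simp: zero_le_mult_iff)
  moreover have "a = pi" using \<open>sin a = 0\<close> assms sin_gt_zero[of a] sin_lt_zero[of a] by (cases a pi rule: linorder_cases) auto
  ultimately show False by simp
qed

text \<open>The offset 1/2 puts the positive axis midway between two rays, at angle at least
  \<open>pi / N\<close> from all of them. The lower bound for the products is needed exactly on that
  axis.\<close>

definition node :: "nat \<Rightarrow> int \<Rightarrow> real" where
  "node N j = (of_int j + 1/2) * (2 * pi / real N)"

text \<open>The weights \<open>\<mu> j\<close> are the masses of the kinks of the indicator at the rays \<open>node N j\<close>; the
  vanishing sum is the resonance condition for integer order \<open>n\<close>.\<close>
lemma sector_product:
  assumes n: "n \<ge> 2" and N: "N \<ge> 4"
  obtains C where "\<forall>(\<mu>::nat \<Rightarrow> real) W. (\<forall>j<N. \<mu> j \<ge> 0) \<longrightarrow>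
      (\<Sum>j<N. of_real (\<mu> j) * cis (- real n * node N j)) = 0 \<longrightarrow>
      (\<exists>F. F holomorphic_on UNIV \<and>
        (\<forall>l<N. \<forall>r>0. \<forall>\<theta>. node N (int l - 1) < \<theta> \<and> \<theta> < node N l \<longrightarrow>
          cmod (F (of_real r * cis \<theta>)) \<le> exp (C + r ^ n * Re ((W - 2 * pi * \<i> * (\<Sum>j<l. of_real (\<mu> j) * cis (- real n * node N j))) * cis (real n * \<theta>)))) \<and>
        (\<forall>r>0. exp (r ^ n * Re W - C) \<le> cmod (F (of_real r))))"
proof -
  have n0: "n > 0" using n by simp
  define \<tau> where "\<tau> = 2 * pi / real N"
  have \<tau>: "\<tau> > 0" "\<tau> / 2 \<le> pi / 2" using N by (auto simp: \<tau>_def divide_simps)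
  obtain G C1 where G: "G holomorphic_on UNIV" "G 0 = 1"
    and up: "\<And>y. y \<notin> \<real>\<^sub>\<ge>\<^sub>0 \<Longrightarrow> cmod (G y) \<le> exp (Re (y ^ n * Ln (- y)) + C1)"
    and low: "\<And>s. s > 0 \<Longrightarrow> \<exists>C'. \<forall>y. y \<notin> \<real>\<^sub>\<ge>\<^sub>0 \<longrightarrow> off_ray s y \<longrightarrow> exp (Re (y ^ n * Ln (- y)) - C') \<le> cmod (G y)"
    using kink_function[OF n] by metis
  define c where "c = cos (\<tau> / 2)"
  have "c < cos 0" unfolding c_def using \<tau> pi_gt_zero by (intro cos_monotone_0_pi) auto
  then have c: "0 \<le> c" "c < 1" using \<tau> by (auto simp: c_def intro!: cos_ge_zero)
  obtain C2 where C2: "\<And>y. y \<notin> \<real>\<^sub>\<ge>\<^sub>0 \<Longrightarrow> off_ray (sqrt (1 - c)) y \<Longrightarrow> exp (Re (y ^ n * Ln (- y)) - C2) \<le> cmod (G y)"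
    using low[of "sqrt (1 - c)"] c by auto
  define C where "C = real N * max 0 (max C1 C2)"
  show ?thesis
  proof (rule that[of C], intro allI impI)
    fix \<mu> :: "nat \<Rightarrow> real" and W :: complex
    assume "\<forall>j<N. \<mu> j \<ge> 0"
    then have \<mu>: "\<mu> j \<ge> 0" if "j < N" for j using that by blast
    define \<theta>' where "\<theta>' j = node N (int j)" for j :: nat
    define w where "w j = of_real (\<mu> j) * cis (- real n * \<theta>' j)" for j
    assume "(\<Sum>j<N. of_real (\<mu> j) * cis (- real n * node N j)) = 0"
    then have w0: "(\<Sum>j<N. w j) = 0" by (simp add: w_def \<theta>'_def)
    \<comment> \<open>Collects what the scalings and rotations inside \<open>Y\<close> add to the
      coefficient of \<open>z^n\<close>. It is the same in every sector, so one exponential removes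
      it.\<close>
    define A where "A = (\<Sum>j<N. w j * (of_real (ln (\<mu> j) / n) - \<i> * of_real (\<theta>' j)))"
    define Y where "Y j z = of_real (\<mu> j powr (1 / n)) * cis (- \<theta>' j) * z" for j and z :: complex
    define F where "F z = exp ((W - A) * z ^ n) * (\<Prod>j<N. G (Y j z))" for z
    have Yn: "Y j z ^ n = w j * z ^ n" if "j < N" for j z
    proof -
      have "(of_real (\<mu> j powr (1 / n)) :: complex) ^ n = of_real (\<mu> j)"
        using \<mu>[OF that] n0 by (cases "\<mu> j = 0") (auto simp: power_0_left powr_power simp flip: of_real_power)
      then show ?thesis by (simp add: Y_def w_def power_mult_distrib Complex.DeMoivre)
    qed
    have th: "\<theta>' j = (real j + 1/2) * \<tau>" for j by (simp add: \<theta>'_def node_def \<tau>_def)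
    have N\<tau>: "real N * \<tau> = 2 * pi" using N by (simp add: \<tau>_def)
    have thN: "\<theta>' j \<le> 2 * pi - \<tau> / 2" if "j < N" for j
    proof -
      have "(real j + 1/2) * \<tau> \<le> (real N - 1/2) * \<tau>" using that \<tau> by (intro mult_right_mono) auto
      then show ?thesis using N\<tau> by (simp add: th algebra_simps)
    qed
    have th0: "\<theta>' j \<ge> \<tau> / 2" for j using \<tau> by (simp add: th algebra_simps)
    have th_mono: "\<theta>' i \<le> \<theta>' j" if "i \<le> j" for i j using that \<tau> by (simp add: th mult_right_mono)
    have node_l: "node N (int l - 1) = \<theta>' l - \<tau>" for l by (simp add: th node_def \<tau>_def algebra_simps diff_divide_distrib add_divide_distrib)
    \<comment> \<open>In sector \<open>l\<close> the principal argument of \<open>- Y j z\<close> is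
      the angle past node \<open>j\<close>, turned by \<open>- pi\<close> if the node has been
      passed (\<open>j < l\<close>) and by \<open>pi\<close> otherwise; the switch is the source of
      the jumps \<open>2 pi \<i>\<close>. For weight 0 the argument \<open>Y j z\<close> is 0 and
      both sides vanish.\<close>
    have factor: "(Y j z \<notin> \<real>\<^sub>\<ge>\<^sub>0 \<or> Y j z = 0) \<and> Y j z ^ n * Ln (- Y j z) =
        z ^ n * (w j * (of_real (ln r) + of_real (ln (\<mu> j) / n) + \<i> * of_real (\<theta> - \<theta>' j + (if j < l then - pi else pi))))"
      if jl: "j < N" "l < N" and r: "r > 0" and \<theta>: "node N (int l - 1) < \<theta>" "\<theta> < node N l"
        and z: "z = of_real r * cis \<theta>" for j l r \<theta> z
    proof (cases "\<mu> j = 0")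
      case True
      then show ?thesis using n0 by (simp add: Y_def w_def)
    next
      case False
      then have lp: "\<mu> j > 0" using \<mu>[OF jl(1)] by simp
      define \<rho> where "\<rho> = \<mu> j powr (1 / n) * r"
      have \<rho>: "\<rho> > 0" using lp r by (simp add: \<rho>_def)
      define a where "a = \<theta> - \<theta>' j + (if j < l then - pi else pi)"
      have \<theta>2: "\<theta>' l - \<tau> < \<theta>" "\<theta> < \<theta>' l" using \<theta> by (auto simp: node_l) (simp add: \<theta>'_def)
      have a: "- pi < a" "a < pi"
      proof -
        show "- pi < a"
        proof (cases "j < l")
          case True
          then have "\<theta>' j \<le> \<theta>' (l - 1)" by (intro th_mono) auto
          also have "\<theta>' (l - 1) = \<theta>' l - \<tau>" using True by (simp add: th algebra_simps of_nat_diff)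
          finally show ?thesis using \<theta>2 True by (simp add: a_def)
        next
          case False
          then show ?thesis using \<theta>2 thN[OF jl(1)] th0[of l] by (simp add: a_def)
        qed
        show "a < pi"
        proof (cases "j < l")
          case True
          then show ?thesis using \<theta>2 thN[OF jl(2)] th0[of j] \<tau> by (simp add: a_def)
        next
          case False
          then have "\<theta>' l \<le> \<theta>' j" by (intro th_mono) auto
          then show ?thesis using \<theta>2 False by (simp add: a_def)
        qed
      qed
      have Yc: "- Y j z = of_real \<rho> * cis a"
      proof -
        have "cis a = - cis (\<theta> - \<theta>' j)" unfolding a_def by (simp add: cis_mult[symmetric] cis_pi flip: cis_inverse)
        moreover have "cis (- \<theta>' j) * cis \<theta> = cis (\<theta> - \<theta>' j)" by (simp add: cis_mult)
        moreover have "Y j z = of_real \<rho> * (cis (- \<theta>' j) * cis \<theta>)" by (simp add: Y_def z \<rho>_def mult_ac)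
        ultimately show ?thesis by simp
      qed
      then have "Y j z = of_real \<rho> * cis (a + pi)" by (simp add: cis_mult[symmetric]) (metis minus_minus)
      moreover have "of_real \<rho> * cis (a + pi) \<notin> \<real>\<^sub>\<ge>\<^sub>0" using \<rho> a by (intro cis_notin_nonneg) auto
      moreover have "Ln (- Y j z) = of_real (ln \<rho>) + \<i> * of_real a" unfolding Yc using \<rho> a by (intro Ln_of_real_cis) auto
      moreover have "ln \<rho> = ln r + ln (\<mu> j) / n" using lp r by (simp add: \<rho>_def ln_mult ln_powr)
      ultimately show ?thesis using Yn[OF jl(1), of z] by (simp add: a_def)
    qed
    \<comment> \<open>The resonance condition \<open>w0\<close> removes the terms with
      \<open>ln r\<close> and with \<open>\<i> * \<theta>\<close>. Without it the growth would be
      \<open>r^n ln r\<close>.\<close>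
    have total: "(W - A) * z ^ n + (\<Sum>j<N. Y j z ^ n * Ln (- Y j z)) = of_real (r ^ n) * ((W - 2 * pi * \<i> * (\<Sum>j<l. w j)) * cis (real n * \<theta>))"
      if l: "l < N" and r: "r > 0" and \<theta>: "node N (int l - 1) < \<theta>" "\<theta> < node N l" and z: "z = of_real r * cis \<theta>"
      for l r \<theta> z
    proof -
      have "(\<Sum>j<N. Y j z ^ n * Ln (- Y j z)) =
          (\<Sum>j<N. z ^ n * (w j * (of_real (ln r) + of_real (ln (\<mu> j) / n) + \<i> * of_real (\<theta> - \<theta>' j + (if j < l then - pi else pi)))))"
        by (intro sum.cong refl) (use factor[OF _ l r \<theta> z] in auto)
      also have "\<dots> = z ^ n * ((of_real (ln r) + \<i> * of_real \<theta>) * (\<Sum>j<N. w j) + A + \<i> * (\<Sum>j<N. w j * complex_of_real (if j < l then - pi else pi)))"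
        by (simp add: A_def sum_distrib_left sum.distrib[symmetric] algebra_simps)
      also have "(\<Sum>j<N. w j * complex_of_real (if j < l then - pi else pi)) = (\<Sum>j<N. pi * w j - (if j < l then 2 * pi * w j else 0))"
        by (intro sum.cong) auto
      also have "\<dots> = pi * (\<Sum>j<N. w j) - (\<Sum>j<N. if j < l then 2 * pi * w j else 0)"
        by (simp add: sum_subtractf sum_distrib_left)
      also have "(\<Sum>j<N. if j < l then 2 * pi * w j else 0) = (\<Sum>j\<in>{j. j < N \<and> j < l}. 2 * pi * w j)"
        by (subst sum.inter_filter[symmetric]) auto
      also have "{j. j < N \<and> j < l} = {..<l}" using l by auto
      finally have "(\<Sum>j<N. Y j z ^ n * Ln (- Y j z)) = z ^ n * (A - 2 * pi * \<i> * (\<Sum>j<l. w j))"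
        by (simp add: w0 sum_distrib_left algebra_simps)
      then show ?thesis by (simp add: z power_mult_distrib Complex.DeMoivre algebra_simps)
    qed
    define C0 where "C0 = max 0 (max C1 C2)"
    have C0: "C0 \<ge> 0" "C1 \<le> C0" "C2 \<le> C0" by (auto simp: C0_def)
    have CN: "C = (\<Sum>j<N. C0)" by (simp add: C_def C0_def)
    have Fn: "cmod (F z) = exp (Re ((W - A) * z ^ n)) * (\<Prod>j<N. cmod (G (Y j z)))" for z
      unfolding F_def norm_mult norm_exp_eq_Re prod_norm[symmetric] ..
    show "\<exists>F. F holomorphic_on UNIV \<and>
        (\<forall>l<N. \<forall>r>0. \<forall>\<theta>. node N (int l - 1) < \<theta> \<and> \<theta> < node N l \<longrightarrow>
          cmod (F (of_real r * cis \<theta>)) \<le> exp (C + r ^ n * Re ((W - 2 * pi * \<i> * (\<Sum>j<l. of_real (\<mu> j) * cis (- real n * node N j))) * cis (real n * \<theta>)))) \<and>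
        (\<forall>r>0. exp (r ^ n * Re W - C) \<le> cmod (F (of_real r)))"
    proof (intro exI[of _ F] conjI allI impI)
      have "(\<lambda>z. G (Y j z)) holomorphic_on UNIV" for j
        unfolding Y_def by (rule holomorphic_on_compose_gen[OF _ G(1), unfolded o_def]) (auto intro!: holomorphic_intros)
      then show "F holomorphic_on UNIV" unfolding F_def by (intro holomorphic_intros) auto
    next
      fix l and r \<theta> :: real
      assume l: "l < N" and r: "0 < r" and "node N (int l - 1) < \<theta> \<and> \<theta> < node N (int l)"
      then have \<theta>: "node N (int l - 1) < \<theta>" "\<theta> < node N l" by auto
      define z where "z = of_real r * cis \<theta>"
      have "(\<Prod>j<N. cmod (G (Y j z))) \<le> (\<Prod>j<N. exp (Re (Y j z ^ n * Ln (- Y j z)) + C0))"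
      proof (rule prod_mono, safe)
        fix j assume "j < N"
        then have "Y j z \<notin> \<real>\<^sub>\<ge>\<^sub>0 \<or> Y j z = 0" using factor[OF _ l r \<theta> z_def] by blast
        then show "cmod (G (Y j z)) \<le> exp (Re (Y j z ^ n * Ln (- Y j z)) + C0)"
        proof
          assume "Y j z \<notin> \<real>\<^sub>\<ge>\<^sub>0"
          then have "cmod (G (Y j z)) \<le> exp (Re (Y j z ^ n * Ln (- Y j z)) + C1)" by (rule up)
          also have "\<dots> \<le> exp (Re (Y j z ^ n * Ln (- Y j z)) + C0)" using C0 by simp
          finally show ?thesis .
        qed (use G n0 C0 in \<open>simp add: power_0_left\<close>)
      qed auto
      also have "\<dots> = exp (\<Sum>j<N. Re (Y j z ^ n * Ln (- Y j z)) + C0)" by (simp only: exp_sum finite_lessThan)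
      finally have "cmod (F z) \<le> exp (Re ((W - A) * z ^ n)) * exp (\<Sum>j<N. Re (Y j z ^ n * Ln (- Y j z)) + C0)"
        unfolding Fn by (intro mult_left_mono) auto
      also have "\<dots> = exp (C + Re ((W - A) * z ^ n + (\<Sum>j<N. Y j z ^ n * Ln (- Y j z))))"
        unfolding CN sum.distrib Re_sum plus_complex.sel by (simp add: algebra_simps flip: exp_add)
      also have "\<dots> = exp (C + r ^ n * Re ((W - 2 * pi * \<i> * (\<Sum>j<l. w j)) * cis (real n * \<theta>)))"
        unfolding total[OF l r \<theta> z_def] by (simp del: of_real_power)
      finally show "cmod (F (of_real r * cis \<theta>)) \<le> exp (C + r ^ n * Re ((W - 2 * pi * \<i> * (\<Sum>j<l. of_real (\<mu> j) * cis (- real n * node N j))) * cis (real n * \<theta>)))"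
        by (simp add: z_def w_def \<theta>'_def)
    next
      fix r :: real assume r: "0 < r"
      have l: "0 < N" using N by simp
      have \<theta>: "node N (int 0 - 1) < 0" "0 < node N (int 0)" using \<tau> by (auto simp: node_def \<tau>_def)
      define z where "z = of_real r * cis 0"
      have "(\<Prod>j<N. exp (Re (Y j z ^ n * Ln (- Y j z)) - C0)) \<le> (\<Prod>j<N. cmod (G (Y j z)))"
      proof (rule prod_mono, safe)
        fix j assume j: "j < N"
        then have "Y j z \<notin> \<real>\<^sub>\<ge>\<^sub>0 \<or> Y j z = 0" using factor[OF _ l r \<theta> z_def] by blast
        then show "exp (Re (Y j z ^ n * Ln (- Y j z)) - C0) \<le> cmod (G (Y j z))"
        proof
          assume Y: "Y j z \<notin> \<real>\<^sub>\<ge>\<^sub>0"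
          \<comment> \<open>On the positive axis every factor is evaluated at angle at least
            \<open>\<tau> / 2\<close> from its own zero ray, so the two-sided estimate applies with
            a constant that depends only on \<open>N\<close>.\<close>
          have "cos (\<theta>' j) \<le> c"
          proof (cases "\<theta>' j \<le> pi")
            case True
            then show ?thesis unfolding c_def using th0[of j] \<tau> by (intro cos_monotone_0_pi_le) auto
          next
            case False
            have "cos (\<theta>' j) = cos (2 * pi - \<theta>' j)" by simp
            also have "\<dots> \<le> c" unfolding c_def using thN[OF j] False \<tau> by (intro cos_monotone_0_pi_le) auto
            finally show ?thesis .
          qed
          then have "Re (Y j z) \<le> c * cmod (Y j z)"
            using mult_left_mono[of "cos (\<theta>' j)" c "\<mu> j powr (1 / n) * r"] r
            by (simp add: Y_def z_def norm_mult mult_ac)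
          then have "off_ray (sqrt (1 - c)) (Y j z)" using c by (intro off_rayI) auto
          then have "exp (Re (Y j z ^ n * Ln (- Y j z)) - C2) \<le> cmod (G (Y j z))" using C2[OF Y] by simp
          moreover have "exp (Re (Y j z ^ n * Ln (- Y j z)) - C0) \<le> exp (Re (Y j z ^ n * Ln (- Y j z)) - C2)" using C0 by simp
          ultimately show ?thesis by linarith
        qed (use G n0 C0 in \<open>simp add: power_0_left\<close>)
      qed auto
      then have "exp (\<Sum>j<N. Re (Y j z ^ n * Ln (- Y j z)) - C0) \<le> (\<Prod>j<N. cmod (G (Y j z)))"
        by (simp only: exp_sum finite_lessThan)
      then have "exp (Re ((W - A) * z ^ n)) * exp (\<Sum>j<N. Re (Y j z ^ n * Ln (- Y j z)) - C0) \<le> cmod (F z)"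
        unfolding Fn by (intro mult_left_mono) auto
      also have "exp (Re ((W - A) * z ^ n)) * exp (\<Sum>j<N. Re (Y j z ^ n * Ln (- Y j z)) - C0)
          = exp (Re ((W - A) * z ^ n + (\<Sum>j<N. Y j z ^ n * Ln (- Y j z))) - C)"
        unfolding CN sum_subtractf Re_sum plus_complex.sel by (simp add: algebra_simps flip: exp_add)
      finally show "exp (r ^ n * Re W - C) \<le> cmod (F (of_real r))"
        unfolding total[OF l r \<theta> z_def] by (simp add: z_def)
    qed
  qed
qed


text \<open>\<open>chord_coeff\<close> encodes the sinusoid \<open>Re (Z * cis (n * \<theta>))\<close> through two neighbouring node values.\<close>
definition chord_coeff :: "nat \<Rightarrow> nat \<Rightarrow> (int \<Rightarrow> real) \<Rightarrow> int \<Rightarrow> complex" where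
  "chord_coeff n N Y l = cis (- real n * node N l) *
     Complex (Y l) ((Y (l - 1) - Y l * cos (real n * (2 * pi / N))) / sin (real n * (2 * pi / N)))"

lemma chord_coeff_value:
  assumes "sin (real n * (2 * pi / N)) \<noteq> 0"
  shows "Re (chord_coeff n N Y l * cis (real n * \<theta>)) =
    (Y l * sin (real n * (\<theta> - node N (l - 1))) + Y (l - 1) * sin (real n * (node N l - \<theta>))) / sin (real n * (2 * pi / N))"
proof -
  define u where "u = real n * (node N l - \<theta>)"
  define t where "t = real n * (2 * pi / N)"
  have t: "sin t \<noteq> 0" using assms by (simp add: t_def)
  have 1: "real n * (\<theta> - node N (l - 1)) = t - u"
    by (simp add: node_def t_def u_def algebra_simps diff_divide_distrib add_divide_distrib)
  have "cis (- real n * node N l) * cis (real n * \<theta>) = cis (- u)" by (simp add: cis_mult u_def algebra_simps)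
  then have "chord_coeff n N Y l * cis (real n * \<theta>) = cis (- u) * Complex (Y l) ((Y (l - 1) - Y l * cos t) / sin t)"
    unfolding chord_coeff_def t_def by (simp add: mult_ac)
  then have "Re (chord_coeff n N Y l * cis (real n * \<theta>)) = cos u * Y l + sin u * ((Y (l - 1) - Y l * cos t) / sin t)"
    by simp
  also have "\<dots> = (Y l * sin (t - u) + Y (l - 1) * sin u) / sin t"
    using t by (simp add: sin_diff field_simps)
  finally show ?thesis unfolding 1 u_def t_def .
qed

text \<open>The numerator is the discrete analogue of \<open>g'' + n^2 g\<close>: it vanishes on
  samples of \<open>n\<close>-sinusoids, and its nonnegativity says that the kink at the node is
  convex.\<close>

lemma chord_coeff_step:
  assumes "sin (real n * (2 * pi / N)) \<noteq> 0"
  shows "chord_coeff n N Y (l + 1) = chord_coeff n N Y l -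
    \<i> * of_real ((Y (l + 1) + Y (l - 1) - 2 * cos (real n * (2 * pi / N)) * Y l) / sin (real n * (2 * pi / N))) * cis (- real n * node N l)"
proof -
  define t where "t = real n * (2 * pi / N)"
  have t: "sin t \<noteq> 0" using assms by (simp add: t_def)
  have "- real n * node N (l + 1) = - real n * node N l + - t"
    by (simp add: node_def t_def algebra_simps diff_divide_distrib add_divide_distrib)
  then have c: "cis (- real n * node N (l + 1)) = cis (- real n * node N l) * cis (- t)" by (simp only: cis_mult)
  have "cis (- t) * Complex (Y (l + 1)) ((Y l - Y (l + 1) * cos t) / sin t) =
     Complex (Y l) ((Y (l - 1) - Y l * cos t) / sin t) - \<i> * of_real ((Y (l + 1) + Y (l - 1) - 2 * cos t * Y l) / sin t)"
  proof (rule complex_eqI)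
    show "Re (cis (- t) * Complex (Y (l + 1)) ((Y l - Y (l + 1) * cos t) / sin t)) =
      Re (Complex (Y l) ((Y (l - 1) - Y l * cos t) / sin t) - \<i> * of_real ((Y (l + 1) + Y (l - 1) - 2 * cos t * Y l) / sin t))"
      using t by (simp add: field_simps)
    have "cos t * (Y l - Y (l + 1) * cos t) - sin t * sin t * Y (l + 1) = cos t * Y l - Y (l + 1) * (sin t * sin t + cos t * cos t)"
      by (simp only: distrib_left right_diff_distrib mult_ac)
    also have "sin t * sin t + cos t * cos t = 1" using sin_cos_squared_add[of t] by (simp add: power2_eq_square)
    finally have "cos t * (Y l - Y (l + 1) * cos t) - sin t * sin t * Y (l + 1) = cos t * Y l - Y (l + 1)" by simp
    then show "Im (cis (- t) * Complex (Y (l + 1)) ((Y l - Y (l + 1) * cos t) / sin t)) =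
      Im (Complex (Y l) ((Y (l - 1) - Y l * cos t) / sin t) - \<i> * of_real ((Y (l + 1) + Y (l - 1) - 2 * cos t * Y l) / sin t))"
      using t by (simp add: field_simps)
  qed
  then show ?thesis unfolding chord_coeff_def c t_def[symmetric] mult.assoc
    by (simp only: add_diff_cancel_right' right_diff_distrib) (simp add: mult_ac)
qed

text \<open>The weights \<open>sin (t - u) / sin t\<close> and \<open>sin u / sin t\<close> have the
  sum \<open>cos (u - t/2) / cos (t/2)\<close>, which lies between 1 and
  \<open>1 / cos (t/2)\<close>. A nonnegative bound is overshot at most by this factor, a negative
  one not at all.\<close>

lemma chord_upper:
  assumes t: "0 < t" "t < pi" and u: "0 \<le> u" "u \<le> t" and ab: "a \<le> m" "b \<le> m"
  shows "(a * sin (t - u) + b * sin u) / sin t \<le> max m (m / cos (t / 2))"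
proof -
  have s: "sin t > 0" "sin u \<ge> 0" "sin (t - u) \<ge> 0" using t u by (auto intro!: sin_gt_zero sin_ge_zero)
  have ch: "cos (t / 2) > 0" using t by (intro cos_gt_zero_pi) auto
  define k where "k = cos (u - t / 2)"
  have k: "k \<ge> cos (t / 2)" "k \<le> 1"
  proof -
    have "cos (t / 2) \<le> cos \<bar>u - t / 2\<bar>" using t u by (intro cos_monotone_0_pi_le) linarith+
    then show "k \<ge> cos (t / 2)" by (simp add: k_def)
  qed (simp add: k_def)
  have s2: "sin t = 2 * sin (t / 2) * cos (t / 2)" using sin_double[of "t / 2"] by simp
  have "sin (t - u) + sin u = 2 * sin (t / 2) * k"
    unfolding k_def using sin_plus_sin[of "t - u" u] by (simp add: diff_divide_distrib cos_minus[of "u - t/2", symmetric] del: cos_minus)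
  then have w: "(sin (t - u) + sin u) / sin t = k / cos (t / 2)"
    using s(1) ch unfolding s2 by (auto simp: field_simps zero_less_mult_iff)
  have "(a * sin (t - u) + b * sin u) / sin t \<le> (m * sin (t - u) + m * sin u) / sin t"
    using s ab by (intro divide_right_mono add_mono mult_right_mono) auto
  also have "\<dots> = m * (k / cos (t / 2))" unfolding w[symmetric] by (simp add: distrib_left)
  also have "\<dots> \<le> max m (m / cos (t / 2))"
  proof (cases "m \<ge> 0")
    case True
    have "m * (k / cos (t / 2)) \<le> m * (1 / cos (t / 2))" using True k ch by (intro mult_left_mono divide_right_mono) auto
    then show ?thesis by simp
  next
    case False
    have "m * (k / cos (t / 2)) \<le> m * 1" using False k ch by (intro mult_left_mono_neg) auto
    then show ?thesis by simp
  qed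
  finally show ?thesis .
qed

text \<open>The kink masses are the second differences of \<open>Y\<close>. Their resonance
  condition holds by telescoping: the chord coefficient returns to its initial value after
  \<open>N\<close> nodes, since \<open>Y\<close> is periodic and \<open>n\<close> is an integer. The
  two zero samples make the sinusoid vanish in the sector of the positive axis, whence the lower
  bound there; \<open>N > 2 n\<close> keeps the angle step \<open>t\<close> below
  \<open>pi\<close>.\<close>

lemma interpolating_function:
  assumes n: "n \<ge> 2" and N: "N > 2 * n"
  obtains C where "\<forall>Y :: int \<Rightarrow> real. (\<forall>j. Y (j + int N) = Y j) \<longrightarrow>
      (\<forall>j. 2 * cos (real n * (2 * pi / N)) * Y j \<le> Y (j + 1) + Y (j - 1)) \<longrightarrow> Y 0 = 0 \<longrightarrow> Y (-1) = 0 \<longrightarrow>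
      (\<exists>F. F holomorphic_on UNIV \<and>
        (\<forall>l<N. \<forall>r>0. \<forall>\<theta> m. node N (int l - 1) < \<theta> \<and> \<theta> < node N l \<and> Y (int l - 1) \<le> m \<and> Y l \<le> m \<longrightarrow>
          cmod (F (of_real r * cis \<theta>)) \<le> exp (C + r ^ n * max m (m / cos (real n * (2 * pi / N) / 2)))) \<and>
        (\<forall>r>0. exp (- C) \<le> cmod (F (of_real r))))"
proof -
  define t where "t = real n * (2 * pi / N)"
  have t: "0 < t" "t < pi" using n N by (auto simp: t_def divide_simps)
  have st: "sin t > 0" using t by (rule sin_gt_zero)
  have N4: "N \<ge> 4" using n N by simp
  obtain C where C: "\<forall>(\<mu>::nat \<Rightarrow> real) W. (\<forall>j<N. \<mu> j \<ge> 0) \<longrightarrow>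
      (\<Sum>j<N. of_real (\<mu> j) * cis (- real n * node N j)) = 0 \<longrightarrow>
      (\<exists>F. F holomorphic_on UNIV \<and>
        (\<forall>l<N. \<forall>r>0. \<forall>\<theta>. node N (int l - 1) < \<theta> \<and> \<theta> < node N l \<longrightarrow>
          cmod (F (of_real r * cis \<theta>)) \<le> exp (C + r ^ n * Re ((W - 2 * pi * \<i> * (\<Sum>j<l. of_real (\<mu> j) * cis (- real n * node N j))) * cis (real n * \<theta>)))) \<and>
        (\<forall>r>0. exp (r ^ n * Re W - C) \<le> cmod (F (of_real r))))"
    by (rule sector_product[OF n N4])
  show ?thesis
  proof (rule that[of C], intro allI impI)
    fix Y :: "int \<Rightarrow> real"
    assume per: "\<forall>j. Y (j + int N) = Y j" and conv: "\<forall>j. 2 * cos (real n * (2 * pi / N)) * Y j \<le> Y (j + 1) + Y (j - 1)"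
      and Y0: "Y 0 = 0" and Y1: "Y (-1) = 0"
    define \<mu> where "\<mu> j = (Y (int j + 1) + Y (int j - 1) - 2 * cos t * Y (int j)) / sin t / (2 * pi)" for j
    have \<mu>: "\<mu> j \<ge> 0" for j using conv[rule_format, of "int j"] st by (simp add: \<mu>_def t_def)
    define S where "S l = (\<Sum>j<l. of_real (\<mu> j) * cis (- real n * node N j))" for l
    have Z: "chord_coeff n N Y (int l) = chord_coeff n N Y 0 - 2 * pi * \<i> * S l" for l
    proof (induction l)
      case (Suc l)
      have "chord_coeff n N Y (int l + 1) = chord_coeff n N Y l - \<i> * of_real (2 * pi * \<mu> l) * cis (- real n * node N l)"
        using st chord_coeff_step[of n N Y "int l"] by (simp add: \<mu>_def t_def)
      then show ?case using Suc by (simp add: S_def algebra_simps)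
    qed (simp add: S_def)
    have "chord_coeff n N Y (int N) = chord_coeff n N Y 0"
    proof -
      have "- real n * node N (int N) = - real n * node N 0 + - (2 * pi * of_int (int n))"
        using N by (simp add: node_def field_simps)
      then have "cis (- real n * node N (int N)) = cis (- real n * node N 0) * cis (- (2 * pi * of_int (int n)))"
        by (simp only: cis_mult)
      also have "cis (- (2 * pi * of_int (int n))) = 1" using cis_multiple_2pi[of "- real n"] by (simp add: mult.commute)
      finally show ?thesis using per[rule_format, of 0] per[rule_format, of "-1"] by (simp add: chord_coeff_def algebra_simps)
    qed
    then have "S N = 0" using Z[of N] by simp
    then obtain F where F: "F holomorphic_on UNIV"
      and up: "\<And>l r \<theta>. l < N \<Longrightarrow> r > 0 \<Longrightarrow> node N (int l - 1) < \<theta> \<Longrightarrow> \<theta> < node N l \<Longrightarrow>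
          cmod (F (of_real r * cis \<theta>)) \<le> exp (C + r ^ n * Re ((chord_coeff n N Y 0 - 2 * pi * \<i> * S l) * cis (real n * \<theta>)))"
      and low: "\<And>r. r > 0 \<Longrightarrow> exp (r ^ n * Re (chord_coeff n N Y 0) - C) \<le> cmod (F (of_real r))"
      using C[rule_format, of \<mu> "chord_coeff n N Y 0"] \<mu> unfolding S_def by blast
    show "\<exists>F. F holomorphic_on UNIV \<and>
        (\<forall>l<N. \<forall>r>0. \<forall>\<theta> m. node N (int l - 1) < \<theta> \<and> \<theta> < node N l \<and> Y (int l - 1) \<le> m \<and> Y l \<le> m \<longrightarrow>
          cmod (F (of_real r * cis \<theta>)) \<le> exp (C + r ^ n * max m (m / cos (real n * (2 * pi / N) / 2)))) \<and>
        (\<forall>r>0. exp (- C) \<le> cmod (F (of_real r)))"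
    proof (intro exI[of _ F] conjI allI impI F)
      fix l and r \<theta> m :: real
      assume l: "l < N" and r: "r > 0"
        and *: "node N (int l - 1) < \<theta> \<and> \<theta> < node N (int l) \<and> Y (int l - 1) \<le> m \<and> Y (int l) \<le> m"
      define u where "u = real n * (node N l - \<theta>)"
      have tu: "t - u = real n * (\<theta> - node N (int l - 1))"
        by (simp add: node_def t_def u_def algebra_simps diff_divide_distrib add_divide_distrib)
      have u: "0 \<le> u" using * by (simp add: u_def)
      have "t - u \<ge> 0" unfolding tu using * by simp
      then have "(Y l * sin (t - u) + Y (int l - 1) * sin u) / sin t \<le> max m (m / cos (t / 2))"
        using u * by (intro chord_upper t) auto
      then have "Re (chord_coeff n N Y l * cis (real n * \<theta>)) \<le> max m (m / cos (t / 2))"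
        using st unfolding tu unfolding u_def t_def by (subst chord_coeff_value) auto
      then have "C + r ^ n * Re (chord_coeff n N Y l * cis (real n * \<theta>)) \<le> C + r ^ n * max m (m / cos (t / 2))"
        using r by (intro add_left_mono mult_left_mono) auto
      then show "cmod (F (of_real r * cis \<theta>)) \<le> exp (C + r ^ n * max m (m / cos (real n * (2 * pi / N) / 2)))"
        using up[OF l r, of \<theta>] * unfolding Z[symmetric] t_def by (meson exp_le_cancel_iff order_trans)
    next
      fix r :: real assume r: "r > 0"
      have "Re (chord_coeff n N Y 0) = 0"
        using chord_coeff_value[of n N Y 0 0] st Y0 Y1 by (simp add: t_def)
      then show "exp (- C) \<le> cmod (F (of_real r))" using low[OF r] by simp
    qed
  qed
qed


section \<open>Sturm comparison and the touching function\<close>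

text \<open>\<open>W\<close> is the Wronskian of \<open>q\<close> with the solution
  \<open>sin (n (s - x))\<close>. Its derivative is
  \<open>(q'' + n^2 q) sin (n (s - x)) \<ge> 0\<close>, and it runs from 0 at 0 to
  \<open>n q(s)\<close> at \<open>s\<close>.\<close>

lemma sturm_nonneg:
  fixes q q1 q2 :: "real \<Rightarrow> real"
  assumes "\<And>x. (q has_real_derivative q1 x) (at x)" "\<And>x. (q1 has_real_derivative q2 x) (at x)"
    and "\<And>x. 0 \<le> q2 x + n\<^sup>2 * q x" and "q 0 = 0" "q1 0 = 0" and n: "n > 0" and s: "0 \<le> s" "s \<le> pi / n"
  shows "q s \<ge> 0"
proof -
  define W where "W x = q1 x * sin (n * (s - x)) + n * q x * cos (n * (s - x))" for x
  have "W 0 \<le> W s"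
  proof (rule DERIV_nonneg_imp_nondecreasing[OF s(1)])
    fix x assume x: "0 \<le> x" "x \<le> s"
    have "(W has_real_derivative (q2 x + n\<^sup>2 * q x) * sin (n * (s - x))) (at x)"
      unfolding W_def by (auto intro!: derivative_eq_intros assms simp: algebra_simps power2_eq_square)
    moreover have "n * (s - x) \<le> n * (pi / n)" using s x n by (intro mult_left_mono) auto
    then have "sin (n * (s - x)) \<ge> 0" using n x by (intro sin_ge_zero) auto
    ultimately show "\<exists>y. (W has_real_derivative y) (at x) \<and> 0 \<le> y" using assms(3) by auto
  qed
  then show ?thesis using assms by (simp add: W_def zero_le_mult_iff)
qed

text \<open>The function compared with \<open>f\<close> solves \<open>g'' + n^2 g = m\<close> with
  the value and slope of \<open>f\<close> at \<theta>. The sign \<open>e\<close> treats negative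
  \<open>s\<close> by reflection.\<close>

lemma sturm_lower:
  fixes f f1 f2 :: "real \<Rightarrow> real"
  assumes d: "\<And>x. (f has_real_derivative f1 x) (at x)" "\<And>x. (f1 has_real_derivative f2 x) (at x)"
    and m: "\<And>x. m \<le> f2 x + n\<^sup>2 * f x" and n: "n > 0" and s: "\<bar>s\<bar> \<le> pi / n"
  shows "f \<theta> * cos (n * s) + f1 \<theta> / n * sin (n * s) + m * (1 - cos (n * s)) / n\<^sup>2 \<le> f (\<theta> + s)"
proof -
  define e :: real where "e = (if s \<ge> 0 then 1 else -1)"
  have e: "e * e = 1" "s = e * \<bar>s\<bar>" by (auto simp: e_def)
  define a b c where "a = f \<theta>" and "b = f1 \<theta> / n" and "c = m / n\<^sup>2"
  define q where "q x = f (\<theta> + e * x) - (a * cos (n * (e * x)) + b * sin (n * (e * x)) + c * (1 - cos (n * (e * x))))" for x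
  define q1 where "q1 x = e * f1 (\<theta> + e * x) - (- a * sin (n * (e * x)) + b * cos (n * (e * x)) + c * sin (n * (e * x))) * (n * e)" for x
  define q2 where "q2 x = f2 (\<theta> + e * x) - (- a * cos (n * (e * x)) - b * sin (n * (e * x)) + c * cos (n * (e * x))) * n\<^sup>2" for x
  have n2: "n * e * (n * e) = n\<^sup>2" using e by (auto simp: power2_eq_square mult_ac)
  have "q \<bar>s\<bar> \<ge> 0"
  proof (rule sturm_nonneg[where q = q and ?q1.0 = q1 and ?q2.0 = q2 and n = n])
    fix x
    show "(q has_real_derivative q1 x) (at x)" unfolding q_def q1_def
      by (rule derivative_eq_intros d[THEN DERIV_chain2] refl)+ (simp add: algebra_simps)
    have "(q1 has_real_derivative e * (f2 (\<theta> + e * x) * e) - (- a * cos (n * (e * x)) - b * sin (n * (e * x)) + c * cos (n * (e * x))) * (n * e * (n * e))) (at x)"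
      unfolding q1_def
      by (rule derivative_eq_intros d[THEN DERIV_chain2] refl)+ (simp add: algebra_simps)
    moreover have "e * (f2 (\<theta> + e * x) * e) = f2 (\<theta> + e * x)" using e(1) by (simp add: mult.left_commute)
    ultimately show "(q1 has_real_derivative q2 x) (at x)" unfolding n2 q2_def by simp
    have "q2 x + n\<^sup>2 * q x = f2 (\<theta> + e * x) + n\<^sup>2 * f (\<theta> + e * x) - n\<^sup>2 * c"
      by (simp add: q_def q2_def algebra_simps)
    also have "n\<^sup>2 * c = m" using n by (simp add: c_def)
    finally show "0 \<le> q2 x + n\<^sup>2 * q x" using m[of "\<theta> + e * x"] by simp
  qed (use n s in \<open>auto simp: q_def q1_def a_def b_def\<close>)
  then show ?thesis unfolding q_def a_def b_def c_def using e(2) by (simp add: algebra_simps)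
qed

lemma periodic_int:
  fixes f :: "real \<Rightarrow> 'a"
  assumes "\<And>x. f (x + p) = f x"
  shows "f (x + of_int k * p) = f x"
proof (induction k arbitrary: x rule: int_induct[where k = 0])
  case (step1 i)
  then show ?case using assms[of "x + of_int i * p"] by (simp add: algebra_simps)
next
  case (step2 i)
  then show ?case using assms[of "x + of_int (i - 1) * p"] by (simp add: algebra_simps)
qed simp


text \<open>Sampling \<open>f - c\<close> leaves room for the interpolation error but loses the
  contact at 0, so near multiples of \<open>2 pi\<close> the samples are clipped to
  \<open>max 0 (f - c)\<close>. Sturm comparison at the contact point gives \<open>f \<ge> 0\<close>
  up to distance \<open>pi / n\<close> and \<open>f \<ge> 2 c\<close> from \<open>pi / (2 n)\<close>
  on, so the clipping is inactive in the outer half and the two recipes fit together. The mesh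
  depends only on \<open>n\<close>, \<open>m0\<close>, \<open>A\<close> and \<open>L\<close>, which
  makes \<open>C\<close> uniform in \<open>f\<close>.\<close>

lemma touching_function:
  fixes m0 A L :: real
  assumes n: "n \<ge> 2" and m0: "m0 > 0"
  obtains C where "\<forall>f f1 f2 :: real \<Rightarrow> real. (\<forall>x. (f has_real_derivative f1 x) (at x)) \<longrightarrow> (\<forall>x. (f1 has_real_derivative f2 x) (at x)) \<longrightarrow>
    (\<forall>x. m0 \<le> f2 x + (real n)\<^sup>2 * f x) \<longrightarrow> (\<forall>x. \<bar>f x\<bar> \<le> A) \<longrightarrow> (\<forall>x. \<bar>f1 x\<bar> \<le> L) \<longrightarrow> (\<forall>x. f (x + 2 * pi) = f x) \<longrightarrow>
    f 0 = 0 \<longrightarrow> f1 0 = 0 \<longrightarrow>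
    (\<exists>F. F holomorphic_on UNIV \<and> (\<forall>r>0. \<forall>\<theta>. cmod (F (of_real r * cis \<theta>)) \<le> exp (C + r ^ n * f \<theta>)) \<and>
      (\<forall>r>0. exp (- C) \<le> cmod (F (of_real r))))"
proof -
  define c where "c = m0 / (2 * (real n)\<^sup>2)"
  have n0: "real n > 0" using n by simp
  have c: "c > 0" using m0 n0 by (simp add: c_def)
  \<comment> \<open>Three demands on the mesh: one step must fit into the outer half of the clipping
    zone, \<open>f\<close> must vary by less than \<open>c / 2\<close> over one step, and the
    overshoot factor \<open>1 / cos (t / 2)\<close> must cost less than
    \<open>c / 2\<close>.\<close>
  have lim: "(\<lambda>N. 2 * pi / real N) \<longlonglongrightarrow> 0" "(\<lambda>N. L * (2 * pi / real N)) \<longlonglongrightarrow> 0"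
    "(\<lambda>N. A * (1 - cos (real n * (2 * pi / real N) / 2))) \<longlonglongrightarrow> 0"
    by real_asymp+
  have "\<forall>\<^sub>F N in sequentially. 2 * pi / real N < pi / (2 * n)" "\<forall>\<^sub>F N in sequentially. L * (2 * pi / real N) < c / 2"
    "\<forall>\<^sub>F N in sequentially. A * (1 - cos (real n * (2 * pi / real N) / 2)) < c / 2"
    by (rule order_tendstoD(2)[OF lim(1)] order_tendstoD(2)[OF lim(2)] order_tendstoD(2)[OF lim(3)]; use c n0 in simp)+
  then have "\<forall>\<^sub>F N in sequentially. 2 * n < N \<and> 2 * pi / real N < pi / (2 * n) \<and> L * (2 * pi / real N) < c / 2 \<and>
      A * (1 - cos (real n * (2 * pi / real N) / 2)) < c / 2"
    using eventually_gt_at_top[of "2 * n"] by eventually_elim auto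
  then obtain N where N: "2 * n < N" and N1: "2 * pi / real N < pi / (2 * n)" and N2: "L * (2 * pi / real N) < c / 2"
    and N3: "A * (1 - cos (real n * (2 * pi / real N) / 2)) < c / 2"
    by (auto dest: eventually_happens simp: trivial_limit_sequentially)
  define \<tau> where "\<tau> = 2 * pi / real N"
  have \<tau>n: "\<tau> \<le> pi / n"
  proof -
    have "pi / (2 * n) \<le> pi / n" using n0 by (intro divide_left_mono) auto
    then show ?thesis using N1 by (simp add: \<tau>_def)
  qed
  define t where "t = real n * \<tau>"
  have \<tau>: "\<tau> > 0" "\<tau> < pi / (2 * n)" "L * \<tau> < c / 2" using N N1 N2 n0 by (auto simp: \<tau>_def)
  have t: "0 < t" "t < pi / 2"
  proof -
    have "real n * \<tau> < real n * (pi / (2 * n))" using \<tau> n0 by (intro mult_strict_left_mono) auto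
    then show "t < pi / 2" using n0 by (simp add: t_def)
  qed (use \<tau> n0 in \<open>simp add: t_def\<close>)
  have ct: "cos (t / 2) > 0" "cos (t / 2) \<le> 1" using t by (auto intro!: cos_gt_zero_pi)
  have A: "A * (1 - cos (t / 2)) < c / 2" using N3 by (simp add: t_def \<tau>_def)
  obtain C where C: "\<forall>Y :: int \<Rightarrow> real. (\<forall>j. Y (j + int N) = Y j) \<longrightarrow>
      (\<forall>j. 2 * cos (real n * (2 * pi / N)) * Y j \<le> Y (j + 1) + Y (j - 1)) \<longrightarrow> Y 0 = 0 \<longrightarrow> Y (-1) = 0 \<longrightarrow>
      (\<exists>F. F holomorphic_on UNIV \<and>
        (\<forall>l<N. \<forall>r>0. \<forall>\<theta> m. node N (int l - 1) < \<theta> \<and> \<theta> < node N l \<and> Y (int l - 1) \<le> m \<and> Y l \<le> m \<longrightarrow>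
          cmod (F (of_real r * cis \<theta>)) \<le> exp (C + r ^ n * max m (m / cos (real n * (2 * pi / N) / 2)))) \<and>
        (\<forall>r>0. exp (- C) \<le> cmod (F (of_real r))))"
    by (rule interpolating_function[OF n N])
  have node1: "node N (j + 1) = node N j + \<tau>" "node N (j - 1) = node N j - \<tau>" for j
    by (auto simp: node_def \<tau>_def algebra_simps add_divide_distrib diff_divide_distrib)
  have nodeN: "node N (j + k * int N) = node N j + of_int k * (2 * pi)" for j k
    using N by (simp add: node_def field_simps)
  show ?thesis
  proof (rule that[of C], intro allI impI)
    fix f f1 f2 :: "real \<Rightarrow> real"
    assume d: "\<forall>x. (f has_real_derivative f1 x) (at x)" "\<forall>x. (f1 has_real_derivative f2 x) (at x)"
      and m: "\<forall>x. m0 \<le> f2 x + (real n)\<^sup>2 * f x" and fA: "\<forall>x. \<bar>f x\<bar> \<le> A" and fL: "\<forall>x. \<bar>f1 x\<bar> \<le> L"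
      and per: "\<forall>x. f (x + 2 * pi) = f x" and f0: "f 0 = 0" "f1 0 = 0"
    have st: "f \<theta> * cos (real n * s) + f1 \<theta> / n * sin (real n * s) + m0 * (1 - cos (real n * s)) / (real n)\<^sup>2 \<le> f (\<theta> + s)"
      if "\<bar>s\<bar> \<le> pi / n" for \<theta> s :: real
      by (rule sturm_lower[where ?f2.0 = f2]) (use d m n0 that in auto)
    have L0: "L \<ge> 0" using fL[rule_format, of 0] by linarith
    have lip: "\<bar>f x - f y\<bar> \<le> L * \<bar>x - y\<bar>" for x y
      using field_differentiable_bound[of UNIV f f1 L x y] d fL by auto
    have perk: "f (x + of_int k * (2 * pi)) = f x" for x k by (rule periodic_int) (use per in auto)
    define near where "near x \<longleftrightarrow> (\<exists>k::int. \<bar>x - of_int k * (2 * pi)\<bar> \<le> pi / n)" for x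
    have nearf: "f x \<ge> m0 * (1 - cos (real n * (x - of_int k * (2 * pi)))) / (real n)\<^sup>2" if "\<bar>x - of_int k * (2 * pi)\<bar> \<le> pi / n" for x k
    proof -
      have "f x = f (0 + (x - of_int k * (2 * pi)))" using perk[of "x - of_int k * (2 * pi)" k] by simp
      also have "\<dots> \<ge> m0 * (1 - cos (real n * (x - of_int k * (2 * pi)))) / (real n)\<^sup>2" using st[OF that, of 0] f0 by simp
      finally show ?thesis by simp
    qed
    have near0: "f x \<ge> 0" if "near x" for x
    proof -
      from that obtain k where k: "\<bar>x - of_int k * (2 * pi)\<bar> \<le> pi / n" by (auto simp: near_def)
      have "m0 * (1 - cos (real n * (x - of_int k * (2 * pi)))) / (real n)\<^sup>2 \<ge> 0" using m0 by simp
      then show ?thesis using nearf[OF k] by linarith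
    qed
    have near2c: "f x \<ge> 2 * c" if "\<bar>x - of_int k * (2 * pi)\<bar> \<le> pi / n" "pi / (2 * n) \<le> \<bar>x - of_int k * (2 * pi)\<bar>" for x k
    proof -
      define u where "u = real n * \<bar>x - of_int k * (2 * pi)\<bar>"
      have "real n * (pi / (2 * n)) \<le> u" "u \<le> real n * (pi / n)"
        unfolding u_def using that n0 by (intro mult_left_mono; simp)+
      then have "cos u \<le> cos (pi / 2)" using n0 by (intro cos_monotone_0_pi_le) auto
      moreover have "cos (real n * (x - of_int k * (2 * pi))) = cos u"
      proof -
        have "real n * (x - of_int k * (2 * pi)) = u \<or> real n * (x - of_int k * (2 * pi)) = - u"
          by (auto simp: u_def abs_if algebra_simps)
        then show ?thesis by (metis cos_minus)
      qed
      ultimately have "m0 * 1 / (real n)\<^sup>2 \<le> m0 * (1 - cos (real n * (x - of_int k * (2 * pi)))) / (real n)\<^sup>2"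
        using m0 by (intro divide_right_mono mult_left_mono) auto
      then show ?thesis using nearf[OF that(1)] n0 by (simp add: c_def)
    qed
    define Y where "Y j = (if near (node N j) then max 0 (f (node N j) - c) else f (node N j) - c)" for j
    have near_shift: "near (x + of_int k * (2 * pi)) \<longleftrightarrow> near x" for x k
    proof -
      have "near (x + of_int k * (2 * pi))" if "near x" for x k
      proof -
        from that obtain i where "\<bar>x - of_int i * (2 * pi)\<bar> \<le> pi / n" by (auto simp: near_def)
        then show ?thesis unfolding near_def by (intro exI[of _ "i + k"]) (simp add: algebra_simps)
      qed
      from this[of x k] this[of "x + of_int k * (2 * pi)" "- k"] show ?thesis by auto
    qed
    have Yper: "Y (j + k * int N) = Y j" for j k
      unfolding Y_def nodeN near_shift perk ..
    have Ylow: "f (node N j) - c \<le> Y j" for j by (simp add: Y_def)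
    \<comment> \<open>At an unclipped sample, Sturm comparison on both sides supplies
      \<open>4 E\<close>, while subtracting \<open>c\<close> uses up only \<open>2 E\<close>. A
      clipped sample is 0 and has \<open>f < c\<close> there, so it lies in the inner half of the
      zone and both neighbours are still in the zone, hence nonnegative.\<close>
    have conv: "2 * cos t * Y j \<le> Y (j + 1) + Y (j - 1)" for j
    proof (cases "Y j = f (node N j) - c")
      case True
      define x where "x = node N j"
      define E where "E = c * (1 - cos t)"
      have E: "m0 * (1 - cos t) / (real n)\<^sup>2 = 2 * E" "E \<ge> 0" using c m0 by (simp_all add: c_def E_def)
      have "f x * cos t + f1 x / n * sin t + 2 * E \<le> f (x + \<tau>)"
        using st[of \<tau> x] \<tau> \<tau>n unfolding t_def[symmetric] E by simp
      moreover have "f x * cos t - f1 x / n * sin t + 2 * E \<le> f (x - \<tau>)"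
        using st[of "- \<tau>" x] \<tau> \<tau>n by (simp add: E flip: t_def)
      moreover have "2 * cos t * (f x - c) = 2 * (f x * cos t) - 2 * c + 2 * E" by (simp add: E_def algebra_simps)
      ultimately have "2 * cos t * (f x - c) \<le> (f (x + \<tau>) - c) + (f (x - \<tau>) - c)" using E(2) by linarith
      then show ?thesis using Ylow[of "j + 1"] Ylow[of "j - 1"] unfolding True node1 x_def by linarith
    next
      case False
      then have Y0: "Y j = 0" "near (node N j)" "f (node N j) < c" by (auto simp: Y_def split: if_splits)
      then obtain k where k: "\<bar>node N j - of_int k * (2 * pi)\<bar> \<le> pi / n" by (auto simp: near_def)
      have k2: "\<bar>node N j - of_int k * (2 * pi)\<bar> < pi / (2 * n)" using near2c[OF k] Y0 c by linarith
      have "pi / n = pi / (2 * n) + pi / (2 * n)" using n0 by (simp add: field_simps)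
      then have "\<bar>node N (j + 1) - of_int k * (2 * pi)\<bar> \<le> pi / n" "\<bar>node N (j - 1) - of_int k * (2 * pi)\<bar> \<le> pi / n"
        unfolding node1 using k2 \<tau> by linarith+
      then have "near (node N (j + 1))" "near (node N (j - 1))" unfolding near_def by blast+
      then have "Y (j + 1) \<ge> 0" "Y (j - 1) \<ge> 0" by (auto simp: Y_def)
      then show ?thesis using Y0 by simp
    qed
    have Y00: "Y j = 0" if "\<bar>node N j\<bar> \<le> \<tau> / 2" for j
    proof -
      have "near (node N j)" unfolding near_def using that \<tau> \<tau>n by (intro exI[of _ 0]) auto
      moreover have "\<bar>f (node N j)\<bar> \<le> L * \<bar>node N j\<bar>" using lip[of "node N j" 0] f0 by simp
      moreover have "L * \<bar>node N j\<bar> \<le> L * \<tau>" using L0 that \<tau> by (intro mult_left_mono) auto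
      ultimately show ?thesis using \<tau> c by (simp add: Y_def)
    qed
    have Y01: "Y 0 = 0" "Y (-1) = 0" using \<tau> by (auto intro!: Y00 simp: node_def \<tau>_def)
    have "\<exists>F. F holomorphic_on UNIV \<and>
        (\<forall>l<N. \<forall>r>0. \<forall>\<theta> m. node N (int l - 1) < \<theta> \<and> \<theta> < node N l \<and> Y (int l - 1) \<le> m \<and> Y l \<le> m \<longrightarrow>
          cmod (F (of_real r * cis \<theta>)) \<le> exp (C + r ^ n * max m (m / cos (real n * (2 * pi / N) / 2)))) \<and>
        (\<forall>r>0. exp (- C) \<le> cmod (F (of_real r)))"
      by (rule C[rule_format, of Y]) (use Yper[of _ 1] conv[unfolded t_def \<tau>_def] Y01 in auto)
    then obtain F where F: "F holomorphic_on UNIV"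
      and up: "\<And>l r \<theta> m. l < N \<Longrightarrow> r > 0 \<Longrightarrow> node N (int l - 1) < \<theta> \<Longrightarrow> \<theta> < node N l \<Longrightarrow> Y (int l - 1) \<le> m \<Longrightarrow> Y l \<le> m \<Longrightarrow>
          cmod (F (of_real r * cis \<theta>)) \<le> exp (C + r ^ n * max m (m / cos (t / 2)))"
      and low: "\<And>r. r > 0 \<Longrightarrow> exp (- C) \<le> cmod (F (of_real r))"
      unfolding t_def \<tau>_def by blast
    \<comment> \<open>For positive \<open>m\<close> the margin \<open>c / 2\<close> pays for the
      overshoot, because \<open>|f|\<close> is at most \<open>A\<close>. For
      \<open>m \<le> 0\<close> there is no overshoot, and \<open>near0\<close> or the margin gives
      \<open>m \<le> f \<theta>\<close>.\<close>
    have small: "max m (m / cos (t / 2)) \<le> f \<theta>" if "m \<le> max 0 (f \<theta> - c / 2)" "near \<theta> \<or> m \<le> f \<theta> - c / 2" for m \<theta>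
    proof (cases "m \<ge> 0 \<and> f \<theta> \<ge> c / 2")
      case True
      then have "m \<le> f \<theta> - c / 2" using that by auto
      moreover have "f \<theta> * (1 - cos (t / 2)) \<le> A * (1 - cos (t / 2))" using ct fA[rule_format, of \<theta>] by (intro mult_right_mono) auto
      ultimately have "m \<le> f \<theta> * cos (t / 2)" using A by (simp add: algebra_simps)
      then have "m / cos (t / 2) \<le> f \<theta>" using ct by (simp add: field_simps)
      then show ?thesis using \<open>m \<le> f \<theta> - c / 2\<close> c by simp
    next
      case False
      have "m / cos (t / 2) \<le> m" if "m \<le> 0" using that ct by (simp add: divide_le_eq mult_le_cancel_left1)
      moreover have "m \<le> 0" using that False by auto
      moreover have "m \<le> f \<theta>" using that near0[of \<theta>] \<open>m \<le> 0\<close> c by auto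
      ultimately show ?thesis by auto
    qed
    have Yup: "Y j \<le> max 0 (f \<theta> - c / 2) \<and> (near \<theta> \<or> Y j \<le> f \<theta> - c / 2)" if "\<bar>node N j - \<theta>\<bar> \<le> \<tau>" for j \<theta>
    proof -
      have "\<bar>f (node N j) - f \<theta>\<bar> \<le> L * \<bar>node N j - \<theta>\<bar>" by (rule lip)
      also have "\<dots> \<le> L * \<tau>" using L0 that by (intro mult_left_mono) auto
      finally have 1: "f (node N j) - c \<le> f \<theta> - c / 2" using \<tau> by linarith
      have "Y j = f (node N j) - c" if nn: "\<not> near \<theta>"
      proof (cases "near (node N j)")
        case True
        then obtain k where k: "\<bar>node N j - of_int k * (2 * pi)\<bar> \<le> pi / n" by (auto simp: near_def)
        have "\<bar>\<theta> - of_int k * (2 * pi)\<bar> > pi / n" using nn by (auto simp: near_def not_le)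
        moreover have "pi / n = pi / (2 * n) + pi / (2 * n)" using n0 by (simp add: field_simps)
        ultimately have "pi / (2 * n) \<le> \<bar>node N j - of_int k * (2 * pi)\<bar>"
          using \<open>\<bar>node N j - \<theta>\<bar> \<le> \<tau>\<close> \<tau> by linarith
        then have "f (node N j) \<ge> 2 * c" by (rule near2c[OF k])
        then show ?thesis using c by (simp add: Y_def)
      qed (simp add: Y_def)
      moreover have "Y j \<le> max 0 (f (node N j) - c)" by (simp add: Y_def)
      ultimately show ?thesis using 1 by (cases "near \<theta>") auto
    qed
    have open_sector: "cmod (F (of_real r * cis \<theta>)) \<le> exp (C + r ^ n * f \<theta>)"
      if r: "r > 0" and \<theta>: "\<theta> \<notin> range (node N)" for r \<theta>
    proof -
      define j where "j = \<lfloor>\<theta> / \<tau> + 1/2\<rfloor>"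
      have "of_int j \<le> \<theta> / \<tau> + 1/2" "\<theta> / \<tau> + 1/2 < of_int j + 1" unfolding j_def by linarith+
      then have "(of_int j - 1/2) * \<tau> \<le> \<theta>" "\<theta> < (of_int j + 1/2) * \<tau>" using \<tau>(1) by (simp_all add: field_simps)
      moreover have "node N (j - 1) = (of_int j - 1/2) * \<tau>" "node N j = (of_int j + 1/2) * \<tau>"
        by (simp_all add: node_def \<tau>_def)
      moreover have "\<theta> \<noteq> node N (j - 1)" using \<theta> by blast
      ultimately have j: "node N (j - 1) < \<theta>" "\<theta> < node N j" by auto
      define l where "l = nat (j mod int N)"
      define k where "k = j div int N"
      have N0: "N > 0" using N by simp
      have l: "l < N" unfolding l_def using N0 by (simp add: nat_less_iff)
      have jl: "j = int l + k * int N" unfolding l_def k_def using N0 by simp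
      define \<theta>' where "\<theta>' = \<theta> - of_int k * (2 * pi)"
      have 1: "node N (int l - 1) < \<theta>'" "\<theta>' < node N l"
        using j nodeN[of "int l - 1" k] nodeN[of "int l" k] unfolding jl \<theta>'_def by (simp_all add: algebra_simps)
      have f: "f \<theta>' = f \<theta>" using perk[of \<theta>' k] by (simp add: \<theta>'_def)
      have cis: "cis \<theta>' = cis \<theta>" unfolding \<theta>'_def cis_divide[symmetric]
        using cis_multiple_2pi[of "of_int k"] by (simp add: mult_ac)
      define m where "m = max (Y (int l - 1)) (Y l)"
      have "node N l = node N (int l - 1) + \<tau>" using node1(1)[of "int l - 1"] by simp
      then have "\<bar>node N (int l - 1) - \<theta>'\<bar> \<le> \<tau>" "\<bar>node N l - \<theta>'\<bar> \<le> \<tau>" using 1 by linarith+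
      then have "max m (m / cos (t / 2)) \<le> f \<theta>'" using Yup by (intro small) (auto simp: m_def)
      moreover have "cmod (F (of_real r * cis \<theta>')) \<le> exp (C + r ^ n * max m (m / cos (t / 2)))"
        by (rule up[OF l r 1]) (auto simp: m_def)
      ultimately have "cmod (F (of_real r * cis \<theta>')) \<le> exp (C + r ^ n * f \<theta>')"
        using r by (elim order_trans) (simp add: mult_left_mono)
      then show ?thesis unfolding f cis .
    qed
    have "cmod (F (of_real r * cis \<theta>)) \<le> exp (C + r ^ n * f \<theta>)" if r: "r > 0" for r \<theta>
    proof (cases "\<theta> \<in> range (node N)")
      case True
      then obtain j where j: "\<theta> = node N j" by auto
      \<comment> \<open>The sector bounds say nothing on the node rays themselves. These are reached
        by continuity: each shift is positive and smaller than the mesh width, so no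
        \<open_sector>-excluded angle occurs.\<close>
      define \<xi> where "\<xi> i = \<theta> + \<tau> / (real i + 2)" for i :: nat
      have "(\<lambda>i. \<theta> + \<tau> / (real i + 2)) \<longlonglongrightarrow> \<theta>" by real_asymp
      then have \<xi>: "\<xi> \<longlonglongrightarrow> \<theta>" by (simp add: \<xi>_def[abs_def])
      have nn: "\<xi> i \<notin> range (node N)" for i
      proof
        assume "\<xi> i \<in> range (node N)"
        then obtain j' where "\<xi> i = node N j'" by auto
        then have "(of_int (j' - j) - 1 / (real i + 2)) * \<tau> = 0"
          unfolding \<xi>_def j node_def \<tau>_def[symmetric] by (simp add: field_simps)
        then have "of_int (j' - j) = 1 / (real i + 2)" using \<tau>(1) by simp
        moreover have "0 < 1 / (real i + 2)" "1 / (real i + 2) < 1" by (auto simp: field_simps)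
        ultimately have "0 < real_of_int (j' - j)" "real_of_int (j' - j) < 1" by auto
        then show False by (simp only: of_int_0_less_iff of_int_less_1_iff)
      qed
      have Fc: "continuous_on UNIV F" using F by (rule holomorphic_on_imp_continuous_on)
      have fc: "isCont f \<theta>" using d by (auto intro: DERIV_isCont)
      show ?thesis
      proof (rule LIMSEQ_le)
        show "(\<lambda>i. exp (C + r ^ n * f (\<xi> i))) \<longlonglongrightarrow> exp (C + r ^ n * f \<theta>)"
          by (intro tendsto_intros isCont_tendsto_compose[OF fc] \<xi>)
        have "isCont (\<lambda>x. exp (\<i> * complex_of_real x)) \<theta>" by (intro continuous_intros)
        then have "isCont cis \<theta>" by (simp flip: cis_conv_exp)
        then have "(\<lambda>i. of_real r * cis (\<xi> i)) \<longlonglongrightarrow> of_real r * cis \<theta>"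
          by (intro tendsto_intros isCont_tendsto_compose[of _ cis] \<xi>)
        then show "(\<lambda>i. cmod (F (of_real r * cis (\<xi> i)))) \<longlonglongrightarrow> cmod (F (of_real r * cis \<theta>))"
          using Fc by (intro tendsto_norm isCont_tendsto_compose[of _ F]) (auto simp: continuous_on_eq_continuous_at)
      qed (use open_sector[OF r nn] in auto)
    qed (use open_sector[OF r] in auto)
    then show "\<exists>F. F holomorphic_on UNIV \<and> (\<forall>r>0. \<forall>\<theta>. cmod (F (of_real r * cis \<theta>)) \<le> exp (C + r ^ n * f \<theta>)) \<and>
      (\<forall>r>0. exp (- C) \<le> cmod (F (of_real r)))"
      using F low by blast
  qed
qed


text \<open>\<open>r^n (a cos (n x) + b sin (n x))\<close> is the real part of
  \<open>(a - \<i> b) z^n\<close>, so an exponential factor and a rotation reduce to a function with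
  value and slope 0 at angle 0. The bounds \<open>A'\<close> and \<open>L'\<close> of the reduced
  function do not involve the base angle, hence neither does \<open>C\<close>.\<close>

lemma entire_with_homogeneous_weight:
  fixes p p1 p2 :: "real \<Rightarrow> real"
  assumes n: "n \<ge> 2" and m0: "m0 > 0"
    and d: "\<And>x. (p has_real_derivative p1 x) (at x)" "\<And>x. (p1 has_real_derivative p2 x) (at x)"
    and m: "\<And>x. m0 \<le> p2 x + (real n)\<^sup>2 * p x" and A: "\<And>x. \<bar>p x\<bar> \<le> A" and L: "\<And>x. \<bar>p1 x\<bar> \<le> L"
    and per: "\<And>x. p (x + 2 * pi) = p x"
  obtains C where "\<forall>\<theta>0. \<exists>h. h holomorphic_on UNIV \<and>
      (\<forall>r>0. \<forall>\<theta>. cmod (h (of_real r * cis \<theta>)) \<le> exp (C + r ^ n * p \<theta>)) \<and>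
      (\<forall>r>0. exp (r ^ n * p \<theta>0 - C) \<le> cmod (h (of_real r * cis \<theta>0)))"
proof -
  have n0: "real n > 0" using n by simp
  define A' where "A' = A + (A + L / n)"
  define L' where "L' = L + (A * n + L)"
  obtain C where C: "\<forall>f f1 f2 :: real \<Rightarrow> real. (\<forall>x. (f has_real_derivative f1 x) (at x)) \<longrightarrow> (\<forall>x. (f1 has_real_derivative f2 x) (at x)) \<longrightarrow>
    (\<forall>x. m0 \<le> f2 x + (real n)\<^sup>2 * f x) \<longrightarrow> (\<forall>x. \<bar>f x\<bar> \<le> A') \<longrightarrow> (\<forall>x. \<bar>f1 x\<bar> \<le> L') \<longrightarrow> (\<forall>x. f (x + 2 * pi) = f x) \<longrightarrow>
    f 0 = 0 \<longrightarrow> f1 0 = 0 \<longrightarrow>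
    (\<exists>F. F holomorphic_on UNIV \<and> (\<forall>r>0. \<forall>\<theta>. cmod (F (of_real r * cis \<theta>)) \<le> exp (C + r ^ n * f \<theta>)) \<and>
      (\<forall>r>0. exp (- C) \<le> cmod (F (of_real r))))"
    by (rule touching_function[OF n m0])
  show ?thesis
  proof (rule that[of C], intro allI)
    fix \<theta>0
    define a b where "a = p \<theta>0" and "b = p1 \<theta>0 / n"
    have ab: "\<bar>a\<bar> \<le> A" "\<bar>b\<bar> \<le> L / n" using A L n0 by (auto simp: a_def b_def divide_right_mono)
    define f where "f x = p (\<theta>0 + x) - (a * cos (real n * x) + b * sin (real n * x))" for x
    define f1 where "f1 x = p1 (\<theta>0 + x) - (- a * sin (real n * x) + b * cos (real n * x)) * n" for x
    define f2 where "f2 x = p2 (\<theta>0 + x) - (- a * cos (real n * x) - b * sin (real n * x)) * n\<^sup>2" for x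
    have trig: "\<bar>u * cos x + v * sin x\<bar> \<le> \<bar>u\<bar> + \<bar>v\<bar>" for u v x :: real
    proof -
      have "\<bar>u * cos x\<bar> \<le> \<bar>u\<bar> * 1" "\<bar>v * sin x\<bar> \<le> \<bar>v\<bar> * 1" unfolding abs_mult by (intro mult_left_mono; simp)+
      then show ?thesis by linarith
    qed
    have "\<exists>F. F holomorphic_on UNIV \<and> (\<forall>r>0. \<forall>\<theta>. cmod (F (of_real r * cis \<theta>)) \<le> exp (C + r ^ n * f \<theta>)) \<and>
      (\<forall>r>0. exp (- C) \<le> cmod (F (of_real r)))"
    proof (rule C[rule_format, of f f1 f2])
      fix x
      show "(f has_real_derivative f1 x) (at x)" unfolding f_def f1_def
        by (rule derivative_eq_intros d[THEN DERIV_chain2] refl)+ (simp add: algebra_simps)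
      show "(f1 has_real_derivative f2 x) (at x)" unfolding f1_def f2_def
        by (rule derivative_eq_intros d[THEN DERIV_chain2] refl)+ (simp add: algebra_simps power2_eq_square)
      have "f2 x + (real n)\<^sup>2 * f x = p2 (\<theta>0 + x) + (real n)\<^sup>2 * p (\<theta>0 + x)" by (simp add: f_def f2_def algebra_simps)
      then show "m0 \<le> f2 x + (real n)\<^sup>2 * f x" using m by simp
      show "\<bar>f x\<bar> \<le> A'" using A[of "\<theta>0 + x"] trig[of a "n * x" b] ab unfolding f_def A'_def by linarith
      have "\<bar>(- a * sin (real n * x) + b * cos (real n * x)) * n\<bar> \<le> (\<bar>b\<bar> + \<bar>-a\<bar>) * n"
        using trig[of b "n * x" "-a"] unfolding abs_mult by (intro mult_mono) (auto simp: algebra_simps)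
      also have "\<dots> \<le> (L / n + A) * n" using ab by (intro mult_right_mono add_mono) auto
      also have "\<dots> = A * n + L" using n0 by (simp add: field_simps)
      finally show "\<bar>f1 x\<bar> \<le> L'" using L[of "\<theta>0 + x"] unfolding f1_def L'_def by linarith
      have "cos (real n * (x + 2 * pi)) = cos (real n * x)" "sin (real n * (x + 2 * pi)) = sin (real n * x)"
        using sin.plus_of_nat[of "real n * x" n] cos.plus_of_nat[of "real n * x" n] by (simp_all add: algebra_simps)
      then show "f (x + 2 * pi) = f x" using per[of "\<theta>0 + x"] by (simp add: f_def add.assoc)
    qed (use n0 in \<open>auto simp: f_def f1_def a_def b_def\<close>)
    then obtain F where F: "F holomorphic_on UNIV"
      and up: "\<And>r \<theta>. r > 0 \<Longrightarrow> cmod (F (of_real r * cis \<theta>)) \<le> exp (C + r ^ n * f \<theta>)"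
      and low: "\<And>r. r > 0 \<Longrightarrow> exp (- C) \<le> cmod (F (of_real r))" by blast
    define h where "h z = F (cis (- \<theta>0) * z) * exp (Complex a (- b) * (cis (- \<theta>0) * z) ^ n)" for z
    have hv: "cmod (h (of_real r * cis \<theta>)) = cmod (F (of_real r * cis (\<theta> - \<theta>0))) * exp (r ^ n * (a * cos (real n * (\<theta> - \<theta>0)) + b * sin (real n * (\<theta> - \<theta>0))))" for r \<theta>
    proof -
      have 1: "cis (- \<theta>0) * (of_real r * cis \<theta>) = of_real r * cis (\<theta> - \<theta>0)"
        by (simp add: mult.left_commute[of "cis (- \<theta>0)"] cis_mult)
      have 2: "Re (Complex a (- b) * (of_real r * cis (\<theta> - \<theta>0)) ^ n) = r ^ n * (a * cos (real n * (\<theta> - \<theta>0)) + b * sin (real n * (\<theta> - \<theta>0)))"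
        by (simp add: power_mult_distrib Complex.DeMoivre algebra_simps flip: of_real_power)
      show ?thesis unfolding h_def norm_mult norm_exp_eq_Re 1 2 ..
    qed
    show "\<exists>h. h holomorphic_on UNIV \<and>
      (\<forall>r>0. \<forall>\<theta>. cmod (h (of_real r * cis \<theta>)) \<le> exp (C + r ^ n * p \<theta>)) \<and>
      (\<forall>r>0. exp (r ^ n * p \<theta>0 - C) \<le> cmod (h (of_real r * cis \<theta>0)))"
    proof (intro exI[of _ h] conjI allI impI)
      have "(\<lambda>z. F (cis (- \<theta>0) * z)) holomorphic_on UNIV"
        by (rule holomorphic_on_compose_gen[OF _ F, unfolded o_def]) (auto intro!: holomorphic_intros)
      then show "h holomorphic_on UNIV" unfolding h_def by (intro holomorphic_intros)
      fix r :: real assume r: "r > 0"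
      show "cmod (h (of_real r * cis \<theta>)) \<le> exp (C + r ^ n * p \<theta>)" for \<theta>
      proof -
        have "cmod (h (of_real r * cis \<theta>)) \<le> exp (C + r ^ n * f (\<theta> - \<theta>0)) * exp (r ^ n * (a * cos (real n * (\<theta> - \<theta>0)) + b * sin (real n * (\<theta> - \<theta>0))))"
          unfolding hv using r by (intro mult_right_mono up) auto
        then show ?thesis by (simp add: f_def right_diff_distrib distrib_left flip: exp_add)
      qed
      have "exp (- C) * exp (r ^ n * a) \<le> cmod (h (of_real r * cis \<theta>0))"
        unfolding hv using low[OF r] by simp
      then show "exp (r ^ n * p \<theta>0 - C) \<le> cmod (h (of_real r * cis \<theta>0))" by (simp add: a_def flip: exp_add)
    qed
  qed
qed

section \<open>Entire functions weighted by a subharmonic homogeneous polynomial\<close>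

lemma pd_polynomial:
  fixes c :: "'i \<Rightarrow> complex"
  shows "pd (\<lambda>w. \<Sum>i\<in>I. c i * w ^ \<alpha> i * cnj w ^ \<beta> i) z e =
    (\<Sum>i\<in>I. c i * of_nat (\<alpha> i) * z ^ (\<alpha> i - 1) * cnj z ^ \<beta> i) * e +
    (\<Sum>i\<in>I. c i * of_nat (\<beta> i) * z ^ \<alpha> i * cnj z ^ (\<beta> i - 1)) * cnj e"
proof -
  have e: "((\<lambda>t. z + t *\<^sub>R e) has_vector_derivative e) (at 0)" "((\<lambda>t. cnj (z + t *\<^sub>R e)) has_vector_derivative cnj e) (at 0)"
    by (auto intro!: derivative_eq_intros simp: scaleR_conv_of_real)
  have pw: "((\<lambda>t. g t ^ m) has_vector_derivative of_nat m * g 0 ^ (m - 1) * D) (at 0)"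
    if "(g has_vector_derivative D) (at 0)" for g :: "real \<Rightarrow> complex" and D m
  proof (induction m)
    case (Suc m)
    have "((\<lambda>t. g t * g t ^ m) has_vector_derivative g 0 * (of_nat m * g 0 ^ (m - 1) * D) + D * g 0 ^ m) (at 0)"
      by (rule has_vector_derivative_mult[OF that Suc])
    then show ?case by (cases m) (simp_all add: algebra_simps)
  qed simp
  have "((\<lambda>t. \<Sum>i\<in>I. c i * (z + t *\<^sub>R e) ^ \<alpha> i * cnj (z + t *\<^sub>R e) ^ \<beta> i) has_vector_derivative
     (\<Sum>i\<in>I. c i * z ^ \<alpha> i * (of_nat (\<beta> i) * cnj z ^ (\<beta> i - 1) * cnj e) + c i * (of_nat (\<alpha> i) * z ^ (\<alpha> i - 1) * e) * cnj z ^ \<beta> i)) (at 0)"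
  proof (rule has_vector_derivative_sum)
    fix i
    have 1: "((\<lambda>t. c i * (z + t *\<^sub>R e) ^ \<alpha> i) has_vector_derivative c i * (of_nat (\<alpha> i) * z ^ (\<alpha> i - 1) * e)) (at 0)"
      using has_vector_derivative_mult_right[OF pw[OF e(1), of "\<alpha> i"]] by simp
    show "((\<lambda>t. c i * (z + t *\<^sub>R e) ^ \<alpha> i * cnj (z + t *\<^sub>R e) ^ \<beta> i) has_vector_derivative
      c i * z ^ \<alpha> i * (of_nat (\<beta> i) * cnj z ^ (\<beta> i - 1) * cnj e) + c i * (of_nat (\<alpha> i) * z ^ (\<alpha> i - 1) * e) * cnj z ^ \<beta> i) (at 0)"
      using has_vector_derivative_mult[OF 1 pw[OF e(2), of "\<beta> i"]] by simp
  qed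
  from vector_derivative_at[OF this] show ?thesis unfolding pd_def
    by (simp only:) (simp add: sum.distrib sum_distrib_left sum_distrib_right mult_ac)
qed

lemma Dz1_polynomial:
  fixes c :: "'i \<Rightarrow> complex"
  shows "Dz1 (\<lambda>w. \<Sum>i\<in>I. c i * w ^ \<alpha> i * cnj w ^ \<beta> i) = (\<lambda>z. \<Sum>i\<in>I. (c i * of_nat (\<alpha> i)) * z ^ (\<alpha> i - 1) * cnj z ^ \<beta> i)"
  by (rule ext, unfold Dz1_def pd_polynomial) (simp add: algebra_simps)

lemma Dzb1_polynomial:
  fixes c :: "'i \<Rightarrow> complex"
  shows "Dzb1 (\<lambda>w. \<Sum>i\<in>I. c i * w ^ \<alpha> i * cnj w ^ \<beta> i) = (\<lambda>z. \<Sum>i\<in>I. (c i * of_nat (\<beta> i)) * z ^ \<alpha> i * cnj z ^ (\<beta> i - 1))"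
  by (rule ext, unfold Dzb1_def pd_polynomial) (simp add: algebra_simps)

text \<open>For fixed \<open>z\<close>, homogeneity is an identity between polynomials in
  \<open>r\<close> on the real axis. It therefore holds coefficientwise, and the coefficient of
  \<open>r^n\<close> is the claim.\<close>

lemma homogeneous_part:
  fixes P :: "complex \<Rightarrow> real"
  assumes poly: "\<forall>z. complex_of_real (P z) = (\<Sum>a\<le>N. \<Sum>b\<le>N. c a b * z ^ a * cnj z ^ b)"
    and hom: "\<forall>(r::real) z. P (r *\<^sub>R z) = r ^ n * P z"
  shows "complex_of_real (P z) = (\<Sum>(a, b)\<in>{(a, b). a \<le> N \<and> b \<le> N \<and> a + b = n}. c a b * z ^ a * cnj z ^ b)"
proof -
  define I where "I = {..N} \<times> {..N}"
  have I: "finite I" by (simp add: I_def)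
  define q where "q = (\<Sum>(a, b)\<in>I. monom (c a b * z ^ a * cnj z ^ b) (a + b)) - monom (complex_of_real (P z)) n"
  have "poly q (of_real r) = 0" for r :: real
  proof -
    have "poly q (of_real r) = (\<Sum>(a, b)\<in>I. c a b * (r *\<^sub>R z) ^ a * cnj (r *\<^sub>R z) ^ b) - complex_of_real (r ^ n * P z)"
      unfolding q_def poly_diff poly_sum
      by (intro arg_cong2[where f = "(-)"] sum.cong) (auto simp: poly_monom scaleR_conv_of_real power_mult_distrib power_add)
    also have "(\<Sum>(a, b)\<in>I. c a b * (r *\<^sub>R z) ^ a * cnj (r *\<^sub>R z) ^ b) = complex_of_real (P (r *\<^sub>R z))"
      unfolding I_def poly[rule_format] by (rule sum.cartesian_product[symmetric])
    finally show ?thesis using hom by simp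
  qed
  then have "range complex_of_real \<subseteq> {x. poly q x = 0}" by auto
  moreover have "infinite (range complex_of_real)"
    by (simp add: finite_image_iff inj_of_real infinite_UNIV_char_0)
  ultimately have "q = 0" using poly_roots_finite finite_subset by blast
  then have "0 = coeff q n" by simp
  also have "\<dots> = (\<Sum>(a, b)\<in>I. if a + b = n then c a b * z ^ a * cnj z ^ b else 0) - of_real (P z)"
    unfolding q_def coeff_diff coeff_sum by (simp add: case_prod_unfold)
  also have "(\<Sum>(a, b)\<in>I. if a + b = n then c a b * z ^ a * cnj z ^ b else 0) = (\<Sum>(a, b)\<in>{x\<in>I. fst x + snd x = n}. c a b * z ^ a * cnj z ^ b)"
    using I by (simp add: sum.inter_filter case_prod_unfold)
  also have "{x\<in>I. fst x + snd x = n} = {(a, b). a \<le> N \<and> b \<le> N \<and> a + b = n}" by (auto simp: I_def)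
  finally show ?thesis by simp
qed


text \<open>Along the unit circle, the second derivative of a polynomial of degree \<open>n\<close> and its \<open>n\<^sup>2\<close>-fold multiple
  add up to four times the mixed Wirtinger derivative, because \<open>n\<^sup>2 - (a - b)\<^sup>2 = 4 a b\<close> for \<open>a + b = n\<close>.\<close>
lemma circle_restriction:
  fixes P :: "complex \<Rightarrow> real" and n :: nat
  assumes poly: "\<exists>N c. \<forall>z. complex_of_real (P z) = (\<Sum>a\<le>N. \<Sum>b\<le>N. c a b * z ^ a * cnj z ^ b)"
    and hom: "\<forall>(r::real) z. P (r *\<^sub>R z) = r ^ n * P z"
    and subh: "\<forall>z. z \<noteq> 0 \<longrightarrow> Re (Dz1 (Dzb1 (\<lambda>w. complex_of_real (P w))) z) > 0"
  obtains p1 p2 :: "real \<Rightarrow> real" and m0 A L where "m0 > 0"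
    "\<And>x. ((\<lambda>\<theta>. P (cis \<theta>)) has_real_derivative p1 x) (at x)" "\<And>x. (p1 has_real_derivative p2 x) (at x)"
    "\<And>x. m0 \<le> p2 x + (real n)\<^sup>2 * P (cis x)" "\<And>x. \<bar>P (cis x)\<bar> \<le> A" "\<And>x. \<bar>p1 x\<bar> \<le> L"
proof -
  obtain N c where c: "\<forall>z. complex_of_real (P z) = (\<Sum>a\<le>N. \<Sum>b\<le>N. c a b * z ^ a * cnj z ^ b)" using poly by blast
  define I where "I = {(a, b). a \<le> N \<and> b \<le> N \<and> a + b = n}"
  have I: "finite I" by (rule finite_subset[of _ "{..N} \<times> {..N}"]) (auto simp: I_def)
  have P: "complex_of_real (P z) = (\<Sum>i\<in>I. c (fst i) (snd i) * z ^ fst i * cnj z ^ snd i)" for z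
    using homogeneous_part[OF c hom, of z] by (simp add: I_def case_prod_unfold)
  define g where "g z = (\<Sum>i\<in>I. c (fst i) (snd i) * of_nat (snd i) * of_nat (fst i) * z ^ (fst i - 1) * cnj z ^ (snd i - 1))" for z
  have g: "Dz1 (Dzb1 (\<lambda>w. complex_of_real (P w))) z = g z" for z
    unfolding P Dzb1_polynomial Dz1_polynomial g_def ..
  have gc: "continuous_on (sphere 0 1) (\<lambda>z. Re (g z))" unfolding g_def by (intro continuous_intros)
  \<comment> \<open>Compactness of the circle turns the pointwise strict subharmonicity into the
    uniform margin \<open>m0 = 4 * Re (g z0)\<close>.\<close>
  obtain z0 where z0: "z0 \<in> sphere 0 1" "\<And>z. z \<in> sphere 0 1 \<Longrightarrow> Re (g z0) \<le> Re (g z)"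
    using continuous_attains_inf[OF _ _ gc] by (metis compact_sphere sphere_eq_empty zero_less_one not_less_iff_gr_or_eq)
  define D where "D i = real (fst i) - real (snd i)" for i :: "nat \<times> nat"
  define p1 where "p1 x = Re (\<Sum>i\<in>I. c (fst i) (snd i) * (\<i> * of_real (D i)) * cis (D i * x))" for x
  define p2 where "p2 x = Re (\<Sum>i\<in>I. c (fst i) (snd i) * (\<i> * of_real (D i)) * (\<i> * of_real (D i)) * cis (D i * x))" for x
  have cisp: "cis x ^ a * cnj (cis x) ^ b = cis ((real a - real b) * x)" for x a b
    by (simp add: cis_cnj Complex.DeMoivre cis_mult algebra_simps)
  have p: "P (cis x) = Re (\<Sum>i\<in>I. c (fst i) (snd i) * cis (D i * x))" for x
  proof -
    have "P (cis x) = Re (complex_of_real (P (cis x)))" by simp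
    also have "\<dots> = Re (\<Sum>i\<in>I. c (fst i) (snd i) * cis (D i * x))" unfolding P mult.assoc cisp D_def ..
    finally show ?thesis .
  qed
  have cd: "((\<lambda>x. cis (d * x)) has_vector_derivative \<i> * of_real d * cis (d * x)) (at x)" for d x
  proof -
    have "((\<lambda>z. exp (\<i> * of_real d * z)) has_field_derivative \<i> * of_real d * exp (\<i> * of_real d * of_real x)) (at (of_real x))"
      by (auto intro!: derivative_eq_intros)
    from has_vector_derivative_real_field[OF this] show ?thesis by (simp add: cis_conv_exp mult.assoc)
  qed
  have dd: "((\<lambda>x. Re (\<Sum>i\<in>I. e i * cis (D i * x))) has_real_derivative Re (\<Sum>i\<in>I. e i * (\<i> * of_real (D i)) * cis (D i * x))) (at x)" for e x
  proof (rule has_field_derivative_Re, rule has_vector_derivative_sum)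
    fix i
    show "((\<lambda>x. e i * cis (D i * x)) has_vector_derivative e i * (\<i> * of_real (D i)) * cis (D i * x)) (at x)"
      using has_vector_derivative_mult_right[OF cd, of "e i" "D i" x] by (simp add: mult_ac)
  qed
  have bd: "\<bar>Re (\<Sum>i\<in>I. e i * cis (D i * x))\<bar> \<le> (\<Sum>i\<in>I. cmod (e i))" for e x
  proof -
    have "\<bar>Re (\<Sum>i\<in>I. e i * cis (D i * x))\<bar> \<le> cmod (\<Sum>i\<in>I. e i * cis (D i * x))" by (rule abs_Re_le_cmod)
    also have "\<dots> \<le> (\<Sum>i\<in>I. cmod (e i * cis (D i * x)))" by (rule norm_sum)
    finally show ?thesis by (simp add: norm_mult)
  qed
  show ?thesis
  proof (rule that[of "4 * Re (g z0)" p1 p2])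
    have "z0 \<noteq> 0" using z0 by auto
    then show "0 < 4 * Re (g z0)" using subh g by simp
    show "((\<lambda>\<theta>. P (cis \<theta>)) has_real_derivative p1 x) (at x)" for x unfolding p p1_def by (rule dd)
    show "(p1 has_real_derivative p2 x) (at x)" for x unfolding p1_def p2_def by (rule dd)
    show "\<bar>P (cis x)\<bar> \<le> (\<Sum>i\<in>I. cmod (c (fst i) (snd i)))" for x unfolding p by (rule bd)
    show "\<bar>p1 x\<bar> \<le> (\<Sum>i\<in>I. cmod (c (fst i) (snd i) * (\<i> * of_real (D i))))" for x unfolding p1_def by (rule bd)
    show "4 * Re (g z0) \<le> p2 x + (real n)\<^sup>2 * P (cis x)" for x
    proof -
      have "p2 x + (real n)\<^sup>2 * P (cis x) = Re (\<Sum>i\<in>I. c (fst i) (snd i) * (\<i> * of_real (D i)) * (\<i> * of_real (D i)) * cis (D i * x))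
          + Re (of_real ((real n)\<^sup>2) * (\<Sum>i\<in>I. c (fst i) (snd i) * cis (D i * x)))"
        unfolding p2_def p by (simp del: of_real_power)
      also have "\<dots> = Re (\<Sum>i\<in>I. c (fst i) (snd i) * of_real ((real n)\<^sup>2 - (D i)\<^sup>2) * cis (D i * x))"
        by (simp only: plus_complex.sel(1)[symmetric] sum_distrib_left sum.distrib[symmetric])
          (intro arg_cong[where f = Re] sum.cong refl, simp add: algebra_simps power2_eq_square)
      also have "\<dots> = Re (\<Sum>i\<in>I. 4 * (c (fst i) (snd i) * of_nat (snd i) * of_nat (fst i) * cis x ^ (fst i - 1) * cnj (cis x) ^ (snd i - 1)))"
      proof (intro arg_cong[where f = Re] sum.cong refl)
        fix i assume "i \<in> I"
        then have n: "real n = real (fst i) + real (snd i)" by (auto simp: I_def)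
        have *: "(real n)\<^sup>2 - (D i)\<^sup>2 = 4 * (real (snd i) * real (fst i))" by (simp add: n D_def power2_eq_square algebra_simps)
        have "real (fst i - 1) - real (snd i - 1) = D i" if "fst i \<noteq> 0" "snd i \<noteq> 0" using that by (simp add: D_def of_nat_diff)
        then show "c (fst i) (snd i) * of_real ((real n)\<^sup>2 - (D i)\<^sup>2) * cis (D i * x)
          = 4 * (c (fst i) (snd i) * of_nat (snd i) * of_nat (fst i) * cis x ^ (fst i - 1) * cnj (cis x) ^ (snd i - 1))"
          unfolding * mult.assoc cisp by (cases "fst i = 0 \<or> snd i = 0") auto
      qed
      also have "\<dots> = 4 * Re (g (cis x))" by (simp add: g_def sum_distrib_left[symmetric])
      finally show ?thesis using z0(2)[of "cis x"] by simp
    qed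
  qed
qed

text \<open>The construction is applied to \<open>P - \<epsilon> |w|^n\<close>, which keeps half of
  the margin. Since \<open>2 Re (w^k cnj a^k) = |w|^n + |a|^n - |w^k - a^k|^2\<close>, multiplying
  by \<open>exp (2 \<epsilon> w^k cnj a^k)\<close> returns the weight that was given up except for
  the square, which is the \<epsilon>-term of the statement. Dilating by \<open>t^(1/n)\<close>
  passes from 1 to any \<open>t\<close> with the same constant.\<close>

lemma weighted_entire_functions:
  fixes P :: "complex \<Rightarrow> real" and k :: nat
  assumes poly: "\<exists>N c. \<forall>z. complex_of_real (P z) = (\<Sum>a\<le>N. \<Sum>b\<le>N. c a b * z ^ a * cnj z ^ b)"
    and k: "k > 1"
    and hom: "\<forall>(r::real) z. P (r *\<^sub>R z) = r ^ (2 * k) * P z"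
    and subh: "\<forall>z. z \<noteq> 0 \<longrightarrow> Re (Dz1 (Dzb1 (\<lambda>w. complex_of_real (P w))) z) > 0"
  obtains C \<epsilon> where "\<epsilon> > 0" "C > 0"
    "\<forall>t>0. \<forall>a. \<exists>h. h holomorphic_on UNIV \<and> h a = 1 \<and>
      (\<forall>w. cmod (h w) \<le> C * exp (t * (P w - P a) - t * \<epsilon> * (cmod (w ^ k - a ^ k))\<^sup>2))"
proof -
  define n where "n = 2 * k"
  have n: "n \<ge> 2" "real n > 0" using k by (auto simp: n_def)
  obtain p1 p2 m0 A L where m0: "m0 > 0" and d: "\<And>x. ((\<lambda>\<theta>. P (cis \<theta>)) has_real_derivative p1 x) (at x)" "\<And>x. (p1 has_real_derivative p2 x) (at x)"
    and m: "\<And>x. m0 \<le> p2 x + (real n)\<^sup>2 * P (cis x)" and A: "\<And>x. \<bar>P (cis x)\<bar> \<le> A" and L: "\<And>x. \<bar>p1 x\<bar> \<le> L"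
    using circle_restriction[OF poly hom subh] unfolding n_def by metis
  define \<epsilon> where "\<epsilon> = m0 / (2 * (real n)\<^sup>2)"
  have \<epsilon>: "\<epsilon> > 0" using m0 n by (simp add: \<epsilon>_def)
  have Pr: "P (of_real r * cis \<theta>) = r ^ n * P (cis \<theta>)" for r \<theta>
    using hom[rule_format, of r "cis \<theta>"] by (simp add: scaleR_conv_of_real n_def)
  have P0: "P 0 = 0" using hom[rule_format, of 0 0] k by (simp add: power_0_left)
  obtain C where C: "\<forall>\<theta>0. \<exists>h. h holomorphic_on UNIV \<and>
      (\<forall>r>0. \<forall>\<theta>. cmod (h (of_real r * cis \<theta>)) \<le> exp (C + r ^ n * (P (cis \<theta>) - \<epsilon>))) \<and>
      (\<forall>r>0. exp (r ^ n * (P (cis \<theta>0) - \<epsilon>) - C) \<le> cmod (h (of_real r * cis \<theta>0)))"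
  proof (rule entire_with_homogeneous_weight[OF n(1), of "m0 / 2" "\<lambda>x. P (cis x) - \<epsilon>" p1 p2 "A + \<epsilon>" L])
    fix x
    show "((\<lambda>\<theta>. P (cis \<theta>) - \<epsilon>) has_real_derivative p1 x) (at x)" using d(1) by (auto intro!: derivative_eq_intros)
    have "(real n)\<^sup>2 * \<epsilon> = m0 / 2" using n by (simp add: \<epsilon>_def)
    then show "m0 / 2 \<le> p2 x + (real n)\<^sup>2 * (P (cis x) - \<epsilon>)" using m[of x] by (simp add: right_diff_distrib)
    show "\<bar>P (cis x) - \<epsilon>\<bar> \<le> A + \<epsilon>" using A[of x] \<epsilon> by linarith
    show "P (cis (x + 2 * pi)) - \<epsilon> = P (cis x) - \<epsilon>" by (simp flip: cis_mult)
  qed (use m0 d L in auto)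
  have base: "\<exists>h. h holomorphic_on UNIV \<and> h a = 1 \<and>
      (\<forall>w. cmod (h w) \<le> exp (2 * C) * exp ((P w - P a) - \<epsilon> * (cmod (w ^ k - a ^ k))\<^sup>2))" for a
  proof -
    define \<theta>0 where "\<theta>0 = Arg a"
    obtain h where h: "h holomorphic_on UNIV"
      and up: "\<And>r \<theta>. r > 0 \<Longrightarrow> cmod (h (of_real r * cis \<theta>)) \<le> exp (C + r ^ n * (P (cis \<theta>) - \<epsilon>))"
      and low: "\<And>r. r > 0 \<Longrightarrow> exp (r ^ n * (P (cis \<theta>0) - \<epsilon>) - C) \<le> cmod (h (of_real r * cis \<theta>0))"
      using C by blast
    have hc: "isCont h z" for z
      using holomorphic_on_imp_continuous_on[OF h] by (simp add: continuous_on_eq_continuous_at)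
    have r0: "(\<lambda>i. 1 / real (Suc i)) \<longlonglongrightarrow> 0" by (rule LIMSEQ_Suc, rule lim_1_over_n)
    have h0: "(\<lambda>i. cmod (h (of_real (1 / real (Suc i)) * cis \<theta>))) \<longlonglongrightarrow> cmod (h (of_real 0 * cis \<theta>))" for \<theta>
      by (intro tendsto_norm isCont_tendsto_compose[OF hc] tendsto_mult tendsto_of_real r0 tendsto_const)
    have e0: "(\<lambda>i. exp ((1 / real (Suc i)) ^ n * x + y)) \<longlonglongrightarrow> exp (0 ^ n * x + y)" for x y
      by (intro tendsto_exp tendsto_add tendsto_mult tendsto_power r0 tendsto_const)
    have up': "cmod (h w) \<le> exp (C + P w - \<epsilon> * cmod w ^ n)" for w
    proof (cases "w = 0")
      case True
      have "cmod (h (of_real 0 * cis 0)) \<le> exp (0 ^ n * (P (cis 0) - \<epsilon>) + C)"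
      proof (rule LIMSEQ_le[OF h0 e0], intro exI[of _ 0] allI impI)
        fix i
        show "cmod (h (of_real (1 / real (Suc i)) * cis 0)) \<le> exp ((1 / real (Suc i)) ^ n * (P (cis 0) - \<epsilon>) + C)"
          using up[of "1 / real (Suc i)" 0] by (simp only: add.commute) simp
      qed
      then show ?thesis using True n P0 by (simp add: power_0_left)
    next
      case False
      then have "w = of_real (cmod w) * cis (Arg w)" by (simp add: rcis_cmod_Arg flip: rcis_def)
      then show ?thesis using up[of "cmod w" "Arg w"] Pr[of "cmod w" "Arg w"] False by (simp add: algebra_simps)
    qed
    have low': "exp (P a - \<epsilon> * cmod a ^ n - C) \<le> cmod (h a)"
    proof (cases "a = 0")
      case True
      have "exp (0 ^ n * (P (cis \<theta>0) - \<epsilon>) + - C) \<le> cmod (h (of_real 0 * cis \<theta>0))"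
      proof (rule LIMSEQ_le[OF e0 h0], intro exI[of _ 0] allI impI)
        fix i
        show "exp ((1 / real (Suc i)) ^ n * (P (cis \<theta>0) - \<epsilon>) + - C) \<le> cmod (h (of_real (1 / real (Suc i)) * cis \<theta>0))"
          using low[of "1 / real (Suc i)"] by (simp only: diff_conv_add_uminus) simp
      qed
      then show ?thesis using True n P0 by (simp add: power_0_left)
    next
      case False
      then have "a = of_real (cmod a) * cis \<theta>0" by (simp add: \<theta>0_def rcis_cmod_Arg flip: rcis_def)
      then show ?thesis using low[of "cmod a"] Pr[of "cmod a" "\<theta>0"] False by (simp add: algebra_simps)
    qed
    define H where "H w = h w * exp (of_real (2 * \<epsilon>) * (w ^ k * cnj a ^ k))" for w
    have sq: "(cmod (w ^ k - a ^ k))\<^sup>2 = cmod w ^ n + cmod a ^ n - 2 * Re (w ^ k * cnj a ^ k)" for w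
    proof -
      have "(cmod (w ^ k - a ^ k))\<^sup>2 = (cmod (w ^ k))\<^sup>2 + (cmod (a ^ k))\<^sup>2 - 2 * Re (w ^ k * cnj (a ^ k))"
        by (simp add: cmod_power2 power2_diff algebra_simps del: complex_cnj_power)
      then show ?thesis by (simp add: n_def norm_power power_mult mult.commute)
    qed
    have Hn: "cmod (H w) = cmod (h w) * exp (\<epsilon> * (cmod w ^ n + cmod a ^ n) - \<epsilon> * (cmod (w ^ k - a ^ k))\<^sup>2)" for w
      unfolding H_def norm_mult norm_exp_eq_Re sq by (simp add: algebra_simps)
    have Hup: "cmod (H w) \<le> exp (C + P w + \<epsilon> * cmod a ^ n - \<epsilon> * (cmod (w ^ k - a ^ k))\<^sup>2)" for w
    proof -
      have "cmod (H w) \<le> exp (C + P w - \<epsilon> * cmod w ^ n) * exp (\<epsilon> * (cmod w ^ n + cmod a ^ n) - \<epsilon> * (cmod (w ^ k - a ^ k))\<^sup>2)"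
        unfolding Hn by (intro mult_right_mono up') auto
      then show ?thesis by (simp add: algebra_simps flip: exp_add)
    qed
    have Hlow: "exp (P a + \<epsilon> * cmod a ^ n - C) \<le> cmod (H a)"
    proof -
      have "exp (P a - \<epsilon> * cmod a ^ n - C) * exp (\<epsilon> * (cmod a ^ n + cmod a ^ n)) \<le> cmod (H a)"
        unfolding Hn using low' by simp
      then show ?thesis by (simp add: algebra_simps flip: exp_add)
    qed
    have Ha: "cmod (H a) > 0" using Hlow by (rule less_le_trans[OF exp_gt_zero])
    show ?thesis
    proof (intro exI[of _ "\<lambda>w. H w / H a"] conjI allI)
      show "(\<lambda>w. H w / H a) holomorphic_on UNIV" unfolding H_def using h Ha
        by (intro holomorphic_intros) (auto simp: H_def)
      fix w
      have "cmod (H w / H a) \<le> exp (C + P w + \<epsilon> * cmod a ^ n - \<epsilon> * (cmod (w ^ k - a ^ k))\<^sup>2) / exp (P a + \<epsilon> * cmod a ^ n - C)"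
        unfolding norm_divide by (intro frac_le Hup Hlow) auto
      then show "cmod (H w / H a) \<le> exp (2 * C) * exp ((P w - P a) - \<epsilon> * (cmod (w ^ k - a ^ k))\<^sup>2)"
        by (simp add: algebra_simps flip: exp_add exp_diff)
    qed (use Ha in auto)
  qed
  show ?thesis
  proof (rule that[OF \<epsilon>, of "exp (2 * C)"], goal_cases)
    case 2
    show ?case
    proof (intro allI impI)
    fix t :: real and a assume t: "t > 0"
    define s where "s = t powr (1 / n)"
    have s: "s > 0" "s ^ n = t" using t n by (auto simp: s_def powr_power)
    define \<sigma> where "\<sigma> = complex_of_real s"
    have Ps: "P (\<sigma> * w) = t * P w" for w using hom[rule_format, of s w] s by (simp add: \<sigma>_def scaleR_conv_of_real n_def)
    have sk: "(cmod ((\<sigma> * w) ^ k - (\<sigma> * a) ^ k))\<^sup>2 = t * (cmod (w ^ k - a ^ k))\<^sup>2" for w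
    proof -
      have "(\<sigma> * w) ^ k - (\<sigma> * a) ^ k = of_real (s ^ k) * (w ^ k - a ^ k)" by (simp add: \<sigma>_def power_mult_distrib right_diff_distrib)
      then have "(cmod ((\<sigma> * w) ^ k - (\<sigma> * a) ^ k))\<^sup>2 = (s ^ k)\<^sup>2 * (cmod (w ^ k - a ^ k))\<^sup>2" using s(1) by (simp only: norm_mult power_mult_distrib norm_of_real) simp
      also have "(s ^ k)\<^sup>2 = t" using s by (simp add: n_def power_mult mult.commute flip: power_mult)
      finally show ?thesis .
    qed
    obtain h where h: "h holomorphic_on UNIV" "h (\<sigma> * a) = 1"
      "\<And>w. cmod (h w) \<le> exp (2 * C) * exp ((P w - P (\<sigma> * a)) - \<epsilon> * (cmod (w ^ k - (\<sigma> * a) ^ k))\<^sup>2)"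
      using base by blast
    show "\<exists>h. h holomorphic_on UNIV \<and> h a = 1 \<and>
      (\<forall>w. cmod (h w) \<le> exp (2 * C) * exp (t * (P w - P a) - t * \<epsilon> * (cmod (w ^ k - a ^ k))\<^sup>2))"
    proof (intro exI[of _ "\<lambda>w. h (\<sigma> * w)"] conjI allI)
      show "(\<lambda>w. h (\<sigma> * w)) holomorphic_on UNIV"
        by (rule holomorphic_on_compose_gen[OF _ h(1), unfolded o_def]) (auto intro!: holomorphic_intros)
      fix w show "cmod (h (\<sigma> * w)) \<le> exp (2 * C) * exp (t * (P w - P a) - t * \<epsilon> * (cmod (w ^ k - a ^ k))\<^sup>2)"
        using h(3)[of "\<sigma> * w"] unfolding sk Ps by (simp add: algebra_simps)
    qed (use h in auto)
    qed
  qed auto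
qed

section \<open>Holomorphic functions and integrated metrics on domains in two variables\<close>

lemma cscale_simps [simp]: "fst (cscale c v) = c * fst v" "snd (cscale c v) = c * snd v"
  by (auto simp: cscale_def)

lemma cscale_0 [simp]: "cscale 0 v = 0"
  by (simp add: cscale_def zero_prod_def)

lemma norm_cscale: "norm (cscale c v) = cmod c * norm v"
  by (simp add: norm_prod_def norm_mult power_mult_distrib flip: distrib_left)
    (simp add: real_sqrt_mult)

lemma bounded_linear_cscale: "bounded_linear (\<lambda>c. cscale c v)"
proof (rule bounded_linear_intro[where K = "norm v"])
  show "norm (cscale c v) \<le> norm c * norm v" for c by (simp add: norm_cscale)
qed (auto simp: cscale_def algebra_simps)

lemma cscale_mult: "cscale (a * b) v = cscale a (cscale b v)"
  by (simp add: cscale_def mult.assoc)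

lemma cscale_of_real: "cscale (of_real t) v = t *\<^sub>R v"
  by (simp add: cscale_def prod_eq_iff scaleR_conv_of_real)

lemma holo_onD:
  assumes "holo_on W f" "z \<in> W"
  shows "(f has_derivative frechet_derivative f (at z)) (at z)"
    and "frechet_derivative f (at z) (cscale c v) = c * frechet_derivative f (at z) v"
proof -
  obtain L where L: "(f has_derivative L) (at z)" "\<forall>c v. L (cscale c v) = c * L v"
    using assms by (auto simp: holo_on_def)
  then have "frechet_derivative f (at z) = L" by (metis frechet_derivative_at)
  then show "(f has_derivative frechet_derivative f (at z)) (at z)"
    "frechet_derivative f (at z) (cscale c v) = c * frechet_derivative f (at z) v" using L by blast+
qed

lemma holo_on_continuous: "holo_on W f \<Longrightarrow> continuous_on W f"
  by (meson continuous_at_imp_continuous_on has_derivative_continuous holo_onD(1))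

lemma holo_on_subset: "holo_on W f \<Longrightarrow> V \<subseteq> W \<Longrightarrow> holo_on V f"
  by (auto simp: holo_on_def)

lemma holo_on_transform:
  assumes "holo_on W f" "open W" "\<And>z. z \<in> W \<Longrightarrow> g z = f z"
  shows "holo_on W g"
  unfolding holo_on_def
proof
  fix z assume z: "z \<in> W"
  then obtain L where L: "(f has_derivative L) (at z)" "\<forall>c v. L (cscale c v) = c * L v"
    using assms by (auto simp: holo_on_def)
  have "(g has_derivative L) (at z)"
    by (rule has_derivative_transform_within_open[OF L(1) assms(2) z]) (use assms in auto)
  then show "\<exists>L. (g has_derivative L) (at z) \<and> (\<forall>c v. L (cscale c v) = c * L v)" using L by blast
qed

lemma holo_on_const [intro]: "holo_on W (\<lambda>z. c)"
  by (auto simp: holo_on_def intro!: exI[of _ "\<lambda>_. 0"])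

lemma holo_on_add:
  assumes "holo_on W f" "holo_on W g"
  shows "holo_on W (\<lambda>z. f z + g z)"
  unfolding holo_on_def
proof
  fix z assume z: "z \<in> W"
  show "\<exists>L. ((\<lambda>z. f z + g z) has_derivative L) (at z) \<and> (\<forall>c v. L (cscale c v) = c * L v)"
    by (rule exI, rule conjI, rule has_derivative_add[OF holo_onD(1)[OF assms(1) z] holo_onD(1)[OF assms(2) z]])
      (simp add: holo_onD(2)[OF assms(1) z] holo_onD(2)[OF assms(2) z] algebra_simps)
qed

lemma holo_on_mult:
  assumes "holo_on W f" "holo_on W g"
  shows "holo_on W (\<lambda>z. f z * g z)"
  unfolding holo_on_def
proof
  fix z assume z: "z \<in> W"
  show "\<exists>L. ((\<lambda>z. f z * g z) has_derivative L) (at z) \<and> (\<forall>c v. L (cscale c v) = c * L v)"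
    by (rule exI, rule conjI, rule has_derivative_mult[OF holo_onD(1)[OF assms(1) z] holo_onD(1)[OF assms(2) z]])
      (simp add: holo_onD(2)[OF assms(1) z] holo_onD(2)[OF assms(2) z] algebra_simps)
qed

lemma holo_on_fst:
  assumes "h holomorphic_on UNIV"
  shows "holo_on W (\<lambda>z. h (fst z))"
  unfolding holo_on_def
proof
  fix z :: c2
  have "(h has_derivative (*) (deriv h (fst z))) (at (fst z))"
    using assms by (simp add: holomorphic_derivI flip: has_field_derivative_def)
  from has_derivative_compose[OF has_derivative_fst[OF has_derivative_ident] this]
  have "((\<lambda>z. h (fst z)) has_derivative (\<lambda>v. deriv h (fst z) * fst v)) (at z)" .
  then show "\<exists>L. ((\<lambda>z. h (fst z)) has_derivative L) (at z) \<and> (\<forall>c v. L (cscale c v) = c * L v)"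
    by (intro exI conjI) auto
qed

lemma holo_on_snd:
  assumes "h holomorphic_on UNIV"
  shows "holo_on W (\<lambda>z. h (snd z))"
  unfolding holo_on_def
proof
  fix z :: c2
  have "(h has_derivative (*) (deriv h (snd z))) (at (snd z))"
    using assms by (simp add: holomorphic_derivI flip: has_field_derivative_def)
  from has_derivative_compose[OF has_derivative_snd[OF has_derivative_ident] this]
  have "((\<lambda>z. h (snd z)) has_derivative (\<lambda>v. deriv h (snd z) * snd v)) (at z)" .
  then show "\<exists>L. ((\<lambda>z. h (snd z)) has_derivative L) (at z) \<and> (\<forall>c v. L (cscale c v) = c * L v)"
    by (intro exI conjI) auto
qed

lemma holo_on_line:
  assumes f: "holo_on W f" and w: "z + cscale \<zeta> v \<in> W"
  shows "((\<lambda>\<zeta>. f (z + cscale \<zeta> v)) has_field_derivative frechet_derivative f (at (z + cscale \<zeta> v)) v) (at \<zeta>)"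
proof -
  have "((\<lambda>\<zeta>. z + cscale \<zeta> v) has_derivative (\<lambda>h. cscale h v)) (at \<zeta>)"
    using has_derivative_add[OF has_derivative_const bounded_linear.has_derivative[OF bounded_linear_cscale has_derivative_ident]] by simp
  from has_derivative_compose[OF this holo_onD(1)[OF f w]]
  have "((\<lambda>\<zeta>. f (z + cscale \<zeta> v)) has_derivative (\<lambda>h. h * frechet_derivative f (at (z + cscale \<zeta> v)) v)) (at \<zeta>)"
    by (simp add: holo_onD(2)[OF f w])
  then show ?thesis unfolding has_field_derivative_def by (simp add: mult.commute[of _ "frechet_derivative f _ v"])
qed

text \<open>Cauchy's inequality on the disc of radius \<open>r / (2 |v|)\<close> in the complex line
  through \<open>z\<close> with direction \<open>v\<close>; the factor 2 keeps the closed disc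
  inside the open ball.\<close>

lemma holo_on_derivative_bound:
  assumes f: "holo_on W f" and B: "ball z r \<subseteq> W" "\<And>w. w \<in> ball z r \<Longrightarrow> cmod (f w) \<le> M" and r: "r > 0"
  shows "cmod (frechet_derivative f (at z) v) \<le> 2 * M * norm v / r"
proof (cases "v = 0")
  case True
  have "frechet_derivative f (at z) (cscale 0 v) = 0"
    using holo_onD(2)[OF f, of z 0 v] B(1) r by (metis centre_in_ball mult_zero_left subsetD)
  moreover have "M \<ge> 0" using B(2)[of z] r norm_ge_zero[of "f z"] by (simp del: norm_ge_zero)
  ultimately show ?thesis using True by simp
next
  case False
  define \<rho> where "\<rho> = r / (2 * norm v)"
  have \<rho>: "\<rho> > 0" using r False by (simp add: \<rho>_def)
  have in_ball: "z + cscale \<zeta> v \<in> ball z r" if "cmod \<zeta> \<le> \<rho>" for \<zeta>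
  proof -
    have "cmod \<zeta> * norm v \<le> \<rho> * norm v" using that by (intro mult_right_mono) auto
    also have "\<dots> < r" using False r by (simp add: \<rho>_def)
    finally show ?thesis by (simp add: dist_norm norm_cscale)
  qed
  define g where "g \<zeta> = f (z + cscale \<zeta> v)" for \<zeta>
  have gd: "(g has_field_derivative frechet_derivative f (at (z + cscale \<zeta> v)) v) (at \<zeta>)" if "cmod \<zeta> \<le> \<rho>" for \<zeta>
    unfolding g_def using in_ball[OF that] B by (intro holo_on_line[OF f]) auto
  then have hol: "g holomorphic_on cball 0 \<rho>"
    unfolding holomorphic_on_def field_differentiable_def using has_field_derivative_at_within by fastforce
  have "cmod ((deriv ^^ 1) g 0) \<le> fact 1 * M / \<rho> ^ 1"
  proof (rule Cauchy_inequality)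
    show "g holomorphic_on ball 0 \<rho>" using hol by (rule holomorphic_on_subset) auto
    show "continuous_on (cball 0 \<rho>) g" using hol by (rule holomorphic_on_imp_continuous_on)
    show "cmod (g \<zeta>) \<le> M" if "cmod (0 - \<zeta>) = \<rho>" for \<zeta>
      unfolding g_def using that in_ball[of \<zeta>] by (intro B(2)) auto
  qed (use \<rho> in auto)
  moreover have "deriv g 0 = frechet_derivative f (at z) v"
    using DERIV_imp_deriv[OF gd[of 0]] \<rho> by simp
  ultimately show ?thesis using r False by (simp add: \<rho>_def field_simps)
qed

section \<open>The Caratheodory metric and integrated distances\<close>

text \<open>The recentred function \<open>(f - f p) / 2\<close> stays in the disc and vanishes at
  \<open>p\<close>. It does the work of a Moebius map at the price of a factor 1/2, which is
  harmless for completeness.\<close>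

lemma carath_lower:
  assumes f: "holo_on W f" "f ` W \<subseteq> ball 0 1" and W: "open W" "p \<in> W"
  shows "ennreal (cmod (frechet_derivative f (at p) v) / 2) \<le> carath W p v"
proof -
  define g where "g z = (f z + - f p) * (1/2)" for z
  have g: "holo_on W g" unfolding g_def by (intro holo_on_mult holo_on_add holo_on_const f)
  have "cmod (g z) < 1" if "z \<in> W" for z
  proof -
    have "cmod (f z) < 1" "cmod (f p) < 1" using f that W by (auto simp: image_subset_iff)
    then have "cmod (f z - f p) < 2" using norm_triangle_ineq4[of "f z" "f p"] by linarith
    then show ?thesis by (simp add: g_def norm_mult)
  qed
  then have "ennreal (cmod (frechet_derivative g (at p) v)) \<le> carath W p v"
    unfolding carath_def using g by (intro SUP_upper) (auto simp: g_def[of p])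
  moreover have "(g has_derivative (\<lambda>v. frechet_derivative f (at p) v * (1/2))) (at p)"
    unfolding g_def by (rule derivative_eq_intros holo_onD(1)[OF f(1) W(2)] refl)+ simp
  then have "frechet_derivative g (at p) = (\<lambda>v. frechet_derivative f (at p) v * (1/2))"
    by (metis frechet_derivative_at)
  ultimately show ?thesis by (simp add: norm_mult)
qed

lemma carath_upper:
  assumes "ball p r \<subseteq> W" and r: "r > 0"
  shows "carath W p v \<le> ennreal (2 / r * norm v)"
  unfolding carath_def
proof (rule SUP_least)
  fix f assume "f \<in> {f. holo_on W f \<and> f ` W \<subseteq> ball 0 1 \<and> f p = 0}"
  then have f: "holo_on W f" "f ` W \<subseteq> ball 0 1" by auto
  have "cmod (frechet_derivative f (at p) v) \<le> 2 * 1 * norm v / r"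
    by (rule holo_on_derivative_bound[OF f(1) assms(1) _ r]) (use f(2) assms in \<open>force simp: image_subset_iff\<close>)
  then show "ennreal (cmod (frechet_derivative f (at p) v)) \<le> ennreal (2 / r * norm v)"
    by (intro ennreal_leI) simp
qed


text \<open>On the set where it is a derivative, \<open>\<phi>\<close> is a limit of difference
  quotients and so becomes measurable. If its norm has infinite integral the claim is trivial;
  otherwise the Lebesgue integral agrees with the gauge integral, for which the fundamental theorem
  holds despite the exceptional points.\<close>

lemma nn_integral_derivative_lower:
  fixes F \<phi> :: "real \<Rightarrow> complex"
  assumes F: "continuous_on {0..1} F" and S: "finite S"
    and d: "\<And>t. t \<in> {0<..<1} - S \<Longrightarrow> (F has_vector_derivative \<phi> t) (at t)"
  shows "ennreal (cmod (F 1 - F 0)) \<le> (\<integral>\<^sup>+ t. indicator {0..1} t * ennreal (cmod (\<phi> t)) \<partial>lborel)"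
proof -
  define T where "T = {0<..<1} - S"
  have T: "open T" unfolding T_def using S by (intro open_Diff finite_imp_closed) auto
  define \<psi> where "\<psi> t = (if t \<in> T then \<phi> t else 0)" for t
  \<comment> \<open>Clamping the argument extends \<open>F\<close> continuously to the whole line,
    so the difference quotients are Borel functions.\<close>
  define F' where "F' t = F (max 0 (min 1 t))" for t :: real
  have F': "continuous_on UNIV F'" unfolding F'_def
    by (intro continuous_on_compose2[OF F] continuous_intros) auto
  define g where "g n t = (if t \<in> T then (F' (t + 1 / real (Suc n)) - F' t) /\<^sub>R (1 / real (Suc n)) else 0)" for n t
  have gm: "g n \<in> borel_measurable borel" for n
  proof -
    have "continuous_on UNIV (\<lambda>t. (F' (t + 1 / real (Suc n)) - F' t) /\<^sub>R (1 / real (Suc n)))"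
      by (intro continuous_intros continuous_on_compose2[OF F']) auto
    then have "(\<lambda>t. (F' (t + 1 / real (Suc n)) - F' t) /\<^sub>R (1 / real (Suc n))) \<in> borel_measurable borel"
      by (rule borel_measurable_continuous_onI)
    moreover have "T \<in> sets borel" using T by simp
    ultimately show ?thesis unfolding g_def by (intro measurable_If_set) auto
  qed
  have glim: "(\<lambda>n. g n t) \<longlonglongrightarrow> \<psi> t" for t
  proof (cases "t \<in> T")
    case True
    then have t: "t \<in> {0<..<1}" by (simp add: T_def)
    have "(F' has_vector_derivative \<phi> t) (at t)"
      by (rule has_vector_derivative_transform_within_open[OF d[OF True[unfolded T_def]] _ t]) (auto simp: F'_def)
    then have "((\<lambda>h. (F' (t + h) - F' t) /\<^sub>R h) \<longlongrightarrow> \<phi> t) (at 0)"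
    proof -
      assume "(F' has_vector_derivative \<phi> t) (at t)"
      then have "((\<lambda>h. norm (F' (t + h) - F' t - h *\<^sub>R \<phi> t) / norm h) \<longlongrightarrow> 0) (at 0)"
        by (simp add: has_vector_derivative_def has_derivative_at)
      then have "((\<lambda>h. norm ((F' (t + h) - F' t) /\<^sub>R h - \<phi> t)) \<longlongrightarrow> 0) (at 0)"
      proof (rule Lim_transform_eventually)
        have "\<forall>\<^sub>F h in at (0::real). h \<noteq> 0" by (simp add: eventually_at_filter)
        then show "\<forall>\<^sub>F h in at 0. norm (F' (t + h) - F' t - h *\<^sub>R \<phi> t) / norm h = norm ((F' (t + h) - F' t) /\<^sub>R h - \<phi> t)"
        proof eventually_elim
          case (elim h)
          then have "(F' (t + h) - F' t) /\<^sub>R h - \<phi> t = (F' (t + h) - F' t - h *\<^sub>R \<phi> t) /\<^sub>R h"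
            by (simp add: scaleR_diff_right)
          then show ?case by (simp add: divide_inverse mult.commute)
        qed
      qed
      then show ?thesis by (simp add: tendsto_norm_zero_iff Lim_null[of _ "\<phi> t"])
    qed
    moreover have "filterlim (\<lambda>n. 1 / real (Suc n)) (at 0) sequentially"
      unfolding filterlim_at by (intro conjI LIMSEQ_Suc lim_1_over_n) (auto intro!: always_eventually)
    ultimately have "(\<lambda>n. (F' (t + 1 / real (Suc n)) - F' t) /\<^sub>R (1 / real (Suc n))) \<longlonglongrightarrow> \<phi> t"
      by (rule filterlim_compose)
    then show ?thesis using True by (simp add: g_def \<psi>_def)
  qed (simp add: g_def \<psi>_def)
  have \<psi>m: "\<psi> \<in> borel_measurable borel"
    by (rule borel_measurable_LIMSEQ_metric[OF gm glim])
  have "(\<psi> has_integral F 1 - F 0) {0..1}"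
    by (rule fundamental_theorem_of_calculus_interior_strong[OF S])
      (use d F in \<open>auto simp: \<psi>_def T_def\<close>)
  then have "((\<lambda>t. if t \<in> {0..1} then \<psi> t else 0) has_integral F 1 - F 0) UNIV" by (simp only: has_integral_restrict_UNIV)
  moreover have "(\<lambda>t. if t \<in> {0..1} then \<psi> t else 0) = \<psi>" by (auto simp: \<psi>_def T_def fun_eq_iff)
  ultimately have hk: "(\<psi> has_integral F 1 - F 0) UNIV" by simp
  have le: "(\<integral>\<^sup>+ t. ennreal (cmod (\<psi> t)) \<partial>lborel) \<le> (\<integral>\<^sup>+ t. indicator {0..1} t * ennreal (cmod (\<phi> t)) \<partial>lborel)"
    by (intro nn_integral_mono) (auto simp: \<psi>_def T_def)
  show ?thesis
  proof (cases "(\<integral>\<^sup>+ t. ennreal (cmod (\<psi> t)) \<partial>lborel) = \<infinity>")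
    case True
    then show ?thesis using le by (metis infinity_ennreal_def top.extremum_uniqueI top_greatest)
  next
    case False
    then have int: "integrable lborel \<psi>" using \<psi>m
      by (intro integrableI_bounded) (auto simp: less_top)
    then have "F 1 - F 0 = integral\<^sup>L lborel \<psi>"
      using has_integral_integral_lborel has_integral_unique hk by blast
    then show ?thesis using integral_norm_bound_ennreal[OF int] le by (metis order_trans)
  qed
qed

lemma int_dist_carath_lower:
  assumes f: "holo_on W f" "f ` W \<subseteq> ball 0 1" and W: "open W"
  shows "ennreal (cmod (f y - f x) / 2) \<le> int_dist W (carath W) x y"
  unfolding int_dist_def
proof (rule INF_greatest)
  fix \<gamma> assume "\<gamma> \<in> curves W x y"
  then have \<gamma>: "\<gamma> piecewise_C1_differentiable_on {0..1}" "\<gamma> ` {0..1} \<subseteq> W" "\<gamma> 0 = x" "\<gamma> 1 = y"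
    by (auto simp: curves_def)
  obtain S where S: "finite S" "\<gamma> C1_differentiable_on {0..1} - S" and \<gamma>c: "continuous_on {0..1} \<gamma>"
    using \<gamma>(1) by (auto simp: piecewise_C1_differentiable_on_def)
  define \<phi> where "\<phi> t = (1/2) *\<^sub>R frechet_derivative f (at (\<gamma> t)) (vector_derivative \<gamma> (at t))" for t
  define F where "F t = (1/2) *\<^sub>R f (\<gamma> t)" for t
  have "ennreal (cmod (F 1 - F 0)) \<le> (\<integral>\<^sup>+ t. indicator {0..1} t * ennreal (cmod (\<phi> t)) \<partial>lborel)"
  proof (rule nn_integral_derivative_lower[OF _ S(1)])
    show "continuous_on {0..1} F"
      unfolding F_def
      by (intro continuous_intros continuous_on_compose2[OF continuous_on_subset[OF holo_on_continuous[OF f(1)] \<gamma>(2)] \<gamma>c]) auto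
    fix t assume t: "t \<in> {0<..<1} - S"
    have "\<gamma> differentiable at t" using S(2) t by (auto simp: C1_differentiable_on_eq)
    then have "(\<gamma> has_derivative (\<lambda>h. h *\<^sub>R vector_derivative \<gamma> (at t))) (at t)"
      by (simp add: vector_derivative_works flip: has_vector_derivative_def)
    moreover have "\<gamma> t \<in> W" using \<gamma>(2) t by auto
    ultimately have "((\<lambda>t. f (\<gamma> t)) has_derivative (\<lambda>h. frechet_derivative f (at (\<gamma> t)) (h *\<^sub>R vector_derivative \<gamma> (at t)))) (at t)"
      using has_derivative_compose holo_onD(1)[OF f(1)] by blast
    moreover have "frechet_derivative f (at (\<gamma> t)) (h *\<^sub>R vector_derivative \<gamma> (at t)) = h *\<^sub>R frechet_derivative f (at (\<gamma> t)) (vector_derivative \<gamma> (at t))" for h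
      unfolding cscale_of_real[symmetric] holo_onD(2)[OF f(1) \<open>\<gamma> t \<in> W\<close>] by (simp add: scaleR_conv_of_real)
    ultimately have "((\<lambda>t. f (\<gamma> t)) has_vector_derivative frechet_derivative f (at (\<gamma> t)) (vector_derivative \<gamma> (at t))) (at t)"
      by (simp add: has_vector_derivative_def)
    from bounded_linear.has_vector_derivative[OF bounded_linear_scaleR_right this]
    show "(F has_vector_derivative \<phi> t) (at t)" unfolding F_def \<phi>_def .
  qed
  also have "\<dots> \<le> (\<integral>\<^sup>+ t. indicator {0..1} t * carath W (\<gamma> t) (vector_derivative \<gamma> (at t)) \<partial>lborel)"
  proof (rule nn_integral_mono)
    fix t :: real
    show "indicator {0..1} t * ennreal (cmod (\<phi> t)) \<le> indicator {0..1} t * carath W (\<gamma> t) (vector_derivative \<gamma> (at t))"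
      using carath_lower[OF f W, of "\<gamma> t" "vector_derivative \<gamma> (at t)"] \<gamma>(2)
      by (auto simp: \<phi>_def indicator_def image_subset_iff)
  qed
  also have "cmod (F 1 - F 0) = cmod (f y - f x) / 2"
    by (simp add: F_def \<gamma> flip: scaleR_diff_right)
  finally show "ennreal (cmod (f y - f x) / 2) \<le> (\<integral>\<^sup>+ t. indicator {0..1} t * carath W (\<gamma> t) (vector_derivative \<gamma> (at t)) \<partial>lborel)" .
qed

lemma int_dist_mono:
  assumes "\<And>z v. z \<in> W \<Longrightarrow> F z v \<le> G z v"
  shows "int_dist W F x y \<le> int_dist W G x y"
  unfolding int_dist_def
proof (rule INF_mono)
  fix \<gamma> assume \<gamma>: "\<gamma> \<in> curves W x y"
  have "(\<integral>\<^sup>+ t. indicator {0..1} t * F (\<gamma> t) (vector_derivative \<gamma> (at t)) \<partial>lborel)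
    \<le> (\<integral>\<^sup>+ t. indicator {0..1} t * G (\<gamma> t) (vector_derivative \<gamma> (at t)) \<partial>lborel)"
    using \<gamma> assms by (intro nn_integral_mono) (auto simp: curves_def indicator_def image_subset_iff)
  then show "\<exists>m\<in>curves W x y. (\<integral>\<^sup>+ t. indicator {0..1} t * F (m t) (vector_derivative m (at t)) \<partial>lborel)
    \<le> (\<integral>\<^sup>+ t. indicator {0..1} t * G (\<gamma> t) (vector_derivative \<gamma> (at t)) \<partial>lborel)" using \<gamma> by blast
qed

lemma int_dist_upper:
  assumes B: "ball p r \<subseteq> W" and C: "\<And>z v. z \<in> ball p r \<Longrightarrow> F z v \<le> ennreal (C * norm v)" and x: "x \<in> ball p r"
  shows "int_dist W F x p \<le> ennreal (C * norm (p - x))"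
proof -
  define \<gamma> where "\<gamma> = linepath x p"
  have img: "\<gamma> ` {0..1} \<subseteq> ball p r"
    using x convex_ball[of p r] unfolding \<gamma>_def by (metis centre_in_ball ball_eq_empty empty_iff
      closed_segment_subset linepath_image_01 not_le)
  have "\<gamma> \<in> curves W x p"
    unfolding curves_def using img B
    by (auto simp: \<gamma>_def linepath_0' linepath_1' C1_differentiable_on_eq intro!: C1_differentiable_imp_piecewise)
  then have "int_dist W F x p \<le> (\<integral>\<^sup>+ t. indicator {0..1} t * F (\<gamma> t) (vector_derivative \<gamma> (at t)) \<partial>lborel)"
    unfolding int_dist_def by (rule INF_lower)
  also have "\<dots> \<le> (\<integral>\<^sup>+ t. indicator {0..1::real} t * ennreal (C * norm (p - x)) \<partial>lborel)"
    by (intro nn_integral_mono) (use img C in \<open>auto simp: \<gamma>_def indicator_def image_subset_iff\<close>)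
  also have "(\<integral>\<^sup>+ t. indicator {0..1::real} t * ennreal (C * norm (p - x)) \<partial>lborel) = ennreal (C * norm (p - x))"
    by (subst mult.commute) (simp add: nn_integral_cmult_indicator)
  finally show ?thesis .
qed

text \<open>No triangle inequality for \<open>int_dist\<close> is needed: bounded holomorphic functions transfer the Cauchy
  property to Euclidean convergence, and local upper bounds transfer it back.\<close>
lemma metric_completeI:
  assumes W: "open W" and lower: "\<And>z v. z \<in> W \<Longrightarrow> carath W z v \<le> F z v"
    and upper: "\<And>p. p \<in> W \<Longrightarrow> \<exists>r>0. \<exists>C. ball p r \<subseteq> W \<and> (\<forall>z\<in>ball p r. \<forall>v. F z v \<le> ennreal (C * norm v))"
    and conv: "\<And>x :: nat \<Rightarrow> c2. (\<And>n. x n \<in> W) \<Longrightarrow>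
      (\<And>e. e > 0 \<Longrightarrow> \<exists>N. \<forall>m\<ge>N. \<forall>n\<ge>N. \<forall>f. holo_on W f \<and> f ` W \<subseteq> ball 0 1 \<longrightarrow> cmod (f (x m) - f (x n)) < e) \<Longrightarrow>
      \<exists>p\<in>W. x \<longlonglongrightarrow> p"
  shows "metric_complete W F"
  unfolding metric_complete_def
proof (intro allI impI, elim conjE)
  fix x :: "nat \<Rightarrow> c2"
  assume x: "\<forall>n. x n \<in> W" and cauchy: "\<forall>e>0. \<exists>N. \<forall>m\<ge>N. \<forall>n\<ge>N. int_dist W F (x m) (x n) < ennreal e"
  have "\<exists>p\<in>W. x \<longlonglongrightarrow> p"
  proof (rule conv)
    fix e :: real assume e: "e > 0"
    then obtain N where N: "\<And>m n. m \<ge> N \<Longrightarrow> n \<ge> N \<Longrightarrow> int_dist W F (x m) (x n) < ennreal (e / 2)"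
      using cauchy by (metis half_gt_zero)
    show "\<exists>N. \<forall>m\<ge>N. \<forall>n\<ge>N. \<forall>f. holo_on W f \<and> f ` W \<subseteq> ball 0 1 \<longrightarrow> cmod (f (x m) - f (x n)) < e"
    proof (intro exI[of _ N] allI impI, elim conjE)
      fix m n f assume mn: "N \<le> m" "N \<le> n" and f: "holo_on W f" "f ` W \<subseteq> ball 0 1"
      have "ennreal (cmod (f (x m) - f (x n)) / 2) \<le> int_dist W (carath W) (x n) (x m)"
        by (rule int_dist_carath_lower[OF f W])
      also have "\<dots> \<le> int_dist W F (x n) (x m)" by (rule int_dist_mono[OF lower])
      also have "\<dots> < ennreal (e / 2)" by (rule N[OF mn(2,1)])
      finally show "cmod (f (x m) - f (x n)) < e" using e by (simp add: ennreal_less_iff)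
    qed
  qed (use x in auto)
  then obtain p where p: "p \<in> W" "x \<longlonglongrightarrow> p" by blast
  obtain r C where r: "r > 0" "ball p r \<subseteq> W" "\<And>z v. z \<in> ball p r \<Longrightarrow> F z v \<le> ennreal (C * norm v)"
    using upper[OF p(1)] by blast
  have "((\<lambda>n. int_dist W F (x n) p) \<longlongrightarrow> 0) sequentially"
  proof (rule tendsto_sandwich[of "\<lambda>_. 0"])
    have "\<forall>\<^sub>F n in sequentially. x n \<in> ball p r"
      using p(2) r(1) by (metis topological_tendstoD open_ball centre_in_ball)
    then show "\<forall>\<^sub>F n in sequentially. int_dist W F (x n) p \<le> ennreal (C * norm (p - x n))"
      by eventually_elim (rule int_dist_upper[OF r(2,3)])
    have "(\<lambda>n. C * norm (p - x n)) \<longlonglongrightarrow> C * norm (p - p)" by (intro tendsto_intros p(2))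
    then show "((\<lambda>n. ennreal (C * norm (p - x n))) \<longlongrightarrow> 0) sequentially"
      using tendsto_ennrealI by fastforce
  qed auto
  then show "\<exists>p\<in>W. ((\<lambda>n. int_dist W F (x n) p) \<longlongrightarrow> 0) sequentially" using p(1) by blast
qed

section \<open>Completeness of the Caratheodory metric\<close>

text \<open>Isolates what the metrics see of \<open>P\<close>: its growth and the weighted entire
  functions, with \<open>C\<close> and \<epsilon> fixed before \<open>t\<close> and
  \<open>a\<close>.\<close>

locale weighted_domain =
  fixes P :: "complex \<Rightarrow> real" and k :: nat and C \<epsilon> A :: real
  assumes k: "k > 1" and P_cont: "continuous_on UNIV P" and P_bound: "\<And>w. \<bar>P w\<bar> \<le> A * cmod w ^ (2 * k)"
    and C: "C > 0" and \<epsilon>: "\<epsilon> > 0" and A: "A > 0"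
    and weight: "\<And>t a. t > 0 \<Longrightarrow> \<exists>h. h holomorphic_on UNIV \<and> h a = 1 \<and>
      (\<forall>w. cmod (h w) \<le> C * exp (t * (P w - P a) - t * \<epsilon> * (cmod (w ^ k - a ^ k))\<^sup>2))"
begin

definition \<Omega> :: "c2 set" where "\<Omega> = {z. Re (snd z) + P (fst z) < 0}"

definition \<rho> :: "c2 \<Rightarrow> real" where "\<rho> z = - (Re (snd z) + P (fst z))"

lemma mem_\<Omega>: "z \<in> \<Omega> \<longleftrightarrow> \<rho> z > 0"
  by (auto simp: \<Omega>_def \<rho>_def)

lemma \<rho>_cont: "continuous_on UNIV \<rho>"
  unfolding \<rho>_def by (intro continuous_intros continuous_on_compose2[OF P_cont]) auto

lemma open_\<Omega>: "open \<Omega>"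
proof -
  have "\<Omega> = \<rho> -` {0<..}" by (auto simp: mem_\<Omega>)
  then show ?thesis using \<rho>_cont by (simp add: continuous_on_open_vimage)
qed

end

text \<open>An entire function with value 1 at 0 that decays like \<open>1 / |x|\<close> where the
  real part is bounded above. It supplies decay in the imaginary direction, where an exponential has
  constant modulus.\<close>

definition expm1_quot :: "complex \<Rightarrow> complex" where
  "expm1_quot x = (if x = 0 then 1 else (exp x - 1) / x)"

lemma expm1_quot_holomorphic: "expm1_quot holomorphic_on UNIV"
proof -
  have "(\<lambda>z. if z = 0 then deriv exp 0 else (exp z - exp 0) / (z - 0)) holomorphic_on (UNIV :: complex set)"
    by (rule pole_lemma_open) (auto intro: holomorphic_intros)
  moreover have "(\<lambda>z. if z = 0 then deriv exp 0 else (exp z - exp 0) / (z - 0)) = expm1_quot"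
    using DERIV_imp_deriv[OF DERIV_exp, of "0 :: complex"] by (auto simp: expm1_quot_def fun_eq_iff)
  ultimately show ?thesis by simp
qed

lemma expm1_quot_bound:
  obtains K where "K > 0" "\<And>x. cmod (expm1_quot x) * (1 + cmod x) \<le> K * (1 + exp (Re x))"
proof -
  have "continuous_on (cball 0 1) expm1_quot"
    using expm1_quot_holomorphic holomorphic_on_imp_continuous_on continuous_on_subset by blast
  then have "bounded (expm1_quot ` cball 0 1)" by (intro compact_imp_bounded compact_continuous_image) auto
  then obtain K0 where "\<forall>x\<in>cball 0 1. cmod (expm1_quot x) \<le> K0" by (auto simp: bounded_iff)
  then have K0: "cmod (expm1_quot x) \<le> K0" if "cmod x \<le> 1" for x using that by simp
  define K where "K = 2 * max 1 K0"
  show ?thesis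
  proof (rule that[of K])
    fix x :: complex
    show "cmod (expm1_quot x) * (1 + cmod x) \<le> K * (1 + exp (Re x))"
    proof (cases "cmod x \<le> 1")
      case True
      have "cmod (expm1_quot x) * (1 + cmod x) \<le> max 1 K0 * 2" using K0[OF True] True by (intro mult_mono) auto
      also have "\<dots> \<le> K * (1 + exp (Re x))" by (simp add: K_def distrib_left)
      finally show ?thesis .
    next
      case False
      then have x: "cmod x > 0" by linarith
      have "cmod (exp x - 1) \<le> exp (Re x) + 1" using norm_triangle_ineq4[of "exp x" 1] by simp
      moreover have "(1 + cmod x) / cmod x \<le> 2" using False by (simp add: divide_simps)
      ultimately have "cmod (exp x - 1) * ((1 + cmod x) / cmod x) \<le> (exp (Re x) + 1) * 2" by (intro mult_mono) auto
      also have "\<dots> \<le> (exp (Re x) + 1) * K" by (intro mult_left_mono) (auto simp: K_def add_nonneg_nonneg)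
      finally show ?thesis using x by (auto simp: expm1_quot_def norm_divide mult_ac add.commute)
    qed
  qed (simp add: K_def)
qed

lemma power4_sum_le: "(1 + u) ^ 4 \<le> 16 * (1 + u ^ 4)" if "u \<ge> 0" for u :: real
proof -
  have "(1 + u) ^ 4 \<le> (2 * max 1 u) ^ 4" using that by (intro power_mono) auto
  also have "\<dots> \<le> 16 * (1 + u ^ 4)" using that by (auto simp: power_mult_distrib max_def)
  finally show ?thesis .
qed

text \<open>With \<open>n \<ge> 4\<close> one has \<open>r^4 \<le> 1 + r^n\<close>, and
  \<open>x exp (- \<delta> x) \<le> 1 / \<delta>\<close> does the rest. The exponent in use is
  \<open>2 k\<close> with \<open>k > 1\<close>.\<close>

lemma poly_exp_bound:
  fixes r \<delta> :: real
  assumes "r \<ge> 0" "\<delta> > 0" "n \<ge> 4"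
  shows "(1 + r) ^ 4 * exp (- \<delta> * r ^ n) \<le> 16 * (2 + 1 / \<delta>)"
proof -
  have r4: "r ^ 4 \<le> 1 + r ^ n"
  proof (cases "r \<le> 1")
    case True
    then have "r ^ 4 \<le> 1" using assms by (intro power_le_one) auto
    moreover have "0 \<le> r ^ n" using assms by simp
    ultimately show ?thesis by linarith
  next
    case False
    then have "r ^ 4 \<le> r ^ n" using assms by (intro power_increasing) auto
    then show ?thesis by simp
  qed
  have e1: "exp (- \<delta> * r ^ n) \<le> 1" using assms by simp
  have "\<delta> * r ^ n \<le> exp (\<delta> * r ^ n)" using exp_ge_add_one_self[of "\<delta> * r ^ n"] by linarith
  then have "r ^ n * exp (- \<delta> * r ^ n) \<le> 1 / \<delta>" using assms by (simp add: exp_minus field_simps)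
  moreover have "2 * exp (- \<delta> * r ^ n) \<le> 2 * 1" using e1 by (intro mult_left_mono) auto
  ultimately have 1: "(2 + r ^ n) * exp (- \<delta> * r ^ n) \<le> 2 + 1 / \<delta>" by (simp only: distrib_right)
  have "16 * (1 + r ^ 4) \<le> 16 * (2 + r ^ n)" using r4 by simp
  then have "(1 + r) ^ 4 * exp (- \<delta> * r ^ n) \<le> 16 * (2 + r ^ n) * exp (- \<delta> * r ^ n)"
    by (intro mult_right_mono order_trans[OF power4_sum_le[OF assms(1)]]) auto
  also have "\<dots> = 16 * ((2 + r ^ n) * exp (- \<delta> * r ^ n))" by (rule mult.assoc)
  also have "\<dots> \<le> 16 * (2 + 1 / \<delta>)" by (intro mult_left_mono 1) auto
  finally show ?thesis .
qed

context weighted_domain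
begin

text \<open>On the domain \<open>Re z2 < - P z1\<close>, so the factor \<open>exp z2\<close> cancels
  the growth \<open>exp (P z1)\<close> of \<open>h\<close> and leaves the gain
  \<open>exp (- \<epsilon> |z1^k - a^k|^2)\<close>. The fourth power of \<open>expm1_quot\<close>
  adds decay in \<open>z2\<close>, but may grow with \<open>Re z2\<close>, which is at most
  \<open>A |z1|^(2 k)\<close>; the gain has to absorb this growth.\<close>

lemma decaying_function:
  obtains h e D where "h holomorphic_on UNIV" "e holomorphic_on UNIV" "h (fst p) \<noteq> 0" "e (snd p) \<noteq> 0" "D > 0"
    "\<And>z. z \<in> \<Omega> \<Longrightarrow> (1 + cmod (fst z)) ^ 4 * (1 + cmod (snd z)) ^ 4 * cmod (h (fst z) * e (snd z)) \<le> D"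
proof -
  define n where "n = 2 * k"
  define a where "a = fst p"
  define b where "b = snd p"
  obtain h where h: "h holomorphic_on UNIV" "h a = 1"
    and hb: "\<And>w. cmod (h w) \<le> C * exp (1 * (P w - P a) - 1 * \<epsilon> * (cmod (w ^ k - a ^ k))\<^sup>2)"
    using weight[of 1 a] by auto
  obtain K where K: "K > 0" "\<And>x. cmod (expm1_quot x) * (1 + cmod x) \<le> K * (1 + exp (Re x))"
    using expm1_quot_bound by metis
  \<comment> \<open>Makes the growth of the fourth power cost one factor \<open>exp Y\<close> with
    \<open>Y = \<epsilon> / 4 * |w|^n\<close>, out of a gain \<open>exp (- 2 Y)\<close>. The
    remaining \<open>exp (- Y)\<close> pays for the power of \<open>1 + |w|\<close>.\<close>
  define \<eta> where "\<eta> = \<epsilon> / (16 * A)"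
  have \<eta>: "\<eta> > 0" "4 * \<eta> * A = \<epsilon> / 4" using \<epsilon> A by (auto simp: \<eta>_def)
  define e where "e x = exp x * expm1_quot (of_real \<eta> * (x - b)) ^ 4" for x
  define L where "L = 1 + cmod b + 1 / \<eta>"
  have L: "L > 0" using \<eta> by (simp add: L_def add_pos_nonneg add_nonneg_pos)
  define X where "X = 4 * \<eta> * cmod b"
  define D where "D = C * exp (- P a + \<epsilon> * cmod a ^ n) * (K ^ 4 * (32 * exp X)) * L ^ 4 * (16 * (2 + 1 / (\<epsilon> / 4)))"
  show ?thesis
  proof (rule that[of h e D])
    show "h holomorphic_on UNIV" by fact
    have "(\<lambda>x. expm1_quot (of_real \<eta> * (x - b))) holomorphic_on UNIV"
      by (rule holomorphic_on_compose_gen[OF _ expm1_quot_holomorphic, unfolded o_def]) (auto intro!: holomorphic_intros)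
    then show "e holomorphic_on UNIV" unfolding e_def by (intro holomorphic_intros)
    show "h (fst p) \<noteq> 0" using h by (simp add: a_def)
    show "e (snd p) \<noteq> 0" by (simp add: e_def b_def expm1_quot_def)
    show "D > 0" unfolding D_def using C K L \<epsilon> by (intro mult_pos_pos add_pos_pos) auto
    fix z assume z: "z \<in> \<Omega>"
    define w x where "w = fst z" and "x = snd z"
    have zx: "Re x + P w < 0" using z by (simp add: \<Omega>_def w_def x_def)
    define Y where "Y = \<epsilon> / 4 * cmod w ^ n"
    have Y: "Y \<ge> 0" using \<epsilon> by (simp add: Y_def)
    have X: "X \<ge> 0" using \<eta> by (simp add: X_def)
    \<comment> \<open>\<open>\<bar>u - v\<bar>\<^sup>2 \<ge> \<bar>u\<bar>\<^sup>2 / 2 - \<bar>v\<bar>\<^sup>2\<close>\<close>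
    have sq: "cmod w ^ n / 2 - cmod a ^ n \<le> (cmod (w ^ k - a ^ k))\<^sup>2"
    proof -
      have "cmod (w ^ k) \<le> cmod (w ^ k - a ^ k) + cmod (a ^ k)" by (metis norm_triangle_sub add.commute)
      then have "(cmod (w ^ k))\<^sup>2 \<le> (cmod (w ^ k - a ^ k) + cmod (a ^ k))\<^sup>2" by (intro power_mono) auto
      also have "\<dots> \<le> 2 * (cmod (w ^ k - a ^ k))\<^sup>2 + 2 * (cmod (a ^ k))\<^sup>2"
        using sum_squares_bound[of "cmod (w ^ k - a ^ k)" "cmod (a ^ k)"] by (simp add: power2_sum)
      finally show ?thesis by (simp add: n_def norm_power power_mult mult.commute flip: power_mult)
    qed
    have 1: "cmod (h w) * exp (Re x) \<le> C * exp (- P a + \<epsilon> * cmod a ^ n) * exp (- 2 * Y)"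
    proof -
      have "cmod (h w) * exp (Re x) \<le> C * exp (1 * (P w - P a) - 1 * \<epsilon> * (cmod (w ^ k - a ^ k))\<^sup>2) * exp (Re x)"
        by (intro mult_right_mono hb) auto
      also have "\<dots> = C * exp (P w - P a - \<epsilon> * (cmod (w ^ k - a ^ k))\<^sup>2 + Re x)" by (simp add: exp_add mult.assoc)
      also have "\<dots> \<le> C * exp (- P a + \<epsilon> * cmod a ^ n + - 2 * Y)"
      proof -
        have "\<epsilon> * (cmod w ^ n / 2 - cmod a ^ n) \<le> \<epsilon> * (cmod (w ^ k - a ^ k))\<^sup>2" using sq \<epsilon> by (intro mult_left_mono) auto
        then show ?thesis using zx C by (simp add: Y_def algebra_simps)
      qed
      finally show ?thesis by (simp only: exp_add mult.assoc)
    qed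
    have 2: "cmod (expm1_quot (of_real \<eta> * (x - b))) ^ 4 * (1 + \<eta> * cmod (x - b)) ^ 4 \<le> K ^ 4 * (32 * exp X) * exp Y"
    proof -
      define u where "u = exp (\<eta> * Re (x - b))"
      have "cmod (expm1_quot (of_real \<eta> * (x - b))) * (1 + \<eta> * cmod (x - b)) \<le> K * (1 + u)"
        using K(2)[of "of_real \<eta> * (x - b)"] \<eta> by (simp add: norm_mult u_def)
      then have "(cmod (expm1_quot (of_real \<eta> * (x - b))) * (1 + \<eta> * cmod (x - b))) ^ 4 \<le> (K * (1 + u)) ^ 4"
        using \<eta> by (intro power_mono) auto
      also have "\<dots> \<le> K ^ 4 * (16 * (1 + u ^ 4))"
        unfolding power_mult_distrib using K by (intro mult_left_mono power4_sum_le) (auto simp: u_def)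
      also have "1 + u ^ 4 \<le> exp (X + Y) + exp (X + Y)"
      proof -
        have "Re x \<le> A * cmod w ^ n" using zx P_bound[of w] by (simp add: n_def abs_le_iff)
        moreover have "- Re b \<le> cmod b" using abs_Re_le_cmod[of b] by linarith
        ultimately have "4 * \<eta> * Re (x - b) \<le> 4 * \<eta> * (A * cmod w ^ n + cmod b)" using \<eta> by (intro mult_left_mono) auto
        also have "\<dots> = (4 * \<eta> * A) * cmod w ^ n + X" by (simp add: X_def algebra_simps)
        also have "\<dots> = X + Y" unfolding \<eta>(2) Y_def by simp
        finally have "u ^ 4 \<le> exp (X + Y)" by (simp add: u_def mult.assoc flip: exp_of_nat_mult)
        then show ?thesis using X Y by (intro add_mono) auto
      qed
      finally have "(cmod (expm1_quot (of_real \<eta> * (x - b))) * (1 + \<eta> * cmod (x - b))) ^ 4 \<le> K ^ 4 * (16 * (exp (X + Y) + exp (X + Y)))"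
        using K by simp
      then show ?thesis by (simp only: power_mult_distrib exp_add) (simp add: mult_ac)
    qed
    have 3: "(1 + cmod x) ^ 4 \<le> L ^ 4 * (1 + \<eta> * cmod (x - b)) ^ 4"
    proof -
      have "1 + cmod x \<le> 1 + cmod b + cmod (x - b)" using norm_triangle_sub[of x b] by simp
      also have "\<dots> \<le> L * (1 + \<eta> * cmod (x - b))"
      proof -
        have "L * (1 + \<eta> * cmod (x - b)) = (1 + cmod b + cmod (x - b)) + (1 / \<eta> + (1 + cmod b) * (\<eta> * cmod (x - b)))"
          using \<eta> by (simp add: L_def field_simps)
        moreover have "0 \<le> 1 / \<eta> + (1 + cmod b) * (\<eta> * cmod (x - b))" using \<eta> by (intro add_nonneg_nonneg mult_nonneg_nonneg) auto
        ultimately show ?thesis by linarith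
      qed
      finally have "(1 + cmod x) ^ 4 \<le> (L * (1 + \<eta> * cmod (x - b))) ^ 4" by (intro power_mono) auto
      then show ?thesis by (simp add: power_mult_distrib)
    qed
    have 4: "(1 + cmod w) ^ 4 * exp (- Y) \<le> 16 * (2 + 1 / (\<epsilon> / 4))"
      using poly_exp_bound[of "cmod w" "\<epsilon> / 4" n] \<epsilon> k by (simp add: Y_def n_def)
    define q where "q = cmod (expm1_quot (of_real \<eta> * (x - b))) ^ 4"
    have q: "q \<ge> 0" by (simp add: q_def)
    have "(1 + cmod w) ^ 4 * (1 + cmod x) ^ 4 * cmod (h w * e x) = (1 + cmod w) ^ 4 * (cmod (h w) * exp (Re x)) * (q * (1 + cmod x) ^ 4)"
      by (simp add: e_def q_def norm_mult norm_power)
    also have "\<dots> \<le> (1 + cmod w) ^ 4 * (C * exp (- P a + \<epsilon> * cmod a ^ n) * exp (- 2 * Y)) * (K ^ 4 * (32 * exp X) * exp Y * L ^ 4)"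
    proof (rule mult_mono)
      have "q * (1 + cmod x) ^ 4 \<le> q * (L ^ 4 * (1 + \<eta> * cmod (x - b)) ^ 4)" using 3 q by (intro mult_left_mono) auto
      also have "\<dots> = (q * (1 + \<eta> * cmod (x - b)) ^ 4) * L ^ 4" by simp
      also have "\<dots> \<le> K ^ 4 * (32 * exp X) * exp Y * L ^ 4" using 2 L unfolding q_def by (intro mult_right_mono) auto
      finally show "q * (1 + cmod x) ^ 4 \<le> K ^ 4 * (32 * exp X) * exp Y * L ^ 4" .
      show "(1 + cmod w) ^ 4 * (cmod (h w) * exp (Re x)) \<le> (1 + cmod w) ^ 4 * (C * exp (- P a + \<epsilon> * cmod a ^ n) * exp (- 2 * Y))"
        by (intro mult_left_mono 1) auto
    qed (use C q in auto)
    also have "\<dots> = C * exp (- P a + \<epsilon> * cmod a ^ n) * (K ^ 4 * (32 * exp X)) * L ^ 4 * ((1 + cmod w) ^ 4 * (exp (- 2 * Y) * exp Y))"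
      by (simp add: mult_ac)
    also have "exp (- 2 * Y) * exp Y = exp (- Y)" by (simp flip: exp_add)
    also have "C * exp (- P a + \<epsilon> * cmod a ^ n) * (K ^ 4 * (32 * exp X)) * L ^ 4 * ((1 + cmod w) ^ 4 * exp (- Y)) \<le> D"
      unfolding D_def using 4 C K L by (intro mult_left_mono) auto
    finally show "(1 + cmod (fst z)) ^ 4 * (1 + cmod (snd z)) ^ 4 * cmod (h (fst z) * e (snd z)) \<le> D"
      by (simp add: w_def x_def)
  qed
qed

end

lemma holo_on_product:
  assumes "h holomorphic_on UNIV" "e holomorphic_on UNIV"
  shows "holo_on W (\<lambda>z. h (fst z) * e (snd z))"
  by (intro holo_on_mult holo_on_fst holo_on_snd assms)

lemma continuous_product:
  assumes "h holomorphic_on UNIV" "e holomorphic_on UNIV"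
  shows "continuous_on UNIV (\<lambda>z :: c2. h (fst z) * e (snd z))"
  using holo_on_continuous[OF holo_on_product[OF assms]] .

context weighted_domain
begin

text \<open>The factor \<open>exp (t (z2 - b2))\<close> turns the difference of the values of
  \<open>P\<close> into one of \<rho>. The base point serves in two roles: a term of a sequence,
  with \<open>t = 1 / \<rho> b\<close>, or a boundary point, where \<open>F\<close> is a peak
  function.\<close>

lemma exponential_function:
  assumes t: "t > 0"
  obtains F where "holo_on \<Omega> F" "continuous_on UNIV F" "F b = 1"
    "\<And>z. cmod (F z) \<le> C * exp (- t * \<rho> z + t * \<rho> b - t * \<epsilon> * (cmod (fst z ^ k - fst b ^ k))\<^sup>2)"
proof -
  obtain h where h: "h holomorphic_on UNIV" "h (fst b) = 1"
    and hb: "\<And>w. cmod (h w) \<le> C * exp (t * (P w - P (fst b)) - t * \<epsilon> * (cmod (w ^ k - fst b ^ k))\<^sup>2)"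
    using weight[OF t, of "fst b"] by blast
  define e where "e x = exp (of_real t * (x - snd b))" for x
  have e: "e holomorphic_on UNIV" unfolding e_def by (intro holomorphic_intros)
  show ?thesis
  proof (rule that[of "\<lambda>z. h (fst z) * e (snd z)"])
    show "holo_on \<Omega> (\<lambda>z. h (fst z) * e (snd z))" by (rule holo_on_product[OF h(1) e])
    show "continuous_on UNIV (\<lambda>z. h (fst z) * e (snd z))" by (rule continuous_product[OF h(1) e])
    fix z
    have "cmod (h (fst z) * e (snd z)) \<le> C * exp (t * (P (fst z) - P (fst b)) - t * \<epsilon> * (cmod (fst z ^ k - fst b ^ k))\<^sup>2) * exp (t * (Re (snd z) - Re (snd b)))"
      unfolding norm_mult by (intro mult_mono hb) (use C in \<open>auto simp: e_def\<close>)
    also have "\<dots> = C * exp (- t * \<rho> z + t * \<rho> b - t * \<epsilon> * (cmod (fst z ^ k - fst b ^ k))\<^sup>2)"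
      by (simp add: \<rho>_def mult.assoc algebra_simps flip: exp_add)
    finally show "cmod (h (fst z) * e (snd z)) \<le> C * exp (- t * \<rho> z + t * \<rho> b - t * \<epsilon> * (cmod (fst z ^ k - fst b ^ k))\<^sup>2)" .
  qed (simp add: h e_def)
qed

text \<open>One \<open>F\<close> for two purposes: the weighted bound makes it square integrable,
  and the bounds on its products with the coordinates let bounded functions recover the coordinates
  as quotients.\<close>

lemma coordinate_functions:
  assumes p: "p \<in> \<Omega>"
  obtains F M where "holo_on \<Omega> F" "F p \<noteq> 0" "M > 0"
    "\<And>z. z \<in> \<Omega> \<Longrightarrow> (1 + cmod (fst z))\<^sup>2 * (1 + cmod (snd z))\<^sup>2 * cmod (F z) < M"
    "\<And>z. z \<in> \<Omega> \<Longrightarrow> cmod (F z) < M"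
    "\<And>z. z \<in> \<Omega> \<Longrightarrow> cmod ((fst z - fst p) * F z) < M"
    "\<And>z. z \<in> \<Omega> \<Longrightarrow> cmod ((snd z - snd p) * F z) < M"
proof -
  obtain h e D where h: "h holomorphic_on UNIV" "e holomorphic_on UNIV" "h (fst p) \<noteq> 0" "e (snd p) \<noteq> 0" "D > 0"
    and D: "\<And>z. z \<in> \<Omega> \<Longrightarrow> (1 + cmod (fst z)) ^ 4 * (1 + cmod (snd z)) ^ 4 * cmod (h (fst z) * e (snd z)) \<le> D"
    using decaying_function by metis
  define F where "F z = h (fst z) * e (snd z)" for z
  define M where "M = (1 + cmod (fst p)) * (1 + cmod (snd p)) * D + 1"
  have D1: "D \<le> (1 + cmod (fst p)) * (1 + cmod (snd p)) * D"
    using h(5) mult_mono[of 1 "1 + cmod (fst p)" 1 "1 + cmod (snd p)"] by simp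
  have main: "a * cmod (F z) < M" if z: "z \<in> \<Omega>" and a: "a \<le> (1 + cmod (fst p)) * (1 + cmod (snd p)) * ((1 + cmod (fst z)) ^ 4 * (1 + cmod (snd z)) ^ 4)" for a z
  proof -
    have "a * cmod (F z) \<le> (1 + cmod (fst p)) * (1 + cmod (snd p)) * ((1 + cmod (fst z)) ^ 4 * (1 + cmod (snd z)) ^ 4) * cmod (F z)"
      using a by (intro mult_right_mono) auto
    also have "\<dots> = (1 + cmod (fst p)) * (1 + cmod (snd p)) * ((1 + cmod (fst z)) ^ 4 * (1 + cmod (snd z)) ^ 4 * cmod (F z))"
      by (simp add: mult_ac)
    also have "\<dots> \<le> (1 + cmod (fst p)) * (1 + cmod (snd p)) * D"
      using D[OF z] unfolding F_def by (intro mult_left_mono) auto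
    finally show ?thesis by (simp add: M_def)
  qed
  have pw: "1 \<le> (1 + x) ^ m" "1 + x \<le> (1 + x) ^ 4" "(1 + x)\<^sup>2 \<le> (1 + x) ^ 4" if "x \<ge> 0" for x :: real and m
    using that power_increasing[of 1 4 "1 + x"] power_increasing[of 2 4 "1 + x"] by auto
  have split: "a * b \<le> (1 + cmod (fst p)) * (1 + cmod (snd p)) * ((1 + cmod (fst z)) ^ 4 * (1 + cmod (snd z)) ^ 4)"
    if "0 \<le> a" "0 \<le> b" "a \<le> (1 + cmod (fst p)) * (1 + cmod (fst z)) ^ 4" "b \<le> (1 + cmod (snd p)) * (1 + cmod (snd z)) ^ 4" for a b and z :: c2
    using mult_mono[OF that(3,4)] that by (simp add: mult_ac)
  have one: "x \<le> (1 + y) * x" if "x \<ge> 0" "y \<ge> 0" for x y :: real using that mult_right_mono[of 1 "1 + y" x] by simp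
  have diff: "cmod (u - v) \<le> (1 + cmod v) * (1 + cmod u) ^ 4" for u v
  proof -
    have "cmod (u - v) \<le> cmod u + cmod v" by (rule norm_triangle_ineq4)
    also have "\<dots> \<le> (1 + cmod v) * (1 + cmod u)" by (simp add: algebra_simps)
    also have "\<dots> \<le> (1 + cmod v) * (1 + cmod u) ^ 4" by (intro mult_left_mono pw) auto
    finally show ?thesis .
  qed
  show ?thesis
  proof (rule that[of F M])
    show "holo_on \<Omega> F" unfolding F_def by (rule holo_on_product[OF h(1,2)])
    show "F p \<noteq> 0" using h by (simp add: F_def)
    show "M > 0" unfolding M_def using h(5) D1 by linarith
    fix z assume z: "z \<in> \<Omega>"
    have sq: "(1 + x)\<^sup>2 \<le> (1 + y) * (1 + x) ^ 4" "1 \<le> (1 + y) * (1 + x) ^ 4" if "x \<ge> 0" "y \<ge> 0" for x y :: real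
      using that by (auto intro!: order_trans[OF _ one] pw)
    show "(1 + cmod (fst z))\<^sup>2 * (1 + cmod (snd z))\<^sup>2 * cmod (F z) < M"
      by (intro main[OF z] split sq) auto
    show "cmod (F z) < M" using main[OF z split[of 1 1 z]] sq by simp
    show "cmod ((fst z - fst p) * F z) < M"
      using main[OF z split[of "cmod (fst z - fst p)" 1 z]] sq diff by (simp add: norm_mult)
    show "cmod ((snd z - snd p) * F z) < M"
      using main[OF z split[of 1 "cmod (snd z - snd p)" z]] sq diff by (simp add: norm_mult)
  qed
qed

section \<open>Positivity and convergence of Cauchy sequences\<close>

lemma carath_positive_\<Omega>: "carath_positive \<Omega>"
  unfolding carath_positive_def
proof (intro ballI allI impI)
  fix p and v :: c2
  assume p: "p \<in> \<Omega>" and v: "v \<noteq> 0"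
  obtain F M where F: "holo_on \<Omega> F" "F p \<noteq> 0" "M > 0"
    "\<And>z. z \<in> \<Omega> \<Longrightarrow> cmod ((fst z - fst p) * F z) < M"
    "\<And>z. z \<in> \<Omega> \<Longrightarrow> cmod ((snd z - snd p) * F z) < M"
    using coordinate_functions[OF p] by metis
  have F': "(F has_derivative frechet_derivative F (at p)) (at p)" by (rule holo_onD(1)[OF F(1) p])
  have id: "(\<lambda>x. x - a) holomorphic_on UNIV" for a :: complex by (intro holomorphic_intros)
  have *: "carath \<Omega> p v > 0"
    if g: "holo_on \<Omega> g" "g p = 0" "\<And>z. z \<in> \<Omega> \<Longrightarrow> cmod (g z * F z) < M" "(g has_derivative g') (at p)" "g' v \<noteq> 0" for g g'
  proof -
    define f where "f z = g z * F z * of_real (1 / M)" for z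
    have f: "holo_on \<Omega> f" unfolding f_def by (intro holo_on_mult holo_on_const g F)
    have "cmod (f z) < 1" if "z \<in> \<Omega>" for z
      using g(3)[OF that] F(3) by (simp add: f_def norm_divide)
    then have "ennreal (cmod (frechet_derivative f (at p) v)) \<le> carath \<Omega> p v"
      unfolding carath_def by (intro SUP_upper) (use f g(2) in \<open>auto simp: f_def[of p]\<close>)
    moreover have "(f has_derivative (\<lambda>v. (g p * frechet_derivative F (at p) v + g' v * F p) * of_real (1 / M))) (at p)"
      unfolding f_def by (intro has_derivative_mult_left has_derivative_mult F' g)
    then have "frechet_derivative f (at p) = (\<lambda>v. (g p * frechet_derivative F (at p) v + g' v * F p) * of_real (1 / M))"
      by (rule frechet_derivative_at[symmetric])
    then have "cmod (frechet_derivative f (at p) v) > 0" using g F by (simp add: norm_mult)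
    ultimately show ?thesis using ennreal_less_zero_iff less_le_trans by (metis ennreal_less_zero_iff)
  qed
  show "carath \<Omega> p v > 0"
  proof (cases "fst v = 0")
    case False
    show ?thesis
    proof (rule *[of "\<lambda>z. fst z - fst p" fst])
      show "holo_on \<Omega> (\<lambda>z. fst z - fst p)" by (rule holo_on_fst[OF id])
      show "((\<lambda>z. fst z - fst p) has_derivative fst) (at p)" by (auto intro!: derivative_eq_intros)
    qed (use False F in auto)
  next
    case True
    then have "snd v \<noteq> 0" using v by (simp add: prod_eq_iff)
    show ?thesis
    proof (rule *[of "\<lambda>z. snd z - snd p" snd])
      show "holo_on \<Omega> (\<lambda>z. snd z - snd p)" by (rule holo_on_snd[OF id])
      show "((\<lambda>z. snd z - snd p) has_derivative snd) (at p)" by (auto intro!: derivative_eq_intros)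
    qed (use \<open>snd v \<noteq> 0\<close> F in auto)
  qed
qed

text \<open>Each way to escape is excluded by its own test functions: exponentials centred at a term
  bound \<rho> and \<open>z1\<close>, vertically translated decaying functions bound
  \<open>Im z2\<close>, and peak functions keep limit points off the boundary.\<close>

lemma carath_cauchy_converges:
  fixes x :: "nat \<Rightarrow> c2"
  assumes x: "\<And>n. x n \<in> \<Omega>"
    and cauchy: "\<And>e. e > 0 \<Longrightarrow> \<exists>N. \<forall>m\<ge>N. \<forall>n\<ge>N. \<forall>f. holo_on \<Omega> f \<and> f ` \<Omega> \<subseteq> ball 0 1 \<longrightarrow> cmod (f (x m) - f (x n)) < e"
  shows "\<exists>p\<in>\<Omega>. x \<longlonglongrightarrow> p"
proof -
  \<comment> \<open>The index works for all functions with the same bound at once. This is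
    essential: each time below, \<open>N\<close> is fixed first and the function is built from the
    term \<open>x N\<close> or from a later one.\<close>
  have scaled: "\<exists>N. \<forall>m\<ge>N. \<forall>n\<ge>N. \<forall>F. holo_on \<Omega> F \<and> (\<forall>z\<in>\<Omega>. cmod (F z) < M) \<longrightarrow> cmod (F (x m) - F (x n)) < e"
    if e: "e > 0" and M: "M > 0" for e M
  proof -
    obtain N where N: "\<And>m n f. m \<ge> N \<Longrightarrow> n \<ge> N \<Longrightarrow> holo_on \<Omega> f \<Longrightarrow> f ` \<Omega> \<subseteq> ball 0 1 \<Longrightarrow> cmod (f (x m) - f (x n)) < e / M"
      using cauchy[of "e / M"] e M by (metis divide_pos_pos)
    show ?thesis
    proof (intro exI[of _ N] allI impI, elim conjE)
      fix m n F assume mn: "N \<le> m" "N \<le> n" and F: "holo_on \<Omega> F" "\<forall>z\<in>\<Omega>. cmod (F z) < M"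
      have "cmod (F (x m) * of_real (1 / M) - F (x n) * of_real (1 / M)) < e / M"
      proof (rule N[OF mn])
        show "holo_on \<Omega> (\<lambda>z. F z * of_real (1 / M))" by (intro holo_on_mult holo_on_const F)
        show "(\<lambda>z. F z * of_real (1 / M)) ` \<Omega> \<subseteq> ball 0 1" using F(2) M by (auto simp: norm_divide divide_simps)
      qed
      also have "F (x m) * of_real (1 / M) - F (x n) * of_real (1 / M) = (F (x m) - F (x n)) / of_real M" by (simp add: diff_divide_distrib)
      finally show "cmod (F (x m) - F (x n)) < e" using M by (simp add: norm_divide divide_less_cancel)
    qed
  qed
  have \<rho>x: "\<rho> (x n) > 0" for n using x mem_\<Omega> by blast
  obtain N1 R where R: "\<And>m. m \<ge> N1 \<Longrightarrow> \<rho> (x m) \<le> R" "\<And>m. m \<ge> N1 \<Longrightarrow> cmod (fst (x m)) ^ k \<le> R"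
  proof -
    obtain N where N: "\<forall>m\<ge>N. \<forall>n\<ge>N. \<forall>F. holo_on \<Omega> F \<and> (\<forall>z\<in>\<Omega>. cmod (F z) < 2 * C * exp 1) \<longrightarrow> cmod (F (x m) - F (x n)) < 1/2"
      using scaled[of "1/2" "2 * C * exp 1"] C by auto
    define b where "b = x N"
    \<comment> \<open>With \<open>t * \<rho> b = 1\<close> the function with value 1 at
      \<open>b\<close> is bounded by \<open>C * exp 1\<close> on the whole domain, a bound known
      before \<open>b\<close> is.\<close>
    define t where "t = 1 / \<rho> b"
    have t: "t > 0" "t * \<rho> b = 1" using \<rho>x[of N] by (auto simp: t_def b_def)
    obtain F where F: "holo_on \<Omega> F" "F b = 1"
      "\<And>z. cmod (F z) \<le> C * exp (- t * \<rho> z + t * \<rho> b - t * \<epsilon> * (cmod (fst z ^ k - fst b ^ k))\<^sup>2)"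
      using exponential_function[OF t(1), of b] by metis
    have Fb: "cmod (F z) < 2 * C * exp 1" if "z \<in> \<Omega>" for z
    proof -
      have "cmod (F z) \<le> C * exp 1"
      proof (rule order_trans[OF F(3)])
        have "t * \<rho> z > 0" "0 \<le> t * \<epsilon> * (cmod (fst z ^ k - fst b ^ k))\<^sup>2" using that t \<epsilon> by (auto simp: mem_\<Omega>)
        then show "C * exp (- t * \<rho> z + t * \<rho> b - t * \<epsilon> * (cmod (fst z ^ k - fst b ^ k))\<^sup>2) \<le> C * exp 1"
          using C t by simp
      qed
      also have "\<dots> < 2 * C * exp 1" using C by simp
      finally show ?thesis .
    qed
    have half: "1/2 \<le> cmod (F (x m))" if "m \<ge> N" for m
    proof -
      have "cmod (F (x m) - F (x N)) < 1/2" using N that F(1) Fb by blast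
      moreover have "cmod (F (x N)) \<le> cmod (F (x m)) + cmod (F (x m) - F (x N))" using norm_triangle_sub[of "F (x N)" "F (x m)"] by (simp add: norm_minus_commute)
      ultimately show ?thesis using F(2) by (simp add: b_def)
    qed
    define B where "B = ln (2 * C) + 1"
    have key: "t * \<rho> (x m) + t * \<epsilon> * (cmod (fst (x m) ^ k - fst b ^ k))\<^sup>2 \<le> B" if "m \<ge> N" for m
    proof -
      have "1/2 \<le> C * exp (- t * \<rho> (x m) + t * \<rho> b - t * \<epsilon> * (cmod (fst (x m) ^ k - fst b ^ k))\<^sup>2)"
        using half[OF that] F(3)[of "x m"] by linarith
      then have "1 \<le> 2 * C * exp (- t * \<rho> (x m) + 1 - t * \<epsilon> * (cmod (fst (x m) ^ k - fst b ^ k))\<^sup>2)" unfolding t(2) by simp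
      then have "ln 1 \<le> ln (2 * C * exp (- t * \<rho> (x m) + 1 - t * \<epsilon> * (cmod (fst (x m) ^ k - fst b ^ k))\<^sup>2))"
        using C by (subst ln_le_cancel_iff) auto
      then show ?thesis using C by (simp add: ln_mult B_def)
    qed
    have q: "t * \<epsilon> > 0" using t \<epsilon> by simp
    define R where "R = max (B / t) (sqrt (B / (t * \<epsilon>)) + cmod (fst b) ^ k)"
    show ?thesis
    proof (rule that[of N R])
      fix m assume m: "m \<ge> N"
      have "0 \<le> t * \<epsilon> * (cmod (fst (x m) ^ k - fst b ^ k))\<^sup>2" using q by simp
      then have "t * \<rho> (x m) \<le> B" using key[OF m] by linarith
      then have "\<rho> (x m) \<le> B / t" using t by (simp add: field_simps)
      then show "\<rho> (x m) \<le> R" by (simp add: R_def)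
      have "0 \<le> t * \<rho> (x m)" using t \<rho>x[of m] by simp
      then have "t * \<epsilon> * (cmod (fst (x m) ^ k - fst b ^ k))\<^sup>2 \<le> B" using key[OF m] by linarith
      then have "(cmod (fst (x m) ^ k - fst b ^ k))\<^sup>2 \<le> B / (t * \<epsilon>)" using q by (simp add: pos_le_divide_eq mult.commute)
      then have "cmod (fst (x m) ^ k - fst b ^ k) \<le> sqrt (B / (t * \<epsilon>))" by (rule real_le_rsqrt)
      moreover have "cmod (fst (x m) ^ k) \<le> cmod (fst (x m) ^ k - fst b ^ k) + cmod (fst b ^ k)" by (metis norm_triangle_sub add.commute)
      ultimately show "cmod (fst (x m)) ^ k \<le> R" by (simp add: R_def norm_power)
    qed
  qed
  have "k > 0" using k by simp
  define R1 where "R1 = 1 + R"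
  have fst_bd: "cmod (fst (x m)) \<le> R1" if "m \<ge> N1" for m
  proof (cases "cmod (fst (x m)) \<le> 1")
    case True
    have "R \<ge> 0" using R(2)[OF that] by (rule order_trans[rotated]) simp
    then show ?thesis using True by (simp add: R1_def)
  next
    case False
    then have "cmod (fst (x m)) ^ 1 \<le> cmod (fst (x m)) ^ k" using \<open>k > 0\<close> by (intro power_increasing) auto
    then show ?thesis using R(2)[OF that] by (simp add: R1_def)
  qed
  define R2 where "R2 = R + A * R1 ^ (2 * k)"
  have Re_bd: "\<bar>Re (snd (x m))\<bar> \<le> R2" if "m \<ge> N1" for m
  proof -
    have "\<bar>P (fst (x m))\<bar> \<le> A * R1 ^ (2 * k)"
      by (rule order_trans[OF P_bound]) (use fst_bd[OF that] A in \<open>auto intro!: mult_left_mono power_mono\<close>)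
    moreover have "\<bar>\<rho> (x m)\<bar> \<le> R" using R(1)[OF that] \<rho>x[of m] by simp
    ultimately show ?thesis unfolding R2_def \<rho>_def by linarith
  qed
  have "bounded (range x)"
  proof -
    have "\<exists>Y. \<forall>m. \<bar>Im (snd (x m))\<bar> \<le> Y"
    proof (rule ccontr)
      assume "\<nexists>Y. \<forall>m. \<bar>Im (snd (x m))\<bar> \<le> Y"
      then have unb: "\<exists>m. \<bar>Im (snd (x m))\<bar> > Y" for Y by (metis not_le)
      have unb': "\<exists>m\<ge>N. \<bar>Im (snd (x m))\<bar> > Y" for Y and N
      proof -
        define Z where "Z = Max ((\<lambda>m. \<bar>Im (snd (x m))\<bar>) ` {..N})"
        obtain m where m: "\<bar>Im (snd (x m))\<bar> > max Y Z" using unb by blast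
        have "\<bar>Im (snd (x i))\<bar> \<le> Z" if "i \<le> N" for i unfolding Z_def using that by (intro Max_ge) auto
        then have "\<not> m \<le> N" using m by fastforce
        then show ?thesis using m by (intro exI[of _ m]) auto
      qed
      \<comment> \<open>The imaginary parts are dropped in order to get a bounded sequence. They can
        be restored later, because the domain is invariant under imaginary translations of
        \<open>z2\<close>, so the decaying function for the limit \<open>p\<close> may be moved to
        the height of a term.\<close>
      define q where "q n = (fst (x (n + N1)), complex_of_real (Re (snd (x (n + N1)))))" for n
      have "q n \<in> cball 0 R1 \<times> cball 0 R2" for n
        using fst_bd[of "n + N1"] Re_bd[of "n + N1"] by (simp add: q_def)
      moreover have "compact (cball (0::complex) R1 \<times> cball (0::complex) R2)" by (intro compact_Times compact_cball)
      ultimately obtain p r where r: "strict_mono r" "(q \<circ> r) \<longlonglongrightarrow> p"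
        unfolding compact_def by metis
      obtain h e D where h: "h holomorphic_on UNIV" "e holomorphic_on UNIV" "h (fst p) \<noteq> 0" "e (snd p) \<noteq> 0" "D > 0"
        and D: "\<And>z. z \<in> \<Omega> \<Longrightarrow> (1 + cmod (fst z)) ^ 4 * (1 + cmod (snd z)) ^ 4 * cmod (h (fst z) * e (snd z)) \<le> D"
        using decaying_function by metis
      have Dz: "(1 + cmod (snd z)) * cmod (h (fst z) * e (snd z)) \<le> D" if "z \<in> \<Omega>" for z
      proof -
        have "1 * (1 + cmod (snd z)) ^ 1 \<le> (1 + cmod (fst z)) ^ 4 * (1 + cmod (snd z)) ^ 4"
          by (intro mult_mono power_increasing one_le_power) auto
        then have "(1 + cmod (snd z)) * cmod (h (fst z) * e (snd z)) \<le> (1 + cmod (fst z)) ^ 4 * (1 + cmod (snd z)) ^ 4 * cmod (h (fst z) * e (snd z))"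
          by (intro mult_right_mono) auto
        then show ?thesis using D[OF that] by linarith
      qed
      define c where "c = cmod (h (fst p) * e (snd p)) / 2"
      have c: "c > 0" using h by (simp add: c_def)
      obtain N where N: "\<forall>m\<ge>N. \<forall>n\<ge>N. \<forall>F. holo_on \<Omega> F \<and> (\<forall>z\<in>\<Omega>. cmod (F z) < D + 1) \<longrightarrow> cmod (F (x m) - F (x n)) < c / 2"
        using scaled[of "c / 2" "D + 1"] c h(5) by auto
      have "((\<lambda>z. cmod (h (fst z) * e (snd z))) \<circ> (q \<circ> r)) \<longlonglongrightarrow> cmod (h (fst p) * e (snd p))"
        unfolding o_def using continuous_product[OF h(1,2)] r(2)
        by (intro tendsto_norm isCont_tendsto_compose[of p "\<lambda>z. h (fst z) * e (snd z)"]) (auto simp: continuous_on_eq_continuous_at o_def simp del: split_paired_All)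
      then have "\<forall>\<^sub>F n in sequentially. ((\<lambda>z. cmod (h (fst z) * e (snd z))) \<circ> (q \<circ> r)) n > c"
        by (rule order_tendstoD) (use c in \<open>simp add: c_def\<close>)
      then have "\<forall>\<^sub>F n in sequentially. n \<ge> N \<and> ((\<lambda>z. cmod (h (fst z) * e (snd z))) \<circ> (q \<circ> r)) n > c"
        using eventually_ge_at_top[of N] by eventually_elim auto
      then obtain n where n: "n \<ge> N" "cmod (h (fst (q (r n))) * e (snd (q (r n)))) > c"
        by (auto dest: eventually_happens simp: trivial_limit_sequentially)
      define m where "m = r n + N1"
      have "r n \<ge> n" using r(1) by (rule strict_mono_imp_increasing)
      then have mN: "m \<ge> N" using n(1) by (simp add: m_def)
      define y where "y = Im (snd (x m))"
      define F where "F z = h (fst z) * e (snd z - \<i> * of_real y)" for z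
      have e': "(\<lambda>w. e (w - \<i> * of_real y)) holomorphic_on UNIV"
        by (rule holomorphic_on_compose_gen[OF _ h(2), unfolded o_def]) (auto intro!: holomorphic_intros)
      have F: "holo_on \<Omega> F" unfolding F_def by (rule holo_on_product[OF h(1) e'])
      have Fb: "(1 + cmod (snd z - \<i> * of_real y)) * cmod (F z) \<le> D" if "z \<in> \<Omega>" for z
        using Dz[of "(fst z, snd z - \<i> * of_real y)"] that by (simp add: F_def \<Omega>_def)
      have FD: "cmod (F z) < D + 1" if "z \<in> \<Omega>" for z
      proof -
        have "1 * cmod (F z) \<le> (1 + cmod (snd z - \<i> * of_real y)) * cmod (F z)" by (intro mult_right_mono) auto
        then show ?thesis using Fb[OF that] by simp
      qed
      have "snd (x m) - \<i> * of_real y = of_real (Re (snd (x m)))" by (simp add: complex_eq_iff y_def)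
      then have Fm: "cmod (F (x m)) > c" using n(2) by (simp add: F_def q_def m_def)
      \<comment> \<open>At vertical distance \<open>2 D / c\<close> from height \<open>y\<close> the
        translated function is at most \<open>c / 2\<close>, while at \<open>x m\<close> it exceeds
        \<open>c\<close>; yet the two values should differ by less than
        \<open>c / 2\<close>.\<close>
      obtain j where j: "j \<ge> N" "\<bar>Im (snd (x j))\<bar> > 2 * D / c + \<bar>y\<bar>" using unb' by blast
      have "2 * D / c \<le> cmod (snd (x j) - \<i> * of_real y)"
        using abs_Im_le_cmod[of "snd (x j) - \<i> * of_real y"] j(2) by simp
      then have "(2 * D / c) * cmod (F (x j)) \<le> (1 + cmod (snd (x j) - \<i> * of_real y)) * cmod (F (x j))"
        by (intro mult_right_mono) auto
      also have "\<dots> \<le> D" by (rule Fb[OF x])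
      finally have Fj: "cmod (F (x j)) \<le> c / 2" using c h(5) by (simp add: field_simps)
      have "cmod (F (x m) - F (x j)) < c / 2" using N mN j(1) F FD by blast
      moreover have "cmod (F (x m)) \<le> cmod (F (x j)) + cmod (F (x m) - F (x j))" by (rule norm_triangle_sub)
      ultimately show False using Fm Fj by linarith
    qed
    then obtain Y where Y: "\<And>m. \<bar>Im (snd (x m))\<bar> \<le> Y" by blast
    have "norm (x m) \<le> R1 + (R2 + Y)" if "m \<in> {N1..}" for m
    proof -
      have "norm (x m) \<le> norm (fst (x m)) + norm (snd (x m))" by (metis norm_Pair_le prod.collapse)
      moreover have "cmod (snd (x m)) \<le> R2 + Y" using cmod_le[of "snd (x m)"] Re_bd[of m] Y[of m] that by simp
      ultimately show ?thesis using fst_bd[of m] that by simp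
    qed
    then have "bounded (x ` {N1..})" by (auto simp: bounded_iff)
    moreover have "bounded (x ` {..<N1})" by (intro finite_imp_bounded) auto
    ultimately have "bounded (x ` {N1..} \<union> x ` {..<N1})" by simp
    moreover have "{N1..} \<union> {..<N1} = UNIV" by auto
    then have "range x = x ` {N1..} \<union> x ` {..<N1}" by (metis image_Un)
    ultimately show ?thesis by simp
  qed
  then obtain q r where r: "strict_mono r" "(x \<circ> r) \<longlonglongrightarrow> q"
    using bounded_imp_convergent_subsequence by blast
  have xr: "(\<lambda>i. x (r i)) \<longlonglongrightarrow> q" using r(2) by (simp add: o_def)
  have ri: "r i \<ge> i" for i using r(1) by (rule strict_mono_imp_increasing)
  have "isCont \<rho> q" using \<rho>_cont by (simp add: continuous_on_eq_continuous_at del: split_paired_All)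
  then have "(\<lambda>i. \<rho> (x (r i))) \<longlonglongrightarrow> \<rho> q" using xr by (rule isCont_tendsto_compose)
  then have \<rho>q: "\<rho> q \<ge> 0" by (rule LIMSEQ_le_const) (use \<rho>x in \<open>auto intro: less_imp_le\<close>)
  text \<open>At a boundary point \<open>q\<close> there are uniformly bounded peak functions \<open>F\<close> with \<open>F q = 1\<close> which are
    small at any prescribed interior point.\<close>
  have "q \<in> \<Omega>"
  proof (rule ccontr)
    assume "q \<notin> \<Omega>"
    then have q0: "\<rho> q = 0" using \<rho>q mem_\<Omega>[of q] by simp
    obtain N where N: "\<forall>m\<ge>N. \<forall>n\<ge>N. \<forall>F. holo_on \<Omega> F \<and> (\<forall>z\<in>\<Omega>. cmod (F z) < 2 * C) \<longrightarrow> cmod (F (x m) - F (x n)) < 1/4"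
      using scaled[of "1/4" "2 * C"] C by auto
    \<comment> \<open>Chosen so that \<open>C * exp (- t * \<rho> (x N)) \<le> 1/2\<close>. Then
      \<open>F\<close> is at most 1/2 at \<open>x N\<close> and equals 1 at \<open>q\<close>,
      against an oscillation of at most 1/4.\<close>
    define t where "t = (\<bar>ln (2 * C)\<bar> + 1) / \<rho> (x N)"
    have t: "t > 0" using \<rho>x[of N] by (simp add: t_def add_nonneg_pos)
    obtain F where F: "holo_on \<Omega> F" "continuous_on UNIV F" "F q = 1"
      "\<And>z. cmod (F z) \<le> C * exp (- t * \<rho> z + t * \<rho> q - t * \<epsilon> * (cmod (fst z ^ k - fst q ^ k))\<^sup>2)"
      using exponential_function[OF t, of q] by metis
    have Fb: "cmod (F z) \<le> C * exp (- t * \<rho> z)" for z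
    proof (rule order_trans[OF F(4)])
      have "0 \<le> t * \<epsilon> * (cmod (fst z ^ k - fst q ^ k))\<^sup>2" using t \<epsilon> by simp
      then show "C * exp (- t * \<rho> z + t * \<rho> q - t * \<epsilon> * (cmod (fst z ^ k - fst q ^ k))\<^sup>2) \<le> C * exp (- t * \<rho> z)"
        using C q0 by simp
    qed
    have F2: "cmod (F z) < 2 * C" if "z \<in> \<Omega>" for z
    proof -
      have "t * \<rho> z > 0" using that t by (simp add: mem_\<Omega>)
      then have "C * exp (- t * \<rho> z) \<le> C * 1" using C by (intro mult_left_mono) auto
      then show ?thesis using Fb[of z] C by linarith
    qed
    have "cmod (F (x N)) \<le> C * exp (- t * \<rho> (x N))" by (rule Fb)
    also have "- t * \<rho> (x N) = - (\<bar>ln (2 * C)\<bar> + 1)" using \<rho>x[of N] by (simp add: t_def)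
    also have "C * exp (- (\<bar>ln (2 * C)\<bar> + 1)) \<le> C * exp (- ln (2 * C))" using C by simp
    also have "\<dots> = 1/2" using C by (simp add: exp_minus)
    finally have FN: "cmod (F (x N)) \<le> 1/2" .
    have "(\<lambda>i. cmod (F (x (r i)) - F (x N))) \<longlonglongrightarrow> cmod (F q - F (x N))"
      using F(2) by (intro tendsto_norm tendsto_diff isCont_tendsto_compose[of q F, OF _ xr] tendsto_const) (simp add: continuous_on_eq_continuous_at del: split_paired_All)
    moreover have "cmod (F (x (r i)) - F (x N)) \<le> 1/4" if "i \<ge> N" for i
      using N F F2 that ri[of i] by (meson le_trans less_imp_le order_refl)
    ultimately have "cmod (F q - F (x N)) \<le> 1/4" by (intro LIMSEQ_le_const2) auto
    moreover have "1 \<le> cmod (F (x N)) + cmod (F q - F (x N))" using norm_triangle_sub[of "F q" "F (x N)"] F(3) by simp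
    ultimately show False using FN by linarith
  qed
  have conv: "(\<lambda>n. F (x n)) \<longlonglongrightarrow> F q" if F: "holo_on \<Omega> F" "M > 0" "\<And>z. z \<in> \<Omega> \<Longrightarrow> cmod (F z) < M" for F M
  proof -
    have "Cauchy (\<lambda>n. F (x n))"
      unfolding Cauchy_def dist_norm using scaled F by meson
    then obtain l where l: "(\<lambda>n. F (x n)) \<longlonglongrightarrow> l" using Cauchy_convergent_iff convergent_def by metis
    then have "(\<lambda>i. F (x (r i))) \<longlonglongrightarrow> l" using LIMSEQ_subseq_LIMSEQ[OF l r(1)] by (simp add: o_def)
    moreover have "isCont F q" using holo_on_continuous[OF F(1)] \<open>q \<in> \<Omega>\<close> open_\<Omega> by (simp add: continuous_on_eq_continuous_at)
    then have "(\<lambda>i. F (x (r i))) \<longlonglongrightarrow> F q" using xr by (rule isCont_tendsto_compose)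
    ultimately show ?thesis using l LIMSEQ_unique by blast
  qed
  obtain F M where F: "holo_on \<Omega> F" "F q \<noteq> 0" "M > 0" "\<And>z. z \<in> \<Omega> \<Longrightarrow> cmod (F z) < M"
    "\<And>z. z \<in> \<Omega> \<Longrightarrow> cmod ((fst z - fst q) * F z) < M"
    "\<And>z. z \<in> \<Omega> \<Longrightarrow> cmod ((snd z - snd q) * F z) < M"
    using coordinate_functions[OF \<open>q \<in> \<Omega>\<close>] by metis
  have id: "(\<lambda>x. x - a) holomorphic_on UNIV" for a :: complex by (intro holomorphic_intros)
  \<comment> \<open>Since \<open>F q\<close> is nonzero, dividing by \<open>F (x n)\<close> recovers
    each coordinate of \<open>x n\<close>; this gives convergence of the whole sequence and not only
    of the subsequence.\<close>
  have F0: "(\<lambda>n. F (x n)) \<longlonglongrightarrow> F q" by (rule conv[OF F(1,3,4)])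
  have "(\<lambda>n. (fst (x n) - fst q) * F (x n)) \<longlonglongrightarrow> (fst q - fst q) * F q"
    by (rule conv[OF holo_on_mult[OF holo_on_fst[OF id] F(1)] F(3,5)])
  then have "(\<lambda>n. (fst (x n) - fst q) * F (x n) / F (x n) + fst q) \<longlonglongrightarrow> (fst q - fst q) * F q / F q + fst q"
    by (intro tendsto_add tendsto_divide F0 F(2) tendsto_const)
  moreover have "\<forall>\<^sub>F n in sequentially. F (x n) \<noteq> 0" using tendsto_imp_eventually_ne[OF F0 F(2)] .
  then have "\<forall>\<^sub>F n in sequentially. (fst (x n) - fst q) * F (x n) / F (x n) + fst q = fst (x n)" by eventually_elim auto
  ultimately have 1: "(\<lambda>n. fst (x n)) \<longlonglongrightarrow> fst q" by (simp add: tendsto_cong)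
  have "(\<lambda>n. (snd (x n) - snd q) * F (x n)) \<longlonglongrightarrow> (snd q - snd q) * F q"
    by (rule conv[OF holo_on_mult[OF holo_on_snd[OF id] F(1)] F(3,6)])
  then have "(\<lambda>n. (snd (x n) - snd q) * F (x n) / F (x n) + snd q) \<longlonglongrightarrow> (snd q - snd q) * F q / F q + snd q"
    by (intro tendsto_add tendsto_divide F0 F(2) tendsto_const)
  moreover have "\<forall>\<^sub>F n in sequentially. F (x n) \<noteq> 0" using tendsto_imp_eventually_ne[OF F0 F(2)] .
  then have "\<forall>\<^sub>F n in sequentially. (snd (x n) - snd q) * F (x n) / F (x n) + snd q = snd (x n)" by eventually_elim auto
  ultimately have 2: "(\<lambda>n. snd (x n)) \<longlonglongrightarrow> snd q" by (simp add: tendsto_cong)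
  have "x \<longlonglongrightarrow> q" using tendsto_Pair[OF 1 2] by simp
  then show ?thesis using \<open>q \<in> \<Omega>\<close> by blast
qed

lemma carath_complete_\<Omega>: "metric_complete \<Omega> (carath \<Omega>)"
proof (rule metric_completeI[OF open_\<Omega> order_refl])
  fix p assume p: "p \<in> \<Omega>"
  then obtain r where r: "r > 0" "ball p r \<subseteq> \<Omega>" using open_\<Omega> open_contains_ball by blast
  have "carath \<Omega> z v \<le> ennreal (4 / r * norm v)" if z: "z \<in> ball p (r / 2)" for z v
  proof -
    have "ball z (r / 2) \<subseteq> \<Omega>"
    proof
      fix w assume "w \<in> ball z (r / 2)"
      then have "dist p w < r" using z dist_triangle[of p w z] by simp
      then show "w \<in> \<Omega>" using r by auto
    qed
    then have "carath \<Omega> z v \<le> ennreal (2 / (r / 2) * norm v)" using r by (intro carath_upper) auto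
    then show ?thesis by simp
  qed
  moreover have "ball p (r / 2) \<subseteq> \<Omega>" using r by auto
  ultimately show "\<exists>r>0. \<exists>C. ball p r \<subseteq> \<Omega> \<and> (\<forall>z\<in>ball p r. \<forall>v. carath \<Omega> z v \<le> ennreal (C * norm v))"
    using r(1) by (intro exI[of _ "r / 2"] conjI exI[of _ "4 / r"]) (auto simp del: split_paired_All)
qed (rule carath_cauchy_converges)

end

section \<open>Mean values, locally uniform limits and series of holomorphic functions\<close>

text \<open>The coordinate isometry \<open>T\<close> carries the measure to \<open>real^4\<close>,
  where the rotation becomes an orthogonal transformation and preserves volumes. Both transports are
  checked on boxes.\<close>

lemma distr_cscale:
  assumes \<omega>: "cmod \<omega> = 1"
  shows "distr lborel borel (cscale \<omega>) = (lborel :: c2 measure)"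
proof -
  define T :: "real^4 \<Rightarrow> c2" where "T x = (Complex (x$1) (x$2), Complex (x$3) (x$4))" for x
  define T' :: "c2 \<Rightarrow> real^4" where "T' z = (\<chi> i. if i = 1 then Re (fst z) else if i = 2 then Im (fst z)
      else if i = 3 then Re (snd z) else Im (snd z))" for z
  have T'_nth [simp]: "T' z $ 1 = Re (fst z)" "T' z $ 2 = Im (fst z)" "T' z $ 3 = Re (snd z)" "T' z $ 4 = Im (snd z)" for z
    by (simp_all add: T'_def)
  have T'T: "T' (T x) = x" and TT': "T (T' z) = z" for x z
    by (auto simp: T_def vec_eq_iff forall_4 prod_eq_iff complex_eq_iff)
  have linT: "linear T"
    by (rule linearI) (auto simp: T_def complex_eq_iff prod_eq_iff)
  have linT': "linear T'"
    by (rule linearI) (auto simp: vec_eq_iff forall_4)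
  have mT [measurable]: "T \<in> borel_measurable borel"
    using linT by (intro borel_measurable_continuous_onI linear_continuous_on) (simp add: linear_linear)
  have mT' [measurable]: "T' \<in> borel_measurable borel"
    using linT' by (intro borel_measurable_continuous_onI linear_continuous_on) (simp add: linear_linear)
  have mS [measurable]: "cscale a \<in> borel_measurable borel" for a
    by (intro borel_measurable_continuous_onI) (auto simp: cscale_def[abs_def] intro!: continuous_intros)
  have normT: "norm (T x) = norm x" for x
    by (simp add: T_def norm_prod_def norm_vec_def L2_set_def sum_4 cmod_power2)
  have normT': "norm (T' z) = norm z" for z
    using normT[of "T' z"] by (simp add: TT')
  have dT: "distr lborel borel T = lborel"
  proof (rule lborel_eqI[symmetric])
    fix l u :: c2 assume le: "\<And>b. b \<in> Basis \<Longrightarrow> l \<bullet> b \<le> u \<bullet> b"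
    have B: "(Basis :: c2 set) = {(1, 0), (\<i>, 0), (0, 1), (0, \<i>)}"
      by (auto simp: Basis_prod_def Basis_complex_def)
    have B4: "(Basis :: (real^4) set) = {axis 1 1, axis 2 1, axis 3 1, axis 4 1}"
      by (auto simp: Basis_vec_def UNIV_4)
    have eq: "T -` box l u = box (T' l) (T' u)"
      by (auto simp: box_def B T_def B4 inner_axis inner_complex_def inner_prod_def)
    have "T' l \<bullet> b \<le> T' u \<bullet> b" if "b \<in> Basis" for b
      using that le[of "(1, 0)"] le[of "(\<i>, 0)"] le[of "(0, 1)"] le[of "(0, \<i>)"]
      by (auto simp: B4 B inner_axis inner_complex_def inner_prod_def)
    then have "emeasure lborel (box (T' l) (T' u)) = (\<Prod>b\<in>Basis. (T' u - T' l) \<bullet> b)"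
      by (rule emeasure_lborel_box)
    also have "(\<Prod>b\<in>Basis. (T' u - T' l) \<bullet> b) = (\<Prod>b\<in>Basis. (u - l) \<bullet> b)"
      by (simp add: B4 B axis_eq_axis inner_axis inner_complex_def inner_prod_def complex_eq_iff)
    finally show "emeasure (distr lborel borel T) (box l u) = (\<Prod>b\<in>Basis. (u - l) \<bullet> b)"
      by (simp add: emeasure_distr eq)
  qed simp
  define R where "R a x = T' (cscale a (T x))" for a x
  have RR: "R (cnj \<omega>) (R \<omega> x) = x" "R \<omega> (R (cnj \<omega>) x) = x" for x
    using \<omega> by (simp_all add: R_def TT' T'T complex_norm_square[symmetric] mult.commute flip: cscale_mult)
      (simp_all add: cscale_def T'T)
  have linR: "linear (R a)" for a
    unfolding R_def[abs_def]
    by (rule linear_compose[OF linT, unfolded o_def], rule linear_compose[OF _ linT', unfolded o_def], rule linearI)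
      (auto simp: cscale_def algebra_simps)
  have orth: "orthogonal_transformation (R (cnj \<omega>))"
    unfolding orthogonal_transformation using linR \<omega> by (simp add: R_def normT normT' norm_cscale)
  have mR [measurable]: "R a \<in> borel_measurable borel" for a unfolding R_def[abs_def] by measurable
  have dR: "distr lborel borel (R \<omega>) = lborel"
  proof (rule lborel_eqI[symmetric])
    fix l u :: "real^4" assume le: "\<And>b. b \<in> Basis \<Longrightarrow> l \<bullet> b \<le> u \<bullet> b"
    have eq: "R \<omega> -` box l u = R (cnj \<omega>) ` box l u" (is "?A = ?B")
    proof
      show "?A \<subseteq> ?B" using RR by (metis image_eqI subsetI vimageE)
    qed (use RR in auto)
    have bx: "box l u \<in> lmeasurable" by simp
    have "emeasure lborel (R \<omega> -` box l u) = emeasure lebesgue (R (cnj \<omega>) ` box l u)"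
      unfolding eq[symmetric] using measurable_sets_borel[OF mR, of "box l u"] by simp
    also have "\<dots> = measure lebesgue (R (cnj \<omega>) ` box l u)"
      using measurable_orthogonal_image[OF orth bx] by (simp add: emeasure_eq_measure2)
    also have "\<dots> = measure lebesgue (box l u)"
      by (simp add: measure_orthogonal_image[OF orth bx])
    also have "\<dots> = (\<Prod>b\<in>Basis. (u - l) \<bullet> b)" using le by (simp add: measure_lborel_box)
    finally show "emeasure (distr lborel borel (R \<omega>)) (box l u) = (\<Prod>b\<in>Basis. (u - l) \<bullet> b)"
      by (simp add: emeasure_distr)
  qed simp
  have "distr lborel borel (cscale \<omega>) = distr (distr lborel borel T) borel (cscale \<omega>)" by (simp add: dT)
  also have "\<dots> = distr lborel borel (\<lambda>x. cscale \<omega> (T x))" by (subst distr_distr) (auto simp: o_def)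
  also have "\<dots> = distr lborel borel (\<lambda>x. T (R \<omega> x))" by (simp add: R_def TT')
  also have "\<dots> = distr (distr lborel borel (R \<omega>)) borel T" by (subst distr_distr) (auto simp: o_def)
  finally show ?thesis by (simp add: dR dT)
qed

text \<open>Averaging the circular mean value inequality over \<open>p + \<omega>(z - p)\<close>, \<open>|\<omega>| = 1\<close>, uses only that Lebesgue measure
  is invariant under these rotations.\<close>
lemma holo_on_submean:
  assumes f: "holo_on W f" "f \<in> borel_measurable borel" and W: "cball p r \<subseteq> W"
  shows "ennreal ((cmod (f p))\<^sup>2) * emeasure lborel (cball (0::c2) r)
    \<le> (\<integral>\<^sup>+ z. indicator (cball p r) z * ennreal ((cmod (f z))\<^sup>2) \<partial>lborel)"
proof -
  define u where "u z = ennreal ((cmod (f z))\<^sup>2)" for z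
  note f(2)[measurable]
  have um [measurable]: "u \<in> borel_measurable borel" unfolding u_def[abs_def] by measurable
  have circ: "u p \<le> (\<integral>\<^sup>+ t. indicator {0..1::real} t * u (p + cscale (cis (2 * pi * t)) z) \<partial>lborel)"
    if z: "z \<in> cball 0 r" for z
  proof -
    \<comment> \<open>The square of \<open>f\<close> on the complex line through \<open>p\<close>
      and \<open>p + z\<close>. Cauchy's formula on the unit circle for this holomorphic function
      gives the mean value inequality for \<open>|f|^2\<close>.\<close>
    define g where "g \<zeta> = (f (p + cscale \<zeta> z))\<^sup>2" for \<zeta>
    have inW: "p + cscale \<zeta> z \<in> W" if "cmod \<zeta> \<le> 1" for \<zeta>
    proof -
      have "cmod \<zeta> * norm z \<le> 1 * r" using that z by (intro mult_mono) auto
      then show ?thesis using W by (auto simp: dist_norm norm_cscale)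
    qed
    have hol: "g holomorphic_on cball 0 1"
      unfolding holomorphic_on_def field_differentiable_def g_def
    proof
      fix \<zeta> :: complex assume "\<zeta> \<in> cball 0 1"
      then have "((\<lambda>\<zeta>. f (p + cscale \<zeta> z)) has_field_derivative frechet_derivative f (at (p + cscale \<zeta> z)) z) (at \<zeta>)"
        by (intro holo_on_line[OF f(1)] inW) auto
      from DERIV_power[OF this, of 2] show "\<exists>f'. ((\<lambda>\<zeta>. (f (p + cscale \<zeta> z))\<^sup>2) has_field_derivative f') (at \<zeta> within cball 0 1)"
        using has_field_derivative_at_within by blast
    qed
    have "((\<lambda>u. g u / (u - 0)) has_contour_integral (2 * of_real pi * \<i> * g 0)) (circlepath 0 1)"
      by (rule Cauchy_integral_circlepath_simple[OF hol]) auto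
    then have "((\<lambda>t. g (exp (2 * of_real pi * \<i> * of_real t)) / exp (2 * of_real pi * \<i> * of_real t) *
       (2 * of_real pi * \<i> * exp (2 * of_real pi * \<i> * of_real t))) has_integral (2 * of_real pi * \<i> * g 0)) {0..1}"
      unfolding has_contour_integral_def
      by (rule has_integral_eq[rotated]) (simp add: vector_derivative_circlepath01, simp add: circlepath)
    then have I: "((\<lambda>t. (2 * of_real pi * \<i>) * g (cis (2 * pi * t))) has_integral (2 * of_real pi * \<i> * g 0)) {0..1}"
      by (rule has_integral_eq[rotated]) (simp add: cis_conv_exp mult_ac)
    have "((\<lambda>t. (1 / (2 * of_real pi * \<i>)) * ((2 * of_real pi * \<i>) * g (cis (2 * pi * t)))) has_integral (1 / (2 * of_real pi * \<i>)) * (2 * of_real pi * \<i> * g 0)) {0..1}"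
      by (rule has_integral_mult_right[OF I])
    then have I: "((\<lambda>t. g (cis (2 * pi * t))) has_integral g 0) {0..1}" by simp
    have cont: "continuous_on {0..1} (\<lambda>t. g (cis (2 * pi * t)))"
      by (intro continuous_on_compose2[OF holomorphic_on_imp_continuous_on[OF hol]] continuous_intros) auto
    have "cmod (g 0) = cmod (integral {0..1} (\<lambda>t. g (cis (2 * pi * t))))" using I by (simp add: integral_unique)
    also have "\<dots> \<le> integral {0..1} (\<lambda>t. cmod (g (cis (2 * pi * t))))"
      by (rule integral_norm_bound_integral) (use I cont in \<open>auto intro!: integrable_continuous_interval continuous_intros\<close>)
    finally have "ennreal (cmod (g 0)) \<le> ennreal (integral {0..1} (\<lambda>t. cmod (g (cis (2 * pi * t)))))" by (rule ennreal_leI)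
    also have "\<dots> = (\<integral>\<^sup>+ t. ennreal (cmod (g (cis (2 * pi * t)))) * indicator {0..1} t \<partial>lborel)"
    proof (rule nn_integral_has_integral_lebesgue'[symmetric])
      show "((\<lambda>t. cmod (g (cis (2 * pi * t)))) has_integral integral {0..1} (\<lambda>t. cmod (g (cis (2 * pi * t))))) {0..1}"
        using cont by (intro integrable_integral integrable_continuous_interval continuous_intros)
    qed auto
    finally show ?thesis by (simp add: g_def u_def norm_power mult.commute)
  qed
  have mpair [measurable]: "(\<lambda>(z::c2, t::real). p + cscale (cis (2 * pi * t)) z) \<in> borel_measurable (borel \<Otimes>\<^sub>M borel)"
    unfolding borel_prod
    by (intro borel_measurable_continuous_onI) (auto simp: cscale_def[abs_def] split_beta cis_conv_exp intro!: continuous_intros)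
  have mS [measurable]: "cscale a \<in> borel_measurable borel" for a
    by (intro borel_measurable_continuous_onI) (auto simp: cscale_def[abs_def] intro!: continuous_intros)
  have ind [measurable]: "(indicator (cball q r) :: c2 \<Rightarrow> ennreal) \<in> borel_measurable borel" for q
    by (intro borel_measurable_indicator borel_closed closed_cball)
  have "u p * emeasure lborel (cball (0::c2) r) = (\<integral>\<^sup>+ z. u p * indicator (cball (0::c2) r) z \<partial>lborel)"
    by (simp add: nn_integral_cmult_indicator)
  also have "\<dots> \<le> (\<integral>\<^sup>+ z. (\<integral>\<^sup>+ t. indicator (cball 0 r) z * (indicator {0..1::real} t * u (p + cscale (cis (2 * pi * t)) z)) \<partial>lborel) \<partial>lborel)"
    using circ by (intro nn_integral_mono) (auto simp: indicator_def)
  also have "\<dots> = (\<integral>\<^sup>+ t. (\<integral>\<^sup>+ z. indicator (cball 0 r) z * (indicator {0..1::real} t * u (p + cscale (cis (2 * pi * t)) z)) \<partial>lborel) \<partial>lborel)"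
  proof (rule lborel_pair.Fubini'[symmetric])
    have "(\<lambda>x::c2 \<times> real. u (p + cscale (cis (2 * pi * snd x)) (fst x))) \<in> borel_measurable (borel \<Otimes>\<^sub>M borel)"
      using measurable_compose[OF mpair um] by (simp add: split_beta)
    moreover have "(\<lambda>x::c2 \<times> real. indicator (cball 0 r) (fst x) :: ennreal) \<in> borel_measurable (borel \<Otimes>\<^sub>M borel)"
      by (rule measurable_compose[OF measurable_fst]) (intro borel_measurable_indicator borel_closed closed_cball)
    moreover have "(\<lambda>x::c2 \<times> real. indicator {0..1} (snd x) :: ennreal) \<in> borel_measurable (borel \<Otimes>\<^sub>M borel)"
      by (rule measurable_compose[OF measurable_snd]) (intro borel_measurable_indicator borel_closed closed_real_atLeastAtMost)
    ultimately have "(\<lambda>(z::c2, t). indicator (cball 0 r) z * (indicator {0..1::real} t * u (p + cscale (cis (2 * pi * t)) z))) \<in> borel_measurable (borel \<Otimes>\<^sub>M borel)"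
      unfolding split_beta by (intro borel_measurable_times_ennreal)
    then show "(\<lambda>(z::c2, t). indicator (cball 0 r) z * (indicator {0..1::real} t * u (p + cscale (cis (2 * pi * t)) z))) \<in> borel_measurable (lborel \<Otimes>\<^sub>M lborel)"
      by (simp cong: measurable_cong_sets sets_pair_measure_cong)
  qed
  also have "\<dots> = (\<integral>\<^sup>+ t. indicator {0..1::real} t * (\<integral>\<^sup>+ z. indicator (cball 0 r) z * u (p + z) \<partial>lborel) \<partial>lborel)"
  proof (rule nn_integral_cong)
    fix t :: real
    define \<omega> where "\<omega> = cis (2 * pi * t)"
    have "(\<integral>\<^sup>+ z. indicator (cball 0 r) z * (indicator {0..1::real} t * u (p + cscale \<omega> z)) \<partial>lborel)
      = indicator {0..1::real} t * (\<integral>\<^sup>+ z. indicator (cball 0 r) z * u (p + cscale \<omega> z) \<partial>lborel)"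
      by (subst nn_integral_cmult[symmetric]) (auto simp: mult_ac)
    also have "(\<integral>\<^sup>+ z. indicator (cball 0 r) z * u (p + cscale \<omega> z) \<partial>lborel)
       = (\<integral>\<^sup>+ z. indicator (cball 0 r) (cscale \<omega> z) * u (p + cscale \<omega> z) \<partial>lborel)"
      by (simp add: indicator_def norm_cscale \<omega>_def)
    also have "\<dots> = (\<integral>\<^sup>+ z. indicator (cball 0 r) z * u (p + z) \<partial>distr lborel borel (cscale \<omega>))"
      by (subst nn_integral_distr) auto
    also have "distr lborel borel (cscale \<omega>) = lborel" by (rule distr_cscale) (simp add: \<omega>_def)
    finally show "(\<integral>\<^sup>+ z. indicator (cball 0 r) z * (indicator {0..1::real} t * u (p + cscale (cis (2 * pi * t)) z)) \<partial>lborel)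
      = indicator {0..1::real} t * (\<integral>\<^sup>+ z. indicator (cball 0 r) z * u (p + z) \<partial>lborel)" by (simp add: \<omega>_def)
  qed
  also have "\<dots> = (\<integral>\<^sup>+ z. indicator (cball 0 r) z * u (p + z) \<partial>lborel)"
    by (subst nn_integral_multc) auto
  also have "\<dots> = (\<integral>\<^sup>+ z. indicator (cball p r) (p + z) * u (p + z) \<partial>lborel)"
    by (simp add: indicator_def dist_norm)
  also have "\<dots> = (\<integral>\<^sup>+ z. indicator (cball p r) z * u z \<partial>distr lborel borel ((+) p))"
    by (subst nn_integral_distr) auto
  finally show ?thesis by (simp add: lborel_distr_plus u_def)
qed

section \<open>Derivative rules and locally uniform limits\<close>

lemma holo_on_frechet_add:
  assumes "holo_on W f" "holo_on W g" "z \<in> W"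
  shows "frechet_derivative (\<lambda>z. f z + g z) (at z) v = frechet_derivative f (at z) v + frechet_derivative g (at z) v"
  by (rule fun_cong[OF frechet_derivative_at[OF has_derivative_add[OF holo_onD(1)[OF assms(1,3)] holo_onD(1)[OF assms(2,3)]]], symmetric])

lemma holo_on_frechet_mult:
  assumes "holo_on W f" "holo_on W g" "z \<in> W"
  shows "frechet_derivative (\<lambda>z. f z * g z) (at z) v = f z * frechet_derivative g (at z) v + frechet_derivative f (at z) v * g z"
  by (rule fun_cong[OF frechet_derivative_at[OF has_derivative_mult[OF holo_onD(1)[OF assms(1,3)] holo_onD(1)[OF assms(2,3)]]], symmetric])

lemma holo_on_cmult:
  assumes "holo_on W f"
  shows "holo_on W (\<lambda>z. c * f z)"
  by (rule holo_on_mult[OF holo_on_const assms])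

lemma holo_on_frechet_cmult:
  assumes "holo_on W f" "z \<in> W"
  shows "frechet_derivative (\<lambda>z. c * f z) (at z) v = c * frechet_derivative f (at z) v"
  using holo_on_frechet_mult[OF holo_on_const assms, of c v] by simp

lemma holo_on_diff:
  assumes "holo_on W f" "holo_on W g"
  shows "holo_on W (\<lambda>z. f z - g z)"
  using holo_on_add[OF assms(1) holo_on_cmult[OF assms(2), of "-1"]] by simp

lemma holo_on_frechet_diff:
  assumes "holo_on W f" "holo_on W g" "z \<in> W"
  shows "frechet_derivative (\<lambda>z. f z - g z) (at z) v = frechet_derivative f (at z) v - frechet_derivative g (at z) v"
  using holo_on_frechet_add[OF assms(1) holo_on_cmult[OF assms(2), of "-1"] assms(3)]
  by (simp add: holo_on_frechet_cmult[OF assms(2,3)] del: mult_minus1) (simp add: holo_on_frechet_cmult[OF assms(2,3), of "-1", simplified])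

lemma holo_on_frechet_sum:
  assumes "\<And>i. i \<in> I \<Longrightarrow> holo_on W (f i)" "z \<in> W"
  shows "frechet_derivative (\<lambda>z. \<Sum>i\<in>I. f i z) (at z) v = (\<Sum>i\<in>I. frechet_derivative (f i) (at z) v)"
proof -
  have "((\<lambda>z. \<Sum>i\<in>I. f i z) has_derivative (\<lambda>v. \<Sum>i\<in>I. frechet_derivative (f i) (at z) v)) (at z)"
    using assms by (intro has_derivative_sum holo_onD(1))
  from fun_cong[OF frechet_derivative_at[OF this], symmetric] show ?thesis .
qed

lemma holo_on_linear:
  assumes "holo_on W f" "z \<in> W"
  shows "frechet_derivative f (at z) (v + w) = frechet_derivative f (at z) v + frechet_derivative f (at z) w"
  using has_derivative_linear[OF holo_onD(1)[OF assms]] by (rule linear_add)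

lemma holo_on_local:
  assumes "\<And>p. p \<in> W \<Longrightarrow> \<exists>r>0. holo_on (ball p r) f"
  shows "holo_on W f"
  unfolding holo_on_def
proof
  fix p assume "p \<in> W"
  then obtain r where "r > 0" "holo_on (ball p r) f" using assms by blast
  then show "\<exists>L. (f has_derivative L) (at p) \<and> (\<forall>c v. L (cscale c v) = c * L v)"
    by (auto simp: holo_on_def)
qed

text \<open>Cauchy estimates make the derivatives uniformly Cauchy on the half ball, so limit and
  derivative may be exchanged there; complex linearity passes to the limit.\<close>

lemma holo_on_uniform_limit:
  assumes F: "\<And>n. holo_on (ball p r) (F n)" and r: "r > 0"
    and lim: "\<And>z. z \<in> ball p r \<Longrightarrow> (\<lambda>n. F n z) \<longlonglongrightarrow> f z"
    and unif: "\<And>e. e > 0 \<Longrightarrow> \<exists>N. \<forall>n\<ge>N. \<forall>m\<ge>N. \<forall>z\<in>ball p r. cmod (F n z - F m z) \<le> e"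
  shows "holo_on (ball p (r/2)) f"
    and "(\<lambda>n. frechet_derivative (F n) (at p) v) \<longlonglongrightarrow> frechet_derivative f (at p) v"
proof -
  define S where "S = ball p (r/2)"
  have S: "open S" "convex S" "p \<in> S" "S \<subseteq> ball p r" using r by (auto simp: S_def)
  define D where "D n x h = frechet_derivative (F n) (at x) h" for n x h
  \<comment> \<open>A bound \<open>e * r / 4\<close> on balls of radius \<open>r / 2\<close> becomes
    \<open>2 * (e * r / 4) / (r / 2) = e\<close> for the derivatives.\<close>
  have dist: "cmod (D n x h - D m x h) \<le> e * norm h"
    if x: "x \<in> S" and e: "\<forall>z\<in>ball p r. cmod (F n z - F m z) \<le> e * r / 4" for n m x h e
  proof -
    have sub: "ball x (r/2) \<subseteq> ball p r" using x by (auto simp: S_def ball_subset_ball_iff dist_commute)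
    have "cmod (frechet_derivative (\<lambda>z. F n z - F m z) (at x) h) \<le> 2 * (e * r / 4) * norm h / (r/2)"
      by (rule holo_on_derivative_bound[OF holo_on_diff[OF F F] sub]) (use sub e r in auto)
    moreover have "frechet_derivative (\<lambda>z. F n z - F m z) (at x) h = D n x h - D m x h"
      unfolding D_def by (rule holo_on_frechet_diff[OF F F]) (use x S(4) in blast)
    ultimately show ?thesis using r by simp
  qed
  have cau: "\<exists>N. \<forall>n\<ge>N. \<forall>m\<ge>N. \<forall>x\<in>S. \<forall>h. cmod (D n x h - D m x h) \<le> e * norm h" if "e > 0" for e
  proof -
    have "e * r / 4 > 0" using that r by simp
    from unif[OF this] show ?thesis using dist by meson
  qed
  have CD: "Cauchy (\<lambda>n. D n x h)" if x: "x \<in> S" for x h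
  proof (rule metric_CauchyI)
    fix e :: real assume e: "e > 0"
    then have "e / (2 * (norm h + 1)) > 0" by (simp add: add_nonneg_pos)
    from cau[OF this] obtain N where N: "\<forall>n\<ge>N. \<forall>m\<ge>N. cmod (D n x h - D m x h) \<le> e / (2 * (norm h + 1)) * norm h"
      using x by blast
    have "0 < norm h + 1" by (simp add: add_nonneg_pos)
    moreover have "e * norm h < e * (2 * (norm h + 1))" using e by (intro mult_strict_left_mono) (auto simp: add_nonneg_pos)
    ultimately have "e / (2 * (norm h + 1)) * norm h < e"
      by (simp add: divide_less_eq)
    then show "\<exists>M. \<forall>m\<ge>M. \<forall>n\<ge>M. dist (D m x h) (D n x h) < e"
      using N by (intro exI[of _ N]) (auto simp: dist_norm intro: le_less_trans)
  qed
  have conv: "(\<lambda>n. D n x h) \<longlonglongrightarrow> lim (\<lambda>n. D n x h)" if "x \<in> S" for x h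
  proof -
    have "Cauchy (\<lambda>n. D n x h)" by (rule CD[OF that])
    then have "convergent (\<lambda>n. D n x h)" by (rule Cauchy_convergent)
    then show ?thesis unfolding convergent_LIMSEQ_iff .
  qed
  define g' where "g' x h = lim (\<lambda>n. D n x h)" for x h
  have "\<exists>g. \<forall>x\<in>S. (\<lambda>n. F n x) \<longlonglongrightarrow> g x \<and> (g has_derivative g' x) (at x within S)"
  proof (rule has_derivative_sequence[where f = F and f' = D and g' = g' and l = "f p", OF S(2) _ _ S(3)])
    show "(F n has_derivative D n x) (at x within S)" if "x \<in> S" for n x
      unfolding D_def by (rule has_derivative_at_withinI, rule holo_onD(1)[OF F subsetD[OF S(4) that]])
    show "\<forall>\<^sub>F n in sequentially. \<forall>x\<in>S. \<forall>h. cmod (D n x h - g' x h) \<le> e * norm h" if e: "e > 0" for e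
    proof -
      from cau[OF e] obtain N where N: "\<forall>n\<ge>N. \<forall>m\<ge>N. \<forall>x\<in>S. \<forall>h. cmod (D n x h - D m x h) \<le> e * norm h" by blast
      have "cmod (D n x h - g' x h) \<le> e * norm h" if "n \<ge> N" "x \<in> S" for n x h
      proof (rule tendsto_le[OF _ tendsto_const])
        show "(\<lambda>m. cmod (D n x h - D m x h)) \<longlonglongrightarrow> cmod (D n x h - g' x h)"
          unfolding g'_def by (intro tendsto_intros conv that)
        show "\<forall>\<^sub>F m in sequentially. cmod (D n x h - D m x h) \<le> e * norm h"
          unfolding eventually_sequentially using N that by blast
      qed simp
      then show ?thesis unfolding eventually_sequentially by blast
    qed
    show "(\<lambda>n. F n p) \<longlonglongrightarrow> f p" using lim r by simp
  qed
  then obtain g where g: "\<And>x. x \<in> S \<Longrightarrow> (\<lambda>n. F n x) \<longlonglongrightarrow> g x"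
    "\<And>x. x \<in> S \<Longrightarrow> (g has_derivative g' x) (at x within S)" by blast
  have gf: "g x = f x" if "x \<in> S" for x
    using LIMSEQ_unique[OF g(1)[OF that] lim] that S(4) by auto
  have fd: "(f has_derivative g' x) (at x)" if "x \<in> S" for x
  proof (rule has_derivative_transform_within_open[OF _ S(1) that gf])
    show "(g has_derivative g' x) (at x)" using g(2)[OF that] at_within_open[OF that S(1)] by simp
  qed
  have lin: "g' x (cscale c h) = c * g' x h" if "x \<in> S" for x c h
  proof (rule LIMSEQ_unique)
    show "(\<lambda>n. D n x (cscale c h)) \<longlonglongrightarrow> g' x (cscale c h)" unfolding g'_def by (rule conv[OF that])
    have "D n x (cscale c h) = c * D n x h" for n
      unfolding D_def by (rule holo_onD(2)[OF F subsetD[OF S(4) that]])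
    then show "(\<lambda>n. D n x (cscale c h)) \<longlonglongrightarrow> c * g' x h"
      unfolding g'_def using tendsto_mult_left[OF conv[OF that]] by simp
  qed
  show "holo_on (ball p (r/2)) f" unfolding holo_on_def S_def[symmetric] using fd lin by blast
  have "frechet_derivative f (at p) = g' p" using frechet_derivative_at[OF fd[OF S(3)]] by simp
  then show "(\<lambda>n. frechet_derivative (F n) (at p) v) \<longlonglongrightarrow> frechet_derivative f (at p) v"
    using conv[OF S(3)] by (simp add: D_def g'_def)
qed

text \<open>First order Taylor expansion on the complex line. Cauchy's inequality with radius
  \<open>R / (2 |v|)\<close> bounds the second derivative by \<open>2 M (2 |v| / R)^2\<close>,
  whence the 8.\<close>

lemma holo_on_difference_quotient:
  assumes f: "holo_on (ball p R) f" and R: "R > 0" and M: "\<And>w. w \<in> ball p R \<Longrightarrow> cmod (f w) \<le> M"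
    and h: "h \<noteq> 0" "cmod h * norm v < R / 2"
  shows "cmod ((f (p + cscale h v) - f p) / h - frechet_derivative f (at p) v) \<le> 8 * M * (norm v)\<^sup>2 * cmod h / R\<^sup>2"
proof -
  define q where "q \<zeta> = f (p + cscale \<zeta> v)" for \<zeta>
  define S where "S = {\<zeta>. cmod \<zeta> * norm v < R}"
  define S' where "S' = {\<zeta>. cmod \<zeta> * norm v < R / 2}"
  have inb: "p + cscale \<zeta> v \<in> ball p R" if "\<zeta> \<in> S" for \<zeta> using that by (simp add: S_def dist_norm norm_cscale)
  have S: "open S" unfolding S_def by (intro open_Collect_less continuous_intros)
  have qd: "(q has_field_derivative frechet_derivative f (at (p + cscale \<zeta> v)) v) (at \<zeta>)" if "\<zeta> \<in> S" for \<zeta>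
    unfolding q_def by (rule holo_on_line[OF f inb[OF that]])
  have hol: "q holomorphic_on S"
    unfolding holomorphic_on_def field_differentiable_def using qd has_field_derivative_at_within by blast
  have zero: "0 \<in> S" "0 \<in> S'" "h \<in> S'" using R h by (auto simp: S_def S'_def)
  have conv: "convex S'"
  proof (cases "v = 0")
    case True then show ?thesis using R by (simp add: S'_def)
  next
    case False
    then have "S' = ball 0 (R / (2 * norm v))" by (auto simp: S'_def field_simps)
    then show ?thesis by simp
  qed
  have sub: "S' \<subseteq> S" using R by (auto simp: S_def S'_def)
  have second: "cmod ((deriv ^^ 2) q \<zeta>) \<le> 8 * M * (norm v)\<^sup>2 / R\<^sup>2" if "\<zeta> \<in> S'" for \<zeta>
  proof (cases "v = 0")
    case True
    then have "q = (\<lambda>\<zeta>. f p)" by (simp add: fun_eq_iff q_def cscale_def flip: zero_prod_def)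
    then show ?thesis by (simp add: True numeral_2_eq_2)
  next
    case False
    define \<rho> where "\<rho> = R / (2 * norm v)"
    have \<rho>: "\<rho> > 0" using R False by (simp add: \<rho>_def)
    have inS: "\<eta> \<in> S" if "\<eta> \<in> cball \<zeta> \<rho>" for \<eta>
    proof -
      have "cmod \<eta> \<le> cmod \<zeta> + \<rho>" using that norm_triangle_ineq2[of \<eta> \<zeta>] by (simp add: dist_norm norm_minus_commute)
      then have "cmod \<eta> * norm v \<le> (cmod \<zeta> + \<rho>) * norm v" by (intro mult_right_mono) auto
      also have "\<dots> < R" using \<open>\<zeta> \<in> S'\<close> False by (simp add: S'_def \<rho>_def distrib_right)
      finally show ?thesis by (simp add: S_def)
    qed
    have "cmod ((deriv ^^ 2) q \<zeta>) \<le> fact 2 * M / \<rho> ^ 2"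
    proof (rule Cauchy_inequality)
      show "q holomorphic_on ball \<zeta> \<rho>" using inS by (intro holomorphic_on_subset[OF hol]) auto
      show "continuous_on (cball \<zeta> \<rho>) q"
        using inS by (intro holomorphic_on_imp_continuous_on holomorphic_on_subset[OF hol]) auto
      show "cmod (q \<eta>) \<le> M" if "cmod (\<zeta> - \<eta>) = \<rho>" for \<eta>
        unfolding q_def using inS that by (intro M inb) (auto simp: dist_norm)
    qed (rule \<rho>)
    then show ?thesis using False R by (simp add: \<rho>_def power2_eq_square field_simps)
  qed
  have "cmod ((deriv ^^ 0) q h - (\<Sum>i\<le>1. (deriv ^^ i) q 0 * (h - 0) ^ i / fact i)) \<le> 8 * M * (norm v)\<^sup>2 / R\<^sup>2 * cmod (h - 0) ^ Suc 1 / fact 1"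
  proof (rule complex_Taylor[where f = "\<lambda>i. (deriv ^^ i) q" and n = 1, OF conv])
    show "((deriv ^^ i) q has_field_derivative (deriv ^^ Suc i) q x) (at x within S')" if "x \<in> S'" for i x
    proof (rule has_field_derivative_at_within)
      have "((deriv ^^ i) q) holomorphic_on S" by (rule holomorphic_higher_deriv[OF hol S])
      from holomorphic_derivI[OF this S] show "((deriv ^^ i) q has_field_derivative (deriv ^^ Suc i) q x) (at x)"
        using that sub by auto
    qed
    show "cmod ((deriv ^^ Suc 1) q x) \<le> 8 * M * (norm v)\<^sup>2 / R\<^sup>2" if "x \<in> S'" for x
      using second[OF that] by (simp add: numeral_2_eq_2)
  qed (use zero in auto)
  moreover have "(\<Sum>i\<le>1. (deriv ^^ i) q 0 * (h - 0) ^ i / fact i) = f p + frechet_derivative f (at p) v * h"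
    using DERIV_imp_deriv[OF qd[OF zero(1)]] by (simp add: q_def)
  moreover have "(f (p + cscale h v) - f p) / h - frechet_derivative f (at p) v = (q h - (f p + frechet_derivative f (at p) v * h)) / h"
    using h by (simp add: q_def field_simps)
  ultimately have "cmod ((f (p + cscale h v) - f p) / h - frechet_derivative f (at p) v) = cmod (q h - (f p + frechet_derivative f (at p) v * h)) / cmod h"
    and "cmod (q h - (f p + frechet_derivative f (at p) v * h)) \<le> 8 * M * (norm v)\<^sup>2 / R\<^sup>2 * cmod h ^ 2"
    by (simp_all add: norm_divide power2_eq_square)
  then have "cmod ((f (p + cscale h v) - f p) / h - frechet_derivative f (at p) v) \<le> 8 * M * (norm v)\<^sup>2 / R\<^sup>2 * cmod h ^ 2 / cmod h"
    by (metis divide_right_mono norm_ge_zero)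
  then show ?thesis using h by (simp add: power2_eq_square)
qed

text \<open>A directional derivative is the locally uniform limit of difference quotients with steps
  \<open>c n\<close>, and these are holomorphic. Second derivatives of the basis functions, which
  enter the Bergman metric, become available in this way.\<close>

lemma holo_on_frechet:
  assumes W: "open W" and f: "holo_on W f"
  shows "holo_on W (\<lambda>z. frechet_derivative f (at z) v)"
proof (rule holo_on_local)
  fix p assume "p \<in> W"
  have "continuous (at p) f" using holo_onD(1)[OF f \<open>p \<in> W\<close>] has_derivative_continuous by blast
  then obtain r0 where r0: "r0 > 0" "\<And>z. dist z p < r0 \<Longrightarrow> dist (f z) (f p) < 1"
    unfolding continuous_at_eps_delta by (metis zero_less_one)
  obtain r1 where r1: "r1 > 0" "ball p r1 \<subseteq> W" using W \<open>p \<in> W\<close> by (meson openE)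
  define r where "r = min r0 r1 / 3"
  define M where "M = cmod (f p) + 1"
  have r: "r > 0" "ball p (3 * r) \<subseteq> W" using r0 r1 by (auto simp: r_def)
  have M: "cmod (f z) \<le> M" if "z \<in> ball p (3 * r)" for z
  proof -
    have "dist (f z) (f p) < 1" using that by (intro r0(2)) (auto simp: r_def dist_commute)
    then show ?thesis using norm_triangle_ineq2[of "f z" "f p"] by (simp add: M_def dist_norm)
  qed
  define c where "c n = r / 2 / (norm v + 1) / real (Suc n)" for n
  have c: "c n > 0" "c n * norm v < r / 2" for n
  proof -
    show "c n > 0" using r by (simp add: c_def add_nonneg_pos)
    have "norm v + 1 \<noteq> 0" using norm_ge_zero[of v] by linarith
    then have "c n * norm v = r / 2 / real (Suc n) * (norm v / (norm v + 1))" unfolding c_def by (simp add: algebra_simps)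
    also have "\<dots> < r / 2 / real (Suc n) * 1" using r by (intro mult_strict_left_mono) (auto simp: add_nonneg_pos)
    also have "\<dots> \<le> r / 2" using r by (simp add: field_simps)
    finally show "c n * norm v < r / 2" .
  qed
  define F where "F n z = (1 / of_real (c n)) * (f (z + cscale (of_real (c n)) v) - f z)" for n z
  have est: "cmod (F n z - frechet_derivative f (at z) v) \<le> 8 * M * (norm v)\<^sup>2 * c n / r\<^sup>2" if "z \<in> ball p (2 * r)" for n z
  proof -
    have sub: "ball z r \<subseteq> ball p (3 * r)" using that by (auto simp: ball_subset_ball_iff dist_commute)
    have "cmod ((f (z + cscale (of_real (c n)) v) - f z) / of_real (c n) - frechet_derivative f (at z) v)
      \<le> 8 * M * (norm v)\<^sup>2 * cmod (of_real (c n)) / r\<^sup>2"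
    proof (rule holo_on_difference_quotient)
      show "holo_on (ball z r) f" using f r sub by (meson holo_on_subset order_trans)
      show "of_real (c n) \<noteq> (0::complex)" "cmod (of_real (c n)) * norm v < r / 2" using c[of n] by auto
      show "cmod (f w) \<le> M" if "w \<in> ball z r" for w using M sub that by blast
    qed (rule r(1))
    then show ?thesis using c(1)[of n] by (simp add: F_def field_simps abs_of_pos)
  qed
  have cl: "c \<longlonglongrightarrow> 0" unfolding c_def by (rule LIMSEQ_Suc[OF lim_const_over_n])
  show "\<exists>r>0. holo_on (ball p r) (\<lambda>z. frechet_derivative f (at z) v)"
  proof (intro exI conjI)
    show "holo_on (ball p ((2*r)/2)) (\<lambda>z. frechet_derivative f (at z) v)"
    proof (rule holo_on_uniform_limit)
      fix n
      show "holo_on (ball p (2*r)) (F n)" unfolding F_def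
      proof (intro holo_on_cmult holo_on_diff)
        show "holo_on (ball p (2 * r)) f" using f r by (rule_tac holo_on_subset) auto
        show "holo_on (ball p (2 * r)) (\<lambda>z. f (z + cscale (of_real (c n)) v))"
          unfolding holo_on_def
        proof
          fix z assume z: "z \<in> ball p (2 * r)"
          have "dist p (z + cscale (of_real (c n)) v) \<le> dist p z + dist z (z + cscale (of_real (c n)) v)" by (rule dist_triangle)
          also have "\<dots> < 3 * r" using z c[of n] r by (simp add: dist_norm norm_cscale)
          finally have w: "z + cscale (of_real (c n)) v \<in> W" using r by auto
          have "((\<lambda>z. z + cscale (of_real (c n)) v) has_derivative (\<lambda>v. v)) (at z)" by (auto intro!: derivative_eq_intros)
          from has_derivative_compose[OF this holo_onD(1)[OF f w]]
          show "\<exists>L. ((\<lambda>z. f (z + cscale (of_real (c n)) v)) has_derivative L) (at z) \<and> (\<forall>c v. L (cscale c v) = c * L v)"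
            using holo_onD(2)[OF f w] by blast
        qed
      qed
    next
      fix z assume z: "z \<in> ball p (2*r)"
      show "(\<lambda>n. F n z) \<longlonglongrightarrow> frechet_derivative f (at z) v"
      proof (rule LIM_zero_cancel, rule Lim_null_comparison)
        show "\<forall>\<^sub>F n in sequentially. norm (F n z - frechet_derivative f (at z) v) \<le> 8 * M * (norm v)\<^sup>2 * c n / r\<^sup>2"
          using est[OF z] by simp
        show "(\<lambda>n. 8 * M * (norm v)\<^sup>2 * c n / r\<^sup>2) \<longlonglongrightarrow> 0"
          using tendsto_mult_right_zero[OF cl, of "8 * M * (norm v)\<^sup>2 / r\<^sup>2"] by simp
      qed
    next
      fix e :: real assume e: "e > 0"
      have "(\<lambda>n. 8 * M * (norm v)\<^sup>2 * c n / r\<^sup>2) \<longlonglongrightarrow> 0"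
          using tendsto_mult_right_zero[OF cl, of "8 * M * (norm v)\<^sup>2 / r\<^sup>2"] by simp
      from order_tendstoD(2)[OF this, of "e/2"] e obtain N where N: "\<And>n. n \<ge> N \<Longrightarrow> 8 * M * (norm v)\<^sup>2 * c n / r\<^sup>2 < e / 2"
        by (auto simp: eventually_sequentially)
      have "cmod (F n z - F m z) \<le> e" if "n \<ge> N" "m \<ge> N" "z \<in> ball p (2*r)" for n m z
      proof -
        have "cmod (F n z - F m z) \<le> cmod (F n z - frechet_derivative f (at z) v) + cmod (F m z - frechet_derivative f (at z) v)"
          by norm
        then show ?thesis using est[OF that(3), of n] est[OF that(3), of m] N[OF that(1)] N[OF that(2)] by linarith
      qed
      then show "\<exists>N. \<forall>n\<ge>N. \<forall>m\<ge>N. \<forall>z\<in>ball p (2*r). cmod (F n z - F m z) \<le> e" by blast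
    qed (use r in auto)
  qed (use r in auto)
qed

section \<open>Differentiation of infinite sums\<close>

lemma summable_on_bounded:
  fixes x :: "'i \<Rightarrow> complex"
  assumes "m summable_on I" "\<And>i. i \<in> I \<Longrightarrow> cmod (x i) \<le> m i"
  shows "x summable_on I"
proof (rule Infinite_Sum.abs_summable_summable, rule Infinite_Sum.abs_summable_on_comparison_test[where g = "\<lambda>i. complex_of_real (m i)"])
  have "0 \<le> m i" if "i \<in> I" for i using assms(2)[OF that] norm_ge_zero order_trans by blast
  then show "(\<lambda>i. norm (complex_of_real (m i))) summable_on I" using assms(1) by (simp cong: summable_on_cong)
  show "norm (x i) \<le> norm (complex_of_real (m i))" if "i \<in> I" for i using assms(2)[OF that] by simp
qed

text \<open>The mean value inequality bounds every difference quotient by the summable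
  \<open>M\<close>, so the sums converge uniformly and the two limits may be swapped. The sums are
  unordered, matching the kernel, whose orthonormal system comes without an enumeration.\<close>

lemma has_vector_derivative_infsum:
  fixes F F' :: "'i \<Rightarrow> real \<Rightarrow> complex"
  assumes d: "d > 0" and F: "\<And>i t. i \<in> I \<Longrightarrow> \<bar>t\<bar> < d \<Longrightarrow> (F i has_vector_derivative F' i t) (at t)"
    and M: "\<And>i t. i \<in> I \<Longrightarrow> \<bar>t\<bar> < d \<Longrightarrow> cmod (F' i t) \<le> M i" "M summable_on I"
    and sm: "\<And>t. \<bar>t\<bar> < d \<Longrightarrow> (\<lambda>i. F i t) summable_on I"
  shows "((\<lambda>t. \<Sum>\<^sub>\<infinity>i\<in>I. F i t) has_vector_derivative (\<Sum>\<^sub>\<infinity>i\<in>I. F' i 0)) (at 0)"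
proof -
  define q where "q i t = (F i t - F i 0) /\<^sub>R t" for i t
  have qb: "norm (q i t) \<le> M i" if "i \<in> I" "t \<in> {-d<..<d} - {0}" for i t
  proof -
    have "norm (F i t - F i 0) \<le> M i * norm (t - 0)"
    proof (rule differentiable_bound[where S = "{-d<..<d}"])
      show "(F i has_derivative (\<lambda>h. h *\<^sub>R F' i x)) (at x within {-d<..<d})" if "x \<in> {-d<..<d}" for x
        using F[OF \<open>i \<in> I\<close>, of x] that by (auto simp: has_vector_derivative_def intro: has_derivative_at_withinI)
      show "onorm (\<lambda>h. h *\<^sub>R F' i x) \<le> M i" if "x \<in> {-d<..<d}" for x
      proof (rule onorm_le)
        fix h :: real
        show "norm (h *\<^sub>R F' i x) \<le> M i * norm h"
          using mult_right_mono[OF M(1)[OF \<open>i \<in> I\<close>, of x], of "\<bar>h\<bar>"] that by (auto simp: mult.commute)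
      qed
    qed (use that d in auto)
    moreover have "norm (q i t) = norm (F i t - F i 0) / \<bar>t\<bar>" by (simp add: q_def divide_inverse mult.commute)
    ultimately show ?thesis using that(2) by (simp add: divide_le_eq)
  qed
  have ql: "(q i \<longlongrightarrow> F' i 0) (at 0)" if "i \<in> I" for i
  proof -
    have "((\<lambda>t. norm (F i t - F i 0 - t *\<^sub>R F' i 0) / norm t) \<longlongrightarrow> 0) (at 0)"
      using F[OF that, of 0] d by (simp add: has_vector_derivative_def has_derivative_at)
    then have "((\<lambda>t. norm (q i t - F' i 0)) \<longlongrightarrow> 0) (at 0)"
    proof (rule Lim_transform_eventually)
      have "\<forall>\<^sub>F t in at (0::real). t \<noteq> 0" by (simp add: eventually_at_filter)
      then show "\<forall>\<^sub>F t in at 0. norm (F i t - F i 0 - t *\<^sub>R F' i 0) / norm t = norm (q i t - F' i 0)"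
      proof eventually_elim
        case (elim t)
        then have "q i t - F' i 0 = (F i t - F i 0 - t *\<^sub>R F' i 0) /\<^sub>R t"
          by (simp add: q_def scaleR_diff_right)
        then show ?case by (simp add: divide_inverse mult.commute)
      qed
    qed
    then show ?thesis by (simp add: tendsto_norm_zero_iff Lim_null[of _ "F' i 0"])
  qed
  have "((\<lambda>t. \<Sum>\<^sub>\<infinity>i\<in>I. q i t) \<longlongrightarrow> (\<Sum>\<^sub>\<infinity>i\<in>I. F' i 0)) (at 0)"
  proof (rule swap_uniform_limit')
    show "uniform_limit ({-d<..<d} - {0}) (\<lambda>X t. \<Sum>i\<in>X. q i t) (\<lambda>t. \<Sum>\<^sub>\<infinity>i\<in>I. q i t) (finite_subsets_at_top I)"
      using qb M(2) by (rule Weierstrass_m_test_general)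
    show "\<forall>\<^sub>F X in finite_subsets_at_top I. ((\<lambda>t. \<Sum>i\<in>X. q i t) \<longlongrightarrow> (\<Sum>i\<in>X. F' i 0)) (at 0)"
      by (rule eventually_finite_subsets_at_top_weakI) (auto intro!: tendsto_sum ql)
    have "(\<lambda>i. F' i 0) summable_on I" by (rule summable_on_bounded[OF M(2)]) (use M(1) d in auto)
    then show "((\<lambda>X. \<Sum>i\<in>X. F' i 0) \<longlongrightarrow> (\<Sum>\<^sub>\<infinity>i\<in>I. F' i 0)) (finite_subsets_at_top I)"
      using has_sum_def has_sum_infsum by blast
    have "\<forall>\<^sub>F t in at (0::real). t \<in> {-d<..<d}"
      using d by (intro eventually_at_in_open') auto
    moreover have "\<forall>\<^sub>F t in at (0::real). t \<noteq> 0" by (simp add: eventually_at_filter)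
    ultimately show "\<forall>\<^sub>F t in at 0. t \<in> {-d<..<d} - {0}" by eventually_elim auto
  qed simp
  then have "((\<lambda>t. norm ((\<Sum>\<^sub>\<infinity>i\<in>I. q i t) - (\<Sum>\<^sub>\<infinity>i\<in>I. F' i 0))) \<longlongrightarrow> 0) (at 0)"
    by (simp add: tendsto_norm_zero_iff LIM_zero)
  then have "((\<lambda>t. norm ((\<Sum>\<^sub>\<infinity>i\<in>I. F i t) - (\<Sum>\<^sub>\<infinity>i\<in>I. F i 0) - t *\<^sub>R (\<Sum>\<^sub>\<infinity>i\<in>I. F' i 0)) / norm t) \<longlongrightarrow> 0) (at 0)"
  proof (rule Lim_transform_eventually)
    have "\<forall>\<^sub>F t in at (0::real). t \<in> {-d<..<d}"
      using d by (intro eventually_at_in_open') auto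
    moreover have "\<forall>\<^sub>F t in at (0::real). t \<noteq> 0" by (simp add: eventually_at_filter)
    ultimately show "\<forall>\<^sub>F t in at 0. norm ((\<Sum>\<^sub>\<infinity>i\<in>I. q i t) - (\<Sum>\<^sub>\<infinity>i\<in>I. F' i 0)) =
      norm ((\<Sum>\<^sub>\<infinity>i\<in>I. F i t) - (\<Sum>\<^sub>\<infinity>i\<in>I. F i 0) - t *\<^sub>R (\<Sum>\<^sub>\<infinity>i\<in>I. F' i 0)) / norm t"
    proof eventually_elim
      case (elim t)
      have "(\<Sum>\<^sub>\<infinity>i\<in>I. q i t) = (\<Sum>\<^sub>\<infinity>i\<in>I. of_real (1/t) * (F i t + (-1) * F i 0))"
        by (simp add: q_def scaleR_conv_of_real divide_inverse)
      also have "\<dots> = of_real (1/t) * ((\<Sum>\<^sub>\<infinity>i\<in>I. F i t) + (-1) * (\<Sum>\<^sub>\<infinity>i\<in>I. F i 0))"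
        unfolding infsum_cmult_right'
        by (subst infsum_add) (use sm[of t] sm[of 0] elim d in \<open>auto simp: infsum_cmult_right' infsum_uminus summable_on_uminus\<close>)
      finally have "(\<Sum>\<^sub>\<infinity>i\<in>I. q i t) - (\<Sum>\<^sub>\<infinity>i\<in>I. F' i 0) = ((\<Sum>\<^sub>\<infinity>i\<in>I. F i t) - (\<Sum>\<^sub>\<infinity>i\<in>I. F i 0) - t *\<^sub>R (\<Sum>\<^sub>\<infinity>i\<in>I. F' i 0)) / of_real t"
        using elim by (simp add: field_simps scaleR_conv_of_real)
      then show ?case by (simp add: norm_divide)
    qed
  qed
  then show ?thesis by (simp add: has_vector_derivative_def has_derivative_at bounded_linear_scaleR_left)
qed

text \<open>The products are only real differentiable; along a real line their derivative has one
  part from each factor. A square summable majorant \<open>m\<close> of the functions yields, by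
  Cauchy estimates on smaller balls, the summable majorant \<open>K * m^2\<close> of both
  parts.\<close>

lemma has_vector_derivative_infsum_product:
  assumes r: "r > 0" and z: "z \<in> ball p r"
    and a: "\<And>i. i \<in> I \<Longrightarrow> holo_on (ball p r) (a i)" "\<And>i z. i \<in> I \<Longrightarrow> z \<in> ball p r \<Longrightarrow> cmod (a i z) \<le> m i"
    and b: "\<And>i. i \<in> I \<Longrightarrow> holo_on (ball p r) (b i)" "\<And>i z. i \<in> I \<Longrightarrow> z \<in> ball p r \<Longrightarrow> cmod (b i z) \<le> m i"
    and m: "(\<lambda>i. (m i)\<^sup>2) summable_on I"
  shows "(\<lambda>i. a i z * cnj (b i z)) summable_on I"
    and "(\<lambda>i. frechet_derivative (a i) (at z) v * cnj (b i z)) summable_on I"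
    and "(\<lambda>i. a i z * cnj (frechet_derivative (b i) (at z) v)) summable_on I"
    and "((\<lambda>t. \<Sum>\<^sub>\<infinity>i\<in>I. a i (z + t *\<^sub>R v) * cnj (b i (z + t *\<^sub>R v))) has_vector_derivative
      (\<Sum>\<^sub>\<infinity>i\<in>I. frechet_derivative (a i) (at z) v * cnj (b i z)) + (\<Sum>\<^sub>\<infinity>i\<in>I. a i z * cnj (frechet_derivative (b i) (at z) v))) (at 0)"
proof -
  define s where "s = (r - dist p z) / 2"
  have s: "s > 0" using z by (simp add: s_def)
  have m0: "m i \<ge> 0" if "i \<in> I" for i using a(2)[OF that z] norm_ge_zero order_trans by blast
  have sub: "ball w s \<subseteq> ball p r" if "dist z w \<le> s" for w
  proof -
    have "dist p w \<le> dist p z + dist z w" by (rule dist_triangle)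
    then show ?thesis using that s by (auto simp: ball_subset_ball_iff s_def dist_commute field_simps)
  qed
  have wb: "w \<in> ball p r" if "dist z w \<le> s" for w using sub[OF that] s centre_in_ball[of w s] by blast
  define K where "K = 2 * norm v / s"
  have K: "K \<ge> 0" using s by (simp add: K_def)
  have Da: "cmod (frechet_derivative (a i) (at w) v) \<le> K * m i" if "i \<in> I" "dist z w \<le> s" for i w
  proof -
    have "cmod (frechet_derivative (a i) (at w) v) \<le> 2 * m i * norm v / s"
      by (rule holo_on_derivative_bound[OF a(1)[OF that(1)] sub[OF that(2)]]) (use a(2)[OF that(1)] sub[OF that(2)] s in blast)+
    then show ?thesis by (simp add: K_def mult_ac)
  qed
  have Db: "cmod (frechet_derivative (b i) (at w) v) \<le> K * m i" if "i \<in> I" "dist z w \<le> s" for i w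
  proof -
    have "cmod (frechet_derivative (b i) (at w) v) \<le> 2 * m i * norm v / s"
      by (rule holo_on_derivative_bound[OF b(1)[OF that(1)] sub[OF that(2)]]) (use b(2)[OF that(1)] sub[OF that(2)] s in blast)+
    then show ?thesis by (simp add: K_def mult_ac)
  qed
  have Kab: "cmod (frechet_derivative (a i) (at w) v * cnj (b i w)) \<le> K * (m i)\<^sup>2"
    "cmod (a i w * cnj (frechet_derivative (b i) (at w) v)) \<le> K * (m i)\<^sup>2"
    if "i \<in> I" "dist z w \<le> s" for i w
  proof -
    have "cmod (frechet_derivative (a i) (at w) v * cnj (b i w)) \<le> (K * m i) * m i"
      unfolding norm_mult complex_mod_cnj using that K m0 by (intro mult_mono Da b(2) wb) auto
    then show "cmod (frechet_derivative (a i) (at w) v * cnj (b i w)) \<le> K * (m i)\<^sup>2" by (simp add: power2_eq_square mult.assoc)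
    have "cmod (a i w * cnj (frechet_derivative (b i) (at w) v)) \<le> m i * (K * m i)"
      unfolding norm_mult complex_mod_cnj using that K m0 by (intro mult_mono Db a(2) wb) auto
    then show "cmod (a i w * cnj (frechet_derivative (b i) (at w) v)) \<le> K * (m i)\<^sup>2" by (simp add: power2_eq_square mult_ac)
  qed
  have Km: "(\<lambda>i. K * (m i)\<^sup>2) summable_on I" using m by (rule summable_on_cmult_right)
  have ab: "(\<lambda>i. a i w * cnj (b i w)) summable_on I" if "dist z w \<le> s" for w
  proof (rule summable_on_bounded[OF m])
    show "cmod (a i w * cnj (b i w)) \<le> (m i)\<^sup>2" if "i \<in> I" for i
      unfolding norm_mult complex_mod_cnj power2_eq_square using that \<open>dist z w \<le> s\<close> m0 by (intro mult_mono a(2) b(2) wb) auto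
  qed
  show "(\<lambda>i. a i z * cnj (b i z)) summable_on I" using ab[of z] s by simp
  show sm1: "(\<lambda>i. frechet_derivative (a i) (at z) v * cnj (b i z)) summable_on I"
    by (rule summable_on_bounded[OF Km Kab(1)]) (use s in auto)
  show sm2: "(\<lambda>i. a i z * cnj (frechet_derivative (b i) (at z) v)) summable_on I"
    by (rule summable_on_bounded[OF Km Kab(2)]) (use s in auto)
  define d where "d = s / (norm v + 1)"
  have nv: "norm v + 1 > 0" by (simp add: add_nonneg_pos)
  have d: "d > 0" using s nv by (simp add: d_def)
  have dz: "dist z (z + t *\<^sub>R v) \<le> s" if "\<bar>t\<bar> < d" for t
  proof -
    have "\<bar>t\<bar> * norm v \<le> d * (norm v + 1)" using that d by (intro mult_mono) auto
    then show ?thesis using nv by (simp add: dist_norm d_def)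
  qed
  have der: "((\<lambda>t. f (z + t *\<^sub>R v)) has_vector_derivative frechet_derivative f (at (z + t *\<^sub>R v)) v) (at t)"
    if f: "holo_on (ball p r) f" and t: "\<bar>t\<bar> < d" for f t
  proof -
    have w: "z + t *\<^sub>R v \<in> ball p r" by (rule wb[OF dz[OF t]])
    have "((\<lambda>t. z + t *\<^sub>R v) has_derivative (\<lambda>h. h *\<^sub>R v)) (at t)" by (auto intro!: derivative_eq_intros)
    from has_derivative_compose[OF this holo_onD(1)[OF f w]]
    have "((\<lambda>t. f (z + t *\<^sub>R v)) has_derivative (\<lambda>h. frechet_derivative f (at (z + t *\<^sub>R v)) (h *\<^sub>R v))) (at t)" .
    moreover have "frechet_derivative f (at (z + t *\<^sub>R v)) (h *\<^sub>R v) = h *\<^sub>R frechet_derivative f (at (z + t *\<^sub>R v)) v" for h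
      using holo_onD(2)[OF f w, of "of_real h" v] by (simp add: cscale_of_real scaleR_conv_of_real)
    ultimately show ?thesis by (simp add: has_vector_derivative_def)
  qed
  have "((\<lambda>t. \<Sum>\<^sub>\<infinity>i\<in>I. a i (z + t *\<^sub>R v) * cnj (b i (z + t *\<^sub>R v))) has_vector_derivative
    (\<Sum>\<^sub>\<infinity>i\<in>I. a i (z + 0 *\<^sub>R v) * cnj (frechet_derivative (b i) (at (z + 0 *\<^sub>R v)) v) + frechet_derivative (a i) (at (z + 0 *\<^sub>R v)) v * cnj (b i (z + 0 *\<^sub>R v)))) (at 0)"
  proof (rule has_vector_derivative_infsum[where M = "\<lambda>i. K * (m i)\<^sup>2 + K * (m i)\<^sup>2", OF d])
    show "((\<lambda>t. a i (z + t *\<^sub>R v) * cnj (b i (z + t *\<^sub>R v))) has_vector_derivative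
      a i (z + t *\<^sub>R v) * cnj (frechet_derivative (b i) (at (z + t *\<^sub>R v)) v) + frechet_derivative (a i) (at (z + t *\<^sub>R v)) v * cnj (b i (z + t *\<^sub>R v))) (at t)"
      if "i \<in> I" "\<bar>t\<bar> < d" for i t
      by (intro has_vector_derivative_mult der has_vector_derivative_cnj a b that)
    show "cmod (a i (z + t *\<^sub>R v) * cnj (frechet_derivative (b i) (at (z + t *\<^sub>R v)) v) + frechet_derivative (a i) (at (z + t *\<^sub>R v)) v * cnj (b i (z + t *\<^sub>R v)))
      \<le> K * (m i)\<^sup>2 + K * (m i)\<^sup>2" if "i \<in> I" "\<bar>t\<bar> < d" for i t
      by (intro order_trans[OF norm_triangle_ineq] add_mono Kab that dz)
    show "(\<lambda>i. K * (m i)\<^sup>2 + K * (m i)\<^sup>2) summable_on I" using Km by (intro summable_on_add)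
    show "(\<lambda>i. a i (z + t *\<^sub>R v) * cnj (b i (z + t *\<^sub>R v))) summable_on I" if "\<bar>t\<bar> < d" for t
      by (rule ab[OF dz[OF that]])
  qed
  then show "((\<lambda>t. \<Sum>\<^sub>\<infinity>i\<in>I. a i (z + t *\<^sub>R v) * cnj (b i (z + t *\<^sub>R v))) has_vector_derivative
      (\<Sum>\<^sub>\<infinity>i\<in>I. frechet_derivative (a i) (at z) v * cnj (b i z)) + (\<Sum>\<^sub>\<infinity>i\<in>I. a i z * cnj (frechet_derivative (b i) (at z) v))) (at 0)"
    by (simp add: infsum_add[OF sm2 sm1] add.commute)
qed

section \<open>The Bergman space\<close>

text \<open>Members of \<open>A2 W\<close> vanish off \<open>W\<close>, so for them the integral
  over the whole space is the squared norm.\<close>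

definition l2sq :: "(c2 \<Rightarrow> complex) \<Rightarrow> real" where
  "l2sq f = (LINT z|lborel. (cmod (f z))\<^sup>2)"

lemma A2_iff:
  "f \<in> A2 W \<longleftrightarrow> holo_on W f \<and> (\<forall>z. z \<notin> W \<longrightarrow> f z = 0) \<and> f \<in> borel_measurable borel \<and> integrable lborel (\<lambda>z. (cmod (f z))\<^sup>2)"
proof -
  have "indicat_real W z *\<^sub>R (cmod (f z))\<^sup>2 = (cmod (f z))\<^sup>2" if "\<forall>z. z \<notin> W \<longrightarrow> f z = 0" for z
    using that by (cases "z \<in> W") (auto simp del: split_paired_All)
  then have "(\<forall>z. z \<notin> W \<longrightarrow> f z = 0) \<Longrightarrow> (\<lambda>z. indicat_real W z *\<^sub>R (cmod (f z))\<^sup>2) = (\<lambda>z. (cmod (f z))\<^sup>2)" by blast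
  then show ?thesis unfolding A2_def set_integrable_def by (auto simp del: split_paired_All)
qed

lemma A2D:
  assumes "f \<in> A2 W"
  shows "holo_on W f" "\<And>z. z \<notin> W \<Longrightarrow> f z = 0" "f \<in> borel_measurable borel" "integrable lborel (\<lambda>z. (cmod (f z))\<^sup>2)"
  using assms by (auto simp: A2_iff simp del: split_paired_All)

lemma L2inner_eq:
  assumes "f \<in> A2 W"
  shows "L2inner W f g = (LINT z|lborel. f z * cnj (g z))"
  unfolding L2inner_def set_lebesgue_integral_def
proof (rule Bochner_Integration.integral_cong)
  fix z show "indicat_real W z *\<^sub>R (f z * cnj (g z)) = f z * cnj (g z)"
    using A2D(2)[OF assms, of z] by (cases "z \<in> W") auto
qed simp

lemma A2_integrable_product:
  assumes "f \<in> A2 W" "g \<in> A2 W"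
  shows "integrable lborel (\<lambda>z. f z * cnj (g z))"
proof (rule Bochner_Integration.integrable_bound)
  show "integrable lborel (\<lambda>z. (cmod (f z))\<^sup>2 + (cmod (g z))\<^sup>2)"
    using A2D(4)[OF assms(1)] A2D(4)[OF assms(2)] by (rule Bochner_Integration.integrable_add)
  note A2D(3)[OF assms(1), measurable] A2D(3)[OF assms(2), measurable]
  have "cnj \<in> borel_measurable borel" by (intro borel_measurable_continuous_onI continuous_intros)
  note this[measurable]
  show "(\<lambda>z. f z * cnj (g z)) \<in> borel_measurable lborel" by measurable
  have "a * b \<le> a\<^sup>2 + b\<^sup>2" if "a \<ge> 0" "b \<ge> 0" for a b :: real
    using sum_squares_bound[of a b] that zero_le_mult_iff[of a b] by linarith
  then show "AE z in lborel. norm (f z * cnj (g z)) \<le> norm ((cmod (f z))\<^sup>2 + (cmod (g z))\<^sup>2)"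
    by (intro AE_I2) (simp add: norm_mult)
qed

lemma A2_cmult:
  assumes "f \<in> A2 W"
  shows "(\<lambda>z. c * f z) \<in> A2 W"
  unfolding A2_iff using A2D[OF assms] holo_on_cmult[OF A2D(1)[OF assms]]
  by (auto simp: norm_mult power_mult_distrib simp del: split_paired_All)

lemma A2_add:
  assumes "f \<in> A2 W" "g \<in> A2 W"
  shows "(\<lambda>z. f z + g z) \<in> A2 W"
proof -
  note A2D(3)[OF assms(1), measurable] A2D(3)[OF assms(2), measurable]
  have "integrable lborel (\<lambda>z. (cmod (f z + g z))\<^sup>2)"
  proof (rule Bochner_Integration.integrable_bound)
    show "integrable lborel (\<lambda>z. 2 * (cmod (f z))\<^sup>2 + 2 * (cmod (g z))\<^sup>2)"
      using A2D(4)[OF assms(1)] A2D(4)[OF assms(2)] by simp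
    show "(\<lambda>z. (cmod (f z + g z))\<^sup>2) \<in> borel_measurable lborel" by measurable
    have "(cmod (a + b))\<^sup>2 \<le> 2 * (cmod a)\<^sup>2 + 2 * (cmod b)\<^sup>2" for a b
    proof -
      have "(cmod (a + b))\<^sup>2 \<le> (cmod a + cmod b)\<^sup>2" by (intro power_mono norm_triangle_ineq) auto
      also have "\<dots> \<le> 2 * (cmod a)\<^sup>2 + 2 * (cmod b)\<^sup>2"
        using sum_squares_bound[of "cmod a" "cmod b"] by (simp add: power2_sum)
      finally show ?thesis .
    qed
    then show "AE z in lborel. norm ((cmod (f z + g z))\<^sup>2) \<le> norm (2 * (cmod (f z))\<^sup>2 + 2 * (cmod (g z))\<^sup>2)"
      by (intro AE_I2) simp
  qed
  then show ?thesis unfolding A2_iff using A2D(1,2,3)[OF assms(1)] A2D(1,2,3)[OF assms(2)] holo_on_add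
    by (auto simp del: split_paired_All)
qed

lemma A2_zero: "(\<lambda>z. 0) \<in> A2 W"
  unfolding A2_iff by auto

lemma A2_sum:
  assumes "\<And>i. i \<in> I \<Longrightarrow> f i \<in> A2 W"
  shows "(\<lambda>z. \<Sum>i\<in>I. c i * f i z) \<in> A2 W"
  using assms by (induction I rule: infinite_finite_induct) (auto intro!: A2_zero A2_add A2_cmult)

lemma A2_diff:
  assumes "f \<in> A2 W" "g \<in> A2 W"
  shows "(\<lambda>z. f z - g z) \<in> A2 W"
  using A2_add[OF assms(1) A2_cmult[OF assms(2), of "-1"]] by simp

lemma L2inner_self:
  assumes "f \<in> A2 W"
  shows "L2inner W f f = of_real (l2sq f)"
  unfolding L2inner_eq[OF assms] l2sq_def
  by (simp only: complex_norm_square[symmetric] of_real_power[symmetric] integral_complex_of_real)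

lemma L2inner_commute:
  assumes "f \<in> A2 W" "g \<in> A2 W"
  shows "L2inner W g f = cnj (L2inner W f g)"
  unfolding L2inner_eq[OF assms(1)] L2inner_eq[OF assms(2)]
  by (subst Bochner_Integration.integral_cnj[symmetric]) (simp add: mult.commute)

lemma L2inner_sum_left:
  assumes "\<And>i. i \<in> I \<Longrightarrow> f i \<in> A2 W" "g \<in> A2 W"
  shows "L2inner W (\<lambda>z. \<Sum>i\<in>I. c i * f i z) g = (\<Sum>i\<in>I. c i * L2inner W (f i) g)"
proof -
  have "(\<lambda>z. \<Sum>i\<in>I. c i * f i z) \<in> A2 W" using assms(1) by (rule A2_sum)
  then have "L2inner W (\<lambda>z. \<Sum>i\<in>I. c i * f i z) g = (LINT z|lborel. (\<Sum>i\<in>I. c i * (f i z * cnj (g z))))"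
    by (subst L2inner_eq) (auto simp: sum_distrib_right mult.assoc)
  also have "\<dots> = (\<Sum>i\<in>I. LINT z|lborel. c i * (f i z * cnj (g z)))"
    by (rule Bochner_Integration.integral_sum, rule integrable_mult_right, rule A2_integrable_product[OF assms])
  also have "\<dots> = (\<Sum>i\<in>I. c i * L2inner W (f i) g)"
    by (intro sum.cong refl) (use assms in \<open>simp add: L2inner_eq\<close>)
  finally show ?thesis .
qed

lemma L2inner_diff_left:
  assumes "f \<in> A2 W" "g \<in> A2 W" "h \<in> A2 W"
  shows "L2inner W (\<lambda>z. f z - g z) h = L2inner W f h - L2inner W g h"
  unfolding L2inner_eq[OF A2_diff[OF assms(1,2)]] L2inner_eq[OF assms(1)] L2inner_eq[OF assms(2)]
  using A2_integrable_product assms by (simp add: algebra_simps)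

lemma L2inner_cmult_left:
  assumes "f \<in> A2 W" "g \<in> A2 W"
  shows "L2inner W (\<lambda>z. c * f z) g = c * L2inner W f g"
  unfolding L2inner_eq[OF A2_cmult[OF assms(1)]] L2inner_eq[OF assms(1)]
  using A2_integrable_product assms by (simp add: mult.assoc)

lemma l2sq_nonneg [simp]: "l2sq f \<ge> 0"
  unfolding l2sq_def by simp

lemma l2sq_cmult: "l2sq (\<lambda>z. c * f z) = (cmod c)\<^sup>2 * l2sq f"
  unfolding l2sq_def by (simp add: norm_mult power_mult_distrib)

lemma nn_integral_l2sq:
  assumes "f \<in> A2 W"
  shows "(\<integral>\<^sup>+ z. ennreal ((cmod (f z))\<^sup>2) \<partial>lborel) = ennreal (l2sq f)"
  unfolding l2sq_def by (rule nn_integral_eq_integral[OF A2D(4)[OF assms]]) auto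

section \<open>Orthonormal systems and evaluation bounds\<close>

text \<open>\<open>complete_ONS\<close> without its completeness clause: the property to which
  Zorn's lemma is applied.\<close>

definition ONS :: "c2 set \<Rightarrow> (c2 \<Rightarrow> complex) set \<Rightarrow> bool" where
  "ONS W B \<longleftrightarrow> B \<subseteq> A2 W \<and> (\<forall>f\<in>B. L2inner W f f = 1) \<and> (\<forall>f\<in>B. \<forall>g\<in>B. f \<noteq> g \<longrightarrow> L2inner W f g = 0)"

lemma ONS_sum_A2:
  assumes "ONS W B" "S \<subseteq> B"
  shows "(\<lambda>z. \<Sum>\<phi>\<in>S. c \<phi> * \<phi> z) \<in> A2 W"
  using assms by (intro A2_sum[where f = "\<lambda>\<phi>. \<phi>"]) (auto simp: ONS_def)

lemma ONS_inner:
  assumes "ONS W B" "finite S" "S \<subseteq> B" "\<phi> \<in> B"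
  shows "L2inner W (\<lambda>z. \<Sum>\<psi>\<in>S. c \<psi> * \<psi> z) \<phi> = (if \<phi> \<in> S then c \<phi> else 0)"
proof -
  have "L2inner W (\<lambda>z. \<Sum>\<psi>\<in>S. c \<psi> * \<psi> z) \<phi> = (\<Sum>\<psi>\<in>S. c \<psi> * L2inner W \<psi> \<phi>)"
    by (rule L2inner_sum_left) (use assms in \<open>auto simp: ONS_def\<close>)
  also have "\<dots> = (\<Sum>\<psi>\<in>S. if \<psi> = \<phi> then c \<phi> else 0)"
    by (intro sum.cong refl) (use assms in \<open>auto simp: ONS_def\<close>)
  finally show ?thesis using assms by simp
qed

lemma ONS_bessel:
  assumes B: "ONS W B" "finite S" "S \<subseteq> B" and f: "f \<in> A2 W" and c: "\<And>\<phi>. \<phi> \<in> S \<Longrightarrow> c \<phi> = L2inner W f \<phi>"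
  shows "l2sq (\<lambda>z. f z - (\<Sum>\<phi>\<in>S. c \<phi> * \<phi> z)) = l2sq f - (\<Sum>\<phi>\<in>S. (cmod (c \<phi>))\<^sup>2)"
proof -
  define G where "G z = (\<Sum>\<phi>\<in>S. c \<phi> * \<phi> z)" for z
  have S: "\<And>\<phi>. \<phi> \<in> S \<Longrightarrow> \<phi> \<in> A2 W" using B by (auto simp: ONS_def)
  have G: "G \<in> A2 W" unfolding G_def[abs_def] by (rule ONS_sum_A2[OF B(1,3)])
  define h where "h z = f z - G z" for z
  have h: "h \<in> A2 W" unfolding h_def using f G by (rule A2_diff)
  have h\<phi>: "L2inner W h \<phi> = 0" if "\<phi> \<in> S" for \<phi>
  proof -
    have "L2inner W G \<phi> = c \<phi>" using ONS_inner[OF B, of \<phi> c] that B(3) by (auto simp: G_def[abs_def])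
    then show ?thesis using L2inner_diff_left[OF f G S[OF that]] c[OF that] by (simp add: h_def[abs_def])
  qed
  have "L2inner W G h = 0"
    unfolding G_def[abs_def]
    by (subst L2inner_sum_left) (use S h h\<phi> in \<open>auto simp: L2inner_commute[OF h] intro!: sum.neutral\<close>)
  then have "L2inner W h h = L2inner W f h"
    using L2inner_diff_left[OF f G h] by (simp add: h_def[abs_def])
  also have "\<dots> = cnj (L2inner W h f)" by (rule L2inner_commute[OF h f])
  also have "L2inner W h f = L2inner W f f - L2inner W G f"
    using L2inner_diff_left[OF f G f] by (simp add: h_def[abs_def])
  also have "L2inner W G f = (\<Sum>\<phi>\<in>S. c \<phi> * cnj (c \<phi>))"
    unfolding G_def[abs_def]
    by (subst L2inner_sum_left) (use S f c in \<open>auto simp: L2inner_commute[OF f] intro!: sum.cong\<close>)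
  also have "\<dots> = of_real (\<Sum>\<phi>\<in>S. (cmod (c \<phi>))\<^sup>2)" by (simp only: complex_norm_square[symmetric] of_real_power[symmetric] of_real_sum)
  finally have "complex_of_real (l2sq h) = of_real (l2sq f - (\<Sum>\<phi>\<in>S. (cmod (c \<phi>))\<^sup>2))"
    by (simp add: L2inner_self[OF h] L2inner_self[OF f])
  then show ?thesis by (simp add: h_def[abs_def] G_def flip: of_real_eq_iff[where 'a = complex])
qed

lemma ONS_l2sq:
  assumes B: "ONS W B" "finite S" "S \<subseteq> B"
  shows "l2sq (\<lambda>z. \<Sum>\<phi>\<in>S. c \<phi> * \<phi> z) = (\<Sum>\<phi>\<in>S. (cmod (c \<phi>))\<^sup>2)"
proof -
  have "c \<phi> = L2inner W (\<lambda>z. \<Sum>\<phi>\<in>S. c \<phi> * \<phi> z) \<phi>" if "\<phi> \<in> S" for \<phi>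
    using ONS_inner[OF B, of \<phi> c] that B(3) by auto
  from ONS_bessel[OF B ONS_sum_A2[OF B(1,3), of c], of c, OF this]
  have "l2sq (\<lambda>z. 0) = l2sq (\<lambda>z. \<Sum>\<phi>\<in>S. c \<phi> * \<phi> z) - (\<Sum>\<phi>\<in>S. (cmod (c \<phi>))\<^sup>2)"
    by (simp only: diff_self)
  then show ?thesis by (simp add: l2sq_def)
qed

text \<open>Test the functional on the combination with coefficients \<open>cnj (ev \<phi>)\<close>.
  Its value and its squared norm are both equal to the sum \<sigma>, so
  \<open>\<sigma>^2 \<le> K * \<sigma>\<close>.\<close>

lemma ONS_sum_bound:
  assumes B: "ONS W B" "finite S" "S \<subseteq> B" and bound: "\<And>f. f \<in> A2 W \<Longrightarrow> (cmod (ev f))\<^sup>2 \<le> K * l2sq f"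
    and lin: "\<And>c. ev (\<lambda>z. \<Sum>\<phi>\<in>S. c \<phi> * \<phi> z) = (\<Sum>\<phi>\<in>S. c \<phi> * ev \<phi>)" and K: "K \<ge> 0"
  shows "(\<Sum>\<phi>\<in>S. (cmod (ev \<phi>))\<^sup>2) \<le> K"
proof -
  define \<sigma> where "\<sigma> = (\<Sum>\<phi>\<in>S. (cmod (ev \<phi>))\<^sup>2)"
  define f where "f z = (\<Sum>\<phi>\<in>S. cnj (ev \<phi>) * \<phi> z)" for z
  have "f \<in> A2 W" unfolding f_def[abs_def] by (rule ONS_sum_A2[OF B(1,3)])
  moreover have "ev f = of_real \<sigma>"
    unfolding f_def[abs_def] lin \<sigma>_def of_real_sum by (intro sum.cong refl) (metis complex_norm_square mult.commute of_real_power)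
  moreover have "l2sq f = \<sigma>" unfolding f_def[abs_def] ONS_l2sq[OF B] by (simp add: \<sigma>_def)
  ultimately have "\<sigma>\<^sup>2 \<le> K * \<sigma>" using bound[of f] by simp
  moreover have "\<sigma> \<ge> 0" unfolding \<sigma>_def by (intro sum_nonneg) auto
  ultimately have "\<sigma> \<le> K" using K by (cases "\<sigma> = 0") (auto simp: power2_eq_square)
  then show ?thesis by (simp add: \<sigma>_def)
qed

definition ball_volume :: "real \<Rightarrow> real" where
  "ball_volume r = measure lborel (cball (0::c2) r)"

lemma ball_volume_pos: "r > 0 \<Longrightarrow> ball_volume r > 0"
  unfolding ball_volume_def by (metis content_cball_pos)

lemma A2_mean_bound:
  assumes f: "f \<in> A2 W" and r: "r > 0" and z: "cball z r \<subseteq> W" "cball z r \<subseteq> A" and A: "A \<in> sets borel"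
  shows "(cmod (f z))\<^sup>2 \<le> (LINT x:A|lborel. (cmod (f x))\<^sup>2) / ball_volume r"
proof -
  have int: "integrable lborel (\<lambda>x. indicator A x *\<^sub>R (cmod (f x))\<^sup>2)"
    using A2D(4)[OF f] A by (intro integrable_mult_indicator) auto
  have "ennreal ((cmod (f z))\<^sup>2 * ball_volume r) = ennreal ((cmod (f z))\<^sup>2) * emeasure lborel (cball (0::c2) r)"
    unfolding ball_volume_def using emeasure_bounded_finite[OF bounded_cball, of "0::c2" r]
    by (subst ennreal_mult') (auto simp: emeasure_eq_ennreal_measure)
  also have "\<dots> \<le> (\<integral>\<^sup>+ x. indicator (cball z r) x * ennreal ((cmod (f x))\<^sup>2) \<partial>lborel)"
    by (rule holo_on_submean[OF A2D(1,3)[OF f] z(1)])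
  also have "\<dots> \<le> (\<integral>\<^sup>+ x. ennreal (indicator A x *\<^sub>R (cmod (f x))\<^sup>2) \<partial>lborel)"
    using z(2) by (intro nn_integral_mono) (auto simp: indicator_def)
  also have "\<dots> = ennreal (LINT x|lborel. indicator A x *\<^sub>R (cmod (f x))\<^sup>2)"
    by (rule nn_integral_eq_integral[OF int]) auto
  finally have "(cmod (f z))\<^sup>2 * ball_volume r \<le> (LINT x|lborel. indicator A x *\<^sub>R (cmod (f x))\<^sup>2)"
    by (subst (asm) ennreal_le_iff) (auto intro!: Bochner_Integration.integral_nonneg)
  then show ?thesis using ball_volume_pos[OF r] by (simp add: field_simps set_lebesgue_integral_def)
qed

lemma A2_point_bound:
  assumes f: "f \<in> A2 W" and r: "r > 0" and z: "cball z r \<subseteq> W"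
  shows "(cmod (f z))\<^sup>2 \<le> l2sq f / ball_volume r"
  using A2_mean_bound[OF f r z, of UNIV] by (simp add: l2sq_def set_lebesgue_integral_def)

text \<open>\<open>m \<phi>\<close> is the mean value bound in terms of the norm of \<phi> over a
  larger ball. On that ball the partial sums of \<open>|\<phi>|^2\<close> are bounded by the norm of
  point evaluation; integrating this bound makes the squares of \<open>m\<close> summable. The
  result is the majorant for all series over the basis.\<close>

lemma ONS_domination:
  assumes W: "open W" and B: "ONS W B" and p: "p \<in> W"
  obtains r m where "r > 0" "ball p r \<subseteq> W" "\<And>\<phi>. m \<phi> \<ge> 0"
    "\<And>\<phi> z. \<phi> \<in> B \<Longrightarrow> z \<in> ball p r \<Longrightarrow> cmod (\<phi> z) \<le> m \<phi>" "(\<lambda>\<phi>. (m \<phi>)\<^sup>2) summable_on B"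
proof -
  obtain R where R: "R > 0" "cball p R \<subseteq> W" using W p open_contains_cball by blast
  define r where "r = R / 3"
  have r: "r > 0" using R by (simp add: r_def)
  have sub: "cball z r \<subseteq> W" if "z \<in> cball p (2 * r)" for z
  proof -
    have "cball z r \<subseteq> cball p R" using that r by (auto simp: cball_subset_cball_iff r_def dist_commute)
    then show ?thesis using R by blast
  qed
  define J where "J \<phi> = (LINT x:cball p (2*r)|lborel. (cmod (\<phi> x))\<^sup>2)" for \<phi> :: "c2 \<Rightarrow> complex"
  have J0: "J \<phi> \<ge> 0" for \<phi> unfolding J_def set_lebesgue_integral_def by (intro Bochner_Integration.integral_nonneg) auto
  define m where "m \<phi> = sqrt (J \<phi> / ball_volume r)" for \<phi>
  have V: "ball_volume r > 0" by (rule ball_volume_pos[OF r])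
  have m2: "(m \<phi>)\<^sup>2 = J \<phi> / ball_volume r" for \<phi> unfolding m_def using J0 V by simp
  have m0: "m \<phi> \<ge> 0" for \<phi> unfolding m_def using J0 V by simp
  have bound: "cmod (\<phi> z) \<le> m \<phi>" if "\<phi> \<in> B" "z \<in> ball p r" for \<phi> z
  proof -
    have "\<phi> \<in> A2 W" using B that by (auto simp: ONS_def)
    moreover have "cball z r \<subseteq> cball p (2*r)" using that r by (auto simp: cball_subset_cball_iff dist_commute)
    moreover have "cball z r \<subseteq> W" using that r by (intro sub) auto
    ultimately have "(cmod (\<phi> z))\<^sup>2 \<le> (m \<phi>)\<^sup>2" unfolding m2 J_def by (intro A2_mean_bound[where W = W]) (auto simp: r)
    then show ?thesis using m0 by (rule power2_le_imp_le)
  qed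
  have "(\<Sum>\<phi>\<in>S. (m \<phi>)\<^sup>2) \<le> (LINT x:cball p (2*r)|lborel. 1 / ball_volume r) / ball_volume r"
    if S: "finite S" "S \<subseteq> B" for S
  proof -
    have A2: "\<phi> \<in> A2 W" if "\<phi> \<in> S" for \<phi> using B S that by (auto simp: ONS_def)
    have int: "integrable lborel (\<lambda>x. indicator (cball p (2*r)) x *\<^sub>R (cmod (\<phi> x))\<^sup>2)" if "\<phi> \<in> S" for \<phi>
      using A2D(4)[OF A2[OF that]] by (intro integrable_mult_indicator) auto
    have "(\<Sum>\<phi>\<in>S. J \<phi>) = (LINT x|lborel. (\<Sum>\<phi>\<in>S. indicator (cball p (2*r)) x *\<^sub>R (cmod (\<phi> x))\<^sup>2))"
      unfolding J_def set_lebesgue_integral_def by (rule Bochner_Integration.integral_sum[symmetric], rule int)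
    also have "\<dots> \<le> (LINT x|lborel. indicator (cball p (2*r)) x *\<^sub>R (1 / ball_volume r))"
    proof (rule integral_mono)
      show "integrable lborel (\<lambda>x. \<Sum>\<phi>\<in>S. indicat_real (cball p (2*r)) x *\<^sub>R (cmod (\<phi> x))\<^sup>2)"
        using int by (rule Bochner_Integration.integrable_sum)
      show "integrable lborel (\<lambda>x. indicat_real (cball p (2*r)) x *\<^sub>R (1 / ball_volume r))"
        by (intro integrable_scaleR_left integrable_real_indicator) (use emeasure_bounded_finite[OF bounded_cball, of p "2*r"] in auto)
      fix x
      show "(\<Sum>\<phi>\<in>S. indicat_real (cball p (2*r)) x *\<^sub>R (cmod (\<phi> x))\<^sup>2) \<le> indicat_real (cball p (2*r)) x *\<^sub>R (1 / ball_volume r)"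
      proof (cases "x \<in> cball p (2*r)")
        case True
        have "(\<Sum>\<phi>\<in>S. (cmod (\<phi> x))\<^sup>2) \<le> 1 / ball_volume r"
        proof (rule ONS_sum_bound[where ev = "\<lambda>f. f x", OF B S])
          show "(cmod (f x))\<^sup>2 \<le> 1 / ball_volume r * l2sq f" if "f \<in> A2 W" for f
            using A2_point_bound[OF that r sub[OF True]] by simp
        qed (use V in auto)
        then show ?thesis using True by simp
      qed simp
    qed
    finally show ?thesis
      unfolding m2 sum_divide_distrib[symmetric] set_lebesgue_integral_def using V by (intro divide_right_mono) auto
  qed
  then have "(\<lambda>\<phi>. (m \<phi>)\<^sup>2) summable_on B"
    by (intro nonneg_bounded_partial_sums_imp_summable_on) (auto simp: eventually_finite_subsets_at_top intro!: exI[of _ "{}"])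
  moreover have "ball p r \<subseteq> W" using sub[of p] r by (meson ball_subset_cball centre_in_cball less_imp_le mult_pos_pos order_trans zero_less_numeral)
  ultimately show ?thesis using that r m0 bound by blast
qed

section \<open>Complete systems and expansions\<close>

text \<open>A maximal system is complete, since a nonzero function orthogonal to it could be
  normalised and added; the mean value bound makes its norm positive. Existence gives meaning to the
  choice made in \<open>bergman_kernel\<close>.\<close>

lemma complete_ONS_exists:
  assumes W: "open W"
  shows "\<exists>B. complete_ONS W B"
proof -
  have "\<exists>M\<in>{B. ONS W B}. \<forall>X\<in>{B. ONS W B}. M \<subseteq> X \<longrightarrow> X = M"
  proof (rule subset_Zorn')
    fix \<C> assume C: "subset.chain {B. ONS W B} \<C>"
    have "L2inner W f g = 0" if fg: "f \<in> \<Union>\<C>" "g \<in> \<Union>\<C>" "f \<noteq> g" for f g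
    proof -
      obtain X Y where XY: "X \<in> \<C>" "Y \<in> \<C>" "f \<in> X" "g \<in> Y" using fg by blast
      have "X \<subseteq> Y \<or> Y \<subseteq> X" using C XY(1,2) by (auto simp: subset.chain_def)
      then obtain Z where "Z \<in> \<C>" "f \<in> Z" "g \<in> Z" using XY by blast
      moreover then have "ONS W Z" using C by (auto simp: subset.chain_def)
      ultimately show ?thesis using fg(3) by (auto simp: ONS_def)
    qed
    moreover have "f \<in> A2 W \<and> L2inner W f f = 1" if "f \<in> \<Union>\<C>" for f
      using that C by (auto simp: subset.chain_def ONS_def)
    ultimately show "\<Union>\<C> \<in> {B. ONS W B}" unfolding ONS_def by blast
  qed
  then obtain M where M: "ONS W M" "\<And>X. ONS W X \<Longrightarrow> M \<subseteq> X \<Longrightarrow> X = M" by blast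
  have "f = (\<lambda>_. 0)" if f: "f \<in> A2 W" "\<forall>\<phi>\<in>M. L2inner W f \<phi> = 0" for f
  proof (rule ccontr)
    assume "f \<noteq> (\<lambda>_. 0)"
    then obtain z where z: "f z \<noteq> 0" by blast
    then have "z \<in> W" using A2D(2)[OF f(1)] by blast
    then obtain r where r: "r > 0" "cball z r \<subseteq> W" using W open_contains_cball by blast
    have "0 < (cmod (f z))\<^sup>2" using z by simp
    also have "\<dots> \<le> l2sq f / ball_volume r" by (rule A2_point_bound[OF f(1) r])
    finally have pos: "l2sq f > 0" using ball_volume_pos[OF r(1)] by (simp add: zero_less_divide_iff)
    define c where "c = complex_of_real (1 / sqrt (l2sq f))"
    have c: "(cmod c)\<^sup>2 = 1 / l2sq f"
      unfolding c_def norm_of_real using pos by (simp add: power_divide)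
    define g where "g z = c * f z" for z
    have g: "g \<in> A2 W" unfolding g_def[abs_def] by (rule A2_cmult[OF f(1)])
    have g1: "L2inner W g g = 1"
      unfolding L2inner_self[OF g] unfolding g_def[abs_def] l2sq_cmult c using pos by simp
    have g0: "L2inner W g \<phi> = 0" "L2inner W \<phi> g = 0" if "\<phi> \<in> M" for \<phi>
    proof -
      have \<phi>: "\<phi> \<in> A2 W" using M that by (auto simp: ONS_def)
      show *: "L2inner W g \<phi> = 0"
        using L2inner_cmult_left[OF f(1) \<phi>, of c] f(2) that by (simp add: g_def[abs_def])
      show "L2inner W \<phi> g = 0" using L2inner_commute[OF g \<phi>] * by simp
    qed
    have "ONS W (insert g M)" using M(1) g g1 g0 by (auto simp: ONS_def)
    then have "g \<in> M" using M(2)[of "insert g M"] by blast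
    then show False using g0(1)[of g] g1 by simp
  qed
  then have "complete_ONS W M" using M(1) by (auto simp: complete_ONS_def ONS_def)
  then show ?thesis ..
qed

text \<open>By the mean value bound a Cauchy sequence in norm is locally uniformly Cauchy, which
  gives a holomorphic limit together with its derivatives. Fatou's lemma then upgrades pointwise
  convergence to convergence in norm.\<close>

lemma A2_complete:
  assumes W: "open W" and G: "\<And>n. G n \<in> A2 W"
    and cauchy: "\<forall>e>0. \<exists>N. \<forall>n\<ge>N. \<forall>m\<ge>N. l2sq (\<lambda>z. G n z - G m z) \<le> e"
  shows "\<exists>g\<in>A2 W. (\<lambda>n. l2sq (\<lambda>z. G n z - g z)) \<longlonglongrightarrow> 0 \<and> (\<forall>z. (\<lambda>n. G n z) \<longlonglongrightarrow> g z) \<and>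
    (\<forall>z\<in>W. \<forall>v. (\<lambda>n. frechet_derivative (G n) (at z) v) \<longlonglongrightarrow> frechet_derivative g (at z) v)"
proof -
  note cau = cauchy[rule_format]
  have unif: "\<exists>N. \<forall>n\<ge>N. \<forall>m\<ge>N. \<forall>x\<in>A. cmod (G n x - G m x) \<le> e"
    if r: "r > 0" and A: "\<And>x. x \<in> A \<Longrightarrow> cball x r \<subseteq> W" and e: "e > 0" for A r e
  proof -
    have V: "ball_volume r > 0" by (rule ball_volume_pos[OF r])
    then obtain N where N: "\<And>n m. n \<ge> N \<Longrightarrow> m \<ge> N \<Longrightarrow> l2sq (\<lambda>z. G n z - G m z) \<le> e\<^sup>2 * ball_volume r"
      using cau[of "e\<^sup>2 * ball_volume r"] e by auto
    have "cmod (G n x - G m x) \<le> e" if "n \<ge> N" "m \<ge> N" "x \<in> A" for n m x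
    proof -
      have "(cmod (G n x - G m x))\<^sup>2 \<le> l2sq (\<lambda>z. G n z - G m z) / ball_volume r"
        by (rule A2_point_bound[OF A2_diff[OF G G] r A[OF that(3)]])
      also have "\<dots> \<le> e\<^sup>2" using N[OF that(1,2)] V by (simp add: field_simps)
      finally show ?thesis using e by (simp add: power2_le_iff_abs_le)
    qed
    then show ?thesis by blast
  qed
  have "convergent (\<lambda>n. G n z)" for z
  proof (cases "z \<in> W")
    case True
    then obtain r where r: "r > 0" "cball z r \<subseteq> W" using W open_contains_cball by blast
    have "Cauchy (\<lambda>n. G n z)"
    proof (rule metric_CauchyI)
      fix e :: real assume "e > 0"
      then obtain N where "\<forall>n\<ge>N. \<forall>m\<ge>N. \<forall>x\<in>{z}. cmod (G n x - G m x) \<le> e / 2"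
        using unif[OF r(1), of "{z}" "e / 2"] r(2) by auto
      then show "\<exists>M. \<forall>m\<ge>M. \<forall>n\<ge>M. dist (G m z) (G n z) < e"
        using \<open>e > 0\<close> by (intro exI[of _ N]) (force simp: dist_norm)
    qed
    then show ?thesis by (rule Cauchy_convergent)
  next
    case False
    then have "(\<lambda>n. G n z) = (\<lambda>n. 0)" using A2D(2)[OF G] by blast
    then show ?thesis by (simp add: convergent_const)
  qed
  then obtain g where g: "\<And>z. (\<lambda>n. G n z) \<longlonglongrightarrow> g z" unfolding convergent_def by metis
  have loc: "(\<exists>r>0. holo_on (ball p r) g) \<and> (\<forall>v. (\<lambda>n. frechet_derivative (G n) (at p) v) \<longlonglongrightarrow> frechet_derivative g (at p) v)"
    if p: "p \<in> W" for p
  proof -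
    obtain R where R: "R > 0" "cball p R \<subseteq> W" using W p open_contains_cball by blast
    have sub: "cball x (R/2) \<subseteq> W" if "x \<in> ball p (R/2)" for x
    proof -
      have "cball x (R/2) \<subseteq> cball p R" using that R by (auto simp: cball_subset_cball_iff dist_commute)
      then show ?thesis using R by blast
    qed
    have hol: "holo_on (ball p (R/2)) (G n)" for n
      using R by (intro holo_on_subset[OF A2D(1)[OF G]]) (auto simp: subset_iff simp del: split_paired_All)
    note * = holo_on_uniform_limit[of p "R/2" G g, OF hol _ g unif[of "R/2" "ball p (R/2)", OF _ sub]]
    show ?thesis using *(1) *(2) R(1) by (meson half_gt_zero)
  qed
  have hol: "holo_on W g" by (rule holo_on_local) (use loc in blast)
  have gm: "g \<in> borel_measurable borel"
    by (rule borel_measurable_LIMSEQ_metric[OF A2D(3)[OF G] g])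
  have van: "g z = 0" if "z \<notin> W" for z
    using LIMSEQ_unique[OF g[of z]] A2D(2)[OF G that] by simp
  have fatou: "(\<integral>\<^sup>+ z. ennreal ((cmod (G n z - g z))\<^sup>2) \<partial>lborel) \<le> ennreal e"
    if N: "\<And>m. m \<ge> N \<Longrightarrow> l2sq (\<lambda>z. G n z - G m z) \<le> e" for n N e
  proof -
    note A2D(3)[OF G, measurable] gm[measurable]
    have "(\<integral>\<^sup>+ z. ennreal ((cmod (G n z - g z))\<^sup>2) \<partial>lborel)
      = (\<integral>\<^sup>+ z. liminf (\<lambda>m. ennreal ((cmod (G n z - G m z))\<^sup>2)) \<partial>lborel)"
    proof (rule nn_integral_cong)
      fix z
      have "(\<lambda>m. ennreal ((cmod (G n z - G m z))\<^sup>2)) \<longlonglongrightarrow> ennreal ((cmod (G n z - g z))\<^sup>2)"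
        by (intro tendsto_ennrealI tendsto_intros g)
      then show "ennreal ((cmod (G n z - g z))\<^sup>2) = liminf (\<lambda>m. ennreal ((cmod (G n z - G m z))\<^sup>2))"
        by (rule lim_imp_Liminf[OF trivial_limit_sequentially, symmetric])
    qed
    also have "\<dots> \<le> liminf (\<lambda>m. \<integral>\<^sup>+ z. ennreal ((cmod (G n z - G m z))\<^sup>2) \<partial>lborel)"
      by (rule nn_integral_liminf) measurable
    also have "\<dots> = liminf (\<lambda>m. ennreal (l2sq (\<lambda>z. G n z - G m z)))"
      by (simp add: nn_integral_l2sq[OF A2_diff[OF G G]])
    also have "\<dots> \<le> liminf (\<lambda>m. ennreal e)"
      by (intro Liminf_mono) (auto simp: eventually_sequentially intro!: exI[of _ N] ennreal_leI N)
    finally show ?thesis by (simp add: Liminf_const)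
  qed
  have diffA2: "(\<lambda>z. G n z - g z) \<in> A2 W" if N: "\<And>m. m \<ge> N \<Longrightarrow> l2sq (\<lambda>z. G n z - G m z) \<le> e" for n N e
  proof -
    note A2D(3)[OF G, measurable] gm[measurable]
    have "integrable lborel (\<lambda>z. (cmod (G n z - g z))\<^sup>2)"
    proof (rule integrableI_bounded)
      show "(\<lambda>z. (cmod (G n z - g z))\<^sup>2) \<in> borel_measurable lborel" by measurable
      show "(\<integral>\<^sup>+ z. ennreal (norm ((cmod (G n z - g z))\<^sup>2)) \<partial>lborel) < \<infinity>"
        using le_less_trans[OF fatou ennreal_less_top, of N n e] N by simp
    qed
    moreover have "(\<lambda>z. G n z - g z) \<in> borel_measurable borel" by measurable
    ultimately show ?thesis
      unfolding A2_iff using holo_on_diff[OF A2D(1)[OF G] hol] A2D(2)[OF G] van by (auto simp del: split_paired_All)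
  qed
  obtain N1 where N1: "\<And>n m. n \<ge> N1 \<Longrightarrow> m \<ge> N1 \<Longrightarrow> l2sq (\<lambda>z. G n z - G m z) \<le> 1" using cau[of 1] by auto
  have "g \<in> A2 W"
    using A2_diff[OF G[of N1] diffA2[of N1 N1 1]] N1 by simp
  moreover have "(\<lambda>n. l2sq (\<lambda>z. G n z - g z)) \<longlonglongrightarrow> 0"
  proof (rule LIMSEQ_I)
    fix e :: real assume e: "e > 0"
    then obtain N where N: "\<And>n m. n \<ge> N \<Longrightarrow> m \<ge> N \<Longrightarrow> l2sq (\<lambda>z. G n z - G m z) \<le> e / 2" using cau[of "e / 2"] by auto
    have "norm (l2sq (\<lambda>z. G n z - g z) - 0) < e" if n: "n \<ge> N" for n
    proof -
      have "(\<lambda>z. G n z - g z) \<in> A2 W" by (rule diffA2) (rule N[OF n])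
      moreover have "(\<integral>\<^sup>+ z. ennreal ((cmod (G n z - g z))\<^sup>2) \<partial>lborel) \<le> ennreal (e / 2)" by (rule fatou) (rule N[OF n])
      ultimately have "ennreal (l2sq (\<lambda>z. G n z - g z)) \<le> ennreal (e / 2)" by (simp add: nn_integral_l2sq)
      then have "l2sq (\<lambda>z. G n z - g z) \<le> e / 2" using e by simp
      then show ?thesis using e by simp
    qed
    then show "\<exists>N. \<forall>n\<ge>N. norm (l2sq (\<lambda>z. G n z - g z) - 0) < e" by blast
  qed
  ultimately show ?thesis using g loc by blast
qed

lemma L2inner_ONS_bound:
  assumes B: "ONS W B" "\<phi> \<in> B" and f: "f \<in> A2 W"
  shows "(cmod (L2inner W f \<phi>))\<^sup>2 \<le> l2sq f"
  using ONS_bessel[OF B(1), of "{\<phi>}" f "\<lambda>\<phi>. L2inner W f \<phi>"] B(2) f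
    l2sq_nonneg[of "\<lambda>z. f z - (\<Sum>\<phi>\<in>{\<phi>}. L2inner W f \<phi> * \<phi> z)"] by simp

lemma ONS_coefficients_bound:
  assumes B: "ONS W B" "finite S" "S \<subseteq> B" and f: "f \<in> A2 W"
  shows "(\<Sum>\<phi>\<in>S. (cmod (L2inner W f \<phi>))\<^sup>2) \<le> l2sq f"
  using ONS_bessel[OF B f, of "\<lambda>\<phi>. L2inner W f \<phi>"]
    l2sq_nonneg[of "\<lambda>z. f z - (\<Sum>\<phi>\<in>S. L2inner W f \<phi> * \<phi> z)"] by simp

text \<open>In place of an enumeration, finite sets \<open>S n\<close> nearly exhaust the sum of the
  squared coefficients. The partial sums over them are Cauchy, and their limit has the same
  coefficients as \<open>g\<close>, so it equals \<open>g\<close> by completeness.\<close>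

lemma ONS_expansion:
  assumes W: "open W" and B: "complete_ONS W B" and g: "g \<in> A2 W"
  shows "\<exists>S. (\<forall>n::nat. finite (S n) \<and> S n \<subseteq> B) \<and>
    (\<forall>z. (\<lambda>n. \<Sum>\<phi>\<in>S n. L2inner W g \<phi> * \<phi> z) \<longlonglongrightarrow> g z) \<and>
    (\<forall>z\<in>W. \<forall>v. (\<lambda>n. \<Sum>\<phi>\<in>S n. L2inner W g \<phi> * frechet_derivative \<phi> (at z) v) \<longlonglongrightarrow> frechet_derivative g (at z) v)"
proof -
  have ons: "ONS W B" using B by (auto simp: complete_ONS_def ONS_def)
  define c where "c \<phi> = L2inner W g \<phi>" for \<phi>
  define q where "q \<phi> = (cmod (c \<phi>))\<^sup>2" for \<phi>
  have q0: "q \<phi> \<ge> 0" for \<phi> by (simp add: q_def)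
  have qB: "sum q S \<le> l2sq g" if "finite S" "S \<subseteq> B" for S
    using ONS_coefficients_bound[OF ons that g] by (simp add: q_def c_def)
  have qs: "q summable_on B"
    using qB q0 by (intro nonneg_bounded_partial_sums_imp_summable_on) (auto simp: eventually_finite_subsets_at_top intro!: exI[of _ "{}"])
  define T where "T = infsum q B"
  have qT: "sum q S \<le> T" if "finite S" "S \<subseteq> B" for S
    unfolding T_def using qs that q0 by (intro finite_sum_le_infsum) auto
  have "\<exists>F. finite F \<and> F \<subseteq> B \<and> sum q F > T - 1 / real (Suc n)" for n
  proof (rule ccontr)
    assume "\<not> ?thesis"
    then have "sum q F \<le> T - 1 / real (Suc n)" if "finite F" "F \<subseteq> B" for F
      using that by (meson not_less)
    then have "T \<le> T - 1 / real (Suc n)" unfolding T_def using qs by (intro infsum_le_finite_sums) auto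
    then show False by simp
  qed
  then obtain F where F: "\<And>n. finite (F n)" "\<And>n. F n \<subseteq> B" "\<And>n. sum q (F n) > T - 1 / real (Suc n)" by metis
  define S where "S n = (\<Union>i\<le>n. F i)" for n
  have S: "finite (S n)" "S n \<subseteq> B" for n using F by (auto simp: S_def)
  have Smono: "S n \<subseteq> S m" if "n \<le> m" for n m
    unfolding S_def using that by (intro UN_mono) auto
  \<comment> \<open>The coefficients outside \<open>S n\<close> have total square below
    \<open>1 / (n + 1)\<close>. This controls the distances of partial sums and also each single
    coefficient that is still missing.\<close>
  have tail: "sum q X < 1 / real (Suc n)" if "finite X" "X \<subseteq> B" "X \<inter> S n = {}" for X n
  proof -
    have "F n \<subseteq> S n" by (auto simp: S_def)
    then have "sum q (F n) \<le> sum q (S n)" using S q0 by (intro sum_mono2) auto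
    moreover have "sum q (X \<union> S n) = sum q X + sum q (S n)" using that S by (intro sum.union_disjoint) auto
    moreover have "sum q (X \<union> S n) \<le> T" using that S by (intro qT) auto
    ultimately show ?thesis using F(3)[of n] by linarith
  qed
  define G where "G n z = (\<Sum>\<phi>\<in>S n. c \<phi> * \<phi> z)" for n z
  have G: "G n \<in> A2 W" for n unfolding G_def[abs_def] by (rule ONS_sum_A2[OF ons S(2)])
  have G2: "l2sq (\<lambda>z. G m z - G n z) \<le> 1 / real (Suc n)" if "n \<le> m" for m n
  proof -
    have "(\<lambda>z. G m z - G n z) = (\<lambda>z. \<Sum>\<phi>\<in>S m - S n. c \<phi> * \<phi> z)"
      unfolding G_def using S Smono[OF that] by (simp add: sum_diff)
    then have "l2sq (\<lambda>z. G m z - G n z) = sum q (S m - S n)"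
      using ONS_l2sq[OF ons, of "S m - S n" c] S by (auto simp: q_def)
    also have "\<dots> < 1 / real (Suc n)" using S by (intro tail) auto
    finally show ?thesis by simp
  qed
  have G2': "l2sq (\<lambda>z. G n z - G m z) = l2sq (\<lambda>z. G m z - G n z)" for m n
    by (simp add: l2sq_def norm_minus_commute)
  have "\<exists>N. \<forall>n\<ge>N. \<forall>m\<ge>N. l2sq (\<lambda>z. G n z - G m z) \<le> e" if "e > 0" for e
  proof -
    from that obtain N where N: "1 / real (Suc N) < e" by (meson nat_approx_posE)
    have "l2sq (\<lambda>z. G n z - G m z) \<le> e" if "n \<ge> N" "m \<ge> N" for n m
    proof -
      have *: "1 / real (Suc k) < e" if "k \<ge> N" for k
        using N that by (meson le_less_trans frac_le le_numeral_extra(4) of_nat_0_less_iff of_nat_mono Suc_le_mono zero_le_one zero_less_Suc)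
      show ?thesis
      proof (cases "n \<le> m")
        case True then show ?thesis using G2[OF True] G2'[of n m] *[OF that(1)] by linarith
      next
        case False then show ?thesis using G2[of m n] *[OF that(2)] by linarith
      qed
    qed
    then show ?thesis by blast
  qed
  then have cau: "\<forall>e>0. \<exists>N. \<forall>n\<ge>N. \<forall>m\<ge>N. l2sq (\<lambda>z. G n z - G m z) \<le> e" by blast
  obtain g' where g': "g' \<in> A2 W" "(\<lambda>n. l2sq (\<lambda>z. G n z - g' z)) \<longlonglongrightarrow> 0" "\<And>z. (\<lambda>n. G n z) \<longlonglongrightarrow> g' z"
    "\<And>z v. z \<in> W \<Longrightarrow> (\<lambda>n. frechet_derivative (G n) (at z) v) \<longlonglongrightarrow> frechet_derivative g' (at z) v"
    using A2_complete[OF W G cau] by blast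
  have "L2inner W (\<lambda>z. g z - g' z) \<phi> = 0" if \<phi>: "\<phi> \<in> B" for \<phi>
  proof -
    have \<phi>A: "\<phi> \<in> A2 W" using ons \<phi> by (auto simp: ONS_def)
    define x where "x n = L2inner W (\<lambda>z. g z - G n z) \<phi>" for n
    define y where "y n = L2inner W (\<lambda>z. G n z - g' z) \<phi>" for n
    have "(cmod (x n))\<^sup>2 \<le> 1 / real (Suc n)" for n
    proof -
      have "x n = c \<phi> - (if \<phi> \<in> S n then c \<phi> else 0)"
        unfolding x_def L2inner_diff_left[OF g G \<phi>A] using ONS_inner[OF ons S(1)[of n] S(2)[of n] \<phi>, of c] by (simp add: c_def G_def[abs_def])
      then show ?thesis using tail[of "{\<phi>}" n] \<phi> by (cases "\<phi> \<in> S n") (auto simp: q_def)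
    qed
    then have "(\<lambda>n. (cmod (x n))\<^sup>2) \<longlonglongrightarrow> 0"
      by (intro tendsto_sandwich[OF _ _ tendsto_const LIMSEQ_Suc[OF lim_const_over_n[of 1]]]) auto
    then have x: "x \<longlonglongrightarrow> 0" by (simp add: tendsto_norm_zero_iff power_tendsto_0_iff)
    have "(cmod (y n))\<^sup>2 \<le> l2sq (\<lambda>z. G n z - g' z)" for n
      unfolding y_def by (rule L2inner_ONS_bound[OF ons \<phi> A2_diff[OF G g'(1)]])
    then have "(\<lambda>n. (cmod (y n))\<^sup>2) \<longlonglongrightarrow> 0"
      by (intro tendsto_sandwich[OF _ _ tendsto_const g'(2)]) auto
    then have y: "y \<longlonglongrightarrow> 0" by (simp add: tendsto_norm_zero_iff power_tendsto_0_iff)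
    have "x n + y n = L2inner W (\<lambda>z. g z - g' z) \<phi>" for n
      unfolding x_def y_def by (simp add: L2inner_diff_left[OF _ _ \<phi>A] g G g'(1))
    then show ?thesis using tendsto_add[OF x y] LIMSEQ_const_iff by auto
  qed
  then have "(\<lambda>z. g z - g' z) = (\<lambda>_. 0)"
    using B A2_diff[OF g g'(1)] by (auto simp: complete_ONS_def)
  then have gg': "g = g'" by (metis eq_iff_diff_eq_0 ext)
  have "frechet_derivative (G n) (at z) v = (\<Sum>\<phi>\<in>S n. c \<phi> * frechet_derivative \<phi> (at z) v)" if "z \<in> W" for n z v
  proof -
    have hol: "holo_on W \<phi>" if "\<phi> \<in> S n" for \<phi> using S(2)[of n] that ons A2D(1)[of \<phi> W] by (auto simp: ONS_def)
    have "frechet_derivative (G n) (at z) v = (\<Sum>\<phi>\<in>S n. frechet_derivative (\<lambda>z. c \<phi> * \<phi> z) (at z) v)"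
      unfolding G_def[abs_def] using hol that by (intro holo_on_frechet_sum holo_on_cmult) auto
    then show ?thesis using holo_on_frechet_cmult[OF hol that] by simp
  qed
  then show ?thesis using g'(3,4) S by (intro exI[of _ S]) (simp add: gg' c_def G_def del: split_paired_All)
qed

lemma cauchy_schwarz_sum:
  fixes a b :: "'i \<Rightarrow> complex"
  shows "(cmod (\<Sum>i\<in>S. a i * b i))\<^sup>2 \<le> (\<Sum>i\<in>S. (cmod (a i))\<^sup>2) * (\<Sum>i\<in>S. (cmod (b i))\<^sup>2)"
proof -
  have "cmod (\<Sum>i\<in>S. a i * b i) \<le> (\<Sum>i\<in>S. cmod (a i) * cmod (b i))"
    using norm_sum[of "\<lambda>i. a i * b i" S] by (simp add: norm_mult)
  then have "(cmod (\<Sum>i\<in>S. a i * b i))\<^sup>2 \<le> (\<Sum>i\<in>S. cmod (a i) * cmod (b i))\<^sup>2" by (intro power_mono) auto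
  also have "\<dots> \<le> (\<Sum>i\<in>S. (cmod (a i))\<^sup>2) * (\<Sum>i\<in>S. (cmod (b i))\<^sup>2)"
    by (rule Cauchy_Schwarz_ineq_sum)
  finally show ?thesis .
qed

section \<open>The kernel on the diagonal and its extremal property\<close>

text \<open>\<open>kernel_eq\<close> ties \<open>B\<close> to the system selected in the definition
  of the kernel, so that all series refer to the same basis; \<open>nonvanishing\<close> yields
  positivity on the diagonal.\<close>

locale bergman_basis =
  fixes W :: "c2 set" and B :: "(c2 \<Rightarrow> complex) set"
  assumes W: "open W" and B: "complete_ONS W B"
    and kernel_eq: "bergman_kernel W = (\<lambda>z w. \<Sum>\<^sub>\<infinity>\<phi>\<in>B. \<phi> z * cnj (\<phi> w))"
    and nonvanishing: "p \<in> W \<Longrightarrow> \<exists>g\<in>A2 W. g p \<noteq> 0"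
begin

abbreviation D :: "c2 \<Rightarrow> (c2 \<Rightarrow> complex) \<Rightarrow> c2 \<Rightarrow> complex" where
  "D v \<phi> z \<equiv> frechet_derivative \<phi> (at z) v"

lemma ons: "ONS W B" using B by (auto simp: complete_ONS_def ONS_def)

lemma basis_A2: "\<phi> \<in> B \<Longrightarrow> \<phi> \<in> A2 W" using ons by (auto simp: ONS_def)

lemma basis_holo: "\<phi> \<in> B \<Longrightarrow> holo_on W \<phi>" by (rule A2D(1)[OF basis_A2])

lemma domination:
  assumes p: "p \<in> W"
  obtains r m where "r > 0" "ball p r \<subseteq> W" "\<And>\<phi>. m \<phi> \<ge> 0" "(\<lambda>\<phi>. (m \<phi>)\<^sup>2) summable_on B"
    "\<And>\<phi> z. \<phi> \<in> B \<Longrightarrow> z \<in> ball p r \<Longrightarrow> cmod (\<phi> z) \<le> m \<phi>"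
    "\<And>\<phi> z v. \<phi> \<in> B \<Longrightarrow> z \<in> ball p r \<Longrightarrow> cmod (D v \<phi> z) \<le> m \<phi> * norm v"
proof -
  obtain r m where r: "r > 0" "ball p r \<subseteq> W" "\<And>\<phi>. m \<phi> \<ge> 0"
    "\<And>\<phi> z. \<phi> \<in> B \<Longrightarrow> z \<in> ball p r \<Longrightarrow> cmod (\<phi> z) \<le> m \<phi>" and m: "(\<lambda>\<phi>. (m \<phi>)\<^sup>2) summable_on B"
    using ONS_domination[OF W ons p] by metis
  define L where "L = 1 + 4 / r"
  have L: "L \<ge> 1" "4 / r \<le> L" using r by (auto simp: L_def)
  show ?thesis
  proof (rule that[of "r/2" "\<lambda>\<phi>. L * m \<phi>"])
    show "r / 2 > 0" using r by simp
    show "ball p (r/2) \<subseteq> W" using r by (auto simp: subset_iff simp del: split_paired_All)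
    show "L * m \<phi> \<ge> 0" for \<phi> using L r by simp
    show "(\<lambda>\<phi>. (L * m \<phi>)\<^sup>2) summable_on B" using m unfolding power_mult_distrib by (rule summable_on_cmult_right)
    fix \<phi> z v assume \<phi>: "\<phi> \<in> B" and z: "z \<in> ball p (r/2)"
    have "cmod (\<phi> z) \<le> m \<phi>" using r \<phi> z by auto
    also have "\<dots> \<le> L * m \<phi>" using L(1) r(3)[of \<phi>] by (simp add: mult_le_cancel_right1)
    finally show "cmod (\<phi> z) \<le> L * m \<phi>" .
    have sub: "ball z (r/2) \<subseteq> ball p r" using z by (auto simp: ball_subset_ball_iff dist_commute)
    have "cmod (D v \<phi> z) \<le> 2 * m \<phi> * norm v / (r/2)"
      by (rule holo_on_derivative_bound[OF basis_holo[OF \<phi>]]) (use sub r \<phi> in blast | use r in simp)+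
    also have "\<dots> = 4 / r * (m \<phi> * norm v)" by simp
    also have "\<dots> \<le> L * (m \<phi> * norm v)" using L r by (intro mult_right_mono) auto
    finally show "cmod (D v \<phi> z) \<le> L * m \<phi> * norm v" by (simp add: mult.assoc)
  qed
qed

lemma summable_products:
  assumes p: "p \<in> W"
  shows "(\<lambda>\<phi>. (cmod (\<phi> p))\<^sup>2) summable_on B" "(\<lambda>\<phi>. (cmod (D v \<phi> p))\<^sup>2) summable_on B"
    "(\<lambda>\<phi>. D v \<phi> p * cnj (D w \<phi> p)) summable_on B" "(\<lambda>\<phi>. D v \<phi> p * cnj (\<phi> p)) summable_on B"
    "(\<lambda>\<phi>. \<phi> p * cnj (D v \<phi> p)) summable_on B"
proof -
  obtain r m where r: "r > 0" "\<And>\<phi>. m \<phi> \<ge> 0" "(\<lambda>\<phi>. (m \<phi>)\<^sup>2) summable_on B"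
    "\<And>\<phi> z. \<phi> \<in> B \<Longrightarrow> z \<in> ball p r \<Longrightarrow> cmod (\<phi> z) \<le> m \<phi>"
    "\<And>\<phi> z v. \<phi> \<in> B \<Longrightarrow> z \<in> ball p r \<Longrightarrow> cmod (D v \<phi> z) \<le> m \<phi> * norm v"
    using domination[OF p] by metis
  have a: "cmod (\<phi> p) \<le> m \<phi>" if "\<phi> \<in> B" for \<phi> using r(1,4) that by simp
  have b: "cmod (D v \<phi> p) \<le> m \<phi> * norm v" if "\<phi> \<in> B" for \<phi> v using r(1,5) that by simp
  have sq: "(\<lambda>\<phi>. m \<phi> * K1 * (m \<phi> * K2)) summable_on B" for K1 K2
    using summable_on_cmult_left[OF r(3), of "K1 * K2"] by (simp add: power2_eq_square mult_ac)
  have bound: "(\<lambda>\<phi>. x \<phi> * cnj (y \<phi>)) summable_on B"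
    if "\<And>\<phi>. \<phi> \<in> B \<Longrightarrow> cmod (x \<phi>) \<le> m \<phi> * K1" "\<And>\<phi>. \<phi> \<in> B \<Longrightarrow> cmod (y \<phi>) \<le> m \<phi> * K2" for x y K1 K2
  proof (rule summable_on_bounded[OF sq[of K1 K2]])
    fix \<phi> assume \<phi>: "\<phi> \<in> B"
    have "0 \<le> m \<phi> * K1" using that(1)[OF \<phi>] norm_ge_zero order_trans by blast
    then show "cmod (x \<phi> * cnj (y \<phi>)) \<le> m \<phi> * K1 * (m \<phi> * K2)"
      unfolding norm_mult complex_mod_cnj using that \<phi> by (intro mult_mono) auto
  qed
  show 1: "(\<lambda>\<phi>. D v \<phi> p * cnj (D w \<phi> p)) summable_on B" for v w by (rule bound[OF b b])
  show "(\<lambda>\<phi>. D v \<phi> p * cnj (\<phi> p)) summable_on B" by (rule bound[of _ _ _ 1, OF b]) (use a in auto)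
  show "(\<lambda>\<phi>. \<phi> p * cnj (D v \<phi> p)) summable_on B" by (rule bound[of _ 1, OF _ b]) (use a in auto)
  have 2: "(\<lambda>\<phi>. \<phi> p * cnj (\<phi> p)) summable_on B" by (rule bound[of _ 1 _ 1]) (use a in auto)
  have re: "(\<lambda>\<phi>. (cmod (x \<phi>))\<^sup>2) summable_on B" if "(\<lambda>\<phi>. x \<phi> * cnj (x \<phi>)) summable_on B" for x :: "(c2 \<Rightarrow> complex) \<Rightarrow> complex"
    using summable_on_Re[OF that] by (simp flip: complex_norm_square of_real_power)
  show "(\<lambda>\<phi>. (cmod (\<phi> p))\<^sup>2) summable_on B" by (rule re[OF 2])
  show "(\<lambda>\<phi>. (cmod (D v \<phi> p))\<^sup>2) summable_on B" by (rule re[OF 1])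
qed

definition diag :: "c2 \<Rightarrow> real" where "diag p = (\<Sum>\<^sub>\<infinity>\<phi>\<in>B. (cmod (\<phi> p))\<^sup>2)"

lemma kernel_diagonal: "bergman_kernel W p p = of_real (diag p)"
proof (cases "p \<in> W")
  case False
  then have "\<phi> p = 0" if "\<phi> \<in> B" for \<phi> using A2D(2)[OF basis_A2[OF that]] by blast
  then show ?thesis by (simp add: kernel_eq diag_def infsum_0)
next
  case True
  have "((\<lambda>\<phi>. complex_of_real ((cmod (\<phi> p))\<^sup>2)) has_sum of_real (diag p)) B"
    unfolding diag_def by (rule has_sum_of_real[OF has_sum_infsum[OF summable_products(1)[OF True]]])
  then have "((\<lambda>\<phi>. \<phi> p * cnj (\<phi> p)) has_sum of_real (diag p)) B"
    by (simp only: complex_norm_square)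
  then show ?thesis unfolding kernel_eq by (rule infsumI)
qed

text \<open>Cauchy-Schwarz on the partial sums of the expansion: the squared norm of this functional
  is the sum of its squared values on the basis. With \<beta> = 0 it bounds point values by the
  kernel; with \<beta> = 1 and a suitable \<alpha> it bounds derivatives by the metric.\<close>

lemma A2_derivative_bound:
  assumes p: "p \<in> W" and g: "g \<in> A2 W"
    and E: "(\<lambda>\<phi>. (cmod (\<beta> * D v \<phi> p + \<alpha> * \<phi> p))\<^sup>2) summable_on B"
  shows "(cmod (\<beta> * D v g p + \<alpha> * g p))\<^sup>2 \<le> l2sq g * (\<Sum>\<^sub>\<infinity>\<phi>\<in>B. (cmod (\<beta> * D v \<phi> p + \<alpha> * \<phi> p))\<^sup>2)"
proof -
  obtain S :: "nat \<Rightarrow> (c2 \<Rightarrow> complex) set" where S0: "\<forall>n. finite (S n) \<and> S n \<subseteq> B"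
    and S1: "\<forall>z. (\<lambda>n. \<Sum>\<phi>\<in>S n. L2inner W g \<phi> * \<phi> z) \<longlonglongrightarrow> g z"
    and S2: "\<forall>z\<in>W. \<forall>v. (\<lambda>n. \<Sum>\<phi>\<in>S n. L2inner W g \<phi> * D v \<phi> z) \<longlonglongrightarrow> D v g z"
    using ONS_expansion[OF W B g] by (elim exE conjE)
  note S = S0[rule_format, THEN conjunct1] S0[rule_format, THEN conjunct2] S1[rule_format] S2[rule_format]
  define x where "x n = (\<Sum>\<phi>\<in>S n. L2inner W g \<phi> * (\<beta> * D v \<phi> p + \<alpha> * \<phi> p))" for n
  have "(\<lambda>n. \<beta> * (\<Sum>\<phi>\<in>S n. L2inner W g \<phi> * D v \<phi> p) + \<alpha> * (\<Sum>\<phi>\<in>S n. L2inner W g \<phi> * \<phi> p)) \<longlonglongrightarrow> \<beta> * D v g p + \<alpha> * g p"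
    by (intro tendsto_intros S p)
  then have "x \<longlonglongrightarrow> \<beta> * D v g p + \<alpha> * g p"
    by (simp add: x_def[abs_def] sum_distrib_left sum.distrib algebra_simps)
  then have "(\<lambda>n. (cmod (x n))\<^sup>2) \<longlonglongrightarrow> (cmod (\<beta> * D v g p + \<alpha> * g p))\<^sup>2" by (intro tendsto_intros)
  moreover have "(cmod (x n))\<^sup>2 \<le> l2sq g * (\<Sum>\<^sub>\<infinity>\<phi>\<in>B. (cmod (\<beta> * D v \<phi> p + \<alpha> * \<phi> p))\<^sup>2)" for n
  proof -
    have "(cmod (x n))\<^sup>2 \<le> (\<Sum>\<phi>\<in>S n. (cmod (L2inner W g \<phi>))\<^sup>2) * (\<Sum>\<phi>\<in>S n. (cmod (\<beta> * D v \<phi> p + \<alpha> * \<phi> p))\<^sup>2)"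
      unfolding x_def by (rule cauchy_schwarz_sum)
    also have "\<dots> \<le> l2sq g * (\<Sum>\<^sub>\<infinity>\<phi>\<in>B. (cmod (\<beta> * D v \<phi> p + \<alpha> * \<phi> p))\<^sup>2)"
      by (intro mult_mono ONS_coefficients_bound[OF ons S(1,2) g] finite_sum_le_infsum[OF E S(1,2)] sum_nonneg) auto
    finally show ?thesis .
  qed
  ultimately show ?thesis by (intro LIMSEQ_le_const2) auto
qed

lemma A2_value_bound:
  assumes p: "p \<in> W" and g: "g \<in> A2 W"
  shows "(cmod (g p))\<^sup>2 \<le> l2sq g * diag p"
  using A2_derivative_bound[OF p g, of 0 0 1] summable_products(1)[OF p] by (simp add: diag_def)

lemma diag_pos:
  assumes p: "p \<in> W"
  shows "diag p > 0"
proof -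
  obtain g where g: "g \<in> A2 W" "g p \<noteq> 0" using nonvanishing[OF p] by blast
  have "0 < (cmod (g p))\<^sup>2" using g by simp
  also have "\<dots> \<le> l2sq g * diag p" by (rule A2_value_bound[OF p g(1)])
  finally show ?thesis using l2sq_nonneg[of g] by (metis mult_le_0_iff not_le)
qed

end

section \<open>The Bergman metric\<close>

lemma pd_eqI:
  assumes "((\<lambda>t. g (z + t *\<^sub>R e)) has_vector_derivative d) (at 0)" "open W" "z \<in> W" "\<And>w. w \<in> W \<Longrightarrow> f w = g w"
  shows "pd f z e = d"
proof -
  have "open ((\<lambda>t. z + t *\<^sub>R e) -` W)" using assms(2) by (intro open_vimage continuous_intros)
  then have "((\<lambda>t. f (z + t *\<^sub>R e)) has_vector_derivative d) (at 0)"
    by (rule has_vector_derivative_transform_within_open[OF assms(1)]) (use assms in auto)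
  then show ?thesis unfolding pd_def by (rule vector_derivative_at)
qed

context bergman_basis
begin

text \<open>The part of the derivative of \<open>K(p, p)\<close> in direction \<open>v\<close> that
  is conjugate linear in \<open>v\<close>; \<open>mixed\<close> is the corresponding mixed second
  derivative.\<close>

definition dbar :: "c2 \<Rightarrow> c2 \<Rightarrow> complex" where "dbar v p = (\<Sum>\<^sub>\<infinity>\<phi>\<in>B. \<phi> p * cnj (D v \<phi> p))"

definition mixed :: "c2 \<Rightarrow> c2 \<Rightarrow> c2 \<Rightarrow> complex" where "mixed v w p = (\<Sum>\<^sub>\<infinity>\<phi>\<in>B. D v \<phi> p * cnj (D w \<phi> p))"

lemma D_cscale: "p \<in> W \<Longrightarrow> \<phi> \<in> B \<Longrightarrow> D (cscale c v) \<phi> p = c * D v \<phi> p"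
  by (rule holo_onD(2)[OF basis_holo])

lemma dbar_cscale:
  assumes "p \<in> W"
  shows "dbar (cscale c v) p = cnj c * dbar v p"
proof -
  have "dbar (cscale c v) p = (\<Sum>\<^sub>\<infinity>\<phi>\<in>B. cnj c * (\<phi> p * cnj (D v \<phi> p)))"
    unfolding dbar_def by (rule infsum_cong) (simp add: D_cscale[OF assms])
  then show ?thesis by (simp add: infsum_cmult_right' dbar_def)
qed

lemma dbar_add:
  assumes "p \<in> W"
  shows "dbar (v + w) p = dbar v p + dbar w p"
proof -
  have "dbar (v + w) p = (\<Sum>\<^sub>\<infinity>\<phi>\<in>B. \<phi> p * cnj (D v \<phi> p) + \<phi> p * cnj (D w \<phi> p))"
    unfolding dbar_def by (rule infsum_cong) (simp add: holo_on_linear[OF basis_holo assms] algebra_simps)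
  then show ?thesis using infsum_add[OF summable_products(5)[OF assms, of v] summable_products(5)[OF assms, of w]] by (simp add: dbar_def)
qed

lemma mixed_cscale:
  assumes "p \<in> W"
  shows "mixed (cscale c v) w p = c * mixed v w p" "mixed v (cscale c w) p = cnj c * mixed v w p"
proof -
  have "mixed (cscale c v) w p = (\<Sum>\<^sub>\<infinity>\<phi>\<in>B. c * (D v \<phi> p * cnj (D w \<phi> p)))"
    unfolding mixed_def by (rule infsum_cong) (simp add: D_cscale[OF assms])
  then show "mixed (cscale c v) w p = c * mixed v w p" by (simp add: infsum_cmult_right' mixed_def)
  have "mixed v (cscale c w) p = (\<Sum>\<^sub>\<infinity>\<phi>\<in>B. cnj c * (D v \<phi> p * cnj (D w \<phi> p)))"
    unfolding mixed_def by (rule infsum_cong) (simp add: D_cscale[OF assms])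
  then show "mixed v (cscale c w) p = cnj c * mixed v w p" by (simp add: infsum_cmult_right' mixed_def)
qed

lemma mixed_add:
  assumes "p \<in> W"
  shows "mixed (v + v') w p = mixed v w p + mixed v' w p" "mixed v (w + w') p = mixed v w p + mixed v w' p"
proof -
  have "mixed (v + v') w p = (\<Sum>\<^sub>\<infinity>\<phi>\<in>B. D v \<phi> p * cnj (D w \<phi> p) + D v' \<phi> p * cnj (D w \<phi> p))"
    unfolding mixed_def by (rule infsum_cong) (simp add: holo_on_linear[OF basis_holo assms] algebra_simps)
  then show "mixed (v + v') w p = mixed v w p + mixed v' w p"
    using infsum_add[OF summable_products(3)[OF assms, of v w] summable_products(3)[OF assms, of v' w]] by (simp add: mixed_def)
  have "mixed v (w + w') p = (\<Sum>\<^sub>\<infinity>\<phi>\<in>B. D v \<phi> p * cnj (D w \<phi> p) + D v \<phi> p * cnj (D w' \<phi> p))"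
    unfolding mixed_def by (rule infsum_cong) (simp add: holo_on_linear[OF basis_holo assms] algebra_simps)
  then show "mixed v (w + w') p = mixed v w p + mixed v w' p"
    using infsum_add[OF summable_products(3)[OF assms, of v w] summable_products(3)[OF assms, of v w']] by (simp add: mixed_def)
qed

lemma mixed_self:
  assumes "p \<in> W"
  shows "mixed v v p = of_real (\<Sum>\<^sub>\<infinity>\<phi>\<in>B. (cmod (D v \<phi> p))\<^sup>2)"
proof -
  have "((\<lambda>\<phi>. complex_of_real ((cmod (D v \<phi> p))\<^sup>2)) has_sum of_real (\<Sum>\<^sub>\<infinity>\<phi>\<in>B. (cmod (D v \<phi> p))\<^sup>2)) B"
    by (rule has_sum_of_real[OF has_sum_infsum[OF summable_products(2)[OF assms]]])
  then show ?thesis unfolding mixed_def by (simp only: complex_norm_square infsumI)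
qed

lemma dbar_cnj: "(\<Sum>\<^sub>\<infinity>\<phi>\<in>B. D v \<phi> p * cnj (\<phi> p)) = cnj (dbar v p)"
  unfolding dbar_def by (subst infsum_cnj[symmetric]) (simp add: mult.commute)

lemma diag_derivative:
  assumes p: "p \<in> W"
  shows "((\<lambda>t. diag (p + t *\<^sub>R v)) has_real_derivative 2 * Re (dbar v p)) (at 0)"
proof -
  obtain r m where r: "r > 0" "ball p r \<subseteq> W" "(\<lambda>\<phi>. (m \<phi>)\<^sup>2) summable_on B"
    "\<And>\<phi> z. \<phi> \<in> B \<Longrightarrow> z \<in> ball p r \<Longrightarrow> cmod (\<phi> z) \<le> m \<phi>"
    using domination[OF p] by metis
  have hol: "holo_on (ball p r) \<phi>" if "\<phi> \<in> B" for \<phi> using holo_on_subset[OF basis_holo[OF that] r(2)] .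
  have "((\<lambda>t. \<Sum>\<^sub>\<infinity>\<phi>\<in>B. \<phi> (p + t *\<^sub>R v) * cnj (\<phi> (p + t *\<^sub>R v))) has_vector_derivative
      (\<Sum>\<^sub>\<infinity>\<phi>\<in>B. D v \<phi> p * cnj (\<phi> p)) + (\<Sum>\<^sub>\<infinity>\<phi>\<in>B. \<phi> p * cnj (D v \<phi> p))) (at 0)"
    by (rule has_vector_derivative_infsum_product(4)[where m = m and r = r and p = p]) (use r hol in auto)
  then have "((\<lambda>t. complex_of_real (diag (p + t *\<^sub>R v))) has_vector_derivative cnj (dbar v p) + dbar v p) (at 0)"
    unfolding dbar_cnj dbar_def[symmetric] by (simp add: kernel_diagonal[unfolded fun_cong[OF fun_cong[OF kernel_eq]]])
  from bounded_linear.has_vector_derivative[OF bounded_linear_Re this]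
  show ?thesis by (simp add: has_real_derivative_iff_has_vector_derivative)
qed

text \<open>\<open>Q\<close> comes from differentiating the conjugated factor. It is conjugate
  linear in the direction and therefore cancels in the Wirtinger derivative \<open>Dz\<close>, so
  this property is all that needs to be known about it.\<close>

lemma dbar_derivative:
  assumes p: "p \<in> W"
  obtains Q where "\<And>v. ((\<lambda>t. dbar e (p + t *\<^sub>R v)) has_vector_derivative mixed v e p + Q v) (at 0)"
    "\<And>c v. Q (cscale c v) = cnj c * Q v"
proof -
  obtain r m where r: "r > 0" "ball p r \<subseteq> W" "\<And>\<phi>. m \<phi> \<ge> 0" "(\<lambda>\<phi>. (m \<phi>)\<^sup>2) summable_on B"
    "\<And>\<phi> z. \<phi> \<in> B \<Longrightarrow> z \<in> ball p r \<Longrightarrow> cmod (\<phi> z) \<le> m \<phi>"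
    "\<And>\<phi> z v. \<phi> \<in> B \<Longrightarrow> z \<in> ball p r \<Longrightarrow> cmod (D v \<phi> z) \<le> m \<phi> * norm v"
    using domination[OF p] by metis
  have hol: "holo_on (ball p r) \<phi>" "holo_on (ball p r) (\<lambda>z. D e \<phi> z)" if "\<phi> \<in> B" for \<phi>
    using holo_on_subset[OF basis_holo[OF that] r(2)] holo_on_subset[OF holo_on_frechet[OF W basis_holo[OF that]] r(2)] by blast+
  define m' where "m' \<phi> = m \<phi> * (1 + norm e)" for \<phi>
  have m': "m \<phi> \<le> m' \<phi>" "m \<phi> * norm e \<le> m' \<phi>" for \<phi>
    using r(3)[of \<phi>] by (auto simp: m'_def distrib_left)
  define Q where "Q v = (\<Sum>\<^sub>\<infinity>\<phi>\<in>B. \<phi> p * cnj (D v (\<lambda>z. D e \<phi> z) p))" for v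
  show ?thesis
  proof (rule that[of Q])
    fix v
    show "((\<lambda>t. dbar e (p + t *\<^sub>R v)) has_vector_derivative mixed v e p + Q v) (at 0)"
      unfolding dbar_def mixed_def Q_def
    proof (rule has_vector_derivative_infsum_product(4)[where m = m' and r = r and p = p])
      show "(\<lambda>\<phi>. (m' \<phi>)\<^sup>2) summable_on B" unfolding m'_def power_mult_distrib using r(4) by (rule summable_on_cmult_left)
      show "cmod (\<phi> z) \<le> m' \<phi>" if "\<phi> \<in> B" "z \<in> ball p r" for \<phi> z
        using r(5)[OF that] m'(1) by (rule order_trans)
      show "cmod (D e \<phi> z) \<le> m' \<phi>" if "\<phi> \<in> B" "z \<in> ball p r" for \<phi> z
        using r(6)[OF that] m'(2) by (rule order_trans)
    qed (use r hol in auto)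
    fix c
    have "Q (cscale c v) = (\<Sum>\<^sub>\<infinity>\<phi>\<in>B. cnj c * (\<phi> p * cnj (D v (\<lambda>z. D e \<phi> z) p)))"
      unfolding Q_def by (rule infsum_cong) (simp add: holo_onD(2)[OF holo_on_frechet[OF W basis_holo] p])
    then show "Q (cscale c v) = cnj c * Q v" by (simp add: infsum_cmult_right' Q_def)
  qed
qed

abbreviation log_kernel :: "c2 \<Rightarrow> complex" where
  "log_kernel w \<equiv> complex_of_real (ln (Re (bergman_kernel W w w)))"

lemma Dzb_log_kernel:
  assumes p: "p \<in> W"
  shows "Dzb k log_kernel p = dbar (cunit k) p / of_real (diag p)"
proof -
  have pd: "pd log_kernel p v = of_real (2 * Re (dbar v p) / diag p)" for v
  proof (rule pd_eqI[OF _ W p])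
    have "((\<lambda>t. ln (diag (p + t *\<^sub>R v))) has_real_derivative 1 / diag (p + 0 *\<^sub>R v) * (2 * Re (dbar v p))) (at 0)"
      by (rule DERIV_chain2[OF DERIV_ln_divide diag_derivative[OF p]]) (simp add: diag_pos[OF p])
    then have "((\<lambda>t. ln (diag (p + t *\<^sub>R v))) has_real_derivative 2 * Re (dbar v p) / diag p) (at 0)" by simp
    then show "((\<lambda>t. complex_of_real (ln (diag (p + t *\<^sub>R v)))) has_vector_derivative of_real (2 * Re (dbar v p) / diag p)) (at 0)"
      by (rule has_vector_derivative_of_real)
  qed (simp add: kernel_diagonal)
  have "Re (dbar (cscale \<i> v) p) = Im (dbar v p)" for v by (simp add: dbar_cscale[OF p])
  then show ?thesis unfolding Dzb_def pd using diag_pos[OF p] by (simp add: complex_eq_iff field_simps)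
qed

lemma bergman_coeff_eq:
  assumes p: "p \<in> W"
  shows "bergman_coeff W j k p = mixed (cunit j) (cunit k) p / of_real (diag p) - dbar (cunit k) p * cnj (dbar (cunit j) p) / (of_real (diag p))\<^sup>2"
proof -
  define e where "e = cunit k"
  obtain Q where Q: "\<And>v. ((\<lambda>t. dbar e (p + t *\<^sub>R v)) has_vector_derivative mixed v e p + Q v) (at 0)"
    "\<And>c v. Q (cscale c v) = cnj c * Q v" using dbar_derivative[OF p] by blast
  have up: "diag p > 0" by (rule diag_pos[OF p])
  have pd: "pd (Dzb k log_kernel) p v = (mixed v e p + Q v) / of_real (diag p) - dbar e p * of_real (2 * Re (dbar v p)) / (of_real (diag p))\<^sup>2" for v
  proof (rule pd_eqI[OF _ W p])
    have "((\<lambda>t. inverse (diag (p + t *\<^sub>R v))) has_real_derivative - (inverse (diag (p + 0 *\<^sub>R v)) * (2 * Re (dbar v p)) * inverse (diag (p + 0 *\<^sub>R v)))) (at 0)"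
      by (rule DERIV_inverse'[OF diag_derivative[OF p]]) (use up in simp)
    then have "((\<lambda>t. complex_of_real (inverse (diag (p + t *\<^sub>R v)))) has_vector_derivative of_real (- (2 * Re (dbar v p)) / (diag p)\<^sup>2)) (at 0)"
      by (intro has_vector_derivative_of_real)
        (simp add: has_real_derivative_iff_has_vector_derivative[symmetric] power2_eq_square divide_inverse mult_ac)
    from has_vector_derivative_mult[OF Q(1)[of v] this]
    show "((\<lambda>t. dbar e (p + t *\<^sub>R v) * complex_of_real (inverse (diag (p + t *\<^sub>R v)))) has_vector_derivative
      (mixed v e p + Q v) / of_real (diag p) - dbar e p * of_real (2 * Re (dbar v p)) / (of_real (diag p))\<^sup>2) (at 0)"
      by (simp add: divide_inverse algebra_simps)
    show "Dzb k log_kernel w = dbar e w * complex_of_real (inverse (diag w))" if "w \<in> W" for w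
      using Dzb_log_kernel[OF that] by (simp add: e_def divide_inverse)
  qed
  have cnjN: "cnj (dbar v p) = of_real (Re (dbar v p)) - \<i> * of_real (Im (dbar v p))" for v by (simp add: complex_eq_iff)
  have "Re (dbar (cscale \<i> v) p) = Im (dbar v p)" for v by (simp add: dbar_cscale[OF p])
  then show ?thesis unfolding bergman_coeff_def Dz_def pd e_def[symmetric] cnjN using up
    by (simp add: mixed_cscale[OF p] Q(2)) (simp add: field_simps)
qed

lemma bergman_form_eq:
  assumes p: "p \<in> W"
  shows "bergman_form W p v = of_real ((\<Sum>\<^sub>\<infinity>\<phi>\<in>B. (cmod (D v \<phi> p))\<^sup>2) / diag p - (cmod (dbar v p))\<^sup>2 / (diag p)\<^sup>2)"
proof -
  have v: "v = cscale (fst v) (cunit 1) + cscale (snd v) (cunit 2)"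
    by (simp add: prod_eq_iff cunit_def)
  have "of_real (\<Sum>\<^sub>\<infinity>\<phi>\<in>B. (cmod (D v \<phi> p))\<^sup>2) = mixed v v p" by (rule mixed_self[OF p, symmetric])
  also have "mixed v v p = (\<Sum>j\<in>{1,2}. \<Sum>k\<in>{1,2}. mixed (cunit j) (cunit k) p * ccomp j v * cnj (ccomp k v))"
    by (subst (1 2) v) (simp add: mixed_add[OF p] mixed_cscale[OF p] ccomp_def algebra_simps)
  finally have mixed: "of_real (\<Sum>\<^sub>\<infinity>\<phi>\<in>B. (cmod (D v \<phi> p))\<^sup>2) = (\<Sum>j\<in>{1,2}. \<Sum>k\<in>{1,2}. mixed (cunit j) (cunit k) p * ccomp j v * cnj (ccomp k v))" .
  have Nv: "dbar v p = cnj (fst v) * dbar (cunit 1) p + cnj (snd v) * dbar (cunit 2) p"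
    by (subst v) (simp add: dbar_add[OF p] dbar_cscale[OF p])
  have "of_real ((cmod (dbar v p))\<^sup>2) = dbar v p * cnj (dbar v p)" by (rule complex_norm_square)
  also have "\<dots> = (\<Sum>j\<in>{1,2}. \<Sum>k\<in>{1,2}. dbar (cunit k) p * cnj (dbar (cunit j) p) * ccomp j v * cnj (ccomp k v))"
    unfolding Nv by (simp add: ccomp_def algebra_simps)
  finally have dbar: "of_real ((cmod (dbar v p))\<^sup>2) = (\<Sum>j\<in>{1,2}. \<Sum>k\<in>{1,2}. dbar (cunit k) p * cnj (dbar (cunit j) p) * ccomp j v * cnj (ccomp k v))" .
  show ?thesis unfolding of_real_diff of_real_divide of_real_power mixed dbar[unfolded of_real_power] bergman_form_def bergman_coeff_eq[OF p]
    by (simp add: left_diff_distrib sum_subtractf sum_divide_distrib add_divide_distrib diff_divide_distrib)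
qed

end

section \<open>Comparison with the Caratheodory metric\<close>

lemma A2_dominated:
  assumes W: "open W" and f: "holo_on W f" "\<And>z. z \<notin> W \<Longrightarrow> f z = 0"
    and h: "integrable lborel (\<lambda>z. (h z)\<^sup>2)" "\<And>z. z \<in> W \<Longrightarrow> cmod (f z) \<le> h z"
  shows "f \<in> A2 W"
proof -
  have "(\<lambda>z. indicator W z *\<^sub>R f z) \<in> borel_measurable borel"
    using W by (intro borel_measurable_continuous_on_indicator holo_on_continuous[OF f(1)]) auto
  moreover have "indicator W z *\<^sub>R f z = f z" for z using f(2)[of z] by (cases "z \<in> W") auto
  ultimately have m: "f \<in> borel_measurable borel" by simp
  note m[measurable]
  have "integrable lborel (\<lambda>z. (cmod (f z))\<^sup>2)"
  proof (rule Bochner_Integration.integrable_bound[OF h(1)])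
    have "(cmod (f z))\<^sup>2 \<le> (h z)\<^sup>2" for z
      using h(2)[of z] f(2)[of z] by (cases "z \<in> W") (auto intro: power_mono)
    then show "AE z in lborel. norm ((cmod (f z))\<^sup>2) \<le> norm ((h z)\<^sup>2)" by (intro AE_I2) simp
  qed measurable
  then show ?thesis using f m by (auto simp: A2_iff simp del: split_paired_All)
qed

context bergman_basis
begin

text \<open>The constant \<kappa> completes the square: it makes the vector
  \<open>D v \<phi> p - \<kappa> * \<phi> p\<close>, indexed by the basis, orthogonal to the vector
  \<open>\<phi> p\<close>. For functions vanishing at \<open>p\<close> the corrected functional is
  just the derivative, which links the metric to an extremal problem.\<close>

lemma form_as_norm:
  fixes v :: c2
  assumes p: "p \<in> W"
  defines "\<kappa> \<equiv> cnj (dbar v p) / of_real (diag p)"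
  shows "((\<lambda>\<phi>. (cmod (1 * D v \<phi> p + (- \<kappa>) * \<phi> p))\<^sup>2) has_sum diag p * Re (bergman_form W p v)) B"
proof -
  have up: "diag p > 0" by (rule diag_pos[OF p])
  have "((\<lambda>\<phi>. (cmod (D v \<phi> p))\<^sup>2 + (cmod \<kappa>)\<^sup>2 * (cmod (\<phi> p))\<^sup>2 + - 2 * Re (cnj \<kappa> * (D v \<phi> p * cnj (\<phi> p)))) has_sum
    (\<Sum>\<^sub>\<infinity>\<phi>\<in>B. (cmod (D v \<phi> p))\<^sup>2) + (cmod \<kappa>)\<^sup>2 * diag p + - 2 * Re (cnj \<kappa> * cnj (dbar v p))) B"
    unfolding diag_def dbar_cnj[symmetric]
    by (intro has_sum_add has_sum_cmult_right has_sum_Re has_sum_infsum summable_products[OF p])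
  moreover have "(cmod (x - \<kappa> * y))\<^sup>2 = (cmod x)\<^sup>2 + (cmod \<kappa>)\<^sup>2 * (cmod y)\<^sup>2 + - 2 * Re (cnj \<kappa> * (x * cnj y))" for x y
    unfolding cmod_power2 by (simp add: algebra_simps power2_eq_square)
  moreover have "(\<Sum>\<^sub>\<infinity>\<phi>\<in>B. (cmod (D v \<phi> p))\<^sup>2) + (cmod \<kappa>)\<^sup>2 * diag p + - 2 * Re (cnj \<kappa> * cnj (dbar v p)) = diag p * Re (bergman_form W p v)"
  proof -
    have "cnj \<kappa> * cnj (dbar v p) = of_real ((cmod (dbar v p))\<^sup>2 / diag p)"
      by (simp add: \<kappa>_def complex_norm_square[of "dbar v p"] del: of_real_power)
    then have 1: "Re (cnj \<kappa> * cnj (dbar v p)) = (cmod (dbar v p))\<^sup>2 / diag p" by (metis Re_complex_of_real)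
    have 2: "(cmod \<kappa>)\<^sup>2 * diag p = (cmod (dbar v p))\<^sup>2 / diag p"
      using up by (simp add: \<kappa>_def norm_divide power_divide power2_eq_square)
    show ?thesis unfolding 1 2 bergman_form_eq[OF p] Re_complex_of_real using up by (simp add: field_simps power2_eq_square)
  qed
  ultimately show ?thesis by simp
qed

text \<open>For finite \<open>T \<subseteq> B\<close> the function \<open>f k\<^sub>T\<close>, where \<open>k\<^sub>T = (\<Sum>\<phi>\<in>T. cnj (\<phi> p) * \<phi>)\<close>, competes in the
  extremal problem which the Bergman metric solves; \<open>k\<^sub>T(p)\<close> exhausts \<open>K(p, p)\<close>.\<close>
lemma disc_derivative_le_form:
  assumes p: "p \<in> W" and f: "holo_on W f" "f ` W \<subseteq> ball 0 1" "f p = 0"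
  shows "(cmod (D v f p))\<^sup>2 \<le> Re (bergman_form W p v)"
proof -
  define \<kappa> where "\<kappa> = cnj (dbar v p) / of_real (diag p)"
  define E where "E = diag p * Re (bergman_form W p v)"
  have hs: "((\<lambda>\<phi>. (cmod (1 * D v \<phi> p + (- \<kappa>) * \<phi> p))\<^sup>2) has_sum E) B"
    unfolding \<kappa>_def E_def by (rule form_as_norm[OF p])
  have E0: "E \<ge> 0" using hs by (rule has_sum_nonneg) auto
  have "(\<Sum>\<phi>\<in>T. (cmod (D v f p))\<^sup>2 * (cmod (\<phi> p))\<^sup>2) \<le> E" if T: "finite T" "T \<subseteq> B" for T
  proof -
    define \<sigma> where "\<sigma> = (\<Sum>\<phi>\<in>T. (cmod (\<phi> p))\<^sup>2)"
    have \<sigma>0: "\<sigma> \<ge> 0" by (simp add: \<sigma>_def sum_nonneg)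
    define k where "k z = (\<Sum>\<phi>\<in>T. cnj (\<phi> p) * \<phi> z)" for z
    have k: "k \<in> A2 W" unfolding k_def[abs_def] by (rule ONS_sum_A2[OF ons T(2)])
    have kp: "k p = of_real \<sigma>"
      unfolding k_def \<sigma>_def of_real_sum by (intro sum.cong refl) (simp only: complex_norm_square mult.commute)
    have lk: "l2sq k = \<sigma>" unfolding k_def[abs_def] ONS_l2sq[OF ons T] by (simp add: \<sigma>_def)
    define g where "g z = f z * k z" for z
    have gk: "cmod (g z) \<le> cmod (k z)" for z
    proof (cases "z \<in> W")
      case True
      then have "cmod (f z) \<le> 1" using f(2) by (force simp: image_subset_iff)
      then show ?thesis by (simp add: g_def norm_mult mult_left_le_one_le)
    qed (simp add: g_def A2D(2)[OF k])
    have g: "g \<in> A2 W"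
    proof (rule A2_dominated[OF W _ _ A2D(4)[OF k] gk])
      show "holo_on W g" unfolding g_def by (rule holo_on_mult[OF f(1) A2D(1)[OF k]])
      show "g z = 0" if "z \<notin> W" for z using A2D(2)[OF k that] by (simp add: g_def)
    qed
    have lg: "l2sq g \<le> \<sigma>"
      unfolding lk[symmetric] l2sq_def
      by (rule integral_mono[OF A2D(4)[OF g] A2D(4)[OF k]]) (use gk in \<open>simp add: power_mono\<close>)
    have Dg: "D v g p = D v f p * of_real \<sigma>"
      unfolding g_def[abs_def] using holo_on_frechet_mult[OF f(1) A2D(1)[OF k] p] f(3) kp by simp
    \<comment> \<open>Here \<open>g p = 0\<close>, so the term with \<kappa> drops out. The
      derivative of \<open>g\<close> contributes \<sigma> twice and its norm once; one factor
      survives on the left, and it is a partial sum of \<open>diag p\<close>.\<close>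
    have "(cmod (1 * D v g p + (- \<kappa>) * g p))\<^sup>2 \<le> l2sq g * E"
      using A2_derivative_bound[OF p g has_sum_imp_summable[OF hs]] infsumI[OF hs] by simp
    also have "\<dots> \<le> \<sigma> * E" using lg E0 by (rule mult_right_mono)
    finally have "(cmod (D v f p))\<^sup>2 * \<sigma> * \<sigma> \<le> E * \<sigma>"
      using f(3) by (simp add: Dg g_def norm_mult power_mult_distrib power2_eq_square mult_ac)
    then have "(cmod (D v f p))\<^sup>2 * \<sigma> \<le> E"
      using \<sigma>0 E0 by (cases "\<sigma> = 0") (auto dest: mult_right_le_imp_le)
    then show ?thesis by (simp add: \<sigma>_def sum_distrib_left)
  qed
  then have "(\<Sum>\<^sub>\<infinity>\<phi>\<in>B. (cmod (D v f p))\<^sup>2 * (cmod (\<phi> p))\<^sup>2) \<le> E"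
    by (intro infsum_le_finite_sums summable_on_cmult_right summable_products p)
  then have "diag p * (cmod (D v f p))\<^sup>2 \<le> diag p * Re (bergman_form W p v)"
    unfolding infsum_cmult_right' by (simp add: diag_def E_def mult.commute)
  then show ?thesis using diag_pos[OF p] by simp
qed

lemma carath_le_bergman:
  assumes p: "p \<in> W"
  shows "carath W p v \<le> bergman_length W p v"
  unfolding carath_def bergman_length_def
  by (intro SUP_least ennreal_leI real_le_rsqrt disc_derivative_le_form[OF p]) auto

text \<open>The subtracted term of the form only helps. The first term is dominated by the basis
  majorant, and \<open>diag\<close> stays away from 0 near \<open>p\<close> because a single
  function \<open>g\<close> with \<open>g p \<noteq> 0\<close> does.\<close>

lemma bergman_length_local_bound:
  assumes p: "p \<in> W"
  shows "\<exists>r>0. \<exists>C. ball p r \<subseteq> W \<and> (\<forall>z\<in>ball p r. \<forall>v. bergman_length W z v \<le> ennreal (C * norm v))"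
proof -
  obtain r m where r: "r > 0" "ball p r \<subseteq> W" "\<And>\<phi>. m \<phi> \<ge> 0" "(\<lambda>\<phi>. (m \<phi>)\<^sup>2) summable_on B"
    "\<And>\<phi> z v. \<phi> \<in> B \<Longrightarrow> z \<in> ball p r \<Longrightarrow> cmod (D v \<phi> z) \<le> m \<phi> * norm v"
    using domination[OF p] by metis
  define M where "M = (\<Sum>\<^sub>\<infinity>\<phi>\<in>B. (m \<phi>)\<^sup>2)"
  have M0: "M \<ge> 0" unfolding M_def by (rule infsum_nonneg) auto
  obtain g where g: "g \<in> A2 W" "g p \<noteq> 0" using nonvanishing[OF p] by blast
  define c where "c = cmod (g p) / 2"
  have c: "c > 0" using g by (simp add: c_def)
  have "continuous (at p) g" using holo_onD(1)[OF A2D(1)[OF g(1)] p] has_derivative_continuous by blast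
  then obtain d where d: "d > 0" "\<And>z. dist z p < d \<Longrightarrow> dist (g z) (g p) < c"
    unfolding continuous_at_eps_delta using c by blast
  define s where "s = min r d"
  define C where "C = sqrt (M * l2sq g) / c"
  have "bergman_length W z v \<le> ennreal (C * norm v)" if z: "z \<in> ball p s" for z v
  proof -
    have zW: "z \<in> W" using z r(2) by (auto simp: s_def)
    have uz: "diag z > 0" by (rule diag_pos[OF zW])
    have "dist (g z) (g p) < c" using z by (intro d(2)) (auto simp: s_def dist_commute)
    then have "c \<le> cmod (g z)" using norm_triangle_ineq2[of "g p" "g z"] by (simp add: c_def dist_norm norm_minus_commute)
    then have "c\<^sup>2 \<le> (cmod (g z))\<^sup>2" using c by (intro power_mono) auto
    also have "\<dots> \<le> l2sq g * diag z" by (rule A2_value_bound[OF zW g(1)])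
    finally have cU: "c\<^sup>2 \<le> l2sq g * diag z" .
    have "(\<Sum>\<^sub>\<infinity>\<phi>\<in>B. (cmod (D v \<phi> z))\<^sup>2) \<le> (\<Sum>\<^sub>\<infinity>\<phi>\<in>B. (m \<phi>)\<^sup>2 * (norm v)\<^sup>2)"
    proof (rule infsum_mono[OF summable_products(2)[OF zW] summable_on_cmult_left[OF r(4)]])
      fix \<phi> assume "\<phi> \<in> B"
      then have "cmod (D v \<phi> z) \<le> m \<phi> * norm v" using z by (intro r(5)) (auto simp: s_def)
      then have "(cmod (D v \<phi> z))\<^sup>2 \<le> (m \<phi> * norm v)\<^sup>2" by (intro power_mono) auto
      then show "(cmod (D v \<phi> z))\<^sup>2 \<le> (m \<phi>)\<^sup>2 * (norm v)\<^sup>2" by (simp add: power_mult_distrib)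
    qed
    also have "\<dots> = M * (norm v)\<^sup>2" by (simp add: infsum_cmult_left' M_def)
    finally have le: "(\<Sum>\<^sub>\<infinity>\<phi>\<in>B. (cmod (D v \<phi> z))\<^sup>2) \<le> M * (norm v)\<^sup>2" .
    have "Re (bergman_form W z v) \<le> (\<Sum>\<^sub>\<infinity>\<phi>\<in>B. (cmod (D v \<phi> z))\<^sup>2) / diag z"
      unfolding bergman_form_eq[OF zW] Re_complex_of_real by simp
    also have "\<dots> \<le> M * (norm v)\<^sup>2 / diag z" using le uz by (intro divide_right_mono) auto
    also have "\<dots> \<le> M * (norm v)\<^sup>2 * (l2sq g / c\<^sup>2)"
    proof -
      have "1 / diag z \<le> l2sq g / c\<^sup>2" using cU uz c by (simp add: field_simps)
      then have "M * (norm v)\<^sup>2 * (1 / diag z) \<le> M * (norm v)\<^sup>2 * (l2sq g / c\<^sup>2)" using M0 by (intro mult_left_mono) auto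
      then show ?thesis by simp
    qed
    also have "\<dots> = (C * norm v)\<^sup>2" using M0 l2sq_nonneg[of g] by (simp add: C_def power_mult_distrib power_divide)
    finally have "sqrt (Re (bergman_form W z v)) \<le> sqrt ((C * norm v)\<^sup>2)" by (rule real_sqrt_le_mono)
    moreover have "C * norm v \<ge> 0" using M0 c l2sq_nonneg[of g] by (simp add: C_def)
    ultimately show ?thesis unfolding bergman_length_def by (intro ennreal_leI) simp
  qed
  moreover have "s > 0" "ball p s \<subseteq> W" using r d by (auto simp: s_def subset_iff simp del: split_paired_All)
  ultimately show ?thesis by blast
qed

lemma bergman_positiveI:
  assumes "carath_positive W"
  shows "bergman_positive W"
  unfolding bergman_positive_def
proof (intro ballI conjI allI impI)
  fix z v :: c2 assume z: "z \<in> W"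
  show "Re (bergman_kernel W z z) > 0" "Im (bergman_kernel W z z) = 0"
    using diag_pos[OF z] by (simp_all add: kernel_diagonal)
  assume "v \<noteq> 0"
  then have "0 < bergman_length W z v"
    using assms z carath_le_bergman[OF z, of v] unfolding carath_positive_def by (meson less_le_trans)
  then show "0 < Re (bergman_form W z v)" unfolding bergman_length_def by (simp add: ennreal_less_zero_iff)
qed

end

section \<open>Square integrable functions on the domain and conclusion\<close>

text \<open>The integrand is dominated by a product of the functions \<open>1 / (1 + x^2)\<close> in
  the four real coordinates, each of which has a finite integral by the arctangent.\<close>

lemma integrable_decay:
  fixes a :: real
  shows "integrable lborel (\<lambda>z::c2. (a / ((1 + cmod (fst z))\<^sup>2 * (1 + cmod (snd z))\<^sup>2))\<^sup>2)"
proof (rule integrableI_bounded)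
  have "(\<lambda>z::c2. (a / ((1 + cmod (fst z))\<^sup>2 * (1 + cmod (snd z))\<^sup>2))\<^sup>2) \<in> borel_measurable borel"
  proof (rule borel_measurable_continuous_onI)
    have "1 + cmod w \<noteq> 0" for w by (metis add_nonneg_pos less_irrefl norm_ge_zero add.commute zero_less_one)
    then show "continuous_on UNIV (\<lambda>z::c2. (a / ((1 + cmod (fst z))\<^sup>2 * (1 + cmod (snd z))\<^sup>2))\<^sup>2)"
      by (auto intro!: continuous_intros)
  qed
  then show "(\<lambda>z::c2. (a / ((1 + cmod (fst z))\<^sup>2 * (1 + cmod (snd z))\<^sup>2))\<^sup>2) \<in> borel_measurable lborel" by simp
  define h where "h x = 1 / (1 + x\<^sup>2)" for x :: real
  have h0: "h x \<ge> 0" for x by (simp add: h_def)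
  have hm [measurable]: "h \<in> borel_measurable borel" unfolding h_def[abs_def] by measurable
  have half: "(\<integral>\<^sup>+ x. ennreal (h x) * indicator {0..} x \<partial>lborel) = ennreal (pi / 2 - arctan 0)"
  proof (rule nn_integral_FTC_atLeast)
    show "DERIV arctan x :> h x" for x unfolding h_def by (auto intro!: derivative_eq_intros simp: divide_inverse)
    show "(arctan \<longlongrightarrow> pi / 2) at_top" by (rule tendsto_arctan_at_top)
  qed (use h0 in auto)
  have fin: "(\<integral>\<^sup>+ x. ennreal (h x) \<partial>lborel) < \<infinity>"
  proof -
    have "(\<integral>\<^sup>+ x. ennreal (h x) \<partial>lborel) \<le> (\<integral>\<^sup>+ x. ennreal (h x) * indicator {0..} x + ennreal (h (- x)) * indicator {0..} (- x) \<partial>lborel)"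
      by (intro nn_integral_mono) (auto simp: indicator_def h_def)
    also have "\<dots> = (\<integral>\<^sup>+ x. ennreal (h x) * indicator {0..} x \<partial>lborel) + (\<integral>\<^sup>+ x. ennreal (h (- x)) * indicator {0..} (- x) \<partial>lborel)"
      by (rule nn_integral_add) measurable
    also have "(\<integral>\<^sup>+ x. ennreal (h (- x)) * indicator {0..} (- x) \<partial>lborel) = (\<integral>\<^sup>+ x. ennreal (h x) * indicator {0..} x \<partial>distr lborel borel uminus)"
      by (subst nn_integral_distr) auto
    finally show ?thesis unfolding lborel_distr_uminus half by (simp add: le_less_trans flip: ennreal_plus)
  qed
  have Bs: "(Basis :: c2 set) = {(1, 0), (\<i>, 0), (0, 1), (0, \<i>)}"
    by (auto simp: Basis_prod_def Basis_complex_def)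
  have one: "1 / (1 + cmod w)\<^sup>2 ^ 2 \<le> h (Re w) * h (Im w)" for w
  proof -
    have "1 + (Re w)\<^sup>2 \<le> (1 + cmod w)\<^sup>2" "1 + (Im w)\<^sup>2 \<le> (1 + cmod w)\<^sup>2"
      using abs_Re_le_cmod[of w] abs_Im_le_cmod[of w] power_mono[of "\<bar>Re w\<bar>" "cmod w" 2] power_mono[of "\<bar>Im w\<bar>" "cmod w" 2]
      by (auto simp: power2_sum intro: add_mono)
    then have "(1 + (Re w)\<^sup>2) * (1 + (Im w)\<^sup>2) \<le> (1 + cmod w)\<^sup>2 * (1 + cmod w)\<^sup>2" by (intro mult_mono) auto
    then have "1 / ((1 + cmod w)\<^sup>2 * (1 + cmod w)\<^sup>2) \<le> 1 / ((1 + (Re w)\<^sup>2) * (1 + (Im w)\<^sup>2))"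
      by (intro frac_le) (auto intro!: mult_pos_pos add_pos_nonneg)
    then show ?thesis by (simp add: h_def power2_eq_square)
  qed
  have bound: "norm ((a / ((1 + cmod (fst z))\<^sup>2 * (1 + cmod (snd z))\<^sup>2))\<^sup>2) \<le> a\<^sup>2 * (\<Prod>b\<in>Basis. h (z \<bullet> b))" for z :: c2
  proof -
    have "(a / ((1 + cmod (fst z))\<^sup>2 * (1 + cmod (snd z))\<^sup>2))\<^sup>2 = a\<^sup>2 * ((1 / (1 + cmod (fst z))\<^sup>2 ^ 2) * (1 / (1 + cmod (snd z))\<^sup>2 ^ 2))"
      by (simp add: power_divide power_mult_distrib)
    also have "\<dots> \<le> a\<^sup>2 * ((h (Re (fst z)) * h (Im (fst z))) * (h (Re (snd z)) * h (Im (snd z))))"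
      using h0 by (intro mult_left_mono mult_mono one) auto
    also have "\<dots> = a\<^sup>2 * (\<Prod>b\<in>Basis. h (z \<bullet> b))"
      by (simp add: Bs inner_prod_def inner_complex_def complex_eq_iff mult_ac)
    finally show ?thesis by simp
  qed
  have "(\<integral>\<^sup>+ z. ennreal (norm ((a / ((1 + cmod (fst z))\<^sup>2 * (1 + cmod (snd z))\<^sup>2))\<^sup>2)) \<partial>(lborel::c2 measure))
    \<le> (\<integral>\<^sup>+ z. ennreal (a\<^sup>2) * (\<Prod>b\<in>Basis. ennreal (h (z \<bullet> b))) \<partial>(lborel::c2 measure))"
    using bound h0 by (intro nn_integral_mono) (simp add: prod_ennreal ennreal_mult'[symmetric] ennreal_leI)
  also have "\<dots> = ennreal (a\<^sup>2) * (\<integral>\<^sup>+ z. (\<Prod>b\<in>Basis. ennreal (h (z \<bullet> b))) \<partial>(lborel::c2 measure))"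
    by (rule nn_integral_cmult) measurable
  also have "(\<integral>\<^sup>+ z. (\<Prod>b\<in>Basis. ennreal (h (z \<bullet> b))) \<partial>(lborel::c2 measure)) = (\<Prod>b\<in>(Basis::c2 set). (\<integral>\<^sup>+ x. ennreal (h x) \<partial>lborel))"
    by (rule nn_integral_lborel_prod) (auto simp: h0)
  also have "ennreal (a\<^sup>2) * \<dots> < \<infinity>"
    using fin by (simp add: ennreal_mult_less_top power_less_top_ennreal)
  finally show "(\<integral>\<^sup>+ z. ennreal (norm ((a / ((1 + cmod (fst z))\<^sup>2 * (1 + cmod (snd z))\<^sup>2))\<^sup>2)) \<partial>(lborel::c2 measure)) < \<infinity>" .
qed

context weighted_domain
begin

lemma bergman_basis_\<Omega>: "bergman_basis \<Omega> (SOME B. complete_ONS \<Omega> B)"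
proof
  show "open \<Omega>" by (rule open_\<Omega>)
  show "complete_ONS \<Omega> (SOME B. complete_ONS \<Omega> B)" by (rule someI_ex[OF complete_ONS_exists[OF open_\<Omega>]])
  show "bergman_kernel \<Omega> = (\<lambda>z w. \<Sum>\<^sub>\<infinity>\<phi>\<in>(SOME B. complete_ONS \<Omega> B). \<phi> z * cnj (\<phi> w))"
    by (simp add: fun_eq_iff bergman_kernel_def)
  fix p assume p: "p \<in> \<Omega>"
  obtain F M where F: "holo_on \<Omega> F" "F p \<noteq> 0"
    "\<And>z. z \<in> \<Omega> \<Longrightarrow> (1 + cmod (fst z))\<^sup>2 * (1 + cmod (snd z))\<^sup>2 * cmod (F z) < M"
    using coordinate_functions[OF p] by metis
  \<comment> \<open>Cut off by 0, as members of \<open>A2\<close> have to vanish outside the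
    domain.\<close>
  define g where "g z = (if z \<in> \<Omega> then F z else 0)" for z
  have "g \<in> A2 \<Omega>"
  proof (rule A2_dominated[OF open_\<Omega> _ _ integrable_decay[of M]])
    show "holo_on \<Omega> g" by (rule holo_on_transform[OF F(1) open_\<Omega>]) (simp add: g_def)
    show "cmod (g z) \<le> M / ((1 + cmod (fst z))\<^sup>2 * (1 + cmod (snd z))\<^sup>2)" if "z \<in> \<Omega>" for z
    proof -
      have "1 + cmod w > 0" for w by (simp add: add_pos_nonneg)
      then have "(1 + cmod (fst z))\<^sup>2 * (1 + cmod (snd z))\<^sup>2 > 0" by (intro mult_pos_pos zero_less_power)
      then show ?thesis using F(3)[OF that] that by (simp add: g_def le_divide_eq mult.commute)
    qed
  qed (simp add: g_def)
  then show "\<exists>g\<in>A2 \<Omega>. g p \<noteq> 0" using p F(2) by (intro bexI[of _ g]) (simp add: g_def)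
qed

lemma bergman_positive_\<Omega>: "bergman_positive \<Omega>"
  by (rule bergman_basis.bergman_positiveI[OF bergman_basis_\<Omega> carath_positive_\<Omega>])

text \<open>The Bergman length dominates the Caratheodory length, so its Cauchy sequences are
  controlled by the same bounded functions and the convergence argument is reused unchanged.\<close>

lemma bergman_complete_\<Omega>: "metric_complete \<Omega> (bergman_length \<Omega>)"
  by (rule metric_completeI[OF open_\<Omega> bergman_basis.carath_le_bergman[OF bergman_basis_\<Omega>]
        bergman_basis.bergman_length_local_bound[OF bergman_basis_\<Omega>] carath_cauchy_converges])

end

theorem theorem1p2:
  fixes P :: "complex \<Rightarrow> real" and k :: nat
  assumes poly: "\<exists>N c. \<forall>z. complex_of_real (P z) =
                    (\<Sum>a\<le>N. \<Sum>b\<le>N. c a b * z ^ a * cnj z ^ b)"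
    and k: "k > 1"
    and hom: "\<forall>(r::real) z. P (r *\<^sub>R z) = r ^ (2 * k) * P z"
    and subh: "\<forall>z. z \<noteq> 0 \<longrightarrow>
                 Dz1 (Dzb1 (\<lambda>w. complex_of_real (P w))) z \<in> \<real> \<and>
                 Re (Dz1 (Dzb1 (\<lambda>w. complex_of_real (P w))) z) > 0"
  shows "let \<Omega> = {(z1, z2). Re z2 + P z1 < 0} in
           bergman_positive \<Omega> \<and> metric_complete \<Omega> (bergman_length \<Omega>) \<and>
           carath_positive \<Omega> \<and> metric_complete \<Omega> (carath \<Omega>)"
proof -
  have subh': "\<forall>z. z \<noteq> 0 \<longrightarrow> Re (Dz1 (Dzb1 (\<lambda>w. complex_of_real (P w))) z) > 0" using subh by blast
  obtain C \<epsilon> where "\<epsilon> > 0" "C > 0" and weight: "\<forall>t>0. \<forall>a. \<exists>h. h holomorphic_on UNIV \<and> h a = 1 \<and>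
      (\<forall>w. cmod (h w) \<le> C * exp (t * (P w - P a) - t * \<epsilon> * (cmod (w ^ k - a ^ k))\<^sup>2))"
    by (rule weighted_entire_functions[OF poly k hom subh'])
  obtain N c where "\<forall>z. complex_of_real (P z) = (\<Sum>a\<le>N. \<Sum>b\<le>N. c a b * z ^ a * cnj z ^ b)" using poly by blast
  then have "P = (\<lambda>z. Re (\<Sum>a\<le>N. \<Sum>b\<le>N. c a b * z ^ a * cnj z ^ b))" by (metis Re_complex_of_real)
  moreover have "continuous_on UNIV (\<lambda>z. Re (\<Sum>a\<le>N. \<Sum>b\<le>N. c a b * z ^ a * cnj z ^ b))" by (intro continuous_intros)
  ultimately have cont: "continuous_on UNIV P" by simp
  \<comment> \<open>By homogeneity a bound on the unit circle becomes the growth bound on the whole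
    plane.\<close>
  then have "bounded (P ` sphere 0 1)"
    by (intro compact_imp_bounded compact_continuous_image) (auto intro: continuous_on_subset)
  then obtain A where "A > 0" "\<forall>x\<in>P ` sphere 0 1. norm x \<le> A" unfolding bounded_pos by blast
  then have A: "A > 0" "\<And>u. cmod u = 1 \<Longrightarrow> \<bar>P u\<bar> \<le> A" by simp_all
  have P_bound: "\<bar>P w\<bar> \<le> A * cmod w ^ (2 * k)" for w
  proof (cases "w = 0")
    case True
    then show ?thesis using hom[rule_format, of 0 0] k by (simp add: zero_power)
  next
    case False
    have "P w = cmod w ^ (2 * k) * P (sgn w)"
      using hom[rule_format, of "cmod w" "sgn w"] False by (simp add: sgn_div_norm)
    moreover have "\<bar>P (sgn w)\<bar> \<le> A" using False by (intro A) (simp add: norm_sgn)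
    ultimately show ?thesis by (simp add: abs_mult mult.commute mult_right_mono)
  qed
  interpret weighted_domain P k C \<epsilon> A
    by unfold_locales (use k cont P_bound \<open>C > 0\<close> \<open>\<epsilon> > 0\<close> A(1) weight in auto)
  have "{(z1, z2). Re z2 + P z1 < 0} = \<Omega>" by (auto simp: \<Omega>_def)
  then show ?thesis
    unfolding Let_def
    using bergman_positive_\<Omega> bergman_complete_\<Omega> carath_positive_\<Omega> carath_complete_\<Omega> by simp
qed

end
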